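(* Consider initial data $r,\Omega,\phi$ for a spherically symmetric self-gravitating Higgs field with nonnegative potential $V\in C^2(\mathbb{R})$ along $\mathcal{C}_{in}\cup\mathcal{C}_{out}$, satisfying $r\le r_+$ and $0\le m\le m_+$ along $\mathcal{C}_{in}\cup\mathcal{C}_{out}$, and $\partial_u r<0$, $\partial_v r>0$ along $\mathcal{C}_{out}$. Suppose there exist positive constants $c_0,c_1,c_2,c_3,c_4$ such that $c_0<\frac{1}{4r_+^2}$; along $\mathcal{C}_{in}$, $\left(\frac{\partial_u\phi}{\partial_u r}\right)^2<c_1$; and along $\mathcal{C}_{out}$, $c_3\le-(\partial_u r)\Omega^{-2}\le\frac12c_2$ and $V'(\phi)<c_4|\partial_v\phi|$. Suppose also $0\le V''(x)\le B$ on $(\phi_0-\delta_0,\phi_1)$ for some $\delta_0>0$, where $\phi_0,\phi_1$ are the (possibly infinite) infimum and supremum of $\phi$ along $\mathcal{C}_{out}$ and $B$ is a constant with $B<r_+^{-2}$. Suppose that along $\mathcal{C}_{out}$ the data satisfy \[ \partial_v r<\epsilon,\quad V(\phi)<\tfrac12\epsilon',\quad |\partial_v\phi|<\tfrac12\epsilon'',\] \[ \partial_v\phi<0,\quad \partial_u\phi<0,\quad V'(\phi)-4\sqrt{c_1}c_2\,(\partial_v\log r)-4c_3r_+^{-1}(\partial_v\phi)>0,\] and either $V'(\phi)\le0$ (along $\mathcal{C}_{out}$) or $|\phi_0|<\infty$, where $\epsilon,\epsilon',\epsilon''>0$ are sufficiently small in the sense that \[ 2\epsilon'+8c_2r_+^{-2}\epsilon<r_+^{-2}-B,\qquad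 \epsilon'<\min\Big\{\frac{1}{2r_+^2}-2c_0,\ 2c_0\Big\},\qquad \epsilon''<\frac{\sqrt{c_1}\,c_3\,(1-2r_+^2\epsilon'-4c_2\epsilon)}{c_2(c_4r_++4c_3)}.\] Then the maximal future development $\mathcal{G}(u_0,v_0)$ of these data contains a marginally trapped tube $\mathcal{A}=\{\partial_v r=0,\ \partial_u r<0\}$ which is asymptotic to the event horizon $\mathcal{C}_{out}$ (i.e. for every small $u>0$ there exists $v>v_0$ with $(u,v)\in\mathcal{A}$), and for large $v$, $\mathcal{A}$ is connected and achronal with no ingoing null segments.
   Context: Double null coordinates $(u,v)$ on $\mathbb{R}^2$, $u,v$ increasing to the future; $K(u_0,v_0)=[0,u_0]\times[v_0,\infty)$, $\mathcal{C}_{in}=[0,u_0]\times\{v_0\}$, $\mathcal{C}_{out}=\{0\}\times[v_0,\infty)$ (the event horizon). The spacetime is spherically symmetric with metric $-\Omega^2du\,dv+r^2g_{S^2}$, Einstein equations $R_{\alpha\beta}-\frac12Rg_{\alpha\beta}=2T_{\alpha\beta}$, and self-gravitating Higgs field matter: a scalar $\phi(u,v)$ with $\Box\phi=V'(\phi)$, i.e. $V'(\phi)=-4\Omega^{-2}(\partial^2_{uv}\phi+\partial_u\phi\,\partial_v\log r+\partial_v\phi\,\partial_u\log r)$, and stress-energy $T_{\alpha\beta}=\phi_{;\alpha}\phi_{;\beta}-(\frac12\phi_{;\gamma}\phi^{;\gamma}+V(\phi))g_{\alpha\beta}$, so $T_{uu}=(\partial_u\phi)^2$, $T_{vv}=(\partial_v\phi)^2$,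 $T_{uv}=\frac12\Omega^2V(\phi)$. The reduced Einstein equations are $\partial_u(\Omega^{-2}\partial_u r)=-r\Omega^{-2}T_{uu}$, $\partial_v(\Omega^{-2}\partial_v r)=-r\Omega^{-2}T_{vv}$, $\partial_u m=2r^2\Omega^{-2}(T_{uv}\partial_u r-T_{uu}\partial_v r)$, $\partial_v m=2r^2\Omega^{-2}(T_{uv}\partial_v r-T_{vv}\partial_u r)$, with Hawking mass $m=\frac r2(1+4\Omega^{-2}\partial_u r\partial_v r)$. $r_+=\sup_{\mathcal{C}_{out}}r<\infty$, $m_+=\sup_{\mathcal{C}_{out}}m<\infty$. The maximal future development $\mathcal{G}(u_0,v_0)$ is the maximal globally hyperbolic relatively open subset of $K(u_0,v_0)$ containing $\mathcal{C}_{in}\cup\mathcal{C}_{out}$ on which the solution exists. An ingoing null segment is a segment of a line $\{v=\text{const}\}$. *)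

theory Defs
  imports "HOL-Analysis.Analysis" "HOL-Library.Extended_Real"
begin

definition pu :: "(real \<Rightarrow> real \<Rightarrow> real) \<Rightarrow> real \<Rightarrow> real \<Rightarrow> real" where
  "pu f u v = deriv (\<lambda>s. f s v) u"

definition pv :: "(real \<Rightarrow> real \<Rightarrow> real) \<Rightarrow> real \<Rightarrow> real \<Rightarrow> real" where
  "pv f u v = deriv (\<lambda>t. f u t) v"

definition C1_on :: "(real \<times> real) set \<Rightarrow> (real \<Rightarrow> real \<Rightarrow> real) \<Rightarrow> bool" where
  "C1_on U f \<longleftrightarrow>
     (\<forall>(u,v)\<in>U. ((\<lambda>s. f s v) has_real_derivative pu f u v) (at u)
              \<and> ((\<lambda>t. f u t) has_real_derivative pv f u v) (at v))
   \<and> continuous_on U (\<lambda>p. f (fst p) (snd p))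
   \<and> continuous_on U (\<lambda>p. pu f (fst p) (snd p))
   \<and> continuous_on U (\<lambda>p. pv f (fst p) (snd p))"

definition C2_on :: "(real \<times> real) set \<Rightarrow> (real \<Rightarrow> real \<Rightarrow> real) \<Rightarrow> bool" where
  "C2_on U f \<longleftrightarrow> C1_on U f \<and> C1_on U (pu f) \<and> C1_on U (pv f)"

definition Kset :: "real \<Rightarrow> real \<Rightarrow> (real \<times> real) set" where
  "Kset u0 v0 = {0..u0} \<times> {v0..}"

definition Cin :: "real \<Rightarrow> real \<Rightarrow> (real \<times> real) set" where
  "Cin u0 v0 = {0..u0} \<times> {v0}"

definition Cout :: "real \<Rightarrow> (real \<times> real) set" where
  "Cout v0 = {0} \<times> {v0..}"

definition hawking_mass ::
  "(real \<Rightarrow> real \<Rightarrow> real) \<Rightarrow> (real \<Rightarrow> real \<Rightarrow> real) \<Rightarrow> real \<Rightarrow> real \<Rightarrow> real" where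
  "hawking_mass r \<Omega> u v =
     r u v / 2 * (1 + 4 * pu r u v * pv r u v / (\<Omega> u v)\<^sup>2)"

definition EH_equations ::
  "(real \<Rightarrow> real) \<Rightarrow> (real \<Rightarrow> real \<Rightarrow> real) \<Rightarrow> (real \<Rightarrow> real \<Rightarrow> real) \<Rightarrow>
   (real \<Rightarrow> real \<Rightarrow> real) \<Rightarrow> real \<Rightarrow> real \<Rightarrow> bool" where
  "EH_equations V r \<Omega> \<phi> u v \<longleftrightarrow>
     (let Tuu = (pu \<phi> u v)\<^sup>2; Tvv = (pv \<phi> u v)\<^sup>2;
          Tuv = (\<Omega> u v)\<^sup>2 * V (\<phi> u v) / 2; m = hawking_mass r \<Omega> in
      deriv V (\<phi> u v) =
        - 4 / (\<Omega> u v)\<^sup>2 * (pu (pv \<phi>) u v + pu \<phi> u v * (pv r u v / r u v)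
                                   + pv \<phi> u v * (pu r u v / r u v))
    \<and> pu (\<lambda>a b. pu r a b / (\<Omega> a b)\<^sup>2) u v = - r u v / (\<Omega> u v)\<^sup>2 * Tuu
    \<and> pv (\<lambda>a b. pv r a b / (\<Omega> a b)\<^sup>2) u v = - r u v / (\<Omega> u v)\<^sup>2 * Tvv
    \<and> pu m u v = 2 * (r u v)\<^sup>2 / (\<Omega> u v)\<^sup>2 * (Tuv * pu r u v - Tuu * pv r u v)
    \<and> pv m u v = 2 * (r u v)\<^sup>2 / (\<Omega> u v)\<^sup>2 * (Tuv * pv r u v - Tvv * pu r u v))"

text \<open>A (globally hyperbolic) development of characteristic data: a relatively open subset G
  of K containing the initial cones which is a past set in K (for characteristic problems in
  1+1 double null coordinates this is global hyperbolicity), on which a C^2 solution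
  (r, Omega, phi), with r > 0 and Omega > 0, of the system exists.  C^2 is understood as C^2 on an
  open neighbourhood of G in the plane.\<close>

definition is_development ::
  "(real \<Rightarrow> real) \<Rightarrow> real \<Rightarrow> real \<Rightarrow> (real \<times> real) set \<Rightarrow>
   (real \<Rightarrow> real \<Rightarrow> real) \<Rightarrow> (real \<Rightarrow> real \<Rightarrow> real) \<Rightarrow> (real \<Rightarrow> real \<Rightarrow> real) \<Rightarrow> bool" where
  "is_development V u0 v0 G r \<Omega> \<phi> \<longleftrightarrow>
     G \<subseteq> Kset u0 v0
   \<and> openin (top_of_set (Kset u0 v0)) G
   \<and> Cin u0 v0 \<union> Cout v0 \<subseteq> G
   \<and> (\<forall>(u,v)\<in>G. \<forall>u'\<in>{0..u}. \<forall>v'\<in>{v0..v}. (u',v') \<in> G)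
   \<and> (\<exists>U. open U \<and> G \<subseteq> U \<and> C2_on U r \<and> C2_on U \<Omega> \<and> C2_on U \<phi>)
   \<and> (\<forall>(u,v)\<in>G. r u v > 0 \<and> \<Omega> u v > 0 \<and> EH_equations V r \<Omega> \<phi> u v)"

definition is_maximal_development ::
  "(real \<Rightarrow> real) \<Rightarrow> real \<Rightarrow> real \<Rightarrow> (real \<times> real) set \<Rightarrow>
   (real \<Rightarrow> real \<Rightarrow> real) \<Rightarrow> (real \<Rightarrow> real \<Rightarrow> real) \<Rightarrow> (real \<Rightarrow> real \<Rightarrow> real) \<Rightarrow> bool" where
  "is_maximal_development V u0 v0 G r \<Omega> \<phi> \<longleftrightarrow>
     is_development V u0 v0 G r \<Omega> \<phi>
   \<and> (\<forall>G' r' \<Omega>' \<phi>'. is_development V u0 v0 G' r' \<Omega>' \<phi>'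
        \<and> (\<forall>(u,v)\<in>Cin u0 v0 \<union> Cout v0. r' u v = r u v \<and> \<Omega>' u v = \<Omega> u v \<and> \<phi>' u v = \<phi> u v)
        \<longrightarrow> G' \<subseteq> G)"

definition achronal :: "(real \<times> real) set \<Rightarrow> bool" where
  "achronal A \<longleftrightarrow> (\<forall>p\<in>A. \<forall>q\<in>A. \<not> (fst p < fst q \<and> snd p < snd q))"

definition no_ingoing_null_segments :: "(real \<times> real) set \<Rightarrow> bool" where
  "no_ingoing_null_segments A \<longleftrightarrow> \<not> (\<exists>v u1 u2. u1 < u2 \<and> {u1..u2} \<times> {v} \<subseteq> A)"

end

theory Submission
  imports Defs
begin

text \<open>
  With \<kappa> = - pu r / \<Omega>^2, the quotient \<zeta> = pu \<phi> / pu r satisfies along outgoing lines the damped equation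
  pv \<zeta> = - \<zeta> (1 - 2 r^2 V) / (4 \<kappa> r) + V' / (4 \<kappa>) - pv \<phi> / r.
  On the event horizon the forcing is bounded by a multiple of |pv \<phi>|, which is square integrable
  because the Hawking mass is bounded, so \<zeta> becomes small at late times.  A bootstrap with an
  exponential weight in r^2 keeps \<zeta> small away from the horizon wherever r is at least r(u0,v0).
  There 2 r^2 V \<le> 1/2, hence r pv r strictly decreases in u, and - r pu r grows exponentially in v,
  which is compatible with r \<le> rp only for a bounded range of v.

  On a line u = const the inequality pv r \<ge> 0 propagates to the past (Raychaudhuri) and gives
  r \<ge> r(u0,v0).  As long as it holds, the bootstrap provides a priori bounds, and the solution
  extends by solving a characteristic problem locally; by maximality the line cannot leave the
  development before it becomes trapped, and by the exponential growth it does become trapped.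
  Conversely every point with pv r = 0 and large v lies in the controlled region, where
  pu (pv r) < 0 on the tube, so at late times the tube is the graph of a continuous nonincreasing
  function u = a(v).
\<close>

text \<open>The equations are degenerate in a way that dictates the preparatory work. The wave
  equation for r enters only through the mass equations, hence multiplied by \<open>pu r\<close> or
  \<open>pv r\<close>, and no wave equation for \<Omega> is given. Both are recovered by dividing by
  \<open>pu r\<close>. This is legitimate on the whole development, also beyond the tube: \<kappa>
  is nondecreasing in u, so its lower bound c3 on the horizon spreads inwards and
  \<open>pu r\<close> never vanishes.

  Maximality compares only with C^2 developments that satisfy every equation. A solution of the
  characteristic problem is at first C^1 with a continuous mixed derivative and satisfies wave
  equations only. Its second derivatives and the two Raychaudhuri equations have to be carried over
  from lines on which the old solution is known.

  The obstacle in the bootstrap is that the forcing of \<zeta> at a point depends on \<zeta> along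
  the whole ingoing segment back to the horizon, with a coefficient that is not small. Smallness of
  \<zeta> alone does not close the argument; the weight makes this coefficient as small as desired
  at the price of a fixed factor in the size of \<zeta>.\<close>

section \<open>Primitives with parameters\<close>

text \<open>The signed integral of f u from b to v, written over a fixed interval so that its regularity
  in both arguments follows from the theorems on parameter integrals.\<close>

definition primitive_v :: "(real \<Rightarrow> real \<Rightarrow> 'e::euclidean_space) \<Rightarrow> real \<Rightarrow> real \<Rightarrow> real \<Rightarrow> 'e" where
  "primitive_v f b u v = (v - b) *\<^sub>R integral {0..1} (\<lambda>\<theta>. f u (b + \<theta> * (v - b)))"

lemma primitive_v_self [simp]: "primitive_v f b u b = 0"
  by (simp add: primitive_v_def)

lemma convex_segment_real:
  fixes b v \<theta> :: real
  assumes "convex J" "b \<in> J" "v \<in> J" "0 \<le> \<theta>" "\<theta> \<le> 1"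
  shows "b + \<theta> * (v - b) \<in> J"
  using convexD[OF assms(1,2,3), of "1 - \<theta>" \<theta>] assms(4,5) by (simp add: algebra_simps)

text \<open>The fundamental theorem of calculus after the substitution t = b + \<theta> (v - b). The
  factor v - b carries the sign, so v may lie on either side of b.\<close>

lemma primitive_v_eq:
  fixes f :: "real \<Rightarrow> real \<Rightarrow> 'e::euclidean_space"
  assumes J: "convex J" "b \<in> J" "v \<in> J"
    and h: "\<And>t. t \<in> J \<Longrightarrow> (h has_vector_derivative f u t) (at t within J)"
  shows "primitive_v f b u v = h v - h b"
proof -
  let ?p = "\<lambda>\<theta>::real. b + \<theta> * (v - b)"
  have "((\<lambda>\<theta>. h (?p \<theta>)) has_vector_derivative (v - b) *\<^sub>R f u (?p \<theta>)) (at \<theta> within {0..1})"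
    if "\<theta> \<in> {0..1}" for \<theta>
  proof -
    have 1: "(?p has_vector_derivative (v - b)) (at \<theta> within {0..1})"
      by (auto intro!: derivative_eq_intros simp: has_real_derivative_iff_has_vector_derivative[symmetric])
    have 2: "?p ` {0..1} \<subseteq> J" using convex_segment_real[OF J] by auto
    have "(h has_vector_derivative f u (?p \<theta>)) (at (?p \<theta>) within ?p ` {0..1})"
      by (rule has_vector_derivative_within_subset[OF h 2])
         (use that in \<open>auto intro!: convex_segment_real[OF J]\<close>)
    from vector_diff_chain_within[OF 1 this] show ?thesis by (simp add: o_def)
  qed
  then have "((\<lambda>\<theta>. (v - b) *\<^sub>R f u (?p \<theta>)) has_integral (h (?p 1) - h (?p 0))) {0..1}"
    by (intro fundamental_theorem_of_calculus) auto
  from integral_unique[OF this] show ?thesis by (simp add: primitive_v_def)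
qed

lemma primitive_v_line_continuous:
  assumes J: "convex J" "b \<in> J" "v \<in> J" and f: "continuous_on J (f u)"
  shows "continuous_on {0..1} (\<lambda>\<theta>::real. f u (b + \<theta> * (v - b)))"
  by (rule continuous_on_compose2[OF f]) (auto intro!: continuous_intros convex_segment_real[OF J])

lemma primitive_v_continuous:
  fixes f :: "real \<Rightarrow> real \<Rightarrow> 'e::euclidean_space"
  assumes J: "convex J" "b \<in> J" and f: "continuous_on (I \<times> J) (\<lambda>p. f (fst p) (snd p))"
  shows "continuous_on (I \<times> J) (\<lambda>p. primitive_v f b (fst p) (snd p))"
proof -
  have "continuous_on ((I \<times> J) \<times> cbox 0 (1::real)) (\<lambda>(p, \<theta>). f (fst p) (b + \<theta> * (snd p - b)))"
    unfolding case_prod_beta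
    by (rule continuous_on_compose2[OF f,
          where f = "\<lambda>q. (fst (fst q), b + snd q * (snd (fst q) - b))", simplified])
       (auto intro!: continuous_intros convex_segment_real[OF J])
  from integral_continuous_on_param[OF this]
  show ?thesis unfolding primitive_v_def by (auto intro!: continuous_intros)
qed

lemma primitive_v_deriv_v:
  fixes f :: "real \<Rightarrow> real \<Rightarrow> 'e::euclidean_space"
  assumes J: "convex J" "open J" "b \<in> J" "v \<in> J" and f: "continuous_on J (f u)"
  shows "((\<lambda>v. primitive_v f b u v) has_vector_derivative f u v) (at v)"
proof -
  obtain e where e: "e > 0" "cball b e \<subseteq> J" using J open_contains_cball by blast
  obtain d where d: "d > 0" "cball v d \<subseteq> J" using J open_contains_cball by blast
  \<comment> \<open>The ordinary integral from \<open>lo\<close> is differentiated at v, and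
    \<open>primitive_v\<close> is its difference between v and b. A compact subinterval of J with
    both points in its interior turns the derivative relative to the interval into a two-sided
    one.\<close>
  define lo hi where "lo = min (b - e) (v - d)" and "hi = max (b + e) (v + d)"
  have "b - e \<in> J" "b + e \<in> J" "v - d \<in> J" "v + d \<in> J"
    using e d by (auto simp: dist_real_def subset_iff)
  then have "lo \<in> J" "hi \<in> J" by (auto simp: lo_def hi_def min_def max_def)
  then have sub: "{lo..hi} \<subseteq> J"
    using J(1) convex_contains_segment closed_segment_eq_real_ivl
    by (metis atLeastatMost_empty_iff empty_subsetI)
  have vb: "v \<in> {lo<..<hi}" "b \<in> {lo<..<hi}" using e(1) d(1) by (auto simp: lo_def hi_def)
  define h where "h t = integral {lo..t} (f u)" for t
  have h: "(h has_vector_derivative f u t) (at t within {lo..hi})" if "t \<in> {lo..hi}" for t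
    unfolding h_def
    by (rule integral_has_vector_derivative[OF continuous_on_subset[OF f sub] that])
  have eq: "primitive_v f b u t = h t - h b" if "t \<in> {lo<..<hi}" for t
    by (rule primitive_v_eq[of "{lo..hi}"]) (use vb that h in auto)
  have "(h has_vector_derivative f u v) (at v)"
    using h[of v] vb at_within_interior[of v "{lo..hi}"] by auto
  then have "((\<lambda>t. h t - h b) has_vector_derivative f u v) (at v)"
    by (auto intro!: derivative_eq_intros)
  then show ?thesis
    by (rule has_vector_derivative_transform_within_open[where S="{lo<..<hi}"])
       (use vb eq in auto)
qed

lemma primitive_v_deriv_u:
  fixes f :: "real \<Rightarrow> real \<Rightarrow> 'e::euclidean_space"
  assumes J: "convex J" "b \<in> J" "v \<in> J" and I: "open I" "convex I" "u \<in> I"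
    and f: "\<And>u. u \<in> I \<Longrightarrow> continuous_on J (f u)"
    and fu: "\<And>u t. u \<in> I \<Longrightarrow> t \<in> J \<Longrightarrow> ((\<lambda>s. f s t) has_vector_derivative fu u t) (at u)"
    and fuc: "continuous_on (I \<times> J) (\<lambda>p. fu (fst p) (snd p))"
  shows "((\<lambda>s. primitive_v f b s v) has_vector_derivative primitive_v fu b u v) (at u)"
proof -
  have "((\<lambda>s. integral (cbox 0 1) (\<lambda>\<theta>. f s (b + \<theta> * (v - b)))) has_vector_derivative
      integral (cbox 0 1) (\<lambda>\<theta>. fu u (b + \<theta> * (v - b)))) (at u within I)"
  proof (rule leibniz_rule_vector_derivative)
    show "continuous_on (I \<times> cbox 0 1) (\<lambda>(s, \<theta>). fu s (b + \<theta> * (v - b)))"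
      unfolding case_prod_beta
      by (rule continuous_on_compose2[OF fuc,
          where f = "\<lambda>q. (fst q, b + snd q * (v - b))", simplified])
       (auto intro!: continuous_intros convex_segment_real[OF J])
    fix s \<theta> :: real assume "s \<in> I"
    then show "(\<lambda>\<theta>. f s (b + \<theta> * (v - b))) integrable_on cbox 0 1"
      using primitive_v_line_continuous[where f=f and u=s, OF J f] by (auto intro!: integrable_continuous_interval)
    assume "\<theta> \<in> cbox 0 1"
    then show "((\<lambda>s. f s (b + \<theta> * (v - b))) has_vector_derivative fu s (b + \<theta> * (v - b)))
        (at s within I)"
      using \<open>s \<in> I\<close> by (intro has_vector_derivative_at_within[OF fu] convex_segment_real[OF J]) auto
  qed (use I in auto)
  then have "((\<lambda>s. integral {0..1} (\<lambda>\<theta>. f s (b + \<theta> * (v - b)))) has_vector_derivative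
      integral {0..1} (\<lambda>\<theta>. fu u (b + \<theta> * (v - b)))) (at u)"
    using I at_within_open by fastforce
  then show ?thesis unfolding primitive_v_def
    by (auto intro!: derivative_eq_intros)
qed

lemma primitive_v_diff_bound:
  fixes f g :: "real \<Rightarrow> real \<Rightarrow> 'e::euclidean_space"
  assumes J: "convex J" "b \<in> J" "v \<in> J" and f: "continuous_on J (f u)" and g: "continuous_on J (g u)"
    and c: "\<And>t. t \<in> J \<Longrightarrow> norm (f u t - g u t) \<le> c"
  shows "norm (primitive_v f b u v - primitive_v g b u v) \<le> \<bar>v - b\<bar> * c"
proof -
  let ?F = "\<lambda>\<theta>. f u (b + \<theta> * (v - b))" and ?G = "\<lambda>\<theta>. g u (b + \<theta> * (v - b))"
  have cF: "continuous_on {0..1} ?F" by (rule primitive_v_line_continuous[where f=f, OF J f])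
  have cG: "continuous_on {0..1} ?G" by (rule primitive_v_line_continuous[where f=g, OF J g])
  have "primitive_v f b u v - primitive_v g b u v = (v - b) *\<^sub>R (integral {0..1} ?F - integral {0..1} ?G)"
    by (simp add: primitive_v_def scaleR_diff_right)
  also have "integral {0..1} ?F - integral {0..1} ?G = integral {0..1} (\<lambda>\<theta>. ?F \<theta> - ?G \<theta>)"
    by (rule integral_diff[symmetric]) (auto intro!: integrable_continuous_interval cF cG)
  finally have 1: "primitive_v f b u v - primitive_v g b u v = (v - b) *\<^sub>R integral {0..1} (\<lambda>\<theta>. ?F \<theta> - ?G \<theta>)" .
  have "norm (integral {0..1} (\<lambda>\<theta>. ?F \<theta> - ?G \<theta>)) \<le> c * (1 - 0)"
    by (rule integral_bound) (auto intro!: continuous_intros cF cG c convex_segment_real[OF J])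
  then show ?thesis unfolding 1 by (simp add: mult_left_mono)
qed

text \<open>Nothing is assumed about the v-derivative of \<open>hu\<close>. Writing h as its value
  on one line plus the v-primitive of \<open>hv\<close>, and differentiating under the integral,
  exhibits \<open>hu\<close> as a v-primitive of \<open>hvu\<close>. This asymmetric form gives the
  symmetry of second derivatives and, applied to \<open>pu r\<close>, a third derivative of a C^2
  function.\<close>

lemma mixed_derivative_exchange:
  fixes h :: "real \<Rightarrow> real \<Rightarrow> real"
  assumes N: "open N" "(u,v) \<in> N"
    and hu: "\<And>u v. (u,v) \<in> N \<Longrightarrow> ((\<lambda>s. h s v) has_real_derivative hu u v) (at u)"
    and hv: "\<And>u v. (u,v) \<in> N \<Longrightarrow> ((\<lambda>t. h u t) has_real_derivative hv u v) (at v)"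
    and hvu: "\<And>u v. (u,v) \<in> N \<Longrightarrow> ((\<lambda>s. hv s v) has_real_derivative hvu u v) (at u)"
    and hvc: "continuous_on N (\<lambda>p. hv (fst p) (snd p))"
    and hvuc: "continuous_on N (\<lambda>p. hvu (fst p) (snd p))"
  shows "((\<lambda>t. hu u t) has_real_derivative hvu u v) (at v)"
proof -
  obtain A B where AB: "open A" "open B" "(u,v) \<in> A \<times> B" "A \<times> B \<subseteq> N"
    by (rule open_prod_elim[OF N])
  obtain d where d: "d > 0" "ball u d \<subseteq> A" using AB by (metis mem_Sigma_iff open_contains_ball)
  obtain e where e: "e > 0" "ball v e \<subseteq> B" using AB by (metis mem_Sigma_iff open_contains_ball)
  let ?I = "ball u d" and ?J = "ball v e"
  have sub: "?I \<times> ?J \<subseteq> N" using AB d e by blast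
  have vJ: "v \<in> ?J" "u \<in> ?I" using e d by auto
  have cl: "continuous_on ?J (hv s)" if "s \<in> ?I" for s
  proof -
    have "continuous_on ?J ((\<lambda>p. hv (fst p) (snd p)) \<circ> (\<lambda>t. (s,t)))"
      by (rule continuous_on_compose)
         (auto intro!: continuous_intros continuous_on_subset[OF hvc] subsetD[OF sub] that
               simp del: mem_ball)
    then show ?thesis by (simp add: o_def)
  qed
  have eq: "h s t = h s v + primitive_v hv v s t" if "s \<in> ?I" "t \<in> ?J" for s t
  proof -
    have "primitive_v hv v s t = h s t - h s v"
    proof (rule primitive_v_eq[of ?J])
      fix t' assume "t' \<in> ?J"
      then have "(s, t') \<in> N" using that sub by blast
      from hv[OF this] show "(h s has_vector_derivative hv s t') (at t' within ?J)"
        by (simp add: has_real_derivative_iff_has_vector_derivative has_vector_derivative_at_within)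
    qed (use that vJ in auto)
    then show ?thesis by simp
  qed
  have eqd: "hu u t = hu u v + primitive_v hvu v u t" if "t \<in> ?J" for t
  proof -
    have 1: "((\<lambda>s. primitive_v hv v s t) has_real_derivative primitive_v hvu v u t) (at u)"
      unfolding has_real_derivative_iff_has_vector_derivative
      by (rule primitive_v_deriv_u[of ?J _ _ ?I])
         (use that vJ sub in \<open>auto intro!: hvu cl continuous_on_subset[OF hvuc]
            simp: has_real_derivative_iff_has_vector_derivative[symmetric] simp del: mem_ball\<close>)
    have "((\<lambda>s. h s v + primitive_v hv v s t) has_real_derivative (hu u v + primitive_v hvu v u t)) (at u)"
      by (intro derivative_intros 1 hu) (use that vJ sub in \<open>auto simp del: mem_ball\<close>)
    moreover have "((\<lambda>s. h s v + primitive_v hv v s t) has_real_derivative hu u t) (at u)"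
      by (rule has_field_derivative_transform_within_open[where f = "\<lambda>s. h s t" and S = "?I"])
         (use that vJ sub in \<open>auto intro!: hu eq simp del: mem_ball\<close>)
    ultimately show ?thesis using DERIV_unique by blast
  qed
  have cu: "continuous_on ?J (hvu u)"
  proof -
    have "continuous_on ?J ((\<lambda>p. hvu (fst p) (snd p)) \<circ> (\<lambda>t. (u,t)))"
      by (rule continuous_on_compose)
         (auto intro!: continuous_intros continuous_on_subset[OF hvuc] subsetD[OF sub] vJ(2)
               simp del: mem_ball)
    then show ?thesis by (simp add: o_def)
  qed
  have "((\<lambda>t. primitive_v hvu v u t) has_real_derivative hvu u v) (at v)"
    unfolding has_real_derivative_iff_has_vector_derivative
    by (rule primitive_v_deriv_v[of ?J]) (use vJ cu in auto)
  then have "((\<lambda>t. hu u v + primitive_v hvu v u t) has_real_derivative hvu u v) (at v)"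
    by (auto intro!: derivative_eq_intros)
  then show ?thesis
    by (rule has_field_derivative_transform_within_open[where S = ?J])
       (use vJ in \<open>auto intro!: eqd[symmetric] simp del: mem_ball\<close>)
qed

section \<open>Local existence for the Goursat problem\<close>

lemma continuous_on_swap_args:
  fixes f :: "'a::topological_space \<Rightarrow> 'b::topological_space \<Rightarrow> 'c::topological_space"
  assumes "continuous_on (A \<times> B) (\<lambda>p. f (fst p) (snd p))"
  shows "continuous_on (B \<times> A) (\<lambda>p. f (snd p) (fst p))"
  by (rule continuous_on_compose2[OF assms, where f = "\<lambda>p. (snd p, fst p)", simplified])
     (auto intro!: continuous_intros)

lemma continuous_on_arg2:
  assumes "continuous_on (A \<times> B) (\<lambda>p. f (fst p) (snd p))" "x \<in> A"
  shows "continuous_on B (f x)"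
  by (rule continuous_on_compose2[OF assms(1), where f = "\<lambda>t. (x, t)", simplified])
     (use assms(2) in \<open>auto intro!: continuous_intros\<close>)

lemma continuous_on_arg1:
  assumes "continuous_on (A \<times> B) (\<lambda>p. f (fst p) (snd p))" "y \<in> B"
  shows "continuous_on A (\<lambda>x. f x y)"
  by (rule continuous_on_compose2[OF assms(1), where f = "\<lambda>t. (t, y)", simplified])
     (use assms(2) in \<open>auto intro!: continuous_intros\<close>)

text \<open>The nonlinearity is known only through its Lipschitz estimate on an admissible set that
  need not be open, so continuity is read off from that estimate along the given arguments.\<close>

lemma lipschitz3_continuous:
  fixes F :: "'e::real_normed_vector \<Rightarrow> 'e \<Rightarrow> 'e \<Rightarrow> 'e"
  assumes lip: "\<And>x p q x' p' q'. x \<in> X \<Longrightarrow> x' \<in> X \<Longrightarrow> norm p \<le> R \<Longrightarrow> norm p' \<le> R \<Longrightarrow>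
      norm q \<le> R \<Longrightarrow> norm q' \<le> R \<Longrightarrow>
      norm (F x p q - F x' p' q') \<le> L * (norm (x - x') + norm (p - p') + norm (q - q'))"
    and c: "continuous_on S x" "continuous_on S p" "continuous_on S q"
    and X: "\<And>z. z \<in> S \<Longrightarrow> x z \<in> X" "\<And>z. z \<in> S \<Longrightarrow> norm (p z) \<le> R" "\<And>z. z \<in> S \<Longrightarrow> norm (q z) \<le> R"
  shows "continuous_on S (\<lambda>z. F (x z) (p z) (q z))"
  unfolding continuous_on_def
proof
  fix z0 assume z0: "z0 \<in> S"
  have "((\<lambda>z. F (x z) (p z) (q z) - F (x z0) (p z0) (q z0)) \<longlongrightarrow> 0) (at z0 within S)"
  proof (rule Lim_null_comparison)
    show "\<forall>\<^sub>F z in at z0 within S. norm (F (x z) (p z) (q z) - F (x z0) (p z0) (q z0))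
        \<le> L * (norm (x z - x z0) + norm (p z - p z0) + norm (q z - q z0))"
      unfolding eventually_at_filter
      by (intro always_eventually allI impI lip X z0)
    have "((\<lambda>z. norm (y z - y z0)) \<longlongrightarrow> 0) (at z0 within S)" if "continuous_on S y" for y :: "_ \<Rightarrow> 'e"
      using that z0 unfolding continuous_on_def
      by (auto intro!: tendsto_norm_zero simp: LIM_zero_iff)
    then have "((\<lambda>z. L * (norm (x z - x z0) + norm (p z - p z0) + norm (q z - q z0))) \<longlongrightarrow> L * (0 + 0 + 0))
        (at z0 within S)"
      by (intro tendsto_intros) (use c in auto)
    then show "((\<lambda>z. L * (norm (x z - x z0) + norm (p z - p z0) + norm (q z - q z0))) \<longlongrightarrow> 0)
        (at z0 within S)" by simp
  qed
  then show "((\<lambda>z. F (x z) (p z) (q z)) \<longlongrightarrow> F (x z0) (p z0) (q z0)) (at z0 within S)"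
    using Lim_null by blast
qed

text \<open>Picard iteration in which the unknown is the mixed derivative w rather than \<Psi>. The
  nonlinearity contains both first derivatives; these and \<Psi> are recovered from w and the data
  by one or two integrations, so the sup norm suffices. Each integration gains a side length, which
  gives the contraction factor 1/2. The data bound R - 1 leaves room 1 for the integrals of w, and d
  leaves room for the double integral.\<close>

theorem goursat_local_existence:
  fixes F :: "'e::euclidean_space \<Rightarrow> 'e \<Rightarrow> 'e \<Rightarrow> 'e" and g k g' k' :: "real \<Rightarrow> 'e"
  assumes ab: "a < a2" "b < b2" and LM: "0 \<le> L" "0 \<le> M"
    and lip: "\<And>x p q x' p' q'. x \<in> X \<Longrightarrow> x' \<in> X \<Longrightarrow> norm p \<le> R \<Longrightarrow> norm p' \<le> R \<Longrightarrow>
      norm q \<le> R \<Longrightarrow> norm q' \<le> R \<Longrightarrow>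
      norm (F x p q - F x' p' q') \<le> L * (norm (x - x') + norm (p - p') + norm (q - q'))"
    and bnd: "\<And>x p q. x \<in> X \<Longrightarrow> norm p \<le> R \<Longrightarrow> norm q \<le> R \<Longrightarrow> norm (F x p q) \<le> M"
    and g: "continuous_on {a..a2} g" "continuous_on {a..a2} g'"
      "\<And>u. a < u \<Longrightarrow> u < a2 \<Longrightarrow> (g has_vector_derivative g' u) (at u)"
      "\<And>u. a \<le> u \<Longrightarrow> u \<le> a2 \<Longrightarrow> norm (g' u) \<le> R - 1"
    and k: "continuous_on {b..b2} k" "continuous_on {b..b2} k'"
      "\<And>v. b < v \<Longrightarrow> v < b2 \<Longrightarrow> (k has_vector_derivative k' v) (at v)"
      "\<And>v. b \<le> v \<Longrightarrow> v \<le> b2 \<Longrightarrow> norm (k' v) \<le> R - 1"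
    and corner: "g a = x0" "k b = x0"
    and inX: "\<And>u v e. a \<le> u \<Longrightarrow> u \<le> a2 \<Longrightarrow> b \<le> v \<Longrightarrow> v \<le> b2 \<Longrightarrow> norm e \<le> d \<Longrightarrow> g u + k v - x0 + e \<in> X"
    and small: "M * (a2 - a) \<le> 1" "M * (b2 - b) \<le> 1" "(a2 - a) * ((b2 - b) * M) \<le> d"
      "L * ((a2 - a) * (b2 - b) + (a2 - a) + (b2 - b)) \<le> 1/2"
  obtains \<Psi> P Q f where
    "continuous_on ({a..a2} \<times> {b..b2}) (\<lambda>z. \<Psi> (fst z) (snd z))"
    "continuous_on ({a..a2} \<times> {b..b2}) (\<lambda>z. P (fst z) (snd z))"
    "continuous_on ({a..a2} \<times> {b..b2}) (\<lambda>z. Q (fst z) (snd z))"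
    "continuous_on ({a..a2} \<times> {b..b2}) (\<lambda>z. f (fst z) (snd z))"
    "\<And>u v. u \<in> {a..a2} \<Longrightarrow> v \<in> {b..b2} \<Longrightarrow> f u v = F (\<Psi> u v) (P u v) (Q u v)"
    "\<And>u v. u \<in> {a..a2} \<Longrightarrow> v \<in> {b..b2} \<Longrightarrow> \<Psi> u v \<in> X"
    "\<And>u. \<Psi> u b = g u" "\<And>v. \<Psi> a v = k v" "\<And>u. P u b = g' u" "\<And>v. Q a v = k' v"
    "\<And>u v. u \<in> {a<..<a2} \<Longrightarrow> ((\<lambda>s. \<Psi> s v) has_vector_derivative P u v) (at u)"
    "\<And>u v. u \<in> {a<..<a2} \<Longrightarrow> ((\<lambda>s. Q s v) has_vector_derivative f u v) (at u)"
    "\<And>u v. v \<in> {b<..<b2} \<Longrightarrow> ((\<lambda>t. \<Psi> u t) has_vector_derivative Q u v) (at v)"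
    "\<And>u v. v \<in> {b<..<b2} \<Longrightarrow> ((\<lambda>t. P u t) has_vector_derivative f u v) (at v)"
proof -
  \<comment> \<open>Clamping to the rectangle lets the iteration act on bounded continuous functions
    on the whole plane, which form a complete space. The fixed point equation is used only inside
    the rectangle, where clamping does nothing.\<close>
  define cu where "cu u = max a (min u a2)" for u :: real
  define cv where "cv v = max b (min v b2)" for v :: real
  have cu: "cu u \<in> {a..a2}" for u using ab by (auto simp: cu_def)
  have cv: "cv v \<in> {b..b2}" for v using ab by (auto simp: cv_def)
  define fw :: "((real \<times> real) \<Rightarrow>\<^sub>C 'e) \<Rightarrow> real \<Rightarrow> real \<Rightarrow> 'e" where "fw w u v = apply_bcontfun w (u,v)" for w u v
  define P where "P w u v = g' u + primitive_v (fw w) b u v" for w u v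
  define Q where "Q w u v = k' v + primitive_v (\<lambda>t s. fw w s t) a v u" for w u v
  define Y where "Y w u v = g u + k v - x0 + primitive_v (\<lambda>t s. primitive_v (fw w) b s t) a v u" for w u v
  define H where "H w z = F (Y w (cu (fst z)) (cv (snd z))) (P w (cu (fst z)) (cv (snd z)))
      (Q w (cu (fst z)) (cv (snd z)))" for w and z :: "real \<times> real"
  \<comment> \<open>The closed ball whose radius M is the bound for F: it is mapped into itself, and
    by the smallness conditions each of its elements produces arguments in the domain of the
    Lipschitz estimate.\<close>
  define C where "C = {w :: (real \<times> real) \<Rightarrow>\<^sub>C 'e. \<forall>z. norm (apply_bcontfun w z) \<le> M}"
  have fwc: "continuous_on A (\<lambda>p. fw w (fst p) (snd p))" for w A
    by (simp add: fw_def)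
  have fwc1: "continuous_on A (fw w u)" for w A u
    unfolding fw_def by (rule continuous_on_compose2[OF continuous_on_apply_bcontfun[of UNIV]]) (auto intro!: continuous_intros)
  have fwc2: "continuous_on A (\<lambda>u. fw w u v)" for w A v
    unfolding fw_def by (rule continuous_on_compose2[OF continuous_on_apply_bcontfun[of UNIV]]) (auto intro!: continuous_intros)
  have fws: "continuous_on (UNIV \<times> UNIV) (\<lambda>p. fw w (snd p) (fst p))" for w
    by (rule continuous_on_swap_args[OF fwc])
  have pc: "continuous_on (UNIV \<times> UNIV) (\<lambda>p. primitive_v (fw w) b (fst p) (snd p))" for w
    by (rule primitive_v_continuous[OF _ _ fwc]) auto
  have qc: "continuous_on (UNIV \<times> UNIV) (\<lambda>p. primitive_v (\<lambda>t s. fw w s t) a (snd p) (fst p))" for w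
    by (rule continuous_on_swap_args, rule primitive_v_continuous[OF _ _ fws]) auto
  have yc: "continuous_on (UNIV \<times> UNIV) (\<lambda>p. primitive_v (\<lambda>t s. primitive_v (fw w) b s t) a (snd p) (fst p))" for w
    by (rule continuous_on_swap_args, rule primitive_v_continuous, simp, simp,
        rule continuous_on_swap_args[OF pc])
  have pc2: "continuous_on A (\<lambda>s. primitive_v (fw w) b s v)" for w A v
    by (rule continuous_on_subset[OF continuous_on_arg1[OF pc]]) auto
  let ?R = "{a..a2} \<times> {b..b2}"
  have gR: "continuous_on ?R (\<lambda>p. g (fst p))" "continuous_on ?R (\<lambda>p. g' (fst p))"
    by (rule continuous_on_compose2[OF g(1)] continuous_on_compose2[OF g(2)]; auto intro!: continuous_intros)+
  have kR: "continuous_on ?R (\<lambda>p. k (snd p))" "continuous_on ?R (\<lambda>p. k' (snd p))"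
    by (rule continuous_on_compose2[OF k(1)] continuous_on_compose2[OF k(2)]; auto intro!: continuous_intros)+
  have PR: "continuous_on ?R (\<lambda>p. P w (fst p) (snd p))" for w
    unfolding P_def by (intro continuous_intros gR continuous_on_subset[OF pc]) auto
  have QR: "continuous_on ?R (\<lambda>p. Q w (fst p) (snd p))" for w
    unfolding Q_def by (intro continuous_intros kR continuous_on_subset[OF qc]) auto
  have YR: "continuous_on ?R (\<lambda>p. Y w (fst p) (snd p))" for w
    unfolding Y_def by (intro continuous_intros gR kR continuous_on_subset[OF yc]) auto
  have pd: "norm (primitive_v (fw w) b u v - primitive_v (fw w') b u v) \<le> (b2 - b) * c"
    if "v \<in> {b..b2}" "\<And>z. norm (apply_bcontfun w z - apply_bcontfun w' z) \<le> c" for w w' u v c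
  proof -
    have "c \<ge> 0" using that(2)[of undefined] norm_ge_zero order_trans by blast
    have "norm (primitive_v (fw w) b u v - primitive_v (fw w') b u v) \<le> \<bar>v - b\<bar> * c"
      by (rule primitive_v_diff_bound[of UNIV]) (use that(2) in \<open>auto simp: fw_def fwc1[unfolded fw_def]\<close>)
    also have "\<dots> \<le> (b2 - b) * c" using that(1) \<open>c \<ge> 0\<close> by (intro mult_right_mono) auto
    finally show ?thesis .
  qed
  have qd: "norm (primitive_v (\<lambda>t s. fw w s t) a v u - primitive_v (\<lambda>t s. fw w' s t) a v u) \<le> (a2 - a) * c"
    if "u \<in> {a..a2}" "\<And>z. norm (apply_bcontfun w z - apply_bcontfun w' z) \<le> c" for w w' u v c
  proof -
    have "c \<ge> 0" using that(2)[of undefined] norm_ge_zero order_trans by blast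
    have "norm (primitive_v (\<lambda>t s. fw w s t) a v u - primitive_v (\<lambda>t s. fw w' s t) a v u) \<le> \<bar>u - a\<bar> * c"
      by (rule primitive_v_diff_bound[of UNIV]) (use that(2) in \<open>auto simp: fw_def fwc2[unfolded fw_def]\<close>)
    also have "\<dots> \<le> (a2 - a) * c" using that(1) \<open>c \<ge> 0\<close> by (intro mult_right_mono) auto
    finally show ?thesis .
  qed
  have yd: "norm (primitive_v (\<lambda>t s. primitive_v (fw w) b s t) a v u - primitive_v (\<lambda>t s. primitive_v (fw w') b s t) a v u)
      \<le> (a2 - a) * ((b2 - b) * c)"
    if "u \<in> {a..a2}" "v \<in> {b..b2}" "\<And>z. norm (apply_bcontfun w z - apply_bcontfun w' z) \<le> c" for w w' u v c
  proof -
    have "c \<ge> 0" using that(3)[of undefined] norm_ge_zero order_trans by blast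
    have "norm (primitive_v (\<lambda>t s. primitive_v (fw w) b s t) a v u - primitive_v (\<lambda>t s. primitive_v (fw w') b s t) a v u)
        \<le> \<bar>u - a\<bar> * ((b2 - b) * c)"
      by (rule primitive_v_diff_bound[of UNIV]) (use pd[OF that(2,3)] in \<open>auto simp: pc2\<close>)
    also have "\<dots> \<le> (a2 - a) * ((b2 - b) * c)"
      using that(1) \<open>c \<ge> 0\<close> ab by (intro mult_right_mono) auto
    finally show ?thesis .
  qed
  have fw0: "fw 0 = (\<lambda>_ _. 0)" by (simp add: fw_def fun_eq_iff)
  have prim0: "primitive_v (\<lambda>_ _. 0::'e) c u v = 0" for c u v by (simp add: primitive_v_def)
  have inP: "norm (P w u v) \<le> R" if "w \<in> C" "u \<in> {a..a2}" "v \<in> {b..b2}" for w u v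
  proof -
    have "norm (primitive_v (fw w) b u v - primitive_v (fw 0) b u v) \<le> (b2 - b) * M"
      by (rule pd) (use that in \<open>auto simp: C_def\<close>)
    then have "norm (primitive_v (fw w) b u v) \<le> 1" using small(2) by (simp add: fw0 prim0 mult.commute)
    then show ?thesis unfolding P_def using g(4)[of u] that norm_triangle_ineq[of "g' u" "primitive_v (fw w) b u v"] by auto
  qed
  have inQ: "norm (Q w u v) \<le> R" if "w \<in> C" "u \<in> {a..a2}" "v \<in> {b..b2}" for w u v
  proof -
    have "norm (primitive_v (\<lambda>t s. fw w s t) a v u - primitive_v (\<lambda>t s. fw 0 s t) a v u) \<le> (a2 - a) * M"
      by (rule qd) (use that in \<open>auto simp: C_def\<close>)
    then have "norm (primitive_v (\<lambda>t s. fw w s t) a v u) \<le> 1" using small(1) by (simp add: fw0 prim0 mult.commute)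
    then show ?thesis unfolding Q_def using k(4)[of v] that
        norm_triangle_ineq[of "k' v" "primitive_v (\<lambda>t s. fw w s t) a v u"] by auto
  qed
  have inY: "Y w u v \<in> X" if "w \<in> C" "u \<in> {a..a2}" "v \<in> {b..b2}" for w u v
  proof -
    have "norm (primitive_v (\<lambda>t s. primitive_v (fw w) b s t) a v u - primitive_v (\<lambda>t s. primitive_v (fw 0) b s t) a v u) \<le> (a2 - a) * ((b2 - b) * M)"
      by (rule yd) (use that in \<open>auto simp: C_def\<close>)
    then have "norm (primitive_v (\<lambda>t s. primitive_v (fw w) b s t) a v u) \<le> d" using small(3) by (simp add: fw0 prim0)
    then show ?thesis unfolding Y_def using that by (auto intro!: inX)
  qed
  have Hc: "continuous_on UNIV (H w)" if "w \<in> C" for w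
  proof -
    have "continuous_on ?R (\<lambda>z. F (Y w (fst z) (snd z)) (P w (fst z) (snd z)) (Q w (fst z) (snd z)))"
      by (rule lipschitz3_continuous[OF lip YR PR QR]) (use that in \<open>auto intro!: inY inP inQ\<close>)
    then have "continuous_on UNIV ((\<lambda>z. F (Y w (fst z) (snd z)) (P w (fst z) (snd z)) (Q w (fst z) (snd z)))
        \<circ> (\<lambda>z. (cu (fst z), cv (snd z))))"
      by (intro continuous_on_compose)
         (auto simp: cu_def cv_def intro!: continuous_intros elim!: continuous_on_subset simp: ab less_imp_le)
    then show ?thesis by (simp add: o_def H_def[abs_def])
  qed
  have Hb: "norm (H w z) \<le> M" if "w \<in> C" for w z
    unfolding H_def by (intro bnd inY inP inQ that cu cv)
  have Hbc: "H w \<in> bcontfun" if "w \<in> C" for w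
    by (rule bcontfun_normI[OF Hc Hb]) (use that in auto)
  define T where "T w = Bcontfun (H w)" for w
  have T: "apply_bcontfun (T w) z = H w z" if "w \<in> C" for w z
    unfolding T_def using Bcontfun_inverse[OF Hbc[OF that]] by simp
  have "closed C"
  proof -
    have "C = PiC UNIV (\<lambda>_. cball 0 M)" by (auto simp: C_def mem_PiC_iff Pi_iff)
    then show ?thesis by (simp add: closed_PiC)
  qed
  then have Cc: "complete C" by (simp add: complete_eq_closed)
  have C0: "C \<noteq> {}" using LM by (auto simp: C_def intro!: exI[of _ 0])
  have TC: "T ` C \<subseteq> C"
  proof (rule image_subsetI)
    fix w assume "w \<in> C"
    then show "T w \<in> C" using Hb T by (simp add: C_def)
  qed
  have contr: "dist (T w) (T w') \<le> 1/2 * dist w w'" if "w \<in> C" "w' \<in> C" for w w'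
  proof (rule dist_bound)
    fix z
    let ?u = "cu (fst z)" and ?v = "cv (snd z)" and ?c = "dist w w'"
    have c: "norm (apply_bcontfun w z - apply_bcontfun w' z) \<le> ?c" for z
      using dist_bounded[of w z w'] by (simp add: dist_norm)
    have "dist (T w z) (T w' z) = norm (H w z - H w' z)" using that by (simp add: T dist_norm)
    also have "\<dots> \<le> L * (norm (Y w ?u ?v - Y w' ?u ?v) + norm (P w ?u ?v - P w' ?u ?v) + norm (Q w ?u ?v - Q w' ?u ?v))"
      unfolding H_def by (intro lip inY inP inQ that cu cv)
    also have "\<dots> \<le> L * ((a2 - a) * ((b2 - b) * ?c) + (b2 - b) * ?c + (a2 - a) * ?c)"
      by (intro mult_left_mono[OF _ LM(1)] add_mono)
         (simp_all add: Y_def P_def Q_def yd[OF cu cv c] pd[OF cv c] qd[OF cu c])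
    also have "\<dots> = (L * ((a2 - a) * (b2 - b) + (a2 - a) + (b2 - b))) * ?c" by (simp add: algebra_simps)
    also have "\<dots> \<le> 1/2 * ?c" by (intro mult_right_mono small(4)) auto
    finally show "dist (T w z) (T w' z) \<le> 1/2 * dist w w'" .
  qed
  obtain w where w: "w \<in> C" "T w = w"
    using Banach_fix[OF Cc C0 _ _ TC, of "1/2"] contr by auto
  have fix_eq: "fw w u v = F (Y w u v) (P w u v) (Q w u v)" if "u \<in> {a..a2}" "v \<in> {b..b2}" for u v
  proof -
    have "fw w u v = H w (u,v)" using T[OF w(1), of "(u,v)"] w(2) by (simp add: fw_def)
    moreover have "cu u = u" "cv v = v" using that by (auto simp: cu_def cv_def)
    ultimately show ?thesis by (simp add: H_def)
  qed
  have dP: "((\<lambda>t. primitive_v (fw w) b u t) has_vector_derivative fw w u v) (at v)" for u v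
    by (rule primitive_v_deriv_v[of UNIV]) (auto simp: fwc1)
  have dQ: "((\<lambda>s. primitive_v (\<lambda>t s. fw w s t) a v s) has_vector_derivative fw w u v) (at u)" for u v
    using primitive_v_deriv_v[of UNIV a u "\<lambda>t s. fw w s t" v] by (auto simp: fwc2)
  have dYu: "((\<lambda>s. primitive_v (\<lambda>t s. primitive_v (fw w) b s t) a v s) has_vector_derivative primitive_v (fw w) b u v) (at u)" for u v
    using primitive_v_deriv_v[of UNIV a u "\<lambda>t s. primitive_v (fw w) b s t" v] by (auto simp: pc2)
  have dYv: "((\<lambda>t. primitive_v (\<lambda>t s. primitive_v (fw w) b s t) a t u) has_vector_derivative primitive_v (\<lambda>t s. fw w s t) a v u) (at v)" for u v
    by (rule primitive_v_deriv_u[of UNIV _ _ UNIV]) (auto simp: pc2 dP intro!: fws[simplified])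
  show thesis
  proof (rule that[of "Y w" "P w" "Q w" "fw w"])
    show "((\<lambda>s. Y w s v) has_vector_derivative P w u v) (at u)" if "u \<in> {a<..<a2}" for u v
    proof -
      have "(g has_vector_derivative g' u) (at u)" using that g(3) by simp
      from has_vector_derivative_add[OF has_vector_derivative_diff[OF has_vector_derivative_add[OF this
          has_vector_derivative_const[of "k v"]] has_vector_derivative_const[of x0]] dYu[of v u]]
      show ?thesis unfolding Y_def P_def by simp
    qed
    show "((\<lambda>s. Q w s v) has_vector_derivative fw w u v) (at u)" if "u \<in> {a<..<a2}" for u v
      unfolding Q_def using has_vector_derivative_add[OF has_vector_derivative_const[of "k' v"] dQ[of v u]] by simp
    show "((\<lambda>t. Y w u t) has_vector_derivative Q w u v) (at v)" if "v \<in> {b<..<b2}" for u v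
    proof -
      have "(k has_vector_derivative k' v) (at v)" using that k(3) by simp
      from has_vector_derivative_add[OF has_vector_derivative_diff[OF has_vector_derivative_add[OF
          has_vector_derivative_const[of "g u"] this] has_vector_derivative_const[of x0]] dYv[of u v]]
      show ?thesis unfolding Y_def Q_def by simp
    qed
    show "((\<lambda>t. P w u t) has_vector_derivative fw w u v) (at v)" if "v \<in> {b<..<b2}" for u v
      unfolding P_def using has_vector_derivative_add[OF has_vector_derivative_const[of "g' u"] dP[of u v]] by simp
    show "Y w u b = g u" for u
      unfolding Y_def using corner by (simp add: primitive_v_def)
    show "Y w a v = k v" "P w u b = g' u" "Q w a v = k' v" for u v
      unfolding Y_def P_def Q_def using corner by simp_all
    show "fw w u v = F (Y w u v) (P w u v) (Q w u v)" if "u \<in> {a..a2}" "v \<in> {b..b2}" for u v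
      by (rule fix_eq[OF that])
    show "Y w u v \<in> X" if "u \<in> {a..a2}" "v \<in> {b..b2}" for u v
      by (rule inY[OF w(1) that])
  qed (rule fwc PR QR YR)+
qed

text \<open>Uniqueness as a linear inequality for the difference of two solutions. With the weight
  exp (- lam (u + v)) each integration gains a factor 1 / lam. Where the weighted maximum W is
  attained, the three components add up to at most 3 L W / lam, which forces W = 0 for large
  lam.\<close>

lemma goursat_zero:
  fixes D P Q f :: "real \<Rightarrow> real \<Rightarrow> 'e::real_normed_vector"
  assumes ab: "a \<le> a2" "b \<le> b2" and L: "0 \<le> L"
    and c: "continuous_on ({a..a2} \<times> {b..b2}) (\<lambda>z. D (fst z) (snd z))"
      "continuous_on ({a..a2} \<times> {b..b2}) (\<lambda>z. P (fst z) (snd z))"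
      "continuous_on ({a..a2} \<times> {b..b2}) (\<lambda>z. Q (fst z) (snd z))"
    and Du: "\<And>u v. a < u \<Longrightarrow> u < a2 \<Longrightarrow> b \<le> v \<Longrightarrow> v \<le> b2 \<Longrightarrow> ((\<lambda>s. D s v) has_vector_derivative P u v) (at u)"
    and Qu: "\<And>u v. a < u \<Longrightarrow> u < a2 \<Longrightarrow> b \<le> v \<Longrightarrow> v \<le> b2 \<Longrightarrow> ((\<lambda>s. Q s v) has_vector_derivative f u v) (at u)"
    and Pv: "\<And>u v. a \<le> u \<Longrightarrow> u \<le> a2 \<Longrightarrow> b < v \<Longrightarrow> v < b2 \<Longrightarrow> ((\<lambda>t. P u t) has_vector_derivative f u v) (at v)"
    and zero: "\<And>v. b \<le> v \<Longrightarrow> v \<le> b2 \<Longrightarrow> D a v = 0" "\<And>v. b \<le> v \<Longrightarrow> v \<le> b2 \<Longrightarrow> Q a v = 0"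
      "\<And>u. a \<le> u \<Longrightarrow> u \<le> a2 \<Longrightarrow> P u b = 0"
    and f: "\<And>u v. a \<le> u \<Longrightarrow> u \<le> a2 \<Longrightarrow> b \<le> v \<Longrightarrow> v \<le> b2 \<Longrightarrow> norm (f u v) \<le> L * (norm (D u v) + norm (P u v) + norm (Q u v))"
    and uv: "a \<le> u" "u \<le> a2" "b \<le> v" "v \<le> b2"
  shows "D u v = 0 \<and> P u v = 0 \<and> Q u v = 0"
proof -
  \<comment> \<open>Three components contribute L / lam each, so lam must exceed 3 L. The summand 1
    also gives lam \<ge> 1, used for D, where two integrations produce 1 / lam^2.\<close>
  define lam where "lam = 4 * L + 1"
  have lam: "lam \<ge> 1" "4 * L \<le> lam" "lam > 0" using L by (auto simp: lam_def)
  let ?R = "{a..a2} \<times> {b..b2}"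
  define N where "N u v = norm (D u v) + norm (P u v) + norm (Q u v)" for u v
  have Nc: "continuous_on ?R (\<lambda>z. exp (- lam * (fst z + snd z)) * N (fst z) (snd z))"
    unfolding N_def by (intro continuous_intros c)
  obtain z0 where z0: "z0 \<in> ?R" "\<And>z. z \<in> ?R \<Longrightarrow> exp (- lam * (fst z + snd z)) * N (fst z) (snd z)
      \<le> exp (- lam * (fst z0 + snd z0)) * N (fst z0) (snd z0)"
    using continuous_attains_sup[OF _ _ Nc] ab compact_Times[of "{a..a2}" "{b..b2}"] by auto
  define W where "W = exp (- lam * (fst z0 + snd z0)) * N (fst z0) (snd z0)"
  have W0: "W \<ge> 0" by (simp add: W_def N_def)
  have NW: "N u v \<le> W * exp (lam * (u + v))" if "a \<le> u" "u \<le> a2" "b \<le> v" "v \<le> b2" for u v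
  proof -
    have "exp (- lam * (u + v)) * N u v \<le> W" using z0(2)[of "(u,v)"] that by (simp add: W_def)
    moreover have "exp (- lam * (u + v)) = 1 / exp (lam * (u + v))" by (simp add: exp_minus divide_inverse)
    ultimately show ?thesis by (simp add: pos_divide_le_eq)
  qed
  have fW: "norm (f u v) \<le> L * W * exp (lam * (u + v))" if "a \<le> u" "u \<le> a2" "b \<le> v" "v \<le> b2" for u v
  proof -
    have "norm (f u v) \<le> L * N u v" using f[OF that] by (simp add: N_def)
    also have "\<dots> \<le> L * (W * exp (lam * (u + v)))" by (intro mult_left_mono NW that L)
    finally show ?thesis by simp
  qed
  have ed: "((\<lambda>t. c / lam * exp (lam * (u + t))) has_vector_derivative c * exp (lam * (u + t))) (at t)" for c u t
    unfolding has_real_derivative_iff_has_vector_derivative[symmetric]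
    using lam by (auto intro!: derivative_eq_intros)
  have ed': "((\<lambda>t. c / lam * exp (lam * (t + u))) has_vector_derivative c * exp (lam * (t + u))) (at t)" for c u t
    using ed[of c u t] by (simp add: add.commute)
  have PW: "norm (P u v) \<le> L * W / lam * exp (lam * (u + v))" if uv: "a \<le> u" "u \<le> a2" "b \<le> v" "v \<le> b2" for u v
  proof (cases "v = b")
    case True then show ?thesis using zero(3) uv L W0 lam by simp
  next
    case False
    have "norm (P u v - P u b) \<le> L * W / lam * exp (lam * (u + v)) - L * W / lam * exp (lam * (u + b))"
      by (rule differentiable_bound_general[OF _ _ _ Pv ed])
         (use uv False lam in \<open>auto intro!: fW continuous_intros continuous_on_subset[OF continuous_on_arg2[OF c(2)]]\<close>)
    moreover have "L * W / lam * exp (lam * (u + b)) \<ge> 0" using L W0 lam by simp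
    ultimately show ?thesis using zero(3) uv by simp
  qed
  have QW: "norm (Q u v) \<le> L * W / lam * exp (lam * (u + v))" if uv: "a \<le> u" "u \<le> a2" "b \<le> v" "v \<le> b2" for u v
  proof (cases "u = a")
    case True then show ?thesis using zero(2) uv L W0 lam by simp
  next
    case False
    have "norm (Q u v - Q a v) \<le> L * W / lam * exp (lam * (u + v)) - L * W / lam * exp (lam * (a + v))"
      by (rule differentiable_bound_general[OF _ _ _ Qu ed'])
         (use uv False lam in \<open>auto intro!: fW continuous_intros continuous_on_subset[OF continuous_on_arg1[OF c(3)]]\<close>)
    moreover have "L * W / lam * exp (lam * (a + v)) \<ge> 0" using L W0 lam by simp
    ultimately show ?thesis using zero(2) uv by simp
  qed
  have DW: "norm (D u v) \<le> L * W / lam * exp (lam * (u + v))" if uv: "a \<le> u" "u \<le> a2" "b \<le> v" "v \<le> b2" for u v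
  proof (cases "u = a")
    case True then show ?thesis using zero(1) uv L W0 lam by simp
  next
    case False
    have "norm (D u v - D a v) \<le> L * W / lam / lam * exp (lam * (u + v)) - L * W / lam / lam * exp (lam * (a + v))"
      by (rule differentiable_bound_general[OF _ _ _ Du ed'])
         (use uv False lam in \<open>auto intro!: PW[simplified] continuous_intros continuous_on_subset[OF continuous_on_arg1[OF c(1)]]\<close>)
    moreover have "L * W / lam / lam * exp (lam * (a + v)) \<ge> 0" using L W0 lam by simp
    moreover have "L * W / lam / lam * exp (lam * (u + v)) \<le> L * W / lam * exp (lam * (u + v))"
      using mult_left_mono[of 1 lam "L * W"] lam L W0
      by (intro mult_right_mono) (auto simp: divide_le_eq)
    ultimately show ?thesis using zero(1) uv by simp
  qed
  obtain u1 v1 where z01: "z0 = (u1, v1)" by (cases z0)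
  have z1: "a \<le> u1" "u1 \<le> a2" "b \<le> v1" "v1 \<le> b2" using z0(1) z01 by auto
  have "N u1 v1 \<le> 3 * (L * W / lam) * exp (lam * (u1 + v1))"
    using PW[OF z1] QW[OF z1] DW[OF z1] by (simp add: N_def)
  moreover have "N u1 v1 = W * exp (lam * (u1 + v1))"
  proof -
    have "exp (- lam * (u1 + v1)) = 1 / exp (lam * (u1 + v1))" by (simp add: exp_minus divide_inverse)
    then show ?thesis by (simp add: W_def z01)
  qed
  ultimately have "W * exp (lam * (u1 + v1)) \<le> 3 * (L * W / lam) * exp (lam * (u1 + v1))" by simp
  then have "W \<le> 3 * (L * W / lam)" by (rule mult_right_le_imp_le) simp
  then have "W * lam \<le> 3 * L * W" using lam by (simp add: field_simps)
  moreover have "W * (3 * L + 1) \<le> W * lam" using lam W0 L by (intro mult_left_mono) (auto simp: lam_def)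
  ultimately have "W \<le> 0" by (simp add: algebra_simps)
  then have "N u v \<le> 0" using NW[OF uv] W0 by simp
  then show ?thesis unfolding N_def
    using norm_ge_zero[of "D u v"] norm_ge_zero[of "P u v"] norm_ge_zero[of "Q u v"] by (smt (verit) norm_eq_zero)
qed

section \<open>The Einstein-Higgs equations as a system of wave equations\<close>

lemma C1_onD:
  assumes "C1_on U f"
  shows "(u,v) \<in> U \<Longrightarrow> ((\<lambda>s. f s v) has_real_derivative pu f u v) (at u)"
    and "(u,v) \<in> U \<Longrightarrow> ((\<lambda>t. f u t) has_real_derivative pv f u v) (at v)"
    and "continuous_on U (\<lambda>p. f (fst p) (snd p))"
    and "continuous_on U (\<lambda>p. pu f (fst p) (snd p))"
    and "continuous_on U (\<lambda>p. pv f (fst p) (snd p))"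
  using assms by (auto simp: C1_on_def)

lemma C1_onI:
  assumes "\<And>u v. (u,v) \<in> U \<Longrightarrow> ((\<lambda>s. f s v) has_real_derivative fu u v) (at u)"
    and "\<And>u v. (u,v) \<in> U \<Longrightarrow> ((\<lambda>t. f u t) has_real_derivative fv u v) (at v)"
    and c: "continuous_on U (\<lambda>p. f (fst p) (snd p))"
      "continuous_on U (\<lambda>p. fu (fst p) (snd p))" "continuous_on U (\<lambda>p. fv (fst p) (snd p))"
  shows "C1_on U f"
proof -
  have u: "pu f u v = fu u v" "pv f u v = fv u v" if "(u,v) \<in> U" for u v
    using assms(1,2)[OF that] by (simp_all add: pu_def pv_def DERIV_imp_deriv)
  then have "continuous_on U (\<lambda>p. pu f (fst p) (snd p))" "continuous_on U (\<lambda>p. pv f (fst p) (snd p))"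
    using c(2,3) by (auto cong: continuous_on_cong)
  then show ?thesis using assms u by (auto simp: C1_on_def)
qed

lemma C1_on_subset: "C1_on U f \<Longrightarrow> S \<subseteq> U \<Longrightarrow> C1_on S f"
  unfolding C1_on_def by (auto elim: continuous_on_subset)

lemma C2_on_subset: "C2_on U f \<Longrightarrow> S \<subseteq> U \<Longrightarrow> C2_on S f"
  unfolding C2_on_def by (auto elim: C1_on_subset)

lemma slice_open:
  assumes "open (N :: (real \<times> real) set)"
  shows "open {s. (s, v) \<in> N}" "open {t. (u, t) \<in> N}"
proof -
  have "open ((\<lambda>s. (s, v)) -` N)" "open ((\<lambda>t. (u, t)) -` N)"
    by (rule open_vimage[OF assms], intro continuous_intros)+
  then show "open {s. (s, v) \<in> N}" "open {t. (u, t) \<in> N}" by (simp_all add: vimage_def)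
qed

lemma pu_cong_open:
  assumes "open N" "(u,v) \<in> N" "\<And>a b. (a,b) \<in> N \<Longrightarrow> f a b = g a b"
  shows "pu f u v = pu g u v" "pv f u v = pv g u v"
proof -
  have "\<forall>\<^sub>F s in nhds u. f s v = g s v"
    using eventually_nhds_in_open[OF slice_open(1)[OF assms(1), of v], of u] assms(2,3)
    by (auto elim: eventually_mono)
  then show "pu f u v = pu g u v" unfolding pu_def by (rule deriv_cong_ev) simp
  have "\<forall>\<^sub>F s in nhds v. f u s = g u s"
    using eventually_nhds_in_open[OF slice_open(2)[OF assms(1), of u], of v] assms(2,3)
    by (auto elim: eventually_mono)
  then show "pv f u v = pv g u v" unfolding pv_def by (rule deriv_cong_ev) simp
qed

lemma C1_on_cong:
  assumes N: "open N" and eq: "\<And>a b. (a,b) \<in> N \<Longrightarrow> f a b = g a b" and f: "C1_on N f"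
  shows "C1_on N g"
proof (rule C1_onI)
  fix u v assume uv: "(u,v) \<in> N"
  show "((\<lambda>s. g s v) has_real_derivative pu f u v) (at u)"
    by (rule has_field_derivative_transform_within_open[OF C1_onD(1)[OF f uv] slice_open(1)[OF N, of v]])
       (use uv eq in auto)
  show "((\<lambda>t. g u t) has_real_derivative pv f u v) (at v)"
    by (rule has_field_derivative_transform_within_open[OF C1_onD(2)[OF f uv] slice_open(2)[OF N, of u]])
       (use uv eq in auto)
next
  show "continuous_on N (\<lambda>p. g (fst p) (snd p))"
    using C1_onD(3)[OF f] by (rule continuous_on_eq) (use eq in auto)
qed (rule C1_onD[OF f])+

lemma C2_on_cong:
  assumes N: "open N" and eq: "\<And>a b. (a,b) \<in> N \<Longrightarrow> f a b = g a b" and f: "C2_on N f"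
  shows "C2_on N g"
  using f unfolding C2_on_def
  by (auto intro: C1_on_cong[OF N eq] C1_on_cong[OF N pu_cong_open(1)[OF N _ eq]]
      C1_on_cong[OF N pu_cong_open(2)[OF N _ eq]])

lemma C1_on_Un: "open A \<Longrightarrow> open B \<Longrightarrow> C1_on A f \<Longrightarrow> C1_on B f \<Longrightarrow> C1_on (A \<union> B) f"
  unfolding C1_on_def by (auto intro!: continuous_on_open_Un)

lemma C2_on_Un: "open A \<Longrightarrow> open B \<Longrightarrow> C2_on A f \<Longrightarrow> C2_on B f \<Longrightarrow> C2_on (A \<union> B) f"
  unfolding C2_on_def by (auto intro!: C1_on_Un)

lemma C2_onD:
  assumes "C2_on U f"
  shows "C1_on U f" "C1_on U (pu f)" "C1_on U (pv f)"
  using assms by (auto simp: C2_on_def)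

lemma pu_pv_commute:
  assumes U: "open U" "(u,v) \<in> U" and f: "C2_on U f"
  shows "pv (pu f) u v = pu (pv f) u v"
proof -
  have "((\<lambda>t. pu f u t) has_real_derivative pu (pv f) u v) (at v)"
    by (rule mixed_derivative_exchange[OF U, where h = f and hv = "pv f"])
       (use C2_onD[OF f] C1_onD in auto)
  then show ?thesis by (simp add: pv_def DERIV_imp_deriv)
qed

section \<open>Wave equations and constraints equivalent to the field equations\<close>

lemma EH_cong:
  assumes N: "open N" "(u,v) \<in> N"
    and eq: "\<And>a b. (a,b) \<in> N \<Longrightarrow> r a b = r' a b" "\<And>a b. (a,b) \<in> N \<Longrightarrow> \<Omega> a b = \<Omega>' a b"
      "\<And>a b. (a,b) \<in> N \<Longrightarrow> \<phi> a b = \<phi>' a b"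
    and EH: "EH_equations V r \<Omega> \<phi> u v"
  shows "EH_equations V r' \<Omega>' \<phi>' u v"
proof -
  note p = pu_cong_open[OF N(1)]
  have d: "pu r a b = pu r' a b" "pv r a b = pv r' a b" "pu \<phi> a b = pu \<phi>' a b" "pv \<phi> a b = pv \<phi>' a b"
    if "(a,b) \<in> N" for a b
    using p[OF that, of r r'] p[OF that, of \<phi> \<phi>'] eq by auto
  have m: "hawking_mass r \<Omega> a b = hawking_mass r' \<Omega>' a b" if "(a,b) \<in> N" for a b
    using d eq that by (simp add: hawking_mass_def)
  have "pu (pv \<phi>) u v = pu (pv \<phi>') u v" by (rule p[OF N(2)]) (rule d)
  moreover have "pu (\<lambda>a b. pu r a b / (\<Omega> a b)\<^sup>2) u v = pu (\<lambda>a b. pu r' a b / (\<Omega>' a b)\<^sup>2) u v"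
    "pv (\<lambda>a b. pv r a b / (\<Omega> a b)\<^sup>2) u v = pv (\<lambda>a b. pv r' a b / (\<Omega>' a b)\<^sup>2) u v"
    by (rule p[OF N(2)]; simp add: d eq)+
  moreover have "pu (hawking_mass r \<Omega>) u v = pu (hawking_mass r' \<Omega>') u v"
    "pv (hawking_mass r \<Omega>) u v = pv (hawking_mass r' \<Omega>') u v"
    by (rule p[OF N(2)]; simp add: m)+
  ultimately show ?thesis using EH d[OF N(2)] eq[OF N(2)] unfolding EH_equations_def Let_def by simp
qed

text \<open>Here w stands for log \<Omega>.  The equation with right-hand side wave_w is not part of
  EH_equations; it follows from them where pu r does not vanish.\<close>

definition wave_r where
  "wave_r V r w \<phi> u v = - (pu r u v * pv r u v / r u v) - exp (2 * w u v) / (4 * r u v)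
      + exp (2 * w u v) * r u v * V (\<phi> u v) / (2::real)"

definition wave_w where
  "wave_w r w \<phi> u v = exp (2 * w u v) / (4 * (r u v)\<^sup>2) + pu r u v * pv r u v / (r u v)\<^sup>2
      - pu \<phi> u v * pv \<phi> u v"

definition wave_phi where
  "wave_phi V r w \<phi> u v = - ((pu \<phi> u v * pv r u v + pv \<phi> u v * pu r u v) / r u v)
      - exp (2 * w u v) * deriv V (\<phi> u v) / (4::real)"

text \<open>Here \<open>Om\<close> is the square of \<Omega>, p and q are the derivatives of r in u
  and v, and x is its mixed derivative. Once the Raychaudhuri equations eliminate \<open>ruu\<close>
  and \<open>rvv\<close>, each mass equation collapses to the wave equation for r times p or
  q.\<close>

lemma EH_algebra:
  fixes Om :: real
  assumes "Om > 0" "r > 0"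
  shows "(V1 = - 4 / Om * (fuv + fu * (q / r) + fv * (p / r))
     \<and> (ruu - 2 * wu * p) / Om = - r / Om * fu\<^sup>2
     \<and> (rvv - 2 * wv * q) / Om = - r / Om * fv\<^sup>2
     \<and> p / 2 * (1 + 4 * p * q / Om) + 2 * r * ((ruu - 2 * wu * p) / Om * q + p * x / Om)
         = 2 * r\<^sup>2 / Om * (Om * V / 2 * p - fu\<^sup>2 * q)
     \<and> q / 2 * (1 + 4 * p * q / Om) + 2 * r * ((rvv - 2 * wv * q) / Om * p + q * x / Om)
         = 2 * r\<^sup>2 / Om * (Om * V / 2 * q - fv\<^sup>2 * p)) \<longleftrightarrow>
    (p * (x - (- (p * q / r) - Om / (4 * r) + Om * r * V / 2)) = 0
     \<and> q * (x - (- (p * q / r) - Om / (4 * r) + Om * r * V / 2)) = 0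
     \<and> fuv = - ((fu * q + fv * p) / r) - Om * V1 / 4
     \<and> ruu = 2 * wu * p - r * fu\<^sup>2 \<and> rvv = 2 * wv * q - r * fv\<^sup>2)" (is "?L \<longleftrightarrow> ?R")
proof -
  have 1: "V1 = - 4 / Om * (fuv + fu * (q / r) + fv * (p / r)) \<longleftrightarrow> fuv = - ((fu * q + fv * p) / r) - Om * V1 / 4"
    using assms by (auto simp: field_simps)
  have 2: "(a - b) / Om = - r / Om * c \<longleftrightarrow> a = b - r * c" for a b c
  proof -
    have "- r / Om * c = (- (r * c)) / Om" by simp
    then have "(a - b) / Om = - r / Om * c \<longleftrightarrow> a - b = - (r * c)"
      using assms by (simp only: divide_cancel_right) auto
    then show ?thesis by (simp add: algebra_simps)
  qed
  \<comment> \<open>Both mass equations are instances of one identity, with the roles of p and q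
    exchanged.\<close>
  have 3: "s / 2 * (1 + 4 * p * q / Om) + 2 * r * (- r / Om * g * t + s * x / Om) = 2 * r\<^sup>2 / Om * (Om * V / 2 * s - g * t)
      \<longleftrightarrow> s * (x - (- (p * q / r) - Om / (4 * r) + Om * r * V / 2)) = 0" for s t g
  proof -
    have "s / 2 * (1 + 4 * p * q / Om) + 2 * r * (- r / Om * g * t + s * x / Om) - 2 * r\<^sup>2 / Om * (Om * V / 2 * s - g * t)
       = 2 * r / Om * (s * (x - (- (p * q / r) - Om / (4 * r) + Om * r * V / 2)))"
      using assms by (simp add: field_simps power2_eq_square)
    then show ?thesis using assms by (metis (no_types, lifting) divide_eq_0_iff eq_iff_diff_eq_0 less_numeral_extra(3) mult_eq_0_iff zero_neq_numeral)
  qed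
  have 4: "p * q = q * p" by (rule mult.commute)
  show ?thesis unfolding 1 2 using 3[of p "fu\<^sup>2" q] 3[of q "fv\<^sup>2" p, folded 4]
      2[of ruu "2 * wu * p" "fu\<^sup>2"] 2[of rvv "2 * wv * q" "fv\<^sup>2"]
    by (smt (verit))
qed

text \<open>As an equivalence it serves in both directions: to extract wave equations from a
  development, and to certify that a newly constructed solution satisfies the field
  equations.\<close>

lemma EH_exp_iff:
  assumes N: "open N" "(u,v) \<in> N" and C2: "C2_on N r" "C2_on N w" "C2_on N \<phi>"
    and pos: "r u v > 0"
  shows "EH_equations V r (\<lambda>u v. exp (w u v)) \<phi> u v \<longleftrightarrow>
     pu r u v * (pu (pv r) u v - wave_r V r w \<phi> u v) = 0 \<and> pv r u v * (pu (pv r) u v - wave_r V r w \<phi> u v) = 0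
     \<and> pu (pv \<phi>) u v = wave_phi V r w \<phi> u v
     \<and> pu (pu r) u v = 2 * pu w u v * pu r u v - r u v * (pu \<phi> u v)\<^sup>2
     \<and> pv (pv r) u v = 2 * pv w u v * pv r u v - r u v * (pv \<phi> u v)\<^sup>2"
proof -
  note d = C1_onD(1,2)[OF C2_onD(1)[OF C2(1)] N(2)] C1_onD(1,2)[OF C2_onD(1)[OF C2(2)] N(2)]
    C1_onD(1,2)[OF C2_onD(2)[OF C2(1)] N(2)] C1_onD(1,2)[OF C2_onD(3)[OF C2(1)] N(2)]
  have sq: "(exp (w a b))\<^sup>2 = exp (2 * w a b)" for a b by (simp add: exp_double)
  have x: "pv (pu r) u v = pu (pv r) u v" by (rule pu_pv_commute[OF N C2(1)])
  let ?O = "exp (2 * w u v)"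
  have 1: "pu (\<lambda>a b. pu r a b / exp (2 * w a b)) u v = (pu (pu r) u v - 2 * pu w u v * pu r u v) / ?O"
    unfolding pu_def[of "\<lambda>a b. pu r a b / exp (2 * w a b)"]
    by (rule DERIV_imp_deriv) (auto intro!: derivative_eq_intros d simp: field_simps)
  have 2: "pv (\<lambda>a b. pv r a b / exp (2 * w a b)) u v = (pv (pv r) u v - 2 * pv w u v * pv r u v) / ?O"
    unfolding pv_def[of "\<lambda>a b. pv r a b / exp (2 * w a b)"]
    by (rule DERIV_imp_deriv) (auto intro!: derivative_eq_intros d simp: field_simps)
  have 3: "pu (hawking_mass r (\<lambda>u v. exp (w u v))) u v = pu r u v / 2 * (1 + 4 * pu r u v * pv r u v / ?O)
      + 2 * r u v * ((pu (pu r) u v - 2 * pu w u v * pu r u v) / ?O * pv r u v + pu r u v * pu (pv r) u v / ?O)"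
    unfolding pu_def[of "hawking_mass r (\<lambda>u v. exp (w u v))"] hawking_mass_def sq
    by (rule DERIV_imp_deriv) (auto intro!: derivative_eq_intros d simp: field_simps)
  have 4: "pv (hawking_mass r (\<lambda>u v. exp (w u v))) u v = pv r u v / 2 * (1 + 4 * pu r u v * pv r u v / ?O)
      + 2 * r u v * ((pv (pv r) u v - 2 * pv w u v * pv r u v) / ?O * pu r u v + pv r u v * pu (pv r) u v / ?O)"
    unfolding pv_def[of "hawking_mass r (\<lambda>u v. exp (w u v))"] hawking_mass_def sq
    by (rule DERIV_imp_deriv) (auto intro!: derivative_eq_intros d simp: x field_simps)
  show ?thesis unfolding EH_equations_def Let_def sq 1 2 3 4 wave_r_def wave_phi_def
    by (rule EH_algebra) (use pos in auto)
qed

lemma continuous_wave_r: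
  assumes "C1_on N r" "C1_on N w" "C1_on N \<phi>" "continuous_on UNIV V" "\<And>u v. (u,v) \<in> N \<Longrightarrow> r u v > 0"
  shows "continuous_on N (\<lambda>p. wave_r V r w \<phi> (fst p) (snd p))"
proof -
  have Vc: "continuous_on N (\<lambda>p. V (\<phi> (fst p) (snd p)))"
    by (rule continuous_on_compose2[OF assms(4) C1_onD(3)[OF assms(3)]]) auto
  have "\<forall>p\<in>N. r (fst p) (snd p) \<noteq> 0" using assms(5) by (metis less_irrefl prod.collapse)
  then show ?thesis unfolding wave_r_def
    by (intro continuous_intros Vc C1_onD(3-5)[OF assms(1)] C1_onD(3-5)[OF assms(2)]) auto
qed

lemma continuous_wave_phi:
  assumes "C1_on N r" "C1_on N w" "C1_on N \<phi>" "continuous_on UNIV (deriv V)" "\<And>u v. (u,v) \<in> N \<Longrightarrow> r u v > 0"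
  shows "continuous_on N (\<lambda>p. wave_phi V r w \<phi> (fst p) (snd p))"
proof -
  have Vc: "continuous_on N (\<lambda>p. deriv V (\<phi> (fst p) (snd p)))"
    by (rule continuous_on_compose2[OF assms(4) C1_onD(3)[OF assms(3)]]) auto
  have "\<forall>p\<in>N. r (fst p) (snd p) \<noteq> 0" using assms(5) by (metis less_irrefl prod.collapse)
  then show ?thesis unfolding wave_phi_def
    by (intro continuous_intros Vc C1_onD(3-5)[OF assms(1)] C1_onD(3-5)[OF assms(2)] C1_onD(3-5)[OF assms(3)]) auto
qed

lemma continuous_wave_w:
  assumes "C1_on N r" "C1_on N w" "C1_on N \<phi>" "\<And>u v. (u,v) \<in> N \<Longrightarrow> r u v > 0"
  shows "continuous_on N (\<lambda>p. wave_w r w \<phi> (fst p) (snd p))"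
proof -
  have "\<forall>p\<in>N. r (fst p) (snd p) \<noteq> 0" using assms(4) by (metis less_irrefl prod.collapse)
  then show ?thesis unfolding wave_w_def
    by (intro continuous_intros C1_onD(3-5)[OF assms(1)] C1_onD(3-5)[OF assms(2)] C1_onD(3-5)[OF assms(3)]) auto
qed

locale C2_potential =
  fixes V :: "real \<Rightarrow> real"
  assumes V1: "\<And>x. (V has_real_derivative deriv V x) (at x)"
    and V2: "\<And>x. (deriv V has_real_derivative deriv (deriv V) x) (at x)"
    and V2c: "continuous_on UNIV (deriv (deriv V))"
begin

lemma Vc: "continuous_on UNIV V" "continuous_on UNIV (deriv V)"
  by (rule DERIV_continuous_on[OF has_field_derivative_at_within[OF V1]]
        DERIV_continuous_on[OF has_field_derivative_at_within[OF V2]])+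

lemma V_chain:
  assumes "(f has_real_derivative d) (at x)"
  shows "((\<lambda>s. V (f s)) has_real_derivative deriv V (f x) * d) (at x)"
    and "((\<lambda>s. deriv V (f s)) has_real_derivative deriv (deriv V) (f x) * d) (at x)"
  using DERIV_chain2[OF V1 assms] DERIV_chain2[OF V2 assms] by auto

lemma continuous_V_comp:
  assumes "continuous_on N f"
  shows "continuous_on N (\<lambda>p. V (f p))" "continuous_on N (\<lambda>p. deriv V (f p))" "continuous_on N (\<lambda>p. deriv (deriv V) (f p))"
  by (rule continuous_on_compose2[OF Vc(1) assms] continuous_on_compose2[OF Vc(2) assms] continuous_on_compose2[OF V2c assms]; simp)+

text \<open>The u-derivative of \<open>wave_r\<close>, with the mixed derivative of r already
  replaced through the wave equation. The second u-derivative of r is left standing, since the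
  Raychaudhuri equation governs it.\<close>

definition wave_r_u where
  "wave_r_u r w \<phi> u v = - ((pu (pu r) u v * pv r u v + pu r u v * wave_r V r w \<phi> u v) / r u v)
      + (pu r u v)\<^sup>2 * pv r u v / (r u v)\<^sup>2
      - pu w u v * exp (2 * w u v) / (2 * r u v) + exp (2 * w u v) * pu r u v / (4 * (r u v)\<^sup>2)
      + exp (2 * w u v) * (pu w u v * r u v * V (\<phi> u v) + pu r u v * V (\<phi> u v) / 2
          + r u v * (deriv V (\<phi> u v) * pu \<phi> u v) / 2)"

text \<open>Although r is only C^2, \<open>pu (pu r)\<close> can be differentiated in v: by the wave
  equation the mixed derivative of r is an expression in first derivatives, and its u-derivative
  involves no derivative beyond second order. The exchange of derivatives is then applied to
  \<open>pu r\<close>.\<close>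

lemma Raychaudhuri_v_derivative:
  assumes N: "open N" "(u,v) \<in> N" and C2: "C2_on N r" and C1: "C1_on N w" "C1_on N \<phi>"
    and pos: "\<And>u v. (u,v) \<in> N \<Longrightarrow> r u v > 0"
    and wave: "\<And>u v. (u,v) \<in> N \<Longrightarrow> pu (pv r) u v = wave_r V r w \<phi> u v"
  shows "((\<lambda>t. pu (pu r) u t) has_real_derivative wave_r_u r w \<phi> u v) (at v)"
proof (rule mixed_derivative_exchange[OF N, where h = "pu r" and hv = "wave_r V r w \<phi>"])
  note r1 = C2_onD(1)[OF C2]
  fix a b assume ab: "(a,b) \<in> N"
  note d = C1_onD(1,2)[OF r1 ab] C1_onD(1,2)[OF C1(1) ab] C1_onD(1,2)[OF C1(2) ab]
    C1_onD(1,2)[OF C2_onD(2)[OF C2] ab]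
  have dq: "((\<lambda>s. pv r s b) has_real_derivative wave_r V r w \<phi> a b) (at a)"
    using C1_onD(1)[OF C2_onD(3)[OF C2] ab] wave[OF ab] by simp
  show "((\<lambda>s. pu r s b) has_real_derivative pu (pu r) a b) (at a)" by (rule d)
  show "((\<lambda>t. pu r a t) has_real_derivative wave_r V r w \<phi> a b) (at b)"
    using d(8) pu_pv_commute[OF N(1) ab C2] wave[OF ab] by simp
  show "((\<lambda>s. wave_r V r w \<phi> s b) has_real_derivative wave_r_u r w \<phi> a b) (at a)"
  proof -
    have eq: "(\<lambda>s. wave_r V r w \<phi> s b) = (\<lambda>s. - (pu r s b * pv r s b / r s b) - exp (2 * w s b) / (4 * r s b)
      + exp (2 * w s b) * r s b * V (\<phi> s b) / 2)"
      by (simp add: fun_eq_iff wave_r_def)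
    show ?thesis
      unfolding eq wave_r_u_def using pos[OF ab]
      by (auto intro!: derivative_eq_intros d dq V_chain simp: field_simps power2_eq_square)
  qed
next
  note r1 = C2_onD(1)[OF C2]
  show Fc: "continuous_on N (\<lambda>p. wave_r V r w \<phi> (fst p) (snd p))"
    by (rule continuous_wave_r[OF r1 C1 Vc(1) pos])
  have "\<forall>p\<in>N. r (fst p) (snd p) \<noteq> 0" using pos by (metis less_irrefl prod.collapse)
  then show "continuous_on N (\<lambda>p. wave_r_u r w \<phi> (fst p) (snd p))"
    unfolding wave_r_u_def
    by (intro continuous_intros Fc continuous_V_comp C1_onD(3-5)[OF r1] C1_onD(3-5)[OF C1(1)]
          C1_onD(3-5)[OF C1(2)] C1_onD(3-5)[OF C2_onD(2)[OF C2]]) auto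
qed

lemma w_wave_algebra:
  fixes r :: real
  assumes "r > 0" "p \<noteq> 0"
    and X: "X = - (p * q / r) - e / (4 * r) + e * r * Vx / 2"
    and Y: "Y = - ((fu * q + fv * p) / r) - e * V1 / 4"
    and E: "- (((2 * a * p - r * fu\<^sup>2) * q + p * X) / r) + p\<^sup>2 * q / r\<^sup>2 - a * e / (2 * r) + e * p / (4 * r\<^sup>2)
        + e * (a * r * Vx + p * Vx / 2 + r * (V1 * fu) / 2)
      = 2 * (Z * p + a * X) - (q * fu\<^sup>2 + 2 * r * fu * Y)"
  shows "Z = e / (4 * r\<^sup>2) + p * q / r\<^sup>2 - fu * fv"
proof -
  \<comment> \<open>A separate name for 1 / r, tied to r by r i = 1, turns the claim into a
    polynomial identity modulo that relation.\<close>
  define i where "i = 1 / r"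
  have ri: "r * i = 1" using assms(1) by (simp add: i_def)
  have "X = - (p * q * i) - e * i / 4 + e * r * Vx / 2" "Y = - ((fu * q + fv * p) * i) - e * V1 / 4"
    using X Y by (simp_all add: i_def)
  moreover have "- (((2 * a * p - r * fu\<^sup>2) * q + p * X) * i) + p\<^sup>2 * q * i\<^sup>2 - a * e * i / 2 + e * p * i\<^sup>2 / 4
        + e * (a * r * Vx + p * Vx / 2 + r * (V1 * fu) / 2)
      = 2 * (Z * p + a * X) - (q * fu\<^sup>2 + 2 * r * fu * Y)"
    using E by (simp add: i_def power_divide)
  ultimately have "2 * p * (Z - (e * i\<^sup>2 / 4 + p * q * i\<^sup>2 - fu * fv)) = 0"
    using ri by algebra
  then have "p * (Z - (e / (4 * r\<^sup>2) + p * q / r\<^sup>2 - fu * fv)) = 0"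
    by (simp add: i_def power_divide mult.commute)
  then show ?thesis using assms(2) by simp
qed

text \<open>The third derivative of r computed from the wave equation is compared with the
  v-derivative of the Raychaudhuri equation in u. The only unknown in the comparison is the mixed
  derivative of w, with coefficient 2 \<open>pu r\<close>; this is where \<open>pu r\<close> must
  not vanish.\<close>

lemma w_wave:
  assumes N: "open N" "(u,v) \<in> N" and C2: "C2_on N r" "C2_on N w" "C2_on N \<phi>"
    and pos: "\<And>u v. (u,v) \<in> N \<Longrightarrow> r u v > 0 \<and> pu r u v \<noteq> 0"
    and wave: "\<And>u v. (u,v) \<in> N \<Longrightarrow> pu (pv r) u v = wave_r V r w \<phi> u v"
      "\<And>u v. (u,v) \<in> N \<Longrightarrow> pu (pv \<phi>) u v = wave_phi V r w \<phi> u v"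
    and R: "\<And>u v. (u,v) \<in> N \<Longrightarrow> pu (pu r) u v = 2 * pu w u v * pu r u v - r u v * (pu \<phi> u v)\<^sup>2"
  shows "pu (pv w) u v = wave_w r w \<phi> u v"
proof -
  note c = pu_pv_commute[OF N C2(1)] pu_pv_commute[OF N C2(2)] pu_pv_commute[OF N C2(3)]
  note d = C1_onD(2)[OF C2_onD(1)[OF C2(1)] N(2)] C1_onD(2)[OF C2_onD(2)[OF C2(1)] N(2)]
    C1_onD(2)[OF C2_onD(2)[OF C2(2)] N(2)] C1_onD(2)[OF C2_onD(2)[OF C2(3)] N(2)]
  note d' = d[unfolded c wave(1)[OF N(2)] wave(2)[OF N(2)]]
  have "((\<lambda>t. pu (pu r) u t) has_real_derivative wave_r_u r w \<phi> u v) (at v)"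
    by (rule Raychaudhuri_v_derivative[OF N C2(1) C2_onD(1)[OF C2(2)] C2_onD(1)[OF C2(3)]])
       (use pos wave in auto)
  moreover have "((\<lambda>t. pu (pu r) u t) has_real_derivative 2 * (pu (pv w) u v * pu r u v + pu w u v * wave_r V r w \<phi> u v)
      - (pv r u v * (pu \<phi> u v)\<^sup>2 + 2 * r u v * pu \<phi> u v * wave_phi V r w \<phi> u v)) (at v)"
  proof (rule has_field_derivative_transform_within_open[OF _ slice_open(2)[OF N(1)]])
    show "((\<lambda>t. 2 * pu w u t * pu r u t - r u t * (pu \<phi> u t)\<^sup>2) has_real_derivative
        2 * (pu (pv w) u v * pu r u v + pu w u v * wave_r V r w \<phi> u v)
      - (pv r u v * (pu \<phi> u v)\<^sup>2 + 2 * r u v * pu \<phi> u v * wave_phi V r w \<phi> u v)) (at v)"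
      by (auto intro!: derivative_eq_intros d' simp: algebra_simps)
    show "2 * pu w u t * pu r u t - r u t * (pu \<phi> u t)\<^sup>2 = pu (pu r) u t" if "t \<in> {t. (u,t) \<in> N}" for t
      using R that by simp
  qed (use N in auto)
  ultimately have "wave_r_u r w \<phi> u v = 2 * (pu (pv w) u v * pu r u v + pu w u v * wave_r V r w \<phi> u v)
      - (pv r u v * (pu \<phi> u v)\<^sup>2 + 2 * r u v * pu \<phi> u v * wave_phi V r w \<phi> u v)"
    by (rule DERIV_unique)
  then show ?thesis unfolding wave_w_def wave_r_u_def R[OF N(2)]
    by (intro w_wave_algebra[where X = "wave_r V r w \<phi> u v" and Y = "wave_phi V r w \<phi> u v"])
       (use pos[OF N(2)] in \<open>simp_all add: wave_r_def wave_phi_def\<close>)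
qed

text \<open>This is the regularity provided by the characteristic fixed point: C^1 with mixed
  derivatives in both orders, and no statement about pure second derivatives. The Raychaudhuri
  equations are left out and treated as constraints.\<close>

definition wave_system where
  "wave_system N r w \<phi> \<longleftrightarrow> C1_on N r \<and> C1_on N w \<and> C1_on N \<phi> \<and> (\<forall>(u,v)\<in>N. r u v > 0
     \<and> ((\<lambda>t. pu r u t) has_real_derivative wave_r V r w \<phi> u v) (at v)
     \<and> ((\<lambda>s. pv r s v) has_real_derivative wave_r V r w \<phi> u v) (at u)
     \<and> ((\<lambda>t. pu w u t) has_real_derivative wave_w r w \<phi> u v) (at v)
     \<and> ((\<lambda>s. pv w s v) has_real_derivative wave_w r w \<phi> u v) (at u)
     \<and> ((\<lambda>t. pu \<phi> u t) has_real_derivative wave_phi V r w \<phi> u v) (at v)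
     \<and> ((\<lambda>s. pv \<phi> s v) has_real_derivative wave_phi V r w \<phi> u v) (at u))"

text \<open>U stands for the second u-derivative of r and is not assumed to satisfy the constraint.
  The left-hand side is a multiple of 1 - r i.\<close>

lemma Raychaudhuri_algebra:
  fixes r :: real
  assumes ri: "r * i = 1"
    and X: "X = - (p * q * i) - e * i / 4 + e * r * Vx / 2"
    and Y: "Y = - ((fu * q + fv * p) * i) - e * V1 / 4"
    and Z: "Z = e * i\<^sup>2 / 4 + p * q * i\<^sup>2 - fu * fv"
  shows "q * (U - (2 * a * p - r * fu\<^sup>2)) + r * (- ((U * q + p * X) * i) + p\<^sup>2 * q * i\<^sup>2 - a * e * i / 2
     + e * p * i\<^sup>2 / 4 + e * (a * r * Vx + p * Vx / 2 + r * (V1 * fu) / 2)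
     - (2 * (Z * p + a * X) - (q * fu\<^sup>2 + 2 * r * fu * Y))) = 0"
proof -
  have "q * (U - (2 * a * p - r * fu\<^sup>2)) + r * (- ((U * q + p * X) * i) + p\<^sup>2 * q * i\<^sup>2 - a * e * i / 2
     + e * p * i\<^sup>2 / 4 + e * (a * r * Vx + p * Vx / 2 + r * (V1 * fu) / 2)
     - (2 * (Z * p + a * X) - (q * fu\<^sup>2 + 2 * r * fu * Y)))
    = (1 - r * i) * (q * U - 2 * a * p * q + 2 * r * q * fu\<^sup>2 + e * r * p * Vx / 2 + 2 * r * p * fu * fv)"
    unfolding X Y Z by (simp add: field_simps power2_eq_square)
  then show ?thesis using ri by simp
qed

text \<open>By the wave equations, the v-derivative of the defect in the Raychaudhuri equation
  equals - \<open>pv r\<close> / r times the defect. So r times the defect is constant in v, and on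
  each line u = const the constraint needs to be known at a single point only.\<close>

lemma Raychaudhuri_propagates:
  assumes IJ: "open I" "open J" "convex J" and C2: "C2_on (I \<times> J) r" "C2_on (I \<times> J) w" "C2_on (I \<times> J) \<phi>"
    and W: "wave_system (I \<times> J) r w \<phi>" and u: "u \<in> I" and c: "c \<in> J" "v \<in> J"
    and base: "pu (pu r) u c = 2 * pu w u c * pu r u c - r u c * (pu \<phi> u c)\<^sup>2"
  shows "pu (pu r) u v = 2 * pu w u v * pu r u v - r u v * (pu \<phi> u v)\<^sup>2"
proof -
  have N: "open (I \<times> J)" by (rule open_Times[OF IJ(1,2)])
  define E where "E t = r u t * (pu (pu r) u t - (2 * pu w u t * pu r u t - r u t * (pu \<phi> u t)\<^sup>2))" for t
  have "(E has_real_derivative 0) (at t)" if "t \<in> J" for t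
  proof -
    have ut: "(u,t) \<in> I \<times> J" using u that by simp
    have pos: "r u t > 0" using W ut by (auto simp: wave_system_def)
    have "((\<lambda>t. pu (pu r) u t) has_real_derivative wave_r_u r w \<phi> u t) (at t)"
      by (rule Raychaudhuri_v_derivative[OF N ut C2(1) C2_onD(1)[OF C2(2)] C2_onD(1)[OF C2(3)]])
         (use W in \<open>auto simp: wave_system_def pu_def DERIV_imp_deriv\<close>)
    moreover have "(r u has_real_derivative pv r u t) (at t)" by (rule C1_onD(2)[OF C2_onD(1)[OF C2(1)] ut])
    moreover have "(pu r u has_real_derivative wave_r V r w \<phi> u t) (at t)"
      "(pu w u has_real_derivative wave_w r w \<phi> u t) (at t)" "(pu \<phi> u has_real_derivative wave_phi V r w \<phi> u t) (at t)"
      using W ut by (auto simp: wave_system_def)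
    ultimately have dE: "(E has_real_derivative pv r u t * (pu (pu r) u t - (2 * pu w u t * pu r u t - r u t * (pu \<phi> u t)\<^sup>2))
      + r u t * (wave_r_u r w \<phi> u t - (2 * (wave_w r w \<phi> u t * pu r u t + pu w u t * wave_r V r w \<phi> u t)
         - (pv r u t * (pu \<phi> u t)\<^sup>2 + 2 * r u t * pu \<phi> u t * wave_phi V r w \<phi> u t)))) (at t)"
      unfolding E_def by (auto intro!: derivative_eq_intros simp: algebra_simps)
    define i where "i = 1 / r u t"
    have ri: "r u t * i = 1" using pos by (simp add: i_def)
    have d: "x / r u t = x * i" "x / (r u t)\<^sup>2 = x * i\<^sup>2" "x / (4 * r u t) = x * i / 4" "x / (2 * r u t) = x * i / 2"
      "x / (4 * (r u t)\<^sup>2) = x * i\<^sup>2 / 4" for x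
      by (simp_all add: i_def power_divide)
    have "pv r u t * (pu (pu r) u t - (2 * pu w u t * pu r u t - r u t * (pu \<phi> u t)\<^sup>2))
      + r u t * (wave_r_u r w \<phi> u t - (2 * (wave_w r w \<phi> u t * pu r u t + pu w u t * wave_r V r w \<phi> u t)
         - (pv r u t * (pu \<phi> u t)\<^sup>2 + 2 * r u t * pu \<phi> u t * wave_phi V r w \<phi> u t))) = 0"
      unfolding wave_r_u_def d
      by (rule Raychaudhuri_algebra[where fv = "pv \<phi> u t", OF ri]) (simp_all add: wave_r_def wave_w_def wave_phi_def d)
    with dE show ?thesis by simp
  qed
  then obtain k where k: "\<And>t. t \<in> J \<Longrightarrow> E t = k"
    using has_field_derivative_zero_constant[OF IJ(3), of E] has_field_derivative_at_within by metis
  have "E v = E c" using k c by simp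
  also have "E c = 0" using base by (simp add: E_def)
  finally have "E v = 0" .
  moreover have "r u v > 0" using W u c by (auto simp: wave_system_def)
  ultimately show ?thesis by (simp add: E_def)
qed

end

text \<open>h is recovered from its values on the line v = c and its v-derivative k. If k can be
  differentiated in u, so can h, although its u-derivative is given only on that line.\<close>

lemma leibniz_regularity:
  fixes h k ku :: "real \<Rightarrow> real \<Rightarrow> real"
  assumes IJ: "open I" "open J" "convex I" "convex J" "c \<in> J"
    and h: "\<And>u v. u \<in> I \<Longrightarrow> v \<in> J \<Longrightarrow> ((\<lambda>t. h u t) has_real_derivative k u v) (at v)"
    and k: "\<And>u v. u \<in> I \<Longrightarrow> v \<in> J \<Longrightarrow> ((\<lambda>s. k s v) has_real_derivative ku u v) (at u)"
    and c: "continuous_on (I \<times> J) (\<lambda>p. k (fst p) (snd p))" "continuous_on (I \<times> J) (\<lambda>p. ku (fst p) (snd p))"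
    and A: "\<And>u. u \<in> I \<Longrightarrow> ((\<lambda>s. h s c) has_real_derivative A u) (at u)" "continuous_on I A"
  obtains hu where "continuous_on (I \<times> J) (\<lambda>p. hu (fst p) (snd p))"
    "\<And>u v. u \<in> I \<Longrightarrow> v \<in> J \<Longrightarrow> ((\<lambda>s. h s v) has_real_derivative hu u v) (at u)"
proof (rule that[of "\<lambda>u v. A u + primitive_v ku c u v"])
  show "continuous_on (I \<times> J) (\<lambda>p. A (fst p) + primitive_v ku c (fst p) (snd p))"
    by (intro continuous_intros primitive_v_continuous c IJ continuous_on_compose2[OF A(2)]) auto
  fix u v assume uv: "u \<in> I" "v \<in> J"
  have eq: "h s c + primitive_v k c s v = h s v" if "s \<in> I" for s
  proof -
    have "primitive_v k c s v = h s v - h s c"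
    proof (rule primitive_v_eq[of J])
      fix t assume "t \<in> J"
      show "(h s has_vector_derivative k s t) (at t within J)"
        using h[OF that \<open>t \<in> J\<close>] by (simp add: has_real_derivative_iff_has_vector_derivative has_vector_derivative_at_within)
    qed (use IJ uv in auto)
    then show ?thesis by simp
  qed
  have "((\<lambda>s. primitive_v k c s v) has_real_derivative primitive_v ku c u v) (at u)"
    unfolding has_real_derivative_iff_has_vector_derivative
  proof (rule primitive_v_deriv_u[of J _ _ I])
    show "continuous_on J (k u)" if "u \<in> I" for u by (rule continuous_on_arg2[OF c(1) that])
    show "((\<lambda>s. k s t) has_vector_derivative ku u t) (at u)" if "u \<in> I" "t \<in> J" for u t
      using k[OF that] by (simp add: has_real_derivative_iff_has_vector_derivative)
  qed (use IJ uv c in auto)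
  from DERIV_add[OF A(1)[OF uv(1)] this]
  show "((\<lambda>s. h s v) has_real_derivative A u + primitive_v ku c u v) (at u)"
    by (rule has_field_derivative_transform_within_open[OF _ IJ(1) uv(1)]) (rule eq)
qed

section \<open>Exchanging the two null coordinates\<close>

lemma pu_flip: "pu (\<lambda>a b. f b a) = (\<lambda>a b. pv f b a)"
  by (simp add: fun_eq_iff pu_def pv_def)

lemma pv_flip: "pv (\<lambda>a b. f b a) = (\<lambda>a b. pu f b a)"
  by (simp add: fun_eq_iff pu_def pv_def)

lemma C1_on_flip:
  assumes "C1_on (prod.swap -` M) f"
  shows "C1_on M (\<lambda>a b. f b a)"
proof (rule C1_onI[where fu = "\<lambda>a b. pv f b a" and fv = "\<lambda>a b. pu f b a"])
  fix u v assume "(u,v) \<in> M"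
  then have "(v,u) \<in> prod.swap -` M" by simp
  from C1_onD(1,2)[OF assms this]
  show "((\<lambda>s. f v s) has_real_derivative pv f v u) (at u)" "((\<lambda>t. f t u) has_real_derivative pu f v u) (at v)"
    by simp_all
next
  have sw: "continuous_on M (\<lambda>p. g (snd p) (fst p))"
    if "continuous_on (prod.swap -` M) (\<lambda>p. g (fst p) (snd p))" for g :: "real \<Rightarrow> real \<Rightarrow> real"
    by (rule continuous_on_compose2[OF that, where f = "\<lambda>p. (snd p, fst p)", simplified])
       (auto intro!: continuous_intros)
  show "continuous_on M (\<lambda>p. f (snd p) (fst p))" "continuous_on M (\<lambda>p. pv f (snd p) (fst p))"
    "continuous_on M (\<lambda>p. pu f (snd p) (fst p))"
    by (rule sw; rule C1_onD[OF assms])+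
qed

lemma C2_on_flip:
  assumes "C2_on (prod.swap -` M) f"
  shows "C2_on M (\<lambda>a b. f b a)"
  using C1_on_flip[of M f] C1_on_flip[of M "pu f"] C1_on_flip[of M "pv f"] assms
  unfolding C2_on_def pu_flip[of f] pv_flip[of f] by auto

lemma swap_vimage_Times: "prod.swap -` (A \<times> B) = B \<times> A"
  by auto

lemma flip_wave_r: "wave_r V (\<lambda>a b. r b a) (\<lambda>a b. w b a) (\<lambda>a b. \<phi> b a) u v = wave_r V r w \<phi> v u"
  "wave_w (\<lambda>a b. r b a) (\<lambda>a b. w b a) (\<lambda>a b. \<phi> b a) u v = wave_w r w \<phi> v u"
  "wave_phi V (\<lambda>a b. r b a) (\<lambda>a b. w b a) (\<lambda>a b. \<phi> b a) u v = wave_phi V r w \<phi> v u"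
  unfolding wave_r_def wave_w_def wave_phi_def pu_flip[of r] pu_flip[of \<phi>] pv_flip[of r] pv_flip[of \<phi>]
  by (simp_all add: mult.commute add.commute)

section \<open>Second-order regularity of solutions of the wave system\<close>

context C2_potential
begin

lemma wave_systemD:
  assumes "wave_system N r w \<phi>" "(u,v) \<in> N"
  shows "r u v > 0"
    "((\<lambda>t. pu r u t) has_real_derivative wave_r V r w \<phi> u v) (at v)"
    "((\<lambda>s. pv r s v) has_real_derivative wave_r V r w \<phi> u v) (at u)"
    "((\<lambda>t. pu w u t) has_real_derivative wave_w r w \<phi> u v) (at v)"
    "((\<lambda>s. pv w s v) has_real_derivative wave_w r w \<phi> u v) (at u)"
    "((\<lambda>t. pu \<phi> u t) has_real_derivative wave_phi V r w \<phi> u v) (at v)"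
    "((\<lambda>s. pv \<phi> s v) has_real_derivative wave_phi V r w \<phi> u v) (at u)"
  using assms by (auto simp: wave_system_def)

lemma wave_systemI:
  assumes "C1_on N r" "C1_on N w" "C1_on N \<phi>"
    and "\<And>u v. (u,v) \<in> N \<Longrightarrow> r u v > 0"
    "\<And>u v. (u,v) \<in> N \<Longrightarrow> ((\<lambda>t. pu r u t) has_real_derivative wave_r V r w \<phi> u v) (at v)"
    "\<And>u v. (u,v) \<in> N \<Longrightarrow> ((\<lambda>s. pv r s v) has_real_derivative wave_r V r w \<phi> u v) (at u)"
    "\<And>u v. (u,v) \<in> N \<Longrightarrow> ((\<lambda>t. pu w u t) has_real_derivative wave_w r w \<phi> u v) (at v)"
    "\<And>u v. (u,v) \<in> N \<Longrightarrow> ((\<lambda>s. pv w s v) has_real_derivative wave_w r w \<phi> u v) (at u)"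
    "\<And>u v. (u,v) \<in> N \<Longrightarrow> ((\<lambda>t. pu \<phi> u t) has_real_derivative wave_phi V r w \<phi> u v) (at v)"
    "\<And>u v. (u,v) \<in> N \<Longrightarrow> ((\<lambda>s. pv \<phi> s v) has_real_derivative wave_phi V r w \<phi> u v) (at u)"
  shows "wave_system N r w \<phi>"
  unfolding wave_system_def using assms by blast

lemma wave_system_flip:
  assumes "wave_system (I \<times> J) r w \<phi>"
  shows "wave_system (J \<times> I) (\<lambda>a b. r b a) (\<lambda>a b. w b a) (\<lambda>a b. \<phi> b a)"
proof -
  note D = wave_systemD[OF assms]
  have C1: "C1_on (I \<times> J) r" "C1_on (I \<times> J) w" "C1_on (I \<times> J) \<phi>"
    using assms by (simp_all add: wave_system_def)
  note flips = flip_wave_r(1)[of V r w \<phi>] flip_wave_r(2)[of r w \<phi>] flip_wave_r(3)[of V r w \<phi>] pu_flip[of r] pu_flip[of \<phi>]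
    pv_flip[of r] pv_flip[of \<phi>] pu_flip[of w] pv_flip[of w]
  show ?thesis
  proof (rule wave_systemI)
    show "C1_on (J \<times> I) (\<lambda>a b. r b a)" "C1_on (J \<times> I) (\<lambda>a b. w b a)" "C1_on (J \<times> I) (\<lambda>a b. \<phi> b a)"
      by (rule C1_on_flip, unfold swap_vimage_Times, rule C1)+
  qed (unfold flips, (rule D, simp)+)
qed

text \<open>The wave equations for r and \<phi> contain \<open>pu r\<close> and
  \<open>pu \<phi>\<close>, so differentiating them in u directly would presuppose the second
  derivatives that are sought. Multiplying by r removes these terms: the v-derivative of r
  \<open>pu r\<close> is free of \<open>pu r\<close>, and that of r \<open>pu \<phi>\<close> is free
  of \<open>pu \<phi>\<close>. The order r, \<phi>, w matters, because the equation for \<phi>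
  contains \<open>pu r\<close> and the one for w contains both.\<close>

lemma wave_regular_u:
  assumes IJ: "open I" "open J" "convex I" "convex J" "c \<in> J"
    and W: "wave_system (I \<times> J) r w \<phi>"
    and M: "\<And>u. u \<in> I \<Longrightarrow> (u,c) \<in> M" "C2_on M r" "C2_on M w" "C2_on M \<phi>"
  shows "C1_on (I \<times> J) (pu r) \<and> C1_on (I \<times> J) (pu w) \<and> C1_on (I \<times> J) (pu \<phi>)"
proof -
  let ?N = "I \<times> J"
  have C1: "C1_on ?N r" "C1_on ?N w" "C1_on ?N \<phi>" using W by (auto simp: wave_system_def)
  note cr = C1_onD(3-5)[OF C1(1)] and cw = C1_onD(3-5)[OF C1(2)] and cp = C1_onD(3-5)[OF C1(3)]
  have pos: "(u,v) \<in> ?N \<Longrightarrow> r u v > 0" for u v using wave_systemD(1)[OF W] .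
  have nz: "\<forall>p\<in>?N. r (fst p) (snd p) \<noteq> 0" using pos by (metis less_irrefl prod.collapse)
  have FrC: "continuous_on ?N (\<lambda>p. wave_r V r w \<phi> (fst p) (snd p))" by (rule continuous_wave_r[OF C1 Vc(1) pos])
  have FwC: "continuous_on ?N (\<lambda>p. wave_w r w \<phi> (fst p) (snd p))" by (rule continuous_wave_w[OF C1 pos])
  have FpC: "continuous_on ?N (\<lambda>p. wave_phi V r w \<phi> (fst p) (snd p))" by (rule continuous_wave_phi[OF C1 Vc(2) pos])
  have line: "continuous_on I (\<lambda>u. f u c)" if "continuous_on M (\<lambda>p. f (fst p) (snd p))" for f :: "real \<Rightarrow> real \<Rightarrow> real"
    by (rule continuous_on_compose2[OF that, where f = "\<lambda>u. (u, c)", simplified])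
       (use M(1) in \<open>auto intro!: continuous_intros\<close>)
  have quot: "((\<lambda>s. g s v) has_real_derivative (hu * r u v - r u v * g u v * pu r u v) / (r u v)\<^sup>2) (at u)"
    if "((\<lambda>s. r s v * g s v) has_real_derivative hu) (at u)" "u \<in> I" "v \<in> J" for g hu u v
  proof -
    have "((\<lambda>s. r s v * g s v / r s v) has_real_derivative (hu * r u v - r u v * g u v * pu r u v) / (r u v)\<^sup>2) (at u)"
      unfolding power2_eq_square
      by (rule DERIV_divide[OF that(1) C1_onD(1)[OF C1(1)]]) (use pos[of u v] that(2,3) in auto)
    then show ?thesis
      by (rule has_field_derivative_transform_within_open[OF _ IJ(1) that(2)])
         (use pos that(3) in fastforce)
  qed
  have r2: "C1_on ?N (pu r)"
  proof -
    have d: "((\<lambda>s. r s v) has_real_derivative pu r u v) (at u)" "((\<lambda>t. r u t) has_real_derivative pv r u v) (at v)"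
      "((\<lambda>s. w s v) has_real_derivative pu w u v) (at u)" "((\<lambda>s. \<phi> s v) has_real_derivative pu \<phi> u v) (at u)"
      "((\<lambda>t. pu r u t) has_real_derivative wave_r V r w \<phi> u v) (at v)" if "u \<in> I" "v \<in> J" for u v
      using C1_onD(1,2)[OF C1(1)] C1_onD(1)[OF C1(2)] C1_onD(1)[OF C1(3)] wave_systemD(2)[OF W] that by auto
    obtain hu where hu: "continuous_on ?N (\<lambda>p. hu (fst p) (snd p))"
      "\<And>u v. u \<in> I \<Longrightarrow> v \<in> J \<Longrightarrow> ((\<lambda>s. r s v * pu r s v) has_real_derivative hu u v) (at u)"
    proof (rule leibniz_regularity[OF IJ(1-5), where h = "\<lambda>u v. r u v * pu r u v"
          and k = "\<lambda>u v. exp (2 * w u v) * ((r u v)\<^sup>2 * V (\<phi> u v) / 2 - 1/4)"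
          and ku = "\<lambda>u v. exp (2 * w u v) * (2 * pu w u v * ((r u v)\<^sup>2 * V (\<phi> u v) / 2 - 1/4)
              + r u v * pu r u v * V (\<phi> u v) + (r u v)\<^sup>2 * (deriv V (\<phi> u v) * pu \<phi> u v) / 2)"
          and A = "\<lambda>u. pu r u c * pu r u c + r u c * pu (pu r) u c"])
      fix u v assume uv: "u \<in> I" "v \<in> J"
      show "((\<lambda>t. r u t * pu r u t) has_real_derivative exp (2 * w u v) * ((r u v)\<^sup>2 * V (\<phi> u v) / 2 - 1/4)) (at v)"
        using pos[of u v] uv by (auto intro!: derivative_eq_intros d[OF uv] simp: wave_r_def field_simps power2_eq_square)
      show "((\<lambda>s. exp (2 * w s v) * ((r s v)\<^sup>2 * V (\<phi> s v) / 2 - 1/4)) has_real_derivative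
         exp (2 * w u v) * (2 * pu w u v * ((r u v)\<^sup>2 * V (\<phi> u v) / 2 - 1/4)
              + r u v * pu r u v * V (\<phi> u v) + (r u v)\<^sup>2 * (deriv V (\<phi> u v) * pu \<phi> u v) / 2)) (at u)"
        by (auto intro!: derivative_eq_intros d[OF uv] V_chain simp: field_simps power2_eq_square)
    next
      fix u assume u: "u \<in> I"
      show "((\<lambda>s. r s c * pu r s c) has_real_derivative pu r u c * pu r u c + r u c * pu (pu r) u c) (at u)"
        using DERIV_mult[OF C1_onD(1)[OF C2_onD(1)[OF M(2)] M(1)[OF u]] C1_onD(1)[OF C2_onD(2)[OF M(2)] M(1)[OF u]]]
        by (simp add: algebra_simps)
    next
      show "continuous_on I (\<lambda>u. pu r u c * pu r u c + r u c * pu (pu r) u c)"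
        by (intro continuous_intros line C1_onD(3-5)[OF C2_onD(1)[OF M(2)]] C1_onD(3-5)[OF C2_onD(2)[OF M(2)]])
    qed (auto intro!: continuous_intros continuous_V_comp cr cw cp)
    show ?thesis
      by (rule C1_onI[where fv = "wave_r V r w \<phi>", OF quot[OF hu(2)]])
         (use nz in \<open>auto intro!: continuous_intros hu cr FrC wave_systemD(2)[OF W]\<close>)
  qed
  note cr2 = C1_onD(3-5)[OF r2]
  have p2: "C1_on ?N (pu \<phi>)"
  proof -
    have d: "((\<lambda>s. r s v) has_real_derivative pu r u v) (at u)" "((\<lambda>t. r u t) has_real_derivative pv r u v) (at v)"
      "((\<lambda>s. w s v) has_real_derivative pu w u v) (at u)" "((\<lambda>s. \<phi> s v) has_real_derivative pu \<phi> u v) (at u)"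
      "((\<lambda>t. pu \<phi> u t) has_real_derivative wave_phi V r w \<phi> u v) (at v)"
      "((\<lambda>s. pu r s v) has_real_derivative pu (pu r) u v) (at u)"
      "((\<lambda>s. pv \<phi> s v) has_real_derivative wave_phi V r w \<phi> u v) (at u)"
      if "u \<in> I" "v \<in> J" for u v
      using C1_onD(1,2)[OF C1(1)] C1_onD(1)[OF C1(2)] C1_onD(1)[OF C1(3)] wave_systemD(6,7)[OF W] C1_onD(1)[OF r2] that by auto
    obtain hu where hu: "continuous_on ?N (\<lambda>p. hu (fst p) (snd p))"
      "\<And>u v. u \<in> I \<Longrightarrow> v \<in> J \<Longrightarrow> ((\<lambda>s. r s v * pu \<phi> s v) has_real_derivative hu u v) (at u)"
    proof (rule leibniz_regularity[OF IJ(1-5), where h = "\<lambda>u v. r u v * pu \<phi> u v"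
          and k = "\<lambda>u v. - (pv \<phi> u v * pu r u v) - r u v * exp (2 * w u v) * deriv V (\<phi> u v) / 4"
          and ku = "\<lambda>u v. - (wave_phi V r w \<phi> u v * pu r u v + pv \<phi> u v * pu (pu r) u v)
             - exp (2 * w u v) * (pu r u v * deriv V (\<phi> u v) + 2 * r u v * pu w u v * deriv V (\<phi> u v)
                + r u v * (deriv (deriv V) (\<phi> u v) * pu \<phi> u v)) / 4"
          and A = "\<lambda>u. pu r u c * pu \<phi> u c + r u c * pu (pu \<phi>) u c"])
      fix u v assume uv: "u \<in> I" "v \<in> J"
      show "((\<lambda>t. r u t * pu \<phi> u t) has_real_derivative - (pv \<phi> u v * pu r u v) - r u v * exp (2 * w u v) * deriv V (\<phi> u v) / 4) (at v)"
        using pos[of u v] uv by (auto intro!: derivative_eq_intros d[OF uv] simp: wave_phi_def field_simps power2_eq_square)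
      show "((\<lambda>s. - (pv \<phi> s v * pu r s v) - r s v * exp (2 * w s v) * deriv V (\<phi> s v) / 4) has_real_derivative
          - (wave_phi V r w \<phi> u v * pu r u v + pv \<phi> u v * pu (pu r) u v)
             - exp (2 * w u v) * (pu r u v * deriv V (\<phi> u v) + 2 * r u v * pu w u v * deriv V (\<phi> u v)
                + r u v * (deriv (deriv V) (\<phi> u v) * pu \<phi> u v)) / 4) (at u)"
        by (auto intro!: derivative_eq_intros d[OF uv] V_chain simp: field_simps power2_eq_square)
    next
      fix u assume u: "u \<in> I"
      show "((\<lambda>s. r s c * pu \<phi> s c) has_real_derivative pu r u c * pu \<phi> u c + r u c * pu (pu \<phi>) u c) (at u)"
        using DERIV_mult[OF C1_onD(1)[OF C2_onD(1)[OF M(2)] M(1)[OF u]] C1_onD(1)[OF C2_onD(2)[OF M(4)] M(1)[OF u]]]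
        by (simp add: algebra_simps)
    next
      show "continuous_on I (\<lambda>u. pu r u c * pu \<phi> u c + r u c * pu (pu \<phi>) u c)"
        by (intro continuous_intros line C1_onD(3-5)[OF C2_onD(1)[OF M(2)]] C1_onD(3-5)[OF C2_onD(2)[OF M(4)]])
    qed (auto intro!: continuous_intros continuous_V_comp cr cw cp cr2 FpC)
    show ?thesis
      by (rule C1_onI[where fv = "wave_phi V r w \<phi>", OF quot[OF hu(2)]])
         (use nz in \<open>auto intro!: continuous_intros hu cr cp FpC wave_systemD(6)[OF W]\<close>)
  qed
  note cp2 = C1_onD(3-5)[OF p2]
  have w2: "C1_on ?N (pu w)"
  proof -
    have d: "((\<lambda>s. r s v) has_real_derivative pu r u v) (at u)"
      "((\<lambda>s. w s v) has_real_derivative pu w u v) (at u)"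
      "((\<lambda>s. pu \<phi> s v) has_real_derivative pu (pu \<phi>) u v) (at u)"
      "((\<lambda>s. pu r s v) has_real_derivative pu (pu r) u v) (at u)"
      "((\<lambda>s. pv r s v) has_real_derivative wave_r V r w \<phi> u v) (at u)"
      "((\<lambda>s. pv \<phi> s v) has_real_derivative wave_phi V r w \<phi> u v) (at u)"
      if "u \<in> I" "v \<in> J" for u v
      using C1_onD(1)[OF C1(1)] C1_onD(1)[OF C1(2)] wave_systemD(3,7)[OF W] C1_onD(1)[OF r2] C1_onD(1)[OF p2] that by auto
    obtain hu where hu: "continuous_on ?N (\<lambda>p. hu (fst p) (snd p))"
      "\<And>u v. u \<in> I \<Longrightarrow> v \<in> J \<Longrightarrow> ((\<lambda>s. pu w s v) has_real_derivative hu u v) (at u)"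
    proof (rule leibniz_regularity[OF IJ(1-5), where h = "pu w" and k = "wave_w r w \<phi>"
          and ku = "\<lambda>u v. exp (2 * w u v) * pu w u v / (2 * (r u v)\<^sup>2) - exp (2 * w u v) * pu r u v / (2 * r u v ^ 3)
             + (pu (pu r) u v * pv r u v + pu r u v * wave_r V r w \<phi> u v) / (r u v)\<^sup>2
             - 2 * (pu r u v)\<^sup>2 * pv r u v / r u v ^ 3
             - (pu (pu \<phi>) u v * pv \<phi> u v + pu \<phi> u v * wave_phi V r w \<phi> u v)"
          and A = "\<lambda>u. pu (pu w) u c"])
      fix u v assume uv: "u \<in> I" "v \<in> J"
      show "((\<lambda>t. pu w u t) has_real_derivative wave_w r w \<phi> u v) (at v)" using wave_systemD(4)[OF W] uv by auto
      have eq: "(\<lambda>s. wave_w r w \<phi> s v) = (\<lambda>s. exp (2 * w s v) / (4 * (r s v)\<^sup>2) + pu r s v * pv r s v / (r s v)\<^sup>2 - pu \<phi> s v * pv \<phi> s v)"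
        by (simp add: wave_w_def fun_eq_iff)
      show "((\<lambda>s. wave_w r w \<phi> s v) has_real_derivative exp (2 * w u v) * pu w u v / (2 * (r u v)\<^sup>2) - exp (2 * w u v) * pu r u v / (2 * r u v ^ 3)
             + (pu (pu r) u v * pv r u v + pu r u v * wave_r V r w \<phi> u v) / (r u v)\<^sup>2
             - 2 * (pu r u v)\<^sup>2 * pv r u v / r u v ^ 3
             - (pu (pu \<phi>) u v * pv \<phi> u v + pu \<phi> u v * wave_phi V r w \<phi> u v)) (at u)"
        unfolding eq using pos[of u v] uv
        by (auto intro!: derivative_eq_intros d[OF uv] simp: field_simps power2_eq_square power3_eq_cube)
    next
      fix u assume u: "u \<in> I"
      show "((\<lambda>s. pu w s c) has_real_derivative pu (pu w) u c) (at u)"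
        by (rule C1_onD(1)[OF C2_onD(2)[OF M(3)] M(1)[OF u]])
    next
      show "continuous_on I (\<lambda>u. pu (pu w) u c)"
        by (intro line C1_onD(3-5)[OF C2_onD(2)[OF M(3)]])
    qed (use nz in \<open>auto intro!: continuous_intros cr cw cp cr2 cp2 FwC FpC FrC\<close>)
    show ?thesis
      by (rule C1_onI[where fv = "wave_w r w \<phi>", OF hu(2)])
         (auto intro!: hu cw FwC wave_systemD(4)[OF W])
  qed
  from r2 p2 w2 show ?thesis by blast
qed

text \<open>The v-derivatives come from the version in u after exchanging the coordinates; hence a
  line of each direction has to lie in the region M of known regularity.\<close>

lemma wave_regular:
  assumes IJ: "open I" "open J" "convex I" "convex J" "c \<in> J" "d \<in> I"
    and W: "wave_system (I \<times> J) r w \<phi>"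
    and M: "\<And>u. u \<in> I \<Longrightarrow> (u,c) \<in> M" "\<And>v. v \<in> J \<Longrightarrow> (d,v) \<in> M" "C2_on M r" "C2_on M w" "C2_on M \<phi>"
  shows "C2_on (I \<times> J) r \<and> C2_on (I \<times> J) w \<and> C2_on (I \<times> J) \<phi>"
proof -
  have M': "prod.swap -` (prod.swap -` M) = M" by auto
  have flip: "C2_on (prod.swap -` M) (\<lambda>a b. f b a)" if "C2_on M f" for f
    by (rule C2_on_flip) (simp only: M' that)
  note u = wave_regular_u[OF IJ(1-5) W M(1) M(3-5)]
  have v: "C1_on (J \<times> I) (pu (\<lambda>a b. r b a)) \<and> C1_on (J \<times> I) (pu (\<lambda>a b. w b a)) \<and> C1_on (J \<times> I) (pu (\<lambda>a b. \<phi> b a))"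
    by (rule wave_regular_u[where M = "prod.swap -` M", OF IJ(2,1,4,3,6) wave_system_flip[OF W] _ flip flip flip])
       (simp_all add: M)
  have "C1_on (I \<times> J) (pv f)" if "C1_on (J \<times> I) (pu (\<lambda>a b. f b a))" for f
    using C1_on_flip[of "I \<times> J" "\<lambda>a b. pv f b a"] that unfolding pu_flip[of f] swap_vimage_Times by simp
  with u v W show ?thesis unfolding C2_on_def wave_system_def by blast
qed

end

section \<open>Extension of developments\<close>

text \<open>Boundedness is part of the notion because a product of Lipschitz functions need not be
  Lipschitz without it.\<close>

definition bdd_lipschitz :: "'a::metric_space set \<Rightarrow> ('a \<Rightarrow> real) \<Rightarrow> bool" where
  "bdd_lipschitz S f \<longleftrightarrow> (\<exists>K\<ge>0. \<forall>x\<in>S. \<bar>f x\<bar> \<le> K) \<and> (\<exists>L\<ge>0. \<forall>x\<in>S. \<forall>y\<in>S. \<bar>f x - f y\<bar> \<le> L * dist x y)"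

lemma bdd_lipschitzI:
  assumes "0 \<le> K" "\<And>x. x \<in> S \<Longrightarrow> \<bar>f x\<bar> \<le> K" "0 \<le> L" "\<And>x y. x \<in> S \<Longrightarrow> y \<in> S \<Longrightarrow> \<bar>f x - f y\<bar> \<le> L * dist x y"
  shows "bdd_lipschitz S f"
  unfolding bdd_lipschitz_def using assms by blast

lemma bdd_lipschitzE:
  assumes "bdd_lipschitz S f"
  obtains K L where "0 \<le> K" "\<And>x. x \<in> S \<Longrightarrow> \<bar>f x\<bar> \<le> K" "0 \<le> L"
    "\<And>x y. x \<in> S \<Longrightarrow> y \<in> S \<Longrightarrow> \<bar>f x - f y\<bar> \<le> L * dist x y"
  using assms unfolding bdd_lipschitz_def by blast

lemma bdd_lipschitz_const: "bdd_lipschitz S (\<lambda>_. c)"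
  by (rule bdd_lipschitzI[of "\<bar>c\<bar>" _ _ 0]) auto

lemma bdd_lipschitz_add:
  assumes "bdd_lipschitz S f" "bdd_lipschitz S g"
  shows "bdd_lipschitz S (\<lambda>x. f x + g x)"
proof -
  obtain K L where f: "0 \<le> K" "\<And>x. x \<in> S \<Longrightarrow> \<bar>f x\<bar> \<le> K" "0 \<le> L"
    "\<And>x y. x \<in> S \<Longrightarrow> y \<in> S \<Longrightarrow> \<bar>f x - f y\<bar> \<le> L * dist x y" using bdd_lipschitzE[OF assms(1)] by blast
  obtain K' L' where g: "0 \<le> K'" "\<And>x. x \<in> S \<Longrightarrow> \<bar>g x\<bar> \<le> K'" "0 \<le> L'"
    "\<And>x y. x \<in> S \<Longrightarrow> y \<in> S \<Longrightarrow> \<bar>g x - g y\<bar> \<le> L' * dist x y" using bdd_lipschitzE[OF assms(2)] by blast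
  show ?thesis
  proof (rule bdd_lipschitzI[of "K + K'" _ _ "L + L'"])
    fix x y assume xy: "x \<in> S" "y \<in> S"
    then show "\<bar>f x + g x\<bar> \<le> K + K'" using f(2)[of x] g(2)[of x] by linarith
    show "\<bar>f x + g x - (f y + g y)\<bar> \<le> (L + L') * dist x y"
      using f(4)[OF xy] g(4)[OF xy] by (simp add: algebra_simps)
  qed (use f g in auto)
qed

lemma bdd_lipschitz_mult:
  assumes "bdd_lipschitz S f" "bdd_lipschitz S g"
  shows "bdd_lipschitz S (\<lambda>x. f x * g x)"
proof -
  obtain K L where f: "0 \<le> K" "\<And>x. x \<in> S \<Longrightarrow> \<bar>f x\<bar> \<le> K" "0 \<le> L"
    "\<And>x y. x \<in> S \<Longrightarrow> y \<in> S \<Longrightarrow> \<bar>f x - f y\<bar> \<le> L * dist x y" using bdd_lipschitzE[OF assms(1)] by blast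
  obtain K' L' where g: "0 \<le> K'" "\<And>x. x \<in> S \<Longrightarrow> \<bar>g x\<bar> \<le> K'" "0 \<le> L'"
    "\<And>x y. x \<in> S \<Longrightarrow> y \<in> S \<Longrightarrow> \<bar>g x - g y\<bar> \<le> L' * dist x y" using bdd_lipschitzE[OF assms(2)] by blast
  show ?thesis
  proof (rule bdd_lipschitzI[of "K * K'" _ _ "L * K' + K * L'"])
    fix x y assume xy: "x \<in> S" "y \<in> S"
    show "\<bar>f x * g x\<bar> \<le> K * K'" using f(1,2) g(2) xy by (auto simp: abs_mult intro!: mult_mono)
    have "f x * g x - f y * g y = (f x - f y) * g x + f y * (g x - g y)" by (simp add: algebra_simps)
    then have "\<bar>f x * g x - f y * g y\<bar> \<le> \<bar>f x - f y\<bar> * \<bar>g x\<bar> + \<bar>f y\<bar> * \<bar>g x - g y\<bar>"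
      by (metis abs_mult abs_triangle_ineq)
    also have "\<dots> \<le> (L * dist x y) * K' + K * (L' * dist x y)"
      using f g xy by (intro add_mono mult_mono) auto
    finally show "\<bar>f x * g x - f y * g y\<bar> \<le> (L * K' + K * L') * dist x y" by (simp add: algebra_simps)
  qed (use f g in auto)
qed

lemma bdd_lipschitz_uminus: "bdd_lipschitz S f \<Longrightarrow> bdd_lipschitz S (\<lambda>x. - f x)"
  using bdd_lipschitz_mult[OF bdd_lipschitz_const[of S "-1"], of f] by simp

lemma bdd_lipschitz_diff: "bdd_lipschitz S f \<Longrightarrow> bdd_lipschitz S g \<Longrightarrow> bdd_lipschitz S (\<lambda>x. f x - g x)"
  using bdd_lipschitz_add[OF _ bdd_lipschitz_uminus[of S g], of f] by simp

text \<open>T may be unbounded: f takes its values in the intersection of T with a bounded interval,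
  which is compact and convex, and g' is bounded there.\<close>

lemma bdd_lipschitz_compose:
  fixes g g' :: "real \<Rightarrow> real"
  assumes f: "bdd_lipschitz S f" and T: "convex T" "closed T" "\<And>x. x \<in> S \<Longrightarrow> f x \<in> T"
    and g: "\<And>t. t \<in> T \<Longrightarrow> (g has_real_derivative g' t) (at t within T)" "continuous_on T g'"
  shows "bdd_lipschitz S (\<lambda>x. g (f x))"
proof -
  obtain K L where fK: "0 \<le> K" "\<And>x. x \<in> S \<Longrightarrow> \<bar>f x\<bar> \<le> K" "0 \<le> L"
    "\<And>x y. x \<in> S \<Longrightarrow> y \<in> S \<Longrightarrow> \<bar>f x - f y\<bar> \<le> L * dist x y" using bdd_lipschitzE[OF f] by blast
  define T' where "T' = T \<inter> {-K..K}"
  have T': "compact T'" "convex T'" "T' \<subseteq> T" "\<And>x. x \<in> S \<Longrightarrow> f x \<in> T'"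
    using T fK(2) by (auto simp: T'_def abs_le_iff intro!: closed_Int_compact convex_Int) fastforce+
  have gc: "continuous_on T' g"
    by (rule DERIV_continuous_on[of T' g g']) (use g(1) T'(3) in \<open>auto intro: DERIV_subset\<close>)
  have "bounded (g ` T')" by (intro compact_imp_bounded compact_continuous_image gc T')
  then obtain B where B: "\<And>t. t \<in> T' \<Longrightarrow> \<bar>g t\<bar> \<le> B" by (auto simp: bounded_iff)
  have "bounded (g' ` T')"
    by (intro compact_imp_bounded compact_continuous_image continuous_on_subset[OF g(2)] T')
  then obtain B' where B': "\<And>t. t \<in> T' \<Longrightarrow> \<bar>g' t\<bar> \<le> B'" by (auto simp: bounded_iff)
  show ?thesis
  proof (rule bdd_lipschitzI[of "\<bar>B\<bar>" _ _ "\<bar>B'\<bar> * L"])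
    fix x y assume xy: "x \<in> S" "y \<in> S"
    show "\<bar>g (f x)\<bar> \<le> \<bar>B\<bar>" using B[OF T'(4)[OF xy(1)]] by simp
    have "norm (g (f x) - g (f y)) \<le> \<bar>B'\<bar> * norm (f x - f y)"
    proof (rule field_differentiable_bound[OF T'(2)])
      show "(g has_field_derivative g' t) (at t within T')" if "t \<in> T'" for t
        using g(1) T'(3) that by (auto intro: DERIV_subset)
      show "norm (g' t) \<le> \<bar>B'\<bar>" if "t \<in> T'" for t using B'[OF that] by simp
    qed (use T'(4) xy in auto)
    also have "\<dots> \<le> \<bar>B'\<bar> * (L * dist x y)" using fK(4)[OF xy] by (intro mult_left_mono) auto
    finally show "\<bar>g (f x) - g (f y)\<bar> \<le> \<bar>B'\<bar> * L * dist x y" by simp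
  qed (use fK in auto)
qed

type_synonym triple = "real \<times> real \<times> real"

lemma triple_norm_le: "norm (x :: triple) \<le> \<bar>fst x\<bar> + \<bar>fst (snd x)\<bar> + \<bar>snd (snd x)\<bar>"
proof -
  obtain a b c where x: "x = (a, b, c)" by (cases x)
  have "norm x \<le> norm a + norm (b, c)" unfolding x by (rule norm_Pair_le)
  also have "norm (b, c) \<le> norm b + norm c" by (rule norm_Pair_le)
  finally show ?thesis by (simp add: x)
qed

lemma norm_fst_snd_le: "norm (fst z) \<le> norm z" "norm (snd z) \<le> norm z"
  using norm_fst_le[of "fst z" "snd z"] norm_snd_le[of "snd z" "fst z"] by auto

lemma triple_abs_le:
  "\<bar>fst (x :: triple)\<bar> \<le> norm x" "\<bar>fst (snd x)\<bar> \<le> norm x" "\<bar>snd (snd x)\<bar> \<le> norm x"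
  using norm_fst_snd_le[of x] order_trans[OF norm_fst_snd_le(1) norm_fst_snd_le(2)[of x]]
    order_trans[OF norm_fst_snd_le(2) norm_fst_snd_le(2)[of x]] by simp_all

text \<open>x, p and q hold the values, u-derivatives and v-derivatives of the triple (r, w,
  \<phi>). The derivatives of w do not occur on the right-hand side.\<close>

definition wave_rhs :: "(real \<Rightarrow> real) \<Rightarrow> triple \<Rightarrow> triple \<Rightarrow> triple \<Rightarrow> triple" where
  "wave_rhs V x p q = (let r = fst x; w = fst (snd x); f = snd (snd x);
       ru = fst p; fu = snd (snd p); rv = fst q; fv = snd (snd q) in
     (- (ru * rv / r) - exp (2 * w) / (4 * r) + exp (2 * w) * r * V f / 2,
      exp (2 * w) / (4 * r\<^sup>2) + ru * rv / r\<^sup>2 - fu * fv,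
      - ((fu * rv + fv * ru) / r) - exp (2 * w) * deriv V f / 4))"

context C2_potential
begin

text \<open>The components are sums and products of coordinates, 1 / r, exp (2 w), V and V'. Only 1
  / r requires a bound away from zero, namely c; continuity of V'' makes V' Lipschitz on bounded
  sets.\<close>

lemma wave_rhs_lipschitz:
  fixes c K R :: real
  assumes "c > 0"
  obtains L M where "0 \<le> L" "0 \<le> M"
    "\<And>x p q x' p' q'. norm x \<le> K \<Longrightarrow> c \<le> fst x \<Longrightarrow> norm x' \<le> K \<Longrightarrow> c \<le> fst x' \<Longrightarrow> norm p \<le> R \<Longrightarrow> norm p' \<le> R \<Longrightarrow>
        norm q \<le> R \<Longrightarrow> norm q' \<le> R \<Longrightarrow>
        norm (wave_rhs V x p q - wave_rhs V x' p' q') \<le> L * (norm (x - x') + norm (p - p') + norm (q - q'))"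
    "\<And>x p q. norm x \<le> K \<Longrightarrow> c \<le> fst x \<Longrightarrow> norm p \<le> R \<Longrightarrow> norm q \<le> R \<Longrightarrow> norm (wave_rhs V x p q) \<le> M"
proof -
  define S where "S = {z :: triple \<times> triple \<times> triple. norm (fst z) \<le> K \<and> c \<le> fst (fst z) \<and> norm (fst (snd z)) \<le> R \<and> norm (snd (snd z)) \<le> R}"
  have proj: "bdd_lipschitz S (\<lambda>z. h z)"
    if "\<And>z z'. h (z - z') = h z - h z'" "\<And>z. \<bar>h z\<bar> \<le> norm z" for h :: "triple \<times> triple \<times> triple \<Rightarrow> real"
  proof (rule bdd_lipschitzI[of "\<bar>K\<bar> + \<bar>R\<bar> + \<bar>R\<bar>" _ _ 1])
    fix z assume z: "z \<in> S"
    obtain x p q where zz: "z = (x, p, q)" by (cases z)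
    have "norm z \<le> norm x + norm (p, q)" unfolding zz by (rule norm_Pair_le)
    also have "norm (p, q) \<le> norm p + norm q" by (rule norm_Pair_le)
    finally have "norm z \<le> norm x + (norm p + norm q)" by simp
    moreover have "norm x \<le> \<bar>K\<bar>" "norm p \<le> \<bar>R\<bar>" "norm q \<le> \<bar>R\<bar>" using z by (auto simp: S_def zz)
    ultimately have "norm z \<le> \<bar>K\<bar> + \<bar>R\<bar> + \<bar>R\<bar>" by linarith
    with that(2)[of z] show "\<bar>h z\<bar> \<le> \<bar>K\<bar> + \<bar>R\<bar> + \<bar>R\<bar>" by simp
  next
    fix z z' assume "z \<in> S" "z' \<in> S"
    show "\<bar>h z - h z'\<bar> \<le> 1 * dist z z'" using that(2)[of "z - z'"] by (simp add: that(1) dist_norm)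
  qed auto
  have n: "norm (fst z) \<le> norm z" "norm (fst (snd z)) \<le> norm z" "norm (snd (snd z)) \<le> norm z" for z :: "triple \<times> triple \<times> triple"
    using norm_fst_snd_le[of z] order_trans[OF norm_fst_snd_le(1) norm_fst_snd_le(2)[of z]]
      order_trans[OF norm_fst_snd_le(2) norm_fst_snd_le(2)[of z]] by simp_all
  have pr: "bdd_lipschitz S (\<lambda>z. fst (fst z))" "bdd_lipschitz S (\<lambda>z. fst (snd (fst z)))" "bdd_lipschitz S (\<lambda>z. snd (snd (fst z)))"
    "bdd_lipschitz S (\<lambda>z. fst (fst (snd z)))" "bdd_lipschitz S (\<lambda>z. snd (snd (fst (snd z))))"
    "bdd_lipschitz S (\<lambda>z. fst (snd (snd z)))" "bdd_lipschitz S (\<lambda>z. snd (snd (snd (snd z))))"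
    using order_trans[OF triple_abs_le(1) n(1)] order_trans[OF triple_abs_le(2) n(1)] order_trans[OF triple_abs_le(3) n(1)]
      order_trans[OF triple_abs_le(1) n(2)] order_trans[OF triple_abs_le(3) n(2)]
      order_trans[OF triple_abs_le(1) n(3)] order_trans[OF triple_abs_le(3) n(3)]
    by (simp_all add: proj)
  have inv: "bdd_lipschitz S (\<lambda>z. inverse (fst (fst z)))"
  proof (rule bdd_lipschitz_compose[OF pr(1), of "{c..}" inverse "\<lambda>t. - (inverse t ^ 2)"])
    show "(inverse has_real_derivative - (inverse t ^ 2)) (at t within {c..})" if "t \<in> {c..}" for t
      using that assms by (auto intro!: derivative_eq_intros simp: power2_eq_square)
  qed (use assms in \<open>auto simp: S_def intro!: continuous_intros\<close>)
  have ex: "bdd_lipschitz S (\<lambda>z. exp (2 * fst (snd (fst z))))"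
    by (rule bdd_lipschitz_compose[OF pr(2), of UNIV "\<lambda>t. exp (2 * t)" "\<lambda>t. exp (2 * t) * 2"])
       (auto intro!: derivative_eq_intros continuous_intros)
  have Vb: "bdd_lipschitz S (\<lambda>z. V (snd (snd (fst z))))"
    by (rule bdd_lipschitz_compose[OF pr(3), of UNIV V "deriv V"]) (use V1 Vc in auto)
  have V1b: "bdd_lipschitz S (\<lambda>z. deriv V (snd (snd (fst z))))"
    by (rule bdd_lipschitz_compose[OF pr(3), of UNIV "deriv V" "deriv (deriv V)"]) (use V2 V2c in auto)
  note bl = bdd_lipschitz_add bdd_lipschitz_mult bdd_lipschitz_uminus bdd_lipschitz_diff bdd_lipschitz_const pr inv ex Vb V1b
  define G where "G z = wave_rhs V (fst z) (fst (snd z)) (snd (snd z))" for z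
  have g1: "bdd_lipschitz S (\<lambda>z. fst (G z))"
    unfolding G_def wave_rhs_def Let_def divide_inverse fst_conv snd_conv inverse_mult_distrib by (intro bl)
  have g2: "bdd_lipschitz S (\<lambda>z. fst (snd (G z)))"
    unfolding G_def wave_rhs_def Let_def divide_inverse fst_conv snd_conv inverse_mult_distrib power2_eq_square by (intro bl)
  have g3: "bdd_lipschitz S (\<lambda>z. snd (snd (G z)))"
    unfolding G_def wave_rhs_def Let_def divide_inverse fst_conv snd_conv inverse_mult_distrib by (intro bl)
  obtain K1 L1 where b1: "0 \<le> K1" "\<And>x. x \<in> S \<Longrightarrow> \<bar>fst (G x)\<bar> \<le> K1" "0 \<le> L1"
    "\<And>x y. x \<in> S \<Longrightarrow> y \<in> S \<Longrightarrow> \<bar>fst (G x) - fst (G y)\<bar> \<le> L1 * dist x y" using bdd_lipschitzE[OF g1] by blast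
  obtain K2 L2 where b2: "0 \<le> K2" "\<And>x. x \<in> S \<Longrightarrow> \<bar>fst (snd (G x))\<bar> \<le> K2" "0 \<le> L2"
    "\<And>x y. x \<in> S \<Longrightarrow> y \<in> S \<Longrightarrow> \<bar>fst (snd (G x)) - fst (snd (G y))\<bar> \<le> L2 * dist x y" using bdd_lipschitzE[OF g2] by blast
  obtain K3 L3 where b3: "0 \<le> K3" "\<And>x. x \<in> S \<Longrightarrow> \<bar>snd (snd (G x))\<bar> \<le> K3" "0 \<le> L3"
    "\<And>x y. x \<in> S \<Longrightarrow> y \<in> S \<Longrightarrow> \<bar>snd (snd (G x)) - snd (snd (G y))\<bar> \<le> L3 * dist x y" using bdd_lipschitzE[OF g3] by blast
  show thesis
  proof (rule that[of "L1 + L2 + L3" "K1 + K2 + K3"])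
    fix x p q :: triple assume h: "norm x \<le> K" "c \<le> fst x" "norm p \<le> R" "norm q \<le> R"
    then have S: "(x,p,q) \<in> S" by (simp add: S_def)
    show "norm (wave_rhs V x p q) \<le> K1 + K2 + K3"
      using triple_norm_le[of "wave_rhs V x p q"] b1(2)[OF S] b2(2)[OF S] b3(2)[OF S] by (simp add: G_def)
    fix x' p' q' :: triple assume h': "norm x' \<le> K" "c \<le> fst x'" "norm p' \<le> R" "norm q' \<le> R"
    then have S': "(x',p',q') \<in> S" by (simp add: S_def)
    have "dist (x,p,q) (x',p',q') = norm (x - x', p - p', q - q')" by (simp add: dist_norm)
    also have "\<dots> \<le> norm (x - x') + norm (p - p', q - q')" by (rule norm_Pair_le)
    also have "norm (p - p', q - q') \<le> norm (p - p') + norm (q - q')" by (rule norm_Pair_le)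
    finally have d: "dist (x,p,q) (x',p',q') \<le> norm (x - x') + norm (p - p') + norm (q - q')" by simp
    have "norm (wave_rhs V x p q - wave_rhs V x' p' q') \<le> (L1 + L2 + L3) * dist (x,p,q) (x',p',q')"
      using triple_norm_le[of "wave_rhs V x p q - wave_rhs V x' p' q'"] b1(4)[OF S S'] b2(4)[OF S S'] b3(4)[OF S S']
      by (simp add: G_def algebra_simps)
    also have "\<dots> \<le> (L1 + L2 + L3) * (norm (x - x') + norm (p - p') + norm (q - q'))"
      using d b1 b2 b3 by (intro mult_left_mono) auto
    finally show "norm (wave_rhs V x p q - wave_rhs V x' p' q') \<le> (L1 + L2 + L3) * (norm (x - x') + norm (p - p') + norm (q - q'))" .
  qed (use b1 b2 b3 in auto)
qed

end

section \<open>Products and compositions of C^2 functions\<close>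

lemma C1_on_mult:
  assumes "C1_on U f" "C1_on U g"
  shows "C1_on U (\<lambda>u v. f u v * g u v)"
proof (rule C1_onI)
  fix u v assume uv: "(u,v) \<in> U"
  show "((\<lambda>s. f s v * g s v) has_real_derivative pu f u v * g u v + pu g u v * f u v) (at u)"
    by (rule DERIV_mult[OF C1_onD(1)[OF assms(1) uv] C1_onD(1)[OF assms(2) uv]])
  show "((\<lambda>t. f u t * g u t) has_real_derivative pv f u v * g u v + pv g u v * f u v) (at v)"
    by (rule DERIV_mult[OF C1_onD(2)[OF assms(1) uv] C1_onD(2)[OF assms(2) uv]])
qed (intro continuous_intros C1_onD(3-5)[OF assms(1)] C1_onD(3-5)[OF assms(2)])+

lemma C1_on_compose:
  assumes f: "C1_on U f" and fS: "\<And>u v. (u,v) \<in> U \<Longrightarrow> f u v \<in> S"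
    and g: "\<And>x. x \<in> S \<Longrightarrow> (g has_real_derivative g1 x) (at x)" "continuous_on S g1"
  shows "C1_on U (\<lambda>u v. g (f u v))"
    and "\<And>u v. (u,v) \<in> U \<Longrightarrow> pu (\<lambda>u v. g (f u v)) u v = g1 (f u v) * pu f u v"
    and "\<And>u v. (u,v) \<in> U \<Longrightarrow> pv (\<lambda>u v. g (f u v)) u v = g1 (f u v) * pv f u v"
proof -
  have du: "((\<lambda>s. g (f s v)) has_real_derivative g1 (f u v) * pu f u v) (at u)"
    and dv: "((\<lambda>t. g (f u t)) has_real_derivative g1 (f u v) * pv f u v) (at v)" if "(u,v) \<in> U" for u v
    using DERIV_chain2[OF g(1)[OF fS[OF that]] C1_onD(1)[OF f that]]
      DERIV_chain2[OF g(1)[OF fS[OF that]] C1_onD(2)[OF f that]] by auto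
  have gc: "continuous_on S g" by (rule DERIV_continuous_on[OF has_field_derivative_at_within[OF g(1)]])
  have im: "(\<lambda>p. f (fst p) (snd p)) ` U \<subseteq> S" using fS by force
  show "C1_on U (\<lambda>u v. g (f u v))"
    by (rule C1_onI[OF du dv])
       (auto intro!: continuous_intros C1_onD(3-5)[OF f] continuous_on_compose2[OF gc _ im] continuous_on_compose2[OF g(2) _ im])
  show "pu (\<lambda>u v. g (f u v)) u v = g1 (f u v) * pu f u v" if "(u,v) \<in> U" for u v
    unfolding pu_def[of "\<lambda>u v. g (f u v)"] by (rule DERIV_imp_deriv[OF du[OF that]])
  show "pv (\<lambda>u v. g (f u v)) u v = g1 (f u v) * pv f u v" if "(u,v) \<in> U" for u v
    unfolding pv_def[of "\<lambda>u v. g (f u v)"] by (rule DERIV_imp_deriv[OF dv[OF that]])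
qed

lemma C2_on_compose:
  assumes U: "open U" and f: "C2_on U f" and fS: "\<And>u v. (u,v) \<in> U \<Longrightarrow> f u v \<in> S"
    and g: "\<And>x. x \<in> S \<Longrightarrow> (g has_real_derivative g1 x) (at x)"
      "\<And>x. x \<in> S \<Longrightarrow> (g1 has_real_derivative g2 x) (at x)" "continuous_on S g2"
  shows "C2_on U (\<lambda>u v. g (f u v))"
proof -
  have g1c: "continuous_on S g1" by (rule DERIV_continuous_on[OF has_field_derivative_at_within[OF g(2)]])
  note c = C1_on_compose[OF C2_onD(1)[OF f] fS g(1) g1c]
  have g1: "C1_on U (\<lambda>u v. g1 (f u v))" by (rule C1_on_compose(1)[OF C2_onD(1)[OF f] fS g(2,3)])
  have "C1_on U (pu (\<lambda>u v. g (f u v)))"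
    by (rule C1_on_cong[OF U c(2)[symmetric] C1_on_mult[OF g1 C2_onD(2)[OF f]]])
  moreover have "C1_on U (pv (\<lambda>u v. g (f u v)))"
    by (rule C1_on_cong[OF U c(3)[symmetric] C1_on_mult[OF g1 C2_onD(3)[OF f]]])
  ultimately show ?thesis using c(1) by (simp add: C2_on_def)
qed

lemma C2_on_exp: "open U \<Longrightarrow> C2_on U f \<Longrightarrow> C2_on U (\<lambda>u v. exp (f u v))"
  by (rule C2_on_compose[where S = UNIV and g = exp and ?g1.0 = exp and ?g2.0 = exp]) (auto intro!: derivative_eq_intros continuous_intros)

lemma C2_on_ln:
  assumes "open U" "C2_on U f" "\<And>u v. (u,v) \<in> U \<Longrightarrow> f u v > 0"
  shows "C2_on U (\<lambda>u v. ln (f u v))"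
  by (rule C2_on_compose[where S = "{0<..}" and g = ln and ?g1.0 = inverse and ?g2.0 = "\<lambda>t. - (inverse t ^ 2)", OF assms(1,2)])
     (use assms(3) in \<open>auto intro!: derivative_eq_intros continuous_intros simp: power2_eq_square divide_inverse\<close>)

lemma triple_derivativeD:
  assumes "(f has_vector_derivative f') (at (x::real))"
  shows "((\<lambda>s. fst (f s)) has_real_derivative fst f') (at x)"
    "((\<lambda>s. fst (snd (f s))) has_real_derivative fst (snd f')) (at x)"
    "((\<lambda>s. snd (snd (f s))) has_real_derivative snd (snd f')) (at x)"
proof -
  note F = bounded_linear.has_vector_derivative[OF bounded_linear_fst]
    and S = bounded_linear.has_vector_derivative[OF bounded_linear_snd]
  show "((\<lambda>s. fst (f s)) has_real_derivative fst f') (at x)"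
    "((\<lambda>s. fst (snd (f s))) has_real_derivative fst (snd f')) (at x)"
    "((\<lambda>s. snd (snd (f s))) has_real_derivative snd (snd f')) (at x)"
    unfolding has_real_derivative_iff_has_vector_derivative
    by (rule F[OF assms] F[OF S[OF assms]] S[OF S[OF assms]])+
qed

lemma triple_derivativeI:
  assumes "(f has_real_derivative f') (at x)" "(g has_real_derivative g') (at x)" "(h has_real_derivative h') (at x)"
  shows "((\<lambda>s. (f s, g s, h s)) has_vector_derivative (f', g', h')) (at x)"
  using assms unfolding has_real_derivative_iff_has_vector_derivative by (intro has_vector_derivative_Pair)

lemma compact_norm_bound:
  fixes f :: "'a::topological_space \<Rightarrow> 'b::real_normed_vector"
  assumes "compact S" "continuous_on S f"
  obtains B where "0 \<le> B" "\<And>x. x \<in> S \<Longrightarrow> norm (f x) \<le> B"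
proof -
  have "bounded (f ` S)" by (intro compact_imp_bounded compact_continuous_image assms)
  then obtain B where "\<And>x. x \<in> S \<Longrightarrow> norm (f x) \<le> B" by (auto simp: bounded_iff)
  then show thesis using that[of "\<bar>B\<bar>"] by force
qed

section \<open>The wave system near a corner\<close>

context C2_potential
begin

lemma wave_rhs_triple:
  "wave_rhs V (r u v, w u v, \<phi> u v) (pu r u v, pu w u v, pu \<phi> u v) (pv r u v, pv w u v, pv \<phi> u v)
    = (wave_r V r w \<phi> u v, wave_w r w \<phi> u v, wave_phi V r w \<phi> u v)"
  by (simp add: wave_rhs_def Let_def wave_r_def wave_w_def wave_phi_def)

text \<open>The new rectangle may reach beyond \<open>N0\<close>; only its two initial edges have to
  lie there. Agreement with the old solution is claimed at points whose whole past within the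
  rectangle lies in \<open>N0\<close>, since uniqueness propagates from the edges.\<close>

lemma local_solution:
  fixes r w \<phi> :: "real \<Rightarrow> real \<Rightarrow> real"
  defines "Y \<equiv> \<lambda>u v. (r u v, w u v, \<phi> u v)" and "Yu \<equiv> \<lambda>u v. (pu r u v, pu w u v, pu \<phi> u v)"
    and "Yv \<equiv> \<lambda>u v. (pv r u v, pv w u v, pv \<phi> u v)"
  assumes N0: "open N0" "wave_system N0 r w \<phi>"
    and ab: "a < a2" "b < b2"
    and seg: "\<And>u. a \<le> u \<Longrightarrow> u \<le> a2 \<Longrightarrow> (u,b) \<in> N0" "\<And>v. b \<le> v \<Longrightarrow> v \<le> b2 \<Longrightarrow> (a,v) \<in> N0"
    and \<rho>: "0 < \<rho>" and x0: "norm (Y a b) \<le> K" "\<rho> \<le> r a b" and R: "1 \<le> R"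
    and dat: "\<And>u. a \<le> u \<Longrightarrow> u \<le> a2 \<Longrightarrow> norm (Yu u b) \<le> R - 1" "\<And>v. b \<le> v \<Longrightarrow> v \<le> b2 \<Longrightarrow> norm (Yv a v) \<le> R - 1"
    and LM: "0 \<le> L" "0 \<le> M"
      "\<And>x p q x' p' q'. norm x \<le> K + \<rho> \<Longrightarrow> \<rho>/4 \<le> fst x \<Longrightarrow> norm x' \<le> K + \<rho> \<Longrightarrow> \<rho>/4 \<le> fst x' \<Longrightarrow> norm p \<le> R \<Longrightarrow> norm p' \<le> R \<Longrightarrow>
        norm q \<le> R \<Longrightarrow> norm q' \<le> R \<Longrightarrow>
        norm (wave_rhs V x p q - wave_rhs V x' p' q') \<le> L * (norm (x - x') + norm (p - p') + norm (q - q'))"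
      "\<And>x p q. norm x \<le> K + \<rho> \<Longrightarrow> \<rho>/4 \<le> fst x \<Longrightarrow> norm p \<le> R \<Longrightarrow> norm q \<le> R \<Longrightarrow> norm (wave_rhs V x p q) \<le> M"
    and small: "M * (a2 - a) \<le> 1" "M * (b2 - b) \<le> 1" "(a2 - a) * ((b2 - b) * M) \<le> \<rho>/4"
      "L * ((a2 - a) * (b2 - b) + (a2 - a) + (b2 - b)) \<le> 1/2"
      "(R - 1) * (a2 - a) \<le> \<rho>/4" "(R - 1) * (b2 - b) \<le> \<rho>/4"
  obtains rn wn \<phi>n where "wave_system ({a<..<a2} \<times> {b<..<b2}) rn wn \<phi>n"
    "\<And>u v. a < u \<Longrightarrow> u < a2 \<Longrightarrow> b < v \<Longrightarrow> v < b2 \<Longrightarrow> {a..u} \<times> {b..v} \<subseteq> N0 \<Longrightarrow>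
       rn u v = r u v \<and> wn u v = w u v \<and> \<phi>n u v = \<phi> u v"
proof -
  have C1: "C1_on N0 r" "C1_on N0 w" "C1_on N0 \<phi>" using N0 by (auto simp: wave_system_def)
  note c = C1_onD(3-5)[OF C1(1)] C1_onD(3-5)[OF C1(2)] C1_onD(3-5)[OF C1(3)]
  have Yc: "continuous_on N0 (\<lambda>p. Y (fst p) (snd p))" "continuous_on N0 (\<lambda>p. Yu (fst p) (snd p))" "continuous_on N0 (\<lambda>p. Yv (fst p) (snd p))"
    unfolding Y_def Yu_def Yv_def by (intro continuous_intros c)+
  have Yd: "((\<lambda>s. Y s v) has_vector_derivative Yu u v) (at u)" "((\<lambda>t. Y u t) has_vector_derivative Yv u v) (at v)"
    "((\<lambda>t. Yu u t) has_vector_derivative wave_rhs V (Y u v) (Yu u v) (Yv u v)) (at v)"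
    "((\<lambda>s. Yv s v) has_vector_derivative wave_rhs V (Y u v) (Yu u v) (Yv u v)) (at u)" if "(u,v) \<in> N0" for u v
    unfolding Y_def Yu_def Yv_def wave_rhs_triple
    using C1_onD(1,2)[OF C1(1) that] C1_onD(1,2)[OF C1(2) that] C1_onD(1,2)[OF C1(3) that] wave_systemD[OF N0(2) that]
    by (simp_all add: triple_derivativeI)
  \<comment> \<open>r is at least \<rho> at the corner, and the variation along each edge and the
    double integral may lower it by \<rho>/4 each. Hence the lower bound \<rho>/4; the enlargement
    of K by \<rho> covers the same three contributions.\<close>
  define X where "X = {x :: triple. norm x \<le> K + \<rho> \<and> \<rho>/4 \<le> fst x}"
  have segc: "continuous_on {a..a2} (\<lambda>u. f u b)" "continuous_on {b..b2} (\<lambda>v. f a v)"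
    if "continuous_on N0 (\<lambda>p. f (fst p) (snd p))" for f :: "real \<Rightarrow> real \<Rightarrow> triple"
    by (rule continuous_on_compose2[OF that, where f = "\<lambda>u. (u, b)", simplified]
          continuous_on_compose2[OF that, where f = "\<lambda>v. (a, v)", simplified],
        use seg in \<open>auto intro!: continuous_intros\<close>)+
  have inX: "Y u b + Y a v - Y a b + e \<in> X"
    if uv: "a \<le> u" "u \<le> a2" "b \<le> v" "v \<le> b2" and e: "norm e \<le> \<rho>/4" for u v e
  proof -
    have lin: "((\<lambda>t. (R - 1) * t) has_vector_derivative (R - 1)) (at t)" for t
      unfolding has_real_derivative_iff_has_vector_derivative[symmetric] by (auto intro!: derivative_eq_intros)
    have 1: "norm (Y u b - Y a b) \<le> \<rho>/4"
    proof (cases "u = a")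
      case False
      have "norm (Y u b - Y a b) \<le> (R - 1) * u - (R - 1) * a"
        by (rule differentiable_bound_general[OF _ _ _ Yd(1) lin])
           (use uv False seg dat in \<open>auto intro!: continuous_intros continuous_on_subset[OF segc(1)[OF Yc(1)]]\<close>)
      also have "\<dots> \<le> (R - 1) * (a2 - a)" using uv R mult_left_mono[of u a2 "R - 1"] by (simp add: algebra_simps)
      finally show ?thesis using small(5) by simp
    qed (use \<rho> in simp)
    have 2: "norm (Y a v - Y a b) \<le> \<rho>/4"
    proof (cases "v = b")
      case False
      have "norm (Y a v - Y a b) \<le> (R - 1) * v - (R - 1) * b"
        by (rule differentiable_bound_general[OF _ _ _ Yd(2) lin])
           (use uv False seg dat in \<open>auto intro!: continuous_intros continuous_on_subset[OF segc(2)[OF Yc(1)]]\<close>)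
      also have "\<dots> \<le> (R - 1) * (b2 - b)" using uv R mult_left_mono[of v b2 "R - 1"] by (simp add: algebra_simps)
      finally show ?thesis using small(6) by simp
    qed (use \<rho> in simp)
    define d where "d = (Y u b - Y a b) + ((Y a v - Y a b) + e)"
    have dn: "norm d \<le> 3 * \<rho> / 4"
      unfolding d_def using norm_triangle_ineq[of "Y u b - Y a b" "(Y a v - Y a b) + e"]
        norm_triangle_ineq[of "Y a v - Y a b" e] 1 2 e by linarith
    have eq: "Y u b + Y a v - Y a b + e = Y a b + d" by (simp add: d_def)
    have "norm (Y a b + d) \<le> K + \<rho>" using norm_triangle_ineq[of "Y a b" d] dn x0(1) \<rho> by linarith
    moreover have "\<rho>/4 \<le> fst (Y a b + d)"
      using triple_abs_le(1)[of d] dn x0(2) by (simp add: Y_def)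
    ultimately show ?thesis unfolding eq X_def by simp
  qed
  obtain Z P Q f where
    Zc: "continuous_on ({a..a2} \<times> {b..b2}) (\<lambda>z. Z (fst z) (snd z))"
    "continuous_on ({a..a2} \<times> {b..b2}) (\<lambda>z. P (fst z) (snd z))"
    "continuous_on ({a..a2} \<times> {b..b2}) (\<lambda>z. Q (fst z) (snd z))"
    "continuous_on ({a..a2} \<times> {b..b2}) (\<lambda>z. f (fst z) (snd z))"
    and ff: "\<And>u v. u \<in> {a..a2} \<Longrightarrow> v \<in> {b..b2} \<Longrightarrow> f u v = wave_rhs V (Z u v) (P u v) (Q u v)"
    and ZX: "\<And>u v. u \<in> {a..a2} \<Longrightarrow> v \<in> {b..b2} \<Longrightarrow> Z u v \<in> X"
    and edge: "\<And>u. Z u b = Y u b" "\<And>v. Z a v = Y a v" "\<And>u. P u b = Yu u b" "\<And>v. Q a v = Yv a v"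
    and Zd: "\<And>u v. u \<in> {a<..<a2} \<Longrightarrow> ((\<lambda>s. Z s v) has_vector_derivative P u v) (at u)"
    "\<And>u v. u \<in> {a<..<a2} \<Longrightarrow> ((\<lambda>s. Q s v) has_vector_derivative f u v) (at u)"
    "\<And>u v. v \<in> {b<..<b2} \<Longrightarrow> ((\<lambda>t. Z u t) has_vector_derivative Q u v) (at v)"
    "\<And>u v. v \<in> {b<..<b2} \<Longrightarrow> ((\<lambda>t. P u t) has_vector_derivative f u v) (at v)"
    by (rule goursat_local_existence[of a a2 b b2 L M X R "wave_rhs V" "\<lambda>u. Y u b" "\<lambda>u. Yu u b" "\<lambda>v. Y a v" "\<lambda>v. Yv a v" "Y a b" "\<rho>/4"])
       (use ab LM small dat inX Yd seg in \<open>auto simp: X_def intro!: segc Yc\<close>)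
  let ?N = "{a<..<a2} \<times> {b<..<b2}"
  have Nop: "open ?N" by (intro open_Times open_greaterThanLessThan)
  define rn wn pn where "rn u v = fst (Z u v)" and "wn u v = fst (snd (Z u v))" and "pn u v = snd (snd (Z u v))" for u v
  have du: "((\<lambda>s. rn s v) has_real_derivative fst (P u v)) (at u)" "((\<lambda>s. wn s v) has_real_derivative fst (snd (P u v))) (at u)"
    "((\<lambda>s. pn s v) has_real_derivative snd (snd (P u v))) (at u)" if "u \<in> {a<..<a2}" for u v
    unfolding rn_def wn_def pn_def by (rule triple_derivativeD[OF Zd(1)[OF that]])+
  have dv: "((\<lambda>t. rn u t) has_real_derivative fst (Q u v)) (at v)" "((\<lambda>t. wn u t) has_real_derivative fst (snd (Q u v))) (at v)"
    "((\<lambda>t. pn u t) has_real_derivative snd (snd (Q u v))) (at v)" if "v \<in> {b<..<b2}" for u v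
    unfolding rn_def wn_def pn_def by (rule triple_derivativeD[OF Zd(3)[OF that]])+
  have pueq: "pu rn u v = fst (P u v)" "pu wn u v = fst (snd (P u v))" "pu pn u v = snd (snd (P u v))" if "u \<in> {a<..<a2}" for u v
    using du[OF that] by (simp_all add: pu_def DERIV_imp_deriv)
  have pveq: "pv rn u v = fst (Q u v)" "pv wn u v = fst (snd (Q u v))" "pv pn u v = snd (snd (Q u v))" if "v \<in> {b<..<b2}" for u v
    using dv[OF that] by (simp_all add: pv_def DERIV_imp_deriv)
  have Nsub: "?N \<subseteq> {a..a2} \<times> {b..b2}" by auto
  note Zcn = continuous_on_subset[OF Zc(1) Nsub] continuous_on_subset[OF Zc(2) Nsub] continuous_on_subset[OF Zc(3) Nsub]
  have C1n: "C1_on ?N rn" "C1_on ?N wn" "C1_on ?N pn"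
    by (rule C1_onI[OF du(1) dv(1)] C1_onI[OF du(2) dv(2)] C1_onI[OF du(3) dv(3)];
        auto simp: rn_def wn_def pn_def intro!: continuous_intros Zcn)+
  have fF: "f u v = (wave_r V rn wn pn u v, wave_w rn wn pn u v, wave_phi V rn wn pn u v)" if "u \<in> {a<..<a2}" "v \<in> {b<..<b2}" for u v
  proof -
    have "Z u v = (rn u v, wn u v, pn u v)" "P u v = (pu rn u v, pu wn u v, pu pn u v)" "Q u v = (pv rn u v, pv wn u v, pv pn u v)"
      using pueq[OF that(1)] pveq[OF that(2)] by (simp_all add: rn_def wn_def pn_def)
    then show ?thesis using ff[of u v] that by (simp add: wave_rhs_triple)
  qed
  have W: "wave_system ?N rn wn pn"
  proof (rule wave_systemI[OF C1n])
    fix u v assume "(u,v) \<in> ?N"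
    then have uv: "u \<in> {a<..<a2}" "v \<in> {b<..<b2}" by auto
    show "rn u v > 0" using ZX[of u v] uv \<rho> by (auto simp: X_def rn_def)
    note P = triple_derivativeD[OF Zd(4)[OF uv(2), of u], unfolded fF[OF uv] fst_conv snd_conv]
    note Q = triple_derivativeD[OF Zd(2)[OF uv(1), of v], unfolded fF[OF uv] fst_conv snd_conv]
    show "((\<lambda>t. pu rn u t) has_real_derivative wave_r V rn wn pn u v) (at v)"
      "((\<lambda>t. pu wn u t) has_real_derivative wave_w rn wn pn u v) (at v)"
      "((\<lambda>t. pu pn u t) has_real_derivative wave_phi V rn wn pn u v) (at v)"
      using P by (simp_all add: pueq[OF uv(1)])
    show "((\<lambda>s. pv rn s v) has_real_derivative wave_r V rn wn pn u v) (at u)"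
      "((\<lambda>s. pv wn s v) has_real_derivative wave_w rn wn pn u v) (at u)"
      "((\<lambda>s. pv pn s v) has_real_derivative wave_phi V rn wn pn u v) (at u)"
      using Q by (simp_all add: pveq[OF uv(2)])
  qed
  have uniq: "Z u v = Y u v" if uv: "a < u" "u < a2" "b < v" "v < b2" and sub: "{a..u} \<times> {b..v} \<subseteq> N0" for u v
  proof -
    let ?R = "{a..u} \<times> {b..v}"
    have cR: "compact ?R" by (intro compact_Times compact_Icc)
    have RR: "?R \<subseteq> {a..a2} \<times> {b..b2}" using uv by auto
    note YcR = continuous_on_subset[OF Yc(1) sub] continuous_on_subset[OF Yc(2) sub] continuous_on_subset[OF Yc(3) sub]
    note ZcR = continuous_on_subset[OF Zc(1) RR] continuous_on_subset[OF Zc(2) RR] continuous_on_subset[OF Zc(3) RR]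
    obtain B1 where B1: "0 \<le> B1" "\<And>z. z \<in> ?R \<Longrightarrow> norm (Y (fst z) (snd z)) \<le> B1" using compact_norm_bound[OF cR YcR(1)] by blast
    obtain B2 where B2: "0 \<le> B2" "\<And>z. z \<in> ?R \<Longrightarrow> norm (Yu (fst z) (snd z)) \<le> B2" using compact_norm_bound[OF cR YcR(2)] by blast
    obtain B3 where B3: "0 \<le> B3" "\<And>z. z \<in> ?R \<Longrightarrow> norm (Yv (fst z) (snd z)) \<le> B3" using compact_norm_bound[OF cR YcR(3)] by blast
    obtain B4 where B4: "0 \<le> B4" "\<And>z. z \<in> ?R \<Longrightarrow> norm (P (fst z) (snd z)) \<le> B4" using compact_norm_bound[OF cR ZcR(2)] by blast
    obtain B5 where B5: "0 \<le> B5" "\<And>z. z \<in> ?R \<Longrightarrow> norm (Q (fst z) (snd z)) \<le> B5" using compact_norm_bound[OF cR ZcR(3)] by blast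
    obtain z0 where z0: "z0 \<in> ?R" "\<And>z. z \<in> ?R \<Longrightarrow> r (fst z0) (snd z0) \<le> r (fst z) (snd z)"
      using continuous_attains_inf[OF cR _ continuous_on_subset[OF c(1) sub]] uv by auto
    have z0p: "r (fst z0) (snd z0) > 0" using wave_systemD(1)[OF N0(2), of "fst z0" "snd z0"] z0(1) sub by auto
    \<comment> \<open>The old solution need not obey the bounds of the construction inside the
      rectangle, so uniqueness uses new constants valid for both solutions on this compact
      set.\<close>
    define c' where "c' = min (\<rho>/4) (r (fst z0) (snd z0))"
    define K' where "K' = max (K + \<rho>) B1"
    define R' where "R' = max (max B2 B3) (max B4 B5)"
    have c': "c' > 0" using z0p \<rho> by (simp add: c'_def)
    obtain L' M' where L': "0 \<le> L'" "0 \<le> M'"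
      "\<And>x p q x' p' q'. norm x \<le> K' \<Longrightarrow> c' \<le> fst x \<Longrightarrow> norm x' \<le> K' \<Longrightarrow> c' \<le> fst x' \<Longrightarrow> norm p \<le> R' \<Longrightarrow> norm p' \<le> R' \<Longrightarrow>
        norm q \<le> R' \<Longrightarrow> norm q' \<le> R' \<Longrightarrow>
        norm (wave_rhs V x p q - wave_rhs V x' p' q') \<le> L' * (norm (x - x') + norm (p - p') + norm (q - q'))"
      "\<And>x p q. norm x \<le> K' \<Longrightarrow> c' \<le> fst x \<Longrightarrow> norm p \<le> R' \<Longrightarrow> norm q \<le> R' \<Longrightarrow> norm (wave_rhs V x p q) \<le> M'"
      by (rule wave_rhs_lipschitz[OF c', of K' R'], rule that)
    have Ysub: "(s,t) \<in> N0" if "a \<le> s" "s \<le> u" "b \<le> t" "t \<le> v" for s t using sub that by auto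
    have "Z u v - Y u v = 0 \<and> P u v - Yu u v = 0 \<and> Q u v - Yv u v = 0"
    proof (rule goursat_zero[of a u b v L' "\<lambda>u v. Z u v - Y u v" "\<lambda>u v. P u v - Yu u v" "\<lambda>u v. Q u v - Yv u v"
          "\<lambda>u v. f u v - wave_rhs V (Y u v) (Yu u v) (Yv u v)"])
      fix s t assume st: "a \<le> s" "s \<le> u" "b \<le> t" "t \<le> v"
      then have "(s,t) \<in> ?R" by auto
      note B = B1(2)[OF this] B2(2)[OF this] B3(2)[OF this] B4(2)[OF this] B5(2)[OF this] z0(2)[OF this]
      have zx: "Z s t \<in> X" "f s t = wave_rhs V (Z s t) (P s t) (Q s t)" using ZX ff st uv by auto
      show "norm (f s t - wave_rhs V (Y s t) (Yu s t) (Yv s t)) \<le> L' * (norm (Z s t - Y s t) + norm (P s t - Yu s t) + norm (Q s t - Yv s t))"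
        unfolding zx(2)
        by (rule L'(3)) (use B zx(1) in \<open>auto simp: K'_def R'_def c'_def X_def Y_def le_max_iff_disj min_le_iff_disj\<close>)
    qed (use uv L'(1) in \<open>auto intro!: continuous_intros YcR ZcR has_vector_derivative_diff Zd Yd Ysub simp: edge\<close>)
    then show ?thesis by simp
  qed
  show thesis
    by (rule that[OF W]) (use uniq in \<open>auto simp: Y_def rn_def wn_def pn_def\<close>)
qed

end

section \<open>Gluing a local solution to a development\<close>

lemma ball_pairI: "(\<And>u v. (u,v) \<in> S \<Longrightarrow> P u v) \<Longrightarrow> \<forall>(u,v)\<in>S. P u v"
  by auto

context C2_potential
begin

lemma wave_system_of_C2:
  assumes N: "open N" and C2: "C2_on N r" "C2_on N w" "C2_on N \<phi>"
    and pos: "\<And>u v. (u,v) \<in> N \<Longrightarrow> r u v > 0"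
    and eq: "\<And>u v. (u,v) \<in> N \<Longrightarrow> pu (pv r) u v = wave_r V r w \<phi> u v"
      "\<And>u v. (u,v) \<in> N \<Longrightarrow> pu (pv w) u v = wave_w r w \<phi> u v"
      "\<And>u v. (u,v) \<in> N \<Longrightarrow> pu (pv \<phi>) u v = wave_phi V r w \<phi> u v"
  shows "wave_system N r w \<phi>"
proof (rule wave_systemI[OF C2_onD(1)[OF C2(1)] C2_onD(1)[OF C2(2)] C2_onD(1)[OF C2(3)] pos])
  fix u v assume uv: "(u,v) \<in> N"
  note D = C1_onD(2)[OF C2_onD(2)] and E = C1_onD(1)[OF C2_onD(3)]
  show "((\<lambda>t. pu r u t) has_real_derivative wave_r V r w \<phi> u v) (at v)"
    using D[OF C2(1) uv] pu_pv_commute[OF N uv C2(1)] eq(1)[OF uv] by simp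
  show "((\<lambda>t. pu w u t) has_real_derivative wave_w r w \<phi> u v) (at v)"
    using D[OF C2(2) uv] pu_pv_commute[OF N uv C2(2)] eq(2)[OF uv] by simp
  show "((\<lambda>t. pu \<phi> u t) has_real_derivative wave_phi V r w \<phi> u v) (at v)"
    using D[OF C2(3) uv] pu_pv_commute[OF N uv C2(3)] eq(3)[OF uv] by simp
  show "((\<lambda>s. pv r s v) has_real_derivative wave_r V r w \<phi> u v) (at u)"
    using E[OF C2(1) uv] eq(1)[OF uv] by simp
  show "((\<lambda>s. pv w s v) has_real_derivative wave_w r w \<phi> u v) (at u)"
    using E[OF C2(2) uv] eq(2)[OF uv] by simp
  show "((\<lambda>s. pv \<phi> s v) has_real_derivative wave_phi V r w \<phi> u v) (at u)"
    using E[OF C2(3) uv] eq(3)[OF uv] by simp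
qed

text \<open>An open set is needed because the wave equation for w is obtained by differentiating the
  other equations. The sign of \<open>pu r\<close> cancels the factor in front of the wave equation
  for r.\<close>

lemma interior_solution:
  assumes N: "open N" and C2: "C2_on N r" "C2_on N \<Omega>" "C2_on N \<phi>"
    and sol: "\<And>u v. (u,v) \<in> N \<Longrightarrow> r u v > 0 \<and> \<Omega> u v > 0 \<and> pu r u v < 0 \<and> EH_equations V r \<Omega> \<phi> u v"
  defines "w \<equiv> \<lambda>a b. ln (\<Omega> a b)"
  shows "C2_on N w" "wave_system N r w \<phi>"
    "\<And>u v. (u,v) \<in> N \<Longrightarrow> pu (pu r) u v = 2 * pu w u v * pu r u v - r u v * (pu \<phi> u v)\<^sup>2"
    "\<And>u v. (u,v) \<in> N \<Longrightarrow> pv (pv r) u v = 2 * pv w u v * pv r u v - r u v * (pv \<phi> u v)\<^sup>2"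
proof -
  show Cw: "C2_on N w" unfolding w_def by (rule C2_on_ln[OF N C2(2)]) (use sol in blast)
  have EH: "EH_equations V r (\<lambda>u v. exp (w u v)) \<phi> u v" if "(u,v) \<in> N" for u v
    by (rule EH_cong[OF N that, of r r \<Omega> _ \<phi> \<phi>]) (use sol that in \<open>auto simp: w_def\<close>)
  have pos: "r u v > 0" if "(u,v) \<in> N" for u v using sol that by blast
  note iff = EH_exp_iff[OF N _ C2(1) Cw C2(3) pos, THEN iffD1, OF _ _ EH]
  have eqr: "pu (pv r) u v = wave_r V r w \<phi> u v" if "(u,v) \<in> N" for u v
    using iff[OF that that that] sol[OF that] by auto
  have eqp: "pu (pv \<phi>) u v = wave_phi V r w \<phi> u v" if "(u,v) \<in> N" for u v
    using iff[OF that that that] by auto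
  show R: "pu (pu r) u v = 2 * pu w u v * pu r u v - r u v * (pu \<phi> u v)\<^sup>2" if "(u,v) \<in> N" for u v
    using iff[OF that that that] by auto
  show "pv (pv r) u v = 2 * pv w u v * pv r u v - r u v * (pv \<phi> u v)\<^sup>2" if "(u,v) \<in> N" for u v
    using iff[OF that that that] by auto
  have eqw: "pu (pv w) u v = wave_w r w \<phi> u v" if "(u,v) \<in> N" for u v
    by (rule w_wave[OF N that C2(1) Cw C2(3) _ eqr eqp R]) (use sol in \<open>auto simp: less_imp_neq\<close>)
  show "wave_system N r w \<phi>"
    by (rule wave_system_of_C2[OF N C2(1) Cw C2(3) pos eqr eqw eqp])
qed

text \<open>A continuation criterion. The rectangle may miss only its future corner, and bounds
  uniform up to that corner determine a size h on which the characteristic problem is solvable.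
  Started at (s - h, T - h) with sides longer than h, the solution covers the corner.\<close>

lemma extension:
  assumes dev: "is_development V u0 v0 G r \<Omega> \<phi>" and neg: "\<And>u v. (u,v) \<in> G \<Longrightarrow> pu r u v < 0"
    and sT: "0 < a0" "a0 < s" "s < u0" "v0 < b0" "b0 < T" and \<rho>: "\<rho> > 0"
  defines "w \<equiv> \<lambda>a b. ln (\<Omega> a b)"
  assumes rect: "\<And>u v. a0 \<le> u \<Longrightarrow> u \<le> s \<Longrightarrow> b0 \<le> v \<Longrightarrow> v \<le> T \<Longrightarrow> (u,v) \<noteq> (s,T) \<Longrightarrow>
      (u,v) \<in> G \<and> \<rho> \<le> r u v \<and> norm (r u v, w u v, \<phi> u v) \<le> K \<and>
      norm (pu r u v, pu w u v, pu \<phi> u v) \<le> K \<and> norm (pv r u v, pv w u v, pv \<phi> u v) \<le> K"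
  shows "\<exists>G' r' \<Omega>' \<phi>'. is_development V u0 v0 G' r' \<Omega>' \<phi>' \<and> (s,T) \<in> G' \<and>
      (\<forall>(u,v)\<in>Cin u0 v0 \<union> Cout v0. r' u v = r u v \<and> \<Omega>' u v = \<Omega> u v \<and> \<phi>' u v = \<phi> u v)"
proof -
  have GK: "G \<subseteq> Kset u0 v0" and Gop: "openin (top_of_set (Kset u0 v0)) G" and Gc: "Cin u0 v0 \<union> Cout v0 \<subseteq> G"
    and past: "\<And>u v u' v'. (u,v) \<in> G \<Longrightarrow> 0 \<le> u' \<Longrightarrow> u' \<le> u \<Longrightarrow> v0 \<le> v' \<Longrightarrow> v' \<le> v \<Longrightarrow> (u',v') \<in> G"
    and sol: "\<And>u v. (u,v) \<in> G \<Longrightarrow> r u v > 0 \<and> \<Omega> u v > 0 \<and> EH_equations V r \<Omega> \<phi> u v"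
    using dev unfolding is_development_def by auto
  obtain U where U: "open U" "G \<subseteq> U" "C2_on U r" "C2_on U \<Omega>" "C2_on U \<phi>"
    using dev unfolding is_development_def by auto
  define N0 where "N0 = G \<inter> ({0<..<u0} \<times> {v0<..})"
  have N0: "open N0"
  proof -
    obtain O' where O: "open O'" "G = Kset u0 v0 \<inter> O'" using Gop unfolding openin_open by blast
    have "N0 = O' \<inter> ({0<..<u0} \<times> {v0<..})" unfolding N0_def O(2) Kset_def by auto
    then show ?thesis using O(1) by (simp add: open_Int open_Times)
  qed
  have N0U: "N0 \<subseteq> U" "N0 \<subseteq> G" using U(2) by (auto simp: N0_def)
  have mem0: "(u',v') \<in> N0" if "(u,v) \<in> N0" "0 < u'" "u' \<le> u" "v0 < v'" "v' \<le> v" for u v u' v'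
    using that past[of u v u' v'] by (auto simp: N0_def)
  note C2N0 = C2_on_subset[OF U(3) N0U(1)] C2_on_subset[OF U(4) N0U(1)] C2_on_subset[OF U(5) N0U(1)]
  have sol0: "r u v > 0 \<and> \<Omega> u v > 0 \<and> pu r u v < 0 \<and> EH_equations V r \<Omega> \<phi> u v" if "(u,v) \<in> N0" for u v
    using sol neg that by (auto simp: N0_def)
  note I = interior_solution[OF N0 C2N0 sol0, folded w_def]
  define P where "P u v = (pu r u v, pu w u v, pu \<phi> u v)" for u v
  define Q where "Q u v = (pv r u v, pv w u v, pv \<phi> u v)" for u v
  have C1: "C1_on N0 r" "C1_on N0 w" "C1_on N0 \<phi>" using I(2) by (auto simp: wave_system_def)
  have PQc: "continuous_on N0 (\<lambda>p. norm (P (fst p) (snd p)))" "continuous_on N0 (\<lambda>p. norm (Q (fst p) (snd p)))"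
    unfolding P_def Q_def by (intro continuous_intros C1_onD(3-5)[OF C1(1)] C1_onD(3-5)[OF C1(2)] C1_onD(3-5)[OF C1(3)])+
  have rect0: "(u,v) \<in> N0" "\<rho> \<le> r u v" "norm (r u v, w u v, \<phi> u v) \<le> K" "norm (P u v) \<le> K" "norm (Q u v) \<le> K"
    if "a0 \<le> u" "u \<le> s" "b0 \<le> v" "v \<le> T" "(u,v) \<noteq> (s,T)" for u v
  proof -
    note x = rect[OF that]
    have "0 < u" "u < u0" "v0 < v" using that sT by linarith+
    then show "(u,v) \<in> N0" using x by (simp add: N0_def)
    show "\<rho> \<le> r u v" "norm (r u v, w u v, \<phi> u v) \<le> K" "norm (P u v) \<le> K" "norm (Q u v) \<le> K"
      using x unfolding P_def Q_def by blast+
  qed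
  define R where "R = K + 2"
  have K0: "K \<ge> 0" 
    by (rule order_trans[OF norm_ge_zero rect0(4)[of a0 b0]]) (use sT in auto)
  obtain L M where LM: "0 \<le> L" "0 \<le> M"
      "\<And>x p q x' p' q'. norm x \<le> K + \<rho> \<Longrightarrow> \<rho>/4 \<le> fst x \<Longrightarrow> norm x' \<le> K + \<rho> \<Longrightarrow> \<rho>/4 \<le> fst x' \<Longrightarrow> norm p \<le> R \<Longrightarrow> norm p' \<le> R \<Longrightarrow>
        norm q \<le> R \<Longrightarrow> norm q' \<le> R \<Longrightarrow>
        norm (wave_rhs V x p q - wave_rhs V x' p' q') \<le> L * (norm (x - x') + norm (p - p') + norm (q - q'))"
      "\<And>x p q. norm x \<le> K + \<rho> \<Longrightarrow> \<rho>/4 \<le> fst x \<Longrightarrow> norm p \<le> R \<Longrightarrow> norm q \<le> R \<Longrightarrow> norm (wave_rhs V x p q) \<le> M"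
    by (rule wave_rhs_lipschitz[of "\<rho>/4" "K + \<rho>" R], use \<rho> in simp, rule that)
  \<comment> \<open>The entries are tuned to sides of length up to 2 h: they make the products with
    M and L small, bound the variation of the data along the edges, and keep the starting corner to
    the future of (a0, b0).\<close>
  define S where "S = {1/2, 1 / (2 * (M + 1)), \<rho> / (8 * (M + 1)), 1 / (12 * (L + 1)), \<rho> / (8 * R), (s - a0) / 2, (T - b0) / 2}"
  define h where "h = Min S"
  have S: "finite S" "S \<noteq> {}" by (simp_all add: S_def)
  have "R > 0" using K0 by (simp add: R_def)
  then have "\<forall>x\<in>S. 0 < x" unfolding S_def using LM(1,2) \<rho> sT by simp
  then have h0: "h > 0" unfolding h_def using Min_in[OF S] by blast
  have hS: "h \<le> x" if "x \<in> S" for x unfolding h_def by (rule Min_le[OF S(1) that])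
  have h: "h > 0" "h \<le> 1/2" "h \<le> 1 / (2 * (M + 1))" "h \<le> \<rho> / (8 * (M + 1))" "h \<le> 1 / (12 * (L + 1))" "h \<le> \<rho> / (8 * R)"
    "h \<le> (s - a0) / 2" "h \<le> (T - b0) / 2"
    by (rule h0 hS; simp add: S_def)+
  define a b where "a = s - h" and "b = T - h"
  have ab: "a0 < a" "a < s" "b0 < b" "b < T" using h sT by (auto simp: a_def b_def)
  have O: "\<exists>d>0. \<forall>u v. \<bar>u - u1\<bar> \<le> d \<and> \<bar>v - v1\<bar> \<le> d \<longrightarrow> (u,v) \<in> N0 \<and> norm (P u v) < K + 1 \<and> norm (Q u v) < K + 1"
    if p: "(u1,v1) \<in> N0" "norm (P u1 v1) \<le> K" "norm (Q u1 v1) \<le> K" for u1 v1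
  proof -
    define O1 where "O1 = (N0 \<inter> (\<lambda>p. norm (P (fst p) (snd p))) -` {..<K + 1}) \<inter> (N0 \<inter> (\<lambda>p. norm (Q (fst p) (snd p))) -` {..<K + 1})"
    have "open O1" unfolding O1_def by (intro open_Int continuous_open_preimage PQc N0 open_lessThan)
    moreover have "(u1,v1) \<in> O1" using p by (simp add: O1_def)
    ultimately obtain A B where AB: "open A" "open B" "(u1,v1) \<in> A \<times> B" "A \<times> B \<subseteq> O1" by (rule open_prod_elim)
    obtain d1 where d1: "d1 > 0" "cball u1 d1 \<subseteq> A" using AB by (metis mem_Sigma_iff open_contains_cball)
    obtain d2 where d2: "d2 > 0" "cball v1 d2 \<subseteq> B" using AB by (metis mem_Sigma_iff open_contains_cball)
    show ?thesis
    proof (intro exI[of _ "min d1 d2"] conjI allI impI)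
      show "min d1 d2 > 0" using d1 d2 by simp
      fix u v assume uv: "\<bar>u - u1\<bar> \<le> min d1 d2 \<and> \<bar>v - v1\<bar> \<le> min d1 d2"
      have "u \<in> cball u1 d1" "v \<in> cball v1 d2" using uv by (auto simp: dist_real_def)
      then have "(u,v) \<in> O1" using AB d1 d2 by blast
      then show "(u,v) \<in> N0" "norm (P u v) < K + 1" "norm (Q u v) < K + 1" by (auto simp: O1_def)
    qed
  qed
  \<comment> \<open>(s,T) has to be an interior point of the new rectangle, so the edges are
    prolonged past u = s and v = T. Openness of \<open>N0\<close> around (a,T) and (s,b) permits
    this; the derivative bound worsens to K + 1.\<close>
  obtain d1 where d1: "d1 > 0" "\<And>u v. \<bar>u - a\<bar> \<le> d1 \<Longrightarrow> \<bar>v - T\<bar> \<le> d1 \<Longrightarrow> (u,v) \<in> N0 \<and> norm (P u v) < K + 1 \<and> norm (Q u v) < K + 1"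
    using O[of a T] rect0[of a T] ab sT by auto
  obtain d2 where d2: "d2 > 0" "\<And>u v. \<bar>u - s\<bar> \<le> d2 \<Longrightarrow> \<bar>v - b\<bar> \<le> d2 \<Longrightarrow> (u,v) \<in> N0 \<and> norm (P u v) < K + 1 \<and> norm (Q u v) < K + 1"
    using O[of s b] rect0[of s b] ab sT by auto
  define a2 b2 where "a2 = s + min h d2" and "b2 = T + min h d1"
  have ab2: "s < a2" "a2 \<le> s + h" "T < b2" "b2 \<le> T + h" using h d1 d2 by (auto simp: a2_def b2_def)
  have len: "0 < a2 - a" "a2 - a \<le> 2 * h" "0 < b2 - b" "b2 - b \<le> 2 * h" using ab2 ab by (auto simp: a_def b_def)
  have segu: "(u,b) \<in> N0 \<and> norm (P u b) \<le> K + 1" if "a \<le> u" "u \<le> a2" for u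
  proof (cases "u \<le> s")
    case True then show ?thesis using rect0[of u b] that ab sT by auto
  next
    case False
    then have "\<bar>u - s\<bar> \<le> d2" using that by (auto simp: a2_def)
    from d2(2)[OF this, of b] d2(1) show ?thesis by (simp add: less_imp_le)
  qed
  have segv: "(a,v) \<in> N0 \<and> norm (Q a v) \<le> K + 1" if "b \<le> v" "v \<le> b2" for v
  proof (cases "v \<le> T")
    case True then show ?thesis using rect0[of a v] that ab sT by auto
  next
    case False
    then have "\<bar>v - T\<bar> \<le> d1" using that by (auto simp: b2_def)
    from d1(2)[OF _ this, of a] d1(1) show ?thesis by (simp add: less_imp_le)
  qed
  have sm: "c * l \<le> e" if "0 \<le> c" "0 < e" "0 < l" "l \<le> 2 * h" "h \<le> e / (2 * (c + 1))" for c l e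
  proof -
    have "c * l \<le> (c + 1) * (2 * h)" using that h by (intro mult_mono) auto
    also have "\<dots> \<le> e" using that(1,5) by (simp add: field_simps)
    finally show ?thesis .
  qed
  have small: "M * (a2 - a) \<le> 1" "M * (b2 - b) \<le> 1" "(a2 - a) * ((b2 - b) * M) \<le> \<rho>/4"
      "L * ((a2 - a) * (b2 - b) + (a2 - a) + (b2 - b)) \<le> 1/2"
      "(R - 1) * (a2 - a) \<le> \<rho>/4" "(R - 1) * (b2 - b) \<le> \<rho>/4"
  proof -
    show "M * (a2 - a) \<le> 1" "M * (b2 - b) \<le> 1" using sm[of M 1] len LM h by auto
    have "M * (b2 - b) \<le> \<rho>/4" using sm[of M "\<rho>/4" "b2 - b"] len LM h \<rho> by auto
    moreover have "0 \<le> M * (b2 - b)" using LM len by simp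
    ultimately have "(a2 - a) * (M * (b2 - b)) \<le> 1 * (\<rho>/4)" using len h by (intro mult_mono) auto
    then show "(a2 - a) * ((b2 - b) * M) \<le> \<rho>/4" by (simp add: mult.commute)
    have "(a2 - a) * (b2 - b) \<le> (2 * h) * 1" using len h by (intro mult_mono) auto
    then have "(a2 - a) * (b2 - b) + (a2 - a) + (b2 - b) \<le> 2 * h * 1 + 2 * h + 2 * h"
      by (intro add_mono len)
    then have "(a2 - a) * (b2 - b) + (a2 - a) + (b2 - b) \<le> 6 * h" by simp
    then have "L * ((a2 - a) * (b2 - b) + (a2 - a) + (b2 - b)) \<le> (L + 1) * (6 * h)"
      using LM(1) len h by (intro mult_mono) auto
    also have "\<dots> \<le> 1/2" using h(5) LM(1) by (simp add: field_simps)
    finally show "L * ((a2 - a) * (b2 - b) + (a2 - a) + (b2 - b)) \<le> 1/2" .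
    have R1: "0 \<le> R - 1" using K0 by (simp add: R_def)
    have Rh: "h \<le> \<rho> / 4 / (2 * ((R - 1) + 1))" using h(6) by simp
    have r4: "0 < \<rho> / 4" using \<rho> by simp
    show "(R - 1) * (a2 - a) \<le> \<rho>/4" "(R - 1) * (b2 - b) \<le> \<rho>/4"
      by (rule sm[OF R1 r4 len(1,2) Rh] sm[OF R1 r4 len(3,4) Rh])+
  qed
  let ?N = "{a<..<a2} \<times> {b<..<b2}"
  have "\<exists>rn wn pn. wave_system ?N rn wn pn \<and> (\<forall>u v. a < u \<longrightarrow> u < a2 \<longrightarrow> b < v \<longrightarrow> v < b2 \<longrightarrow> {a..u} \<times> {b..v} \<subseteq> N0 \<longrightarrow>
       rn u v = r u v \<and> wn u v = w u v \<and> pn u v = \<phi> u v)" (is ?ex)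
  proof (rule local_solution[OF N0 I(2), of a a2 b b2 \<rho> K R L M])
    show "norm (r a b, w a b, \<phi> a b) \<le> K" "\<rho> \<le> r a b" using rect0(2,3)[of a b] ab sT by auto
    show "norm (pu r u b, pu w u b, pu \<phi> u b) \<le> R - 1" if "a \<le> u" "u \<le> a2" for u
      using segu[OF that] by (simp add: R_def P_def add.commute)
    show "norm (pv r a v, pv w a v, pv \<phi> a v) \<le> R - 1" if "b \<le> v" "v \<le> b2" for v
      using segv[OF that] by (simp add: R_def Q_def add.commute)
    show "(u,b) \<in> N0" if "a \<le> u" "u \<le> a2" for u using segu[OF that] ..
    show "(a,v) \<in> N0" if "b \<le> v" "v \<le> b2" for v using segv[OF that] ..
    show "a < a2" "b < b2" "1 \<le> R" using len K0 by (auto simp: R_def)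
    show ?ex if "wave_system ?N rn wn pn" "\<And>u v. a < u \<Longrightarrow> u < a2 \<Longrightarrow> b < v \<Longrightarrow> v < b2 \<Longrightarrow> {a..u} \<times> {b..v} \<subseteq> N0 \<Longrightarrow>
       rn u v = r u v \<and> wn u v = w u v \<and> pn u v = \<phi> u v" for rn wn pn
      using that by (intro exI[of _ rn] exI[of _ wn] exI[of _ pn]) simp
  qed (assumption | (rule LM small \<rho>; assumption))+
  then obtain rn wn pn where W: "wave_system ?N rn wn pn"
    and same: "\<And>u v. a < u \<Longrightarrow> u < a2 \<Longrightarrow> b < v \<Longrightarrow> v < b2 \<Longrightarrow> {a..u} \<times> {b..v} \<subseteq> N0 \<Longrightarrow>
       rn u v = r u v \<and> wn u v = w u v \<and> pn u v = \<phi> u v"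
    by blast
  have Nop: "open ?N" by (intro open_Times open_greaterThanLessThan)
  have a2u: "a2 < u0" and av: "0 < a" "v0 < b" using segu[of a2] len ab sT by (auto simp: N0_def)
  have NK: "?N \<subseteq> Kset u0 v0" using a2u av by (auto simp: Kset_def)
  have Nint: "?N \<subseteq> {0<..<u0} \<times> {v0<..}" using a2u av by auto
  have GN: "(u,v) \<in> N0" if "(u,v) \<in> ?N" "(u,v) \<in> G" for u v using that a2u av by (auto simp: N0_def)
  have eqN: "rn u v = r u v \<and> wn u v = w u v \<and> pn u v = \<phi> u v" if "(u,v) \<in> ?N" "(u,v) \<in> N0" for u v
  proof (rule same)
    show "{a..u} \<times> {b..v} \<subseteq> N0" using mem0[OF that(2)] av by auto
  qed (use that in auto)
  define M0 where "M0 = ?N \<inter> N0"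
  have M0: "open M0" using Nop N0 by (auto simp: M0_def)
  have C2M0: "C2_on M0 rn" "C2_on M0 wn" "C2_on M0 pn"
    by (rule C2_on_cong[OF M0 _ C2_on_subset[OF C2N0(1)], of rn] C2_on_cong[OF M0 _ C2_on_subset[OF I(1)], of wn]
          C2_on_cong[OF M0 _ C2_on_subset[OF C2N0(3)], of pn]; use eqN in \<open>auto simp: M0_def\<close>)+
  \<comment> \<open>Second derivatives and constraints are carried over from lines v = c and u = d.
    They run strictly inside the new rectangle, yet so near its initial edges that they lie in
    \<open>N0\<close>, where the old solution is C^2.\<close>
  have mid: "\<exists>m>0. m \<le> e \<and> m < l" if "0 < e" "0 < l" for e l :: real
    by (rule exI[of _ "min e (l / 2)"]) (use that in \<open>auto simp: min_def\<close>)
  obtain m where m: "0 < m" "m \<le> d2" "m < b2 - b" using mid[OF d2(1) len(3)] by blast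
  define c where "c = b + m"
  have "\<bar>c - b\<bar> \<le> d2" "\<bar>a2 - s\<bar> \<le> d2" using m h(1) d2(1) by (auto simp: c_def a2_def)
  then have c: "b < c" "c < b2" "(a2,c) \<in> N0" using d2(2)[of a2 c] m by (auto simp: c_def)
  obtain m' where m': "0 < m'" "m' \<le> d1" "m' < a2 - a" using mid[OF d1(1) len(1)] by blast
  define d where "d = a + m'"
  have "\<bar>d - a\<bar> \<le> d1" "\<bar>b2 - T\<bar> \<le> d1" using m' h(1) d1(1) by (auto simp: d_def b2_def)
  then have d: "a < d" "d < a2" "(d,b2) \<in> N0" using d1(2)[of d b2] m' by (auto simp: d_def)
  have base: "(u,c) \<in> M0" if "u \<in> {a<..<a2}" for u
    using mem0[OF c(3), of u c] that av c by (auto simp: M0_def)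
  have base': "(d,v) \<in> M0" if "v \<in> {b<..<b2}" for v
    using mem0[OF d(3), of d v] that av d by (auto simp: M0_def)
  have C2n: "C2_on ?N rn \<and> C2_on ?N wn \<and> C2_on ?N pn"
    by (rule wave_regular[OF _ _ _ _ _ _ W base base' C2M0]) (use c d in auto)
  note cong = pu_cong_open[OF M0]
  have e1: "pu rn u v = pu r u v" "pv rn u v = pv r u v" "pu wn u v = pu w u v" "pv wn u v = pv w u v"
    "pu pn u v = pu \<phi> u v" "pv pn u v = pv \<phi> u v" if "(u,v) \<in> M0" for u v
    using cong[OF that, of rn r] cong[OF that, of wn w] cong[OF that, of pn \<phi>] eqN by (auto simp: M0_def)
  have e2: "pu (pu rn) u v = pu (pu r) u v" "pv (pv rn) u v = pv (pv r) u v" if "(u,v) \<in> M0" for u v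
    using cong(1)[OF that, of "pu rn" "pu r"] cong(2)[OF that, of "pv rn" "pv r"] e1 by auto
  have e0: "rn u v = r u v" if "(u,v) \<in> M0" for u v using eqN that by (auto simp: M0_def)
  have Ru: "pu (pu rn) u v = 2 * pu wn u v * pu rn u v - rn u v * (pu pn u v)\<^sup>2" if "(u,v) \<in> ?N" for u v
  proof (rule Raychaudhuri_propagates[OF _ _ _ _ _ _ W, of u c v])
    have m: "(u,c) \<in> M0" using base that by auto
    show "pu (pu rn) u c = 2 * pu wn u c * pu rn u c - rn u c * (pu pn u c)\<^sup>2"
      using I(3)[of u c] m e1[OF m] e2[OF m] e0[OF m] by (auto simp: M0_def)
  qed (use that c C2n in auto)
  have Rv: "pv (pv rn) u v = 2 * pv wn u v * pv rn u v - rn u v * (pv pn u v)\<^sup>2" if "(u,v) \<in> ?N" for u v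
  proof -
    have f: "C2_on ({b<..<b2} \<times> {a<..<a2}) (\<lambda>x y. f y x)" if "C2_on ?N f" for f
      by (rule C2_on_flip) (simp only: swap_vimage_Times that)
    have m: "(d,v) \<in> M0" using base' that by auto
    have "pu (pu (\<lambda>x y. rn y x)) v u = 2 * pu (\<lambda>x y. wn y x) v u * pu (\<lambda>x y. rn y x) v u - rn u v * (pu (\<lambda>x y. pn y x) v u)\<^sup>2"
    proof (rule Raychaudhuri_propagates[OF _ _ _ f f f wave_system_flip[OF W], of v d u])
      show "pu (pu (\<lambda>x y. rn y x)) v d = 2 * pu (\<lambda>x y. wn y x) v d * pu (\<lambda>x y. rn y x) v d - rn d v * (pu (\<lambda>x y. pn y x) v d)\<^sup>2"
        unfolding pu_flip[of rn] pu_flip[of wn] pu_flip[of pn] pu_flip[of "pv rn"]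
        using I(4)[of d v] m e1[OF m] e2[OF m] e0[OF m] by (auto simp: M0_def)
    qed (use that d C2n in auto)
    then show ?thesis unfolding pu_flip[of rn] pu_flip[of wn] pu_flip[of pn] pu_flip[of "pv rn"] .
  qed
  have EHn: "EH_equations V rn (\<lambda>u v. exp (wn u v)) pn u v" if "(u,v) \<in> ?N" for u v
  proof -
    have "rn u v > 0" using wave_systemD(1)[OF W that] .
    moreover have "pu (pv rn) u v = wave_r V rn wn pn u v" "pu (pv pn) u v = wave_phi V rn wn pn u v"
      using wave_systemD(3,7)[OF W that] by (simp_all add: pu_def[of "pv rn"] pu_def[of "pv pn"] DERIV_imp_deriv)
    ultimately show ?thesis using EH_exp_iff[OF Nop that, of rn wn pn V] C2n Ru[OF that] Rv[OF that] by simp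
  qed
  define r' where "r' u v = (if (u,v) \<in> ?N then rn u v else r u v)" for u v
  define \<Omega>' where "\<Omega>' u v = (if (u,v) \<in> ?N then exp (wn u v) else \<Omega> u v)" for u v
  define \<phi>' where "\<phi>' u v = (if (u,v) \<in> ?N then pn u v else \<phi> u v)" for u v
  \<comment> \<open>The neighbourhood U of the development may meet the new rectangle outside G,
    where the old functions are unrelated to the new solution. Removing the closed rectangle and
    restoring \<open>N0\<close> leaves an open set on which old and glued functions agree.\<close>
  define U1 where "U1 = (U - {a..a2} \<times> {b..b2}) \<union> N0"
  have U1: "open U1" "U1 \<subseteq> U"
    using U(1) N0 N0U by (auto simp: U1_def intro!: open_Un open_Diff closed_Times)
  have eq1: "r u v = r' u v" "\<Omega> u v = \<Omega>' u v" "\<phi> u v = \<phi>' u v" if "(u,v) \<in> U1" for u v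
  proof -
    have "(u,v) \<in> N0 \<and> exp (w u v) = \<Omega> u v" if "(u,v) \<in> ?N"
    proof -
      have "(u,v) \<in> N0" using that \<open>(u,v) \<in> U1\<close> by (auto simp: U1_def)
      then show ?thesis using sol0 by (simp add: w_def)
    qed
    then show "r u v = r' u v" "\<Omega> u v = \<Omega>' u v" "\<phi> u v = \<phi>' u v"
      using eqN[of u v] by (auto simp: r'_def \<Omega>'_def \<phi>'_def)
  qed
  have eq2: "rn u v = r' u v" "exp (wn u v) = \<Omega>' u v" "pn u v = \<phi>' u v" if "(u,v) \<in> ?N" for u v
    using that by (auto simp: r'_def \<Omega>'_def \<phi>'_def)
  have GU: "G \<subseteq> U1 \<union> ?N"
  proof
    fix p assume p: "p \<in> G"
    obtain u v where uv: "p = (u,v)" by (cases p)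
    show "p \<in> U1 \<union> ?N"
    proof (cases "p \<in> {a..a2} \<times> {b..b2}")
      case True
      then have "p \<in> N0" using p av a2u uv by (auto simp: N0_def)
      then show ?thesis by (simp add: U1_def)
    next
      case False then show ?thesis using p U(2) by (auto simp: U1_def)
    qed
  qed
  have "is_development V u0 v0 (G \<union> ?N) r' \<Omega>' \<phi>'"
    unfolding is_development_def
  proof (intro conjI)
    show "G \<union> ?N \<subseteq> Kset u0 v0" using GK NK by auto
    have "openin (top_of_set (Kset u0 v0)) (Kset u0 v0 \<inter> ?N)" by (rule openin_open_Int[OF Nop])
    then have "openin (top_of_set (Kset u0 v0)) ?N" using NK by (simp add: Int_absorb1)
    then show "openin (top_of_set (Kset u0 v0)) (G \<union> ?N)" by (rule openin_Un[OF Gop])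
    show "Cin u0 v0 \<union> Cout v0 \<subseteq> G \<union> ?N" using Gc by auto
    \<comment> \<open>A past point of the new rectangle that lies outside it is to the left of a or
      below b, hence in the past of one of the edge end points (a,b2) and (a2,b).\<close>
    have "(u',v') \<in> G \<union> ?N"
      if uv: "(u,v) \<in> G \<union> ?N" "u' \<in> {0..u}" "v' \<in> {v0..v}" for u v u' v'
    proof (cases "(u,v) \<in> G \<or> (u',v') \<in> ?N")
      case True then show ?thesis using past[of u v u' v'] uv by auto
    next
      case False
      then have N: "a < u" "u < a2" "b < v" "v < b2" using uv(1) by auto
      then have "u' \<le> a \<or> v' \<le> b" using uv False by auto
      then have "(u',v') \<in> G"
      proof
        assume "u' \<le> a"
        moreover have "(a,b2) \<in> G" using segv[of b2] len N0U by auto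
        ultimately show ?thesis using past[of a b2 u' v'] uv N by auto
      next
        assume "v' \<le> b"
        moreover have "(a2,b) \<in> G" using segu[of a2] len N0U by auto
        ultimately show ?thesis using past[of a2 b u' v'] uv N by auto
      qed
      then show ?thesis ..
    qed
    then show "\<forall>(u,v)\<in>G \<union> ?N. \<forall>u'\<in>{0..u}. \<forall>v'\<in>{v0..v}. (u',v') \<in> G \<union> ?N"
      by (intro ball_pairI ballI)
    show "\<exists>U. open U \<and> G \<union> ?N \<subseteq> U \<and> C2_on U r' \<and> C2_on U \<Omega>' \<and> C2_on U \<phi>'"
    proof (intro exI[of _ "U1 \<union> ?N"] conjI)
      show "open (U1 \<union> ?N)" using U1 Nop by auto
      show "G \<union> ?N \<subseteq> U1 \<union> ?N" using GU by auto
      have "C2_on U1 r'" by (rule C2_on_cong[OF U1(1) eq1(1) C2_on_subset[OF U(3) U1(2)]])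
      moreover have "C2_on ?N r'" by (rule C2_on_cong[OF Nop eq2(1)]) (use C2n in auto)
      ultimately show "C2_on (U1 \<union> ?N) r'" using C2_on_Un[OF U1(1) Nop] by blast
      have "C2_on U1 \<Omega>'" by (rule C2_on_cong[OF U1(1) eq1(2) C2_on_subset[OF U(4) U1(2)]])
      moreover have "C2_on ?N \<Omega>'" by (rule C2_on_cong[OF Nop eq2(2)]) (use C2n in \<open>auto intro!: C2_on_exp Nop\<close>)
      ultimately show "C2_on (U1 \<union> ?N) \<Omega>'" using C2_on_Un[OF U1(1) Nop] by blast
      have "C2_on U1 \<phi>'" by (rule C2_on_cong[OF U1(1) eq1(3) C2_on_subset[OF U(5) U1(2)]])
      moreover have "C2_on ?N \<phi>'" by (rule C2_on_cong[OF Nop eq2(3)]) (use C2n in auto)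
      ultimately show "C2_on (U1 \<union> ?N) \<phi>'" using C2_on_Un[OF U1(1) Nop] by blast
    qed
    show "\<forall>(u,v)\<in>G \<union> ?N. r' u v > 0 \<and> \<Omega>' u v > 0 \<and> EH_equations V r' \<Omega>' \<phi>' u v"
    proof (rule ball_pairI)
      fix u v assume uv: "(u,v) \<in> G \<union> ?N"
      show "r' u v > 0 \<and> \<Omega>' u v > 0 \<and> EH_equations V r' \<Omega>' \<phi>' u v"
      proof (cases "(u,v) \<in> ?N")
        case True
        have "EH_equations V r' \<Omega>' \<phi>' u v" by (rule EH_cong[OF Nop True eq2 EHn[OF True]])
        then show ?thesis using wave_systemD(1)[OF W True] True by (simp add: r'_def \<Omega>'_def)
      next
        case False
        then have G: "(u,v) \<in> G" "(u,v) \<in> U1" using uv GU by auto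
        have "EH_equations V r' \<Omega>' \<phi>' u v" by (rule EH_cong[OF U1(1) G(2) eq1]) (use sol[OF G(1)] in auto)
        then show ?thesis using sol[OF G(1)] eq1[OF G(2)] by simp
      qed
    qed
  qed
  moreover have "(s,T) \<in> G \<union> ?N" using ab ab2 by auto
  moreover have "\<forall>(u,v)\<in>Cin u0 v0 \<union> Cout v0. r' u v = r u v \<and> \<Omega>' u v = \<Omega> u v \<and> \<phi>' u v = \<phi> u v"
  proof (rule ball_pairI)
    fix u v assume "(u,v) \<in> Cin u0 v0 \<union> Cout v0"
    then have "(u,v) \<notin> ?N" using av by (auto simp: Cin_def Cout_def)
    then show "r' u v = r u v \<and> \<Omega>' u v = \<Omega> u v \<and> \<phi>' u v = \<phi> u v" by (simp add: r'_def \<Omega>'_def \<phi>'_def del: mem_Sigma_iff)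
  qed
  ultimately show ?thesis by blast
qed

end

section \<open>Late-time control near the event horizon\<close>

lemma deriv_nonneg_mono:
  fixes f :: "real \<Rightarrow> real"
  assumes "a \<le> b" "\<And>x. a \<le> x \<Longrightarrow> x \<le> b \<Longrightarrow> (f has_real_derivative f' x) (at x)"
    "\<And>x. a \<le> x \<Longrightarrow> x \<le> b \<Longrightarrow> 0 \<le> f' x"
  shows "f a \<le> f b"
  by (rule DERIV_nonneg_imp_nondecreasing[OF assms(1)]) (use assms(2,3) in blast)

lemma deriv_nonpos_mono:
  fixes f :: "real \<Rightarrow> real"
  assumes "a \<le> b" "\<And>x. a \<le> x \<Longrightarrow> x \<le> b \<Longrightarrow> (f has_real_derivative f' x) (at x)"
    "\<And>x. a \<le> x \<Longrightarrow> x \<le> b \<Longrightarrow> f' x \<le> 0"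
  shows "f b \<le> f a"
  by (rule DERIV_nonpos_imp_nonincreasing[OF assms(1)]) (use assms(2,3) in blast)

lemma deriv_bound:
  fixes f :: "real \<Rightarrow> real"
  assumes "a \<le> b" "\<And>x. a \<le> x \<Longrightarrow> x \<le> b \<Longrightarrow> (f has_real_derivative f' x) (at x)"
    "\<And>x. a \<le> x \<Longrightarrow> x \<le> b \<Longrightarrow> \<bar>f' x\<bar> \<le> g' x"
    "\<And>x. a \<le> x \<Longrightarrow> x \<le> b \<Longrightarrow> (g has_real_derivative g' x) (at x)"
  shows "\<bar>f b - f a\<bar> \<le> g b - g a"
proof -
  have "g a - f a \<le> g b - f b"
  proof (rule deriv_nonneg_mono[OF assms(1)])
    fix x assume x: "a \<le> x" "x \<le> b"
    show "((\<lambda>x. g x - f x) has_real_derivative g' x - f' x) (at x)" by (rule DERIV_diff[OF assms(4)[OF x] assms(2)[OF x]])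
    show "0 \<le> g' x - f' x" using assms(3)[OF x] by linarith
  qed
  moreover have "g a + f a \<le> g b + f b"
  proof (rule deriv_nonneg_mono[OF assms(1)])
    fix x assume x: "a \<le> x" "x \<le> b"
    show "((\<lambda>x. g x + f x) has_real_derivative g' x + f' x) (at x)" by (rule DERIV_add[OF assms(4)[OF x] assms(2)[OF x]])
    show "0 \<le> g' x + f' x" using assms(3)[OF x] by linarith
  qed
  ultimately show ?thesis by linarith
qed

text \<open>The data in the form used by the estimates. Bounding V' by a multiple of
  \<open>pv \<phi>\<close> on the horizon is what makes the forcing of \<zeta> square integrable
  there. The bound on V'' is asked for only from v0 + 1 on, so that \<phi> has had room to move away
  from its supremum.\<close>

locale horizon_data = C2_potential V for V +
  fixes u0 v0 :: real and G :: "(real \<times> real) set" and r \<Omega> \<phi> :: "real \<Rightarrow> real \<Rightarrow> real"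
    and rp mp c2 c3 B Cv \<delta> e1 e2 e3 :: real
  assumes u0_pos: "u0 > 0"
    and V_nonneg: "\<And>x. V x \<ge> 0"
    and dev: "is_development V u0 v0 G r \<Omega> \<phi>"
    and maximal: "\<And>G' r' \<Omega>' \<phi>'. is_development V u0 v0 G' r' \<Omega>' \<phi>' \<Longrightarrow>
        \<forall>(u,v)\<in>Cin u0 v0 \<union> Cout v0. r' u v = r u v \<and> \<Omega>' u v = \<Omega> u v \<and> \<phi>' u v = \<phi> u v \<Longrightarrow> G' \<subseteq> G"
    and pos: "0 < c2" "0 < c3" "0 \<le> B" "0 \<le> Cv" "0 < \<delta>" "0 < e1" "0 < e2" "0 < e3"
    and r_out: "\<And>v. v0 \<le> v \<Longrightarrow> r 0 v \<le> rp"
    and m_out: "\<And>v. v0 \<le> v \<Longrightarrow> hawking_mass r \<Omega> 0 v \<le> mp"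
      "\<And>e. 0 < e \<Longrightarrow> \<exists>v\<ge>v0. mp - e < hawking_mass r \<Omega> 0 v"
    and pu_out: "\<And>v. v0 \<le> v \<Longrightarrow> pu r 0 v < 0"
    and pv_out: "\<And>v. v0 \<le> v \<Longrightarrow> 0 < pv r 0 v" "\<And>v. v0 \<le> v \<Longrightarrow> pv r 0 v \<le> e1"
    and kappa_out: "\<And>v. v0 \<le> v \<Longrightarrow> c3 \<le> - pu r 0 v / (\<Omega> 0 v)\<^sup>2" "\<And>v. v0 \<le> v \<Longrightarrow> - pu r 0 v / (\<Omega> 0 v)\<^sup>2 \<le> c2 / 2"
    and V_out: "\<And>v. v0 \<le> v \<Longrightarrow> V (\<phi> 0 v) \<le> e2 / 2"
    and phi_out: "\<And>v. v0 \<le> v \<Longrightarrow> \<bar>pv \<phi> 0 v\<bar> \<le> e3" "\<And>v. v0 \<le> v \<Longrightarrow> \<bar>deriv V (\<phi> 0 v)\<bar> \<le> Cv * \<bar>pv \<phi> 0 v\<bar>"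
    and V2_out: "\<And>v x. v0 + 1 \<le> v \<Longrightarrow> \<bar>x - \<phi> 0 v\<bar> \<le> \<delta> \<Longrightarrow> \<bar>deriv (deriv V) x\<bar> \<le> B"
    and e2_small: "4 * rp\<^sup>2 * e2 \<le> 1"
begin

definition \<rho> where "\<rho> = r u0 v0"
definition \<kappa> where "\<kappa> u v = - pu r u v / (\<Omega> u v)\<^sup>2"
definition \<zeta> where "\<zeta> u v = pu \<phi> u v / pu r u v"
definition w where "w = (\<lambda>a b. ln (\<Omega> a b))"

section \<open>Signs and monotonicity on the development\<close>

lemma G_facts:
  shows GK: "G \<subseteq> Kset u0 v0" and Gop: "openin (top_of_set (Kset u0 v0)) G"
    and Gin: "0 \<le> u \<Longrightarrow> u \<le> u0 \<Longrightarrow> (u, v0) \<in> G" and Gout: "v0 \<le> v \<Longrightarrow> (0, v) \<in> G"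
    and past: "(u,v) \<in> G \<Longrightarrow> 0 \<le> u' \<Longrightarrow> u' \<le> u \<Longrightarrow> v0 \<le> v' \<Longrightarrow> v' \<le> v \<Longrightarrow> (u',v') \<in> G"
    and r_pos: "(u,v) \<in> G \<Longrightarrow> r u v > 0" and Om_pos: "(u,v) \<in> G \<Longrightarrow> \<Omega> u v > 0"
    and EH: "(u,v) \<in> G \<Longrightarrow> EH_equations V r \<Omega> \<phi> u v"
    and G_ge: "(u,v) \<in> G \<Longrightarrow> 0 \<le> u" "(u,v) \<in> G \<Longrightarrow> u \<le> u0" "(u,v) \<in> G \<Longrightarrow> v0 \<le> v"
  using dev unfolding is_development_def by (auto simp: Cin_def Cout_def Kset_def)

text \<open>The equations give \<Omega> > 0 on G only; shrinking the neighbourhood makes log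
  \<Omega> a C^2 function on an open set.\<close>

lemma obtain_U:
  obtains U where "open U" "G \<subseteq> U" "C2_on U r" "C2_on U \<Omega>" "C2_on U \<phi>" "C2_on U w"
    "\<And>u v. (u,v) \<in> U \<Longrightarrow> \<Omega> u v > 0"
proof -
  obtain U where U: "open U" "G \<subseteq> U" "C2_on U r" "C2_on U \<Omega>" "C2_on U \<phi>"
    using dev unfolding is_development_def by auto
  define U' where "U' = U \<inter> (\<lambda>p. \<Omega> (fst p) (snd p)) -` {0<..}"
  have o: "open U'" unfolding U'_def
    by (rule continuous_open_preimage[OF C1_onD(3)[OF C2_onD(1)[OF U(4)]] U(1)]) simp
  have s: "U' \<subseteq> U" "G \<subseteq> U'" using U(2) Om_pos by (auto simp: U'_def)
  have p: "\<And>u v. (u,v) \<in> U' \<Longrightarrow> \<Omega> u v > 0" by (auto simp: U'_def)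
  note c = C2_on_subset[OF _ s(1)]
  show thesis
    by (rule that[OF o s(2) c[OF U(3)] c[OF U(4)] c[OF U(5)] _ p])
       (auto simp: w_def intro!: C2_on_ln o c[OF U(4)] p)
qed

lemma C1_facts:
  shows C1r: "C1_on G r" and C1Om: "C1_on G \<Omega>" and C1p: "C1_on G \<phi>" and C1w: "C1_on G w"
    and C1ru: "C1_on G (pu r)" and C1rv: "C1_on G (pv r)" and C1pu: "C1_on G (pu \<phi>)" and C1pv: "C1_on G (pv \<phi>)"
    and C1wu: "C1_on G (pu w)" and C1wv: "C1_on G (pv w)"
  using obtain_U by (metis C1_on_subset C2_onD)+

lemma wave_facts:
  assumes "(u,v) \<in> G"
  shows "pu r u v * (pu (pv r) u v - wave_r V r w \<phi> u v) = 0" "pu (pv \<phi>) u v = wave_phi V r w \<phi> u v"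
    "pv (pu r) u v = pu (pv r) u v" "pv (pu \<phi>) u v = pu (pv \<phi>) u v" "exp (2 * w u v) = (\<Omega> u v)\<^sup>2"
proof -
  obtain U where U: "open U" "G \<subseteq> U" "C2_on U r" "C2_on U \<Omega>" "C2_on U \<phi>" "C2_on U w"
    "\<And>u v. (u,v) \<in> U \<Longrightarrow> \<Omega> u v > 0" by (rule obtain_U, rule that)
  have uv: "(u,v) \<in> U" using U(2) assms by blast
  have "EH_equations V r (\<lambda>u v. exp (w u v)) \<phi> u v"
    by (rule EH_cong[OF U(1) uv, of r r \<Omega> _ \<phi> \<phi>]) (use EH[OF assms] U(7) in \<open>auto simp: w_def\<close>)
  then show "pu r u v * (pu (pv r) u v - wave_r V r w \<phi> u v) = 0" "pu (pv \<phi>) u v = wave_phi V r w \<phi> u v"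
    using EH_exp_iff[OF U(1) uv U(3,6,5) r_pos[OF assms], of V] by auto
  show "pv (pu r) u v = pu (pv r) u v" "pv (pu \<phi>) u v = pu (pv \<phi>) u v"
    by (rule pu_pv_commute[OF U(1) uv U(3)] pu_pv_commute[OF U(1) uv U(5)])+
  show "exp (2 * w u v) = (\<Omega> u v)\<^sup>2" using Om_pos[OF assms] by (simp add: w_def exp_double)
qed

lemma kappa_u:
  assumes "(u,v) \<in> G"
  shows "((\<lambda>s. \<kappa> s v) has_real_derivative r u v * (pu \<phi> u v)\<^sup>2 / (\<Omega> u v)\<^sup>2) (at u)"
proof -
  note d = C1_onD(1)[OF C1ru assms] C1_onD(1)[OF C1Om assms]
  have "(\<lambda>s. pu r s v / (\<Omega> s v)\<^sup>2) field_differentiable at u"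
    using d Om_pos[OF assms] by (intro field_differentiable_divide field_differentiable_power)
      (auto simp: field_differentiable_def)
  then have "((\<lambda>s. pu r s v / (\<Omega> s v)\<^sup>2) has_real_derivative pu (\<lambda>a b. pu r a b / (\<Omega> a b)\<^sup>2) u v) (at u)"
    unfolding pu_def[of "\<lambda>a b. pu r a b / (\<Omega> a b)\<^sup>2"] by (simp add: field_differentiable_derivI)
  moreover have "pu (\<lambda>a b. pu r a b / (\<Omega> a b)\<^sup>2) u v = - r u v / (\<Omega> u v)\<^sup>2 * (pu \<phi> u v)\<^sup>2"
    using EH[OF assms] unfolding EH_equations_def Let_def by blast
  ultimately have "((\<lambda>s. pu r s v / (\<Omega> s v)\<^sup>2) has_real_derivative - r u v / (\<Omega> u v)\<^sup>2 * (pu \<phi> u v)\<^sup>2) (at u)"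
    by (simp only:)
  from DERIV_minus[OF this] show ?thesis by (simp add: \<kappa>_def)
qed

lemma Raychaudhuri_v_line:
  assumes "(u,v) \<in> G"
  shows "((\<lambda>t. pv r u t / (\<Omega> u t)\<^sup>2) has_real_derivative - r u v / (\<Omega> u v)\<^sup>2 * (pv \<phi> u v)\<^sup>2) (at v)"
proof -
  note d = C1_onD(2)[OF C1rv assms] C1_onD(2)[OF C1Om assms]
  have "(\<lambda>t. pv r u t / (\<Omega> u t)\<^sup>2) field_differentiable at v"
    using d Om_pos[OF assms] by (intro field_differentiable_divide field_differentiable_power)
      (auto simp: field_differentiable_def)
  then have "((\<lambda>t. pv r u t / (\<Omega> u t)\<^sup>2) has_real_derivative pv (\<lambda>a b. pv r a b / (\<Omega> a b)\<^sup>2) u v) (at v)"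
    unfolding pv_def[of "\<lambda>a b. pv r a b / (\<Omega> a b)\<^sup>2"] by (simp add: field_differentiable_derivI)
  moreover have "pv (\<lambda>a b. pv r a b / (\<Omega> a b)\<^sup>2) u v = - r u v / (\<Omega> u v)\<^sup>2 * (pv \<phi> u v)\<^sup>2"
    using EH[OF assms] unfolding EH_equations_def Let_def by blast
  ultimately show ?thesis by simp
qed

text \<open>The Raychaudhuri equation in u makes \<kappa> nondecreasing in u, so the horizon bound
  c3 holds on the whole development, whatever the sign of \<open>pv r\<close>. Negativity of
  \<open>pu r\<close> follows.\<close>

lemma kappa_ge: "(u,v) \<in> G \<Longrightarrow> c3 \<le> \<kappa> u v"
proof -
  assume uv: "(u,v) \<in> G"
  have "\<kappa> 0 v \<le> \<kappa> u v"
  proof (rule deriv_nonneg_mono[OF G_ge(1)[OF uv]])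
    fix s assume s: "0 \<le> s" "s \<le> u"
    have sv: "(s,v) \<in> G" using past[OF uv s] G_ge(3)[OF uv] by simp
    show "((\<lambda>s. \<kappa> s v) has_real_derivative r s v * (pu \<phi> s v)\<^sup>2 / (\<Omega> s v)\<^sup>2) (at s)" by (rule kappa_u[OF sv])
    show "0 \<le> r s v * (pu \<phi> s v)\<^sup>2 / (\<Omega> s v)\<^sup>2" using r_pos[OF sv] by simp
  qed
  then show ?thesis using kappa_out(1)[OF G_ge(3)[OF uv]] by (simp add: \<kappa>_def)
qed

lemma ru_neg: "(u,v) \<in> G \<Longrightarrow> pu r u v < 0"
proof -
  assume uv: "(u,v) \<in> G"
  have "0 < - pu r u v / (\<Omega> u v)\<^sup>2" using kappa_ge[OF uv] pos(2) by (simp add: \<kappa>_def)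
  then show ?thesis using Om_pos[OF uv] by (auto simp: divide_less_0_iff)
qed

lemma Om_kappa: "(u,v) \<in> G \<Longrightarrow> (\<Omega> u v)\<^sup>2 = - pu r u v / \<kappa> u v"
  using ru_neg[of u v] Om_pos[of u v] by (simp add: \<kappa>_def)

lemma rv_sign_past:
  assumes "(u,v) \<in> G" "v0 \<le> v'" "v' \<le> v"
  shows "pv r u v / (\<Omega> u v)\<^sup>2 \<le> pv r u v' / (\<Omega> u v')\<^sup>2"
proof (rule deriv_nonpos_mono[OF assms(3)])
  fix t assume t: "v' \<le> t" "t \<le> v"
  have ut: "(u,t) \<in> G" using past[OF assms(1)] G_ge(1)[OF assms(1)] t assms by simp
  show "((\<lambda>t. pv r u t / (\<Omega> u t)\<^sup>2) has_real_derivative - r u t / (\<Omega> u t)\<^sup>2 * (pv \<phi> u t)\<^sup>2) (at t)"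
    by (rule Raychaudhuri_v_line[OF ut])
  show "- r u t / (\<Omega> u t)\<^sup>2 * (pv \<phi> u t)\<^sup>2 \<le> 0" using r_pos[OF ut] by (simp add: mult_nonpos_nonneg)
qed

lemma rv_past:
  assumes "(u,v) \<in> G" "v0 \<le> v'" "v' \<le> v"
  shows "0 \<le> pv r u v \<Longrightarrow> 0 \<le> pv r u v'" "0 < pv r u v \<Longrightarrow> 0 < pv r u v'"
proof -
  have G: "(u,v') \<in> G" using past[OF assms(1)] G_ge(1)[OF assms(1)] assms by simp
  have O: "(\<Omega> u v)\<^sup>2 > 0" "(\<Omega> u v')\<^sup>2 > 0" using Om_pos[OF assms(1)] Om_pos[OF G] by auto
  note le = rv_sign_past[OF assms]
  show "0 \<le> pv r u v \<Longrightarrow> 0 \<le> pv r u v'"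
    using order_trans[OF _ le, of 0] O by (simp add: zero_le_divide_iff not_less)
  show "0 < pv r u v \<Longrightarrow> 0 < pv r u v'"
    using less_le_trans[OF _ le, of 0] O by (simp add: zero_less_divide_iff)
qed

lemma r_uv:
  assumes uv: "(u,v) \<in> G"
  defines "X \<equiv> - (pu r u v * pv r u v / r u v) - (\<Omega> u v)\<^sup>2 * (1 - 2 * (r u v)\<^sup>2 * V (\<phi> u v)) / (4 * r u v)"
  shows "((\<lambda>s. pv r s v) has_real_derivative X) (at u)" "((\<lambda>t. pu r u t) has_real_derivative X) (at v)"
proof -
  have "wave_r V r w \<phi> u v = X" using r_pos[OF uv] unfolding wave_r_def X_def wave_facts(5)[OF uv]
    by (simp add: field_simps power2_eq_square)
  then have "pu (pv r) u v = X" using wave_facts(1)[OF uv] ru_neg[OF uv] by simp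
  then show "((\<lambda>s. pv r s v) has_real_derivative X) (at u)" "((\<lambda>t. pu r u t) has_real_derivative X) (at v)"
    using C1_onD(1)[OF C1rv uv] C1_onD(2)[OF C1ru uv] wave_facts(3)[OF uv] by auto
qed

lemma phi_uv:
  assumes uv: "(u,v) \<in> G"
  defines "Y \<equiv> - ((pu \<phi> u v * pv r u v + pv \<phi> u v * pu r u v) / r u v) - (\<Omega> u v)\<^sup>2 * deriv V (\<phi> u v) / 4"
  shows "((\<lambda>s. pv \<phi> s v) has_real_derivative Y) (at u)" "((\<lambda>t. pu \<phi> u t) has_real_derivative Y) (at v)"
proof -
  have "wave_phi V r w \<phi> u v = Y" unfolding wave_phi_def Y_def wave_facts(5)[OF uv] by simp
  then have "pu (pv \<phi>) u v = Y" using wave_facts(2)[OF uv] by simp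
  then show "((\<lambda>s. pv \<phi> s v) has_real_derivative Y) (at u)" "((\<lambda>t. pu \<phi> u t) has_real_derivative Y) (at v)"
    using C1_onD(1)[OF C1pv uv] C1_onD(2)[OF C1pu uv] wave_facts(4)[OF uv] by auto
qed

lemma r_rv_u:
  assumes uv: "(u,v) \<in> G"
  shows "((\<lambda>s. r s v * pv r s v) has_real_derivative - ((\<Omega> u v)\<^sup>2 / 4 * (1 - 2 * (r u v)\<^sup>2 * V (\<phi> u v)))) (at u)"
  by (rule DERIV_cong[OF DERIV_mult[OF C1_onD(1)[OF C1r uv] r_uv(1)[OF uv]]])
     (use r_pos[OF uv] in \<open>simp add: field_simps\<close>)

lemma r_ru_v:
  assumes uv: "(u,v) \<in> G"
  shows "((\<lambda>t. r u t * pu r u t) has_real_derivative - ((\<Omega> u v)\<^sup>2 / 4 * (1 - 2 * (r u v)\<^sup>2 * V (\<phi> u v)))) (at v)"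
  by (rule DERIV_cong[OF DERIV_mult[OF C1_onD(2)[OF C1r uv] r_uv(2)[OF uv]]])
     (use r_pos[OF uv] in \<open>simp add: field_simps\<close>)

lemma r_phiv_u:
  assumes uv: "(u,v) \<in> G"
  shows "((\<lambda>s. r s v * pv \<phi> s v) has_real_derivative - (pu \<phi> u v * pv r u v) - r u v * (\<Omega> u v)\<^sup>2 * deriv V (\<phi> u v) / 4) (at u)"
  by (rule DERIV_cong[OF DERIV_mult[OF C1_onD(1)[OF C1r uv] phi_uv(1)[OF uv]]])
     (use r_pos[OF uv] in \<open>simp add: field_simps\<close>)

text \<open>The terms with \<open>pv r\<close> in the equations for \<open>pu \<phi>\<close> and
  \<open>pu r\<close> cancel in the quotient. What remains of the equation for \<open>pu r\<close>
  acts as damping once 2 r^2 V < 1.\<close>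

lemma zeta_v:
  assumes uv: "(u,v) \<in> G"
  shows "((\<lambda>t. \<zeta> u t) has_real_derivative
     - (\<zeta> u v * ((1 - 2 * (r u v)\<^sup>2 * V (\<phi> u v)) / (4 * \<kappa> u v * r u v)))
     + (deriv V (\<phi> u v) / (4 * \<kappa> u v) - pv \<phi> u v / r u v)) (at v)"
  unfolding \<zeta>_def
  using DERIV_divide[OF phi_uv(2)[OF uv] r_uv(2)[OF uv] less_imp_neq[OF ru_neg[OF uv]]]
proof (rule DERIV_cong)
  have p: "r u v > 0" "pu r u v < 0" "(\<Omega> u v)\<^sup>2 > 0" using r_pos[OF uv] ru_neg[OF uv] Om_pos[OF uv] by auto
  show "((- ((pu \<phi> u v * pv r u v + pv \<phi> u v * pu r u v) / r u v) - (\<Omega> u v)\<^sup>2 * deriv V (\<phi> u v) / 4) * pu r u v -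
     pu \<phi> u v * (- (pu r u v * pv r u v / r u v) - (\<Omega> u v)\<^sup>2 * (1 - 2 * (r u v)\<^sup>2 * V (\<phi> u v)) / (4 * r u v))) /
    (pu r u v * pu r u v) =
    - (pu \<phi> u v / pu r u v * ((1 - 2 * (r u v)\<^sup>2 * V (\<phi> u v)) / (4 * \<kappa> u v * r u v))) +
    (deriv V (\<phi> u v) / (4 * \<kappa> u v) - pv \<phi> u v / r u v)"
    using p unfolding \<kappa>_def by (simp add: field_simps power2_eq_square)
qed

lemma mass_out:
  assumes v: "v0 \<le> v"
  shows "((\<lambda>t. hawking_mass r \<Omega> 0 t) has_real_derivative (r 0 v)\<^sup>2 * V (\<phi> 0 v) * pv r 0 v + 2 * (r 0 v)\<^sup>2 * \<kappa> 0 v * (pv \<phi> 0 v)\<^sup>2) (at v)"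
proof -
  note uv = Gout[OF v]
  note d = C1_onD(2)[OF C1ru uv] C1_onD(2)[OF C1rv uv] C1_onD(2)[OF C1Om uv] C1_onD(2)[OF C1r uv]
  have "(\<lambda>t. hawking_mass r \<Omega> 0 t) field_differentiable at v"
    unfolding hawking_mass_def using d Om_pos[OF uv]
    by (intro field_differentiable_divide field_differentiable_power field_differentiable_mult field_differentiable_add field_differentiable_const)
      (auto simp: field_differentiable_def)
  then have "((\<lambda>t. hawking_mass r \<Omega> 0 t) has_real_derivative pv (hawking_mass r \<Omega>) 0 v) (at v)"
    unfolding pv_def[of "hawking_mass r \<Omega>"] by (simp add: field_differentiable_derivI)
  moreover have "pv (hawking_mass r \<Omega>) 0 v = 2 * (r 0 v)\<^sup>2 / (\<Omega> 0 v)\<^sup>2 * ((\<Omega> 0 v)\<^sup>2 * V (\<phi> 0 v) / 2 * pv r 0 v - (pv \<phi> 0 v)\<^sup>2 * pu r 0 v)"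
    using EH[OF uv] unfolding EH_equations_def Let_def by blast
  moreover have "\<dots> = (r 0 v)\<^sup>2 * V (\<phi> 0 v) * pv r 0 v + 2 * (r 0 v)\<^sup>2 * \<kappa> 0 v * (pv \<phi> 0 v)\<^sup>2"
    using Om_pos[OF uv] unfolding \<kappa>_def by (simp add: field_simps power2_eq_square)
  ultimately show ?thesis by simp
qed

lemma r_decreasing:
  assumes "(u,v) \<in> G" "0 \<le> u'" "u' \<le> u"
  shows "r u v \<le> r u' v"
proof (rule deriv_nonpos_mono[OF assms(3)])
  fix s assume s: "u' \<le> s" "s \<le> u"
  have sv: "(s,v) \<in> G" using past[OF assms(1)] G_ge(3)[OF assms(1)] s assms by simp
  show "((\<lambda>s. r s v) has_real_derivative pu r s v) (at s)" by (rule C1_onD(1)[OF C1r sv])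
  show "pu r s v \<le> 0" using ru_neg[OF sv] by simp
qed

lemma r_le_rp: "(u,v) \<in> G \<Longrightarrow> r u v \<le> rp"
  using r_decreasing[of u v 0] G_ge[of u v] r_out[of v] by auto

lemma rho_pos: "0 < \<rho>"
  unfolding \<rho>_def by (rule r_pos[OF Gin]) (use u0_pos in auto)

lemma rho_le_in: "0 \<le> u \<Longrightarrow> u \<le> u0 \<Longrightarrow> \<rho> \<le> r u v0"
  unfolding \<rho>_def by (rule r_decreasing[OF Gin]) (use u0_pos in auto)

text \<open>Since \<open>pv r\<close> \<ge> 0 persists to the past, r is at least its value where
  the outgoing line meets the ingoing cone, and along that cone r decreases to \<rho>.\<close>

lemma rho_le:
  assumes "(u,v) \<in> G" "0 \<le> pv r u v"
  shows "\<rho> \<le> r u v"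
proof -
  have "r u v0 \<le> r u v"
  proof (rule deriv_nonneg_mono[OF G_ge(3)[OF assms(1)]])
    fix t assume t: "v0 \<le> t" "t \<le> v"
    have ut: "(u,t) \<in> G" using past[OF assms(1)] G_ge(1)[OF assms(1)] t by simp
    show "((\<lambda>t. r u t) has_real_derivative pv r u t) (at t)" by (rule C1_onD(2)[OF C1r ut])
    show "0 \<le> pv r u t" by (rule rv_past(1)[OF assms(1) t assms(2)])
  qed
  then show ?thesis using rho_le_in[OF G_ge(1,2)[OF assms(1)]] by simp
qed

lemma rho_le_out: "v0 \<le> v \<Longrightarrow> \<rho> \<le> r 0 v"
  by (rule rho_le[OF Gout]) (use pv_out(1)[of v] in auto)

lemma rp_pos: "0 < rp" "\<rho> \<le> rp"
  using rho_pos r_out[of v0] rho_le_out[of v0] by auto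

text \<open>Bound for the modulus of r \<open>pv r\<close>: the horizon contributes rp e1, and
  integrating a quarter of the square of \<Omega>, which is at most - \<open>pu r\<close> / (4 c3),
  contributes at most rp / (4 c3).\<close>

definition rv_bound where "rv_bound = rp * e1 + rp / (4 * c3)"
text \<open>Coefficient of the horizon value of \<open>pv \<phi>\<close> in the forcing of \<zeta>.
  The first summand comes from V' / (4 \<kappa>), the second from \<open>pv \<phi>\<close> / r after
  integrating r \<open>pv \<phi>\<close> inwards from the horizon.\<close>

definition forcing_out where "forcing_out = Cv / (4 * c3) + (rp + rp\<^sup>2 * Cv / (4 * c3)) / \<rho>\<^sup>2"
text \<open>Coefficient of the part of the forcing that depends on \<zeta> along the ingoing
  segment; the weight will divide it by lam.\<close>

definition forcing_in where "forcing_in = B / (4 * c3 * \<rho>) + (rv_bound / \<rho> + rp * B / (4 * c3 * \<rho>)) / \<rho> ^ 3"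

text \<open>If |\<zeta>| \<le> \<sigma>, then \<phi> moves by at most \<sigma> rp along an ingoing
  segment. The conditions keep this within the range where V'' is bounded, let the bound on \<kappa>
  at most double, and let the bound on V grow from e2 / 2 to at most e2.\<close>

definition small_sigma where
  "small_sigma \<sigma> \<longleftrightarrow> 0 < \<sigma> \<and> \<sigma> * rp \<le> \<delta> \<and> \<sigma> * rp \<le> 1 \<and> (Cv * e3 + B * \<delta>) * (\<sigma> * rp) \<le> e2 / 2"

definition controlled where
  "controlled \<sigma> u v \<longleftrightarrow> \<bar>\<zeta> u v\<bar> \<le> \<sigma> \<and> \<kappa> u v \<le> c2 \<and> \<bar>\<phi> u v - \<phi> 0 v\<bar> \<le> \<delta> \<and>
     \<bar>deriv V (\<phi> u v)\<bar> \<le> Cv * e3 + B * \<delta> \<and> 4 * (r u v)\<^sup>2 * V (\<phi> u v) \<le> 1 \<and>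
     \<bar>r u v * pv r u v\<bar> \<le> rv_bound \<and> r u v * pv r u v \<le> r 0 v * pv r 0 v"

text \<open>Integrating the weight \<Lambda> against - pu r gains a factor 1/lam, so for large lam the nonlocal
  part of the forcing is absorbed by the damping.\<close>

lemma line_estimates:
  fixes lam \<beta> \<sigma> u v :: real
  defines "\<Lambda> \<equiv> \<lambda>s. exp (lam * ((r 0 v)\<^sup>2 - (r s v)\<^sup>2) / 2)"
  assumes uv: "(u,v) \<in> G" and v: "v0 + 1 \<le> v" and rho: "\<rho> \<le> r u v"
    and lam: "1 \<le> lam" and \<beta>: "0 \<le> \<beta>" and \<sigma>: "small_sigma \<sigma>" and \<beta>\<sigma>: "\<beta> * exp (lam * rp\<^sup>2 / 2) \<le> \<sigma>"
    and zeta: "\<And>s. 0 \<le> s \<Longrightarrow> s \<le> u \<Longrightarrow> \<bar>\<zeta> s v\<bar> \<le> \<beta> * \<Lambda> s"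
    and s: "0 \<le> s" "s \<le> u"
  shows "controlled \<sigma> s v"
    and "\<bar>deriv V (\<phi> s v) / (4 * \<kappa> s v) - pv \<phi> s v / r s v\<bar> \<le> forcing_out * \<bar>pv \<phi> 0 v\<bar> + forcing_in / lam * \<beta> * \<Lambda> s"
proof -
  have v0: "v0 \<le> v" using v by simp
  have sG: "(s,v) \<in> G" if "0 \<le> s" "s \<le> u" for s using past[OF uv that v0] by simp
  have rs: "\<rho> \<le> r s v" "r s v \<le> rp" "r s v \<le> r 0 v" if "0 \<le> s" "s \<le> u" for s
    using r_decreasing[OF uv that] r_le_rp[OF sG[OF that]] r_decreasing[OF sG[OF that], of 0] rho that by auto
  have rn: "pu r s v < 0" if "0 \<le> s" "s \<le> u" for s by (rule ru_neg[OF sG[OF that]])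
  have rd: "((\<lambda>s. r s v) has_real_derivative pu r s v) (at s)" if "0 \<le> s" "s \<le> u" for s
    by (rule C1_onD(1)[OF C1r sG[OF that]])
  have Ld: "(\<Lambda> has_real_derivative lam * r s v * (- pu r s v) * \<Lambda> s) (at s)" if "0 \<le> s" "s \<le> u" for s
    unfolding \<Lambda>_def by (auto intro!: derivative_eq_intros rd[OF that] simp: algebra_simps)
  have L1: "1 \<le> \<Lambda> s" "\<Lambda> s \<le> exp (lam * rp\<^sup>2 / 2)" if "0 \<le> s" "s \<le> u" for s
  proof -
    have "(r s v)\<^sup>2 \<le> (r 0 v)\<^sup>2" using rs[OF that] rho_pos by (intro power_mono) auto
    then show "1 \<le> \<Lambda> s" using lam by (simp add: \<Lambda>_def)
    have "(r 0 v)\<^sup>2 \<le> rp\<^sup>2" using r_out[OF v0] rho_le_out[OF v0] rho_pos by (intro power_mono) auto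
    then have "(r 0 v)\<^sup>2 - (r s v)\<^sup>2 \<le> rp\<^sup>2" using zero_le_power2[of "r s v"] by linarith
    then show "\<Lambda> s \<le> exp (lam * rp\<^sup>2 / 2)" using lam by (simp add: \<Lambda>_def mult_left_mono)
  qed
  have z\<sigma>: "\<bar>\<zeta> s v\<bar> \<le> \<sigma>" if "0 \<le> s" "s \<le> u" for s
  proof -
    have "\<bar>\<zeta> s v\<bar> \<le> \<beta> * exp (lam * rp\<^sup>2 / 2)"
      using zeta[OF that] mult_left_mono[OF L1(2)[OF that] \<beta>] by linarith
    then show ?thesis using \<beta>\<sigma> by simp
  qed
  have phu: "pu \<phi> s v = \<zeta> s v * pu r s v" if "0 \<le> s" "s \<le> u" for s
    using rn[OF that] by (simp add: \<zeta>_def)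
  have pd: "((\<lambda>s. \<phi> s v) has_real_derivative pu \<phi> s v) (at s)" if "0 \<le> s" "s \<le> u" for s
    by (rule C1_onD(1)[OF C1p sG[OF that]])
  have \<sigma>0: "0 < \<sigma>" "\<sigma> * rp \<le> \<delta>" "\<sigma> * rp \<le> 1" "(Cv * e3 + B * \<delta>) * (\<sigma> * rp) \<le> e2 / 2"
    using \<sigma> by (auto simp: small_sigma_def)
  have lr: "0 < lam * \<rho>" using lam rho_pos by simp
  \<comment> \<open>\<zeta> is the derivative of \<phi> with respect to r, so the bound is \<sigma>
    times the variation of r.\<close>
  have dphi1: "\<bar>\<phi> s v - \<phi> 0 v\<bar> \<le> \<sigma> * rp" if s: "0 \<le> s" "s \<le> u" for s
  proof -
    have "\<bar>\<phi> s v - \<phi> 0 v\<bar> \<le> (- \<sigma> * r s v) - (- \<sigma> * r 0 v)"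
    proof (rule deriv_bound[OF s(1)])
      fix x assume x: "0 \<le> x" "x \<le> s"
      then have x': "x \<le> u" using s by simp
      show "((\<lambda>s. \<phi> s v) has_real_derivative pu \<phi> x v) (at x)" by (rule pd[OF x(1) x'])
      show "((\<lambda>s. - \<sigma> * r s v) has_real_derivative - \<sigma> * pu r x v) (at x)"
        by (rule DERIV_cmult[OF rd[OF x(1) x']])
      show "\<bar>pu \<phi> x v\<bar> \<le> - \<sigma> * pu r x v"
        unfolding phu[OF x(1) x'] using mult_right_mono[OF z\<sigma>[OF x(1) x'], of "\<bar>pu r x v\<bar>"] rn[OF x(1) x'] by (simp add: abs_mult)
    qed
    also have "\<dots> = \<sigma> * (r 0 v - r s v)" by (simp add: algebra_simps)
    also have "\<dots> \<le> \<sigma> * rp" using rs[OF s] rho_pos r_out[OF v0] \<sigma>0 by (intro mult_left_mono) auto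
    finally show ?thesis .
  qed
  \<comment> \<open>Here the weight is integrated. \<Lambda> has derivative lam r (-
    \<open>pu r\<close>) \<Lambda> and r \<ge> \<rho>, so a multiple of \<Lambda> / (lam \<rho>) is
    a majorant. This is the source of the factor 1 / lam.\<close>
  have dphi2: "\<bar>\<phi> s v - \<phi> 0 v\<bar> \<le> \<beta> / (lam * \<rho>) * \<Lambda> s" if s: "0 \<le> s" "s \<le> u" for s
  proof -
    have "\<bar>\<phi> s v - \<phi> 0 v\<bar> \<le> \<beta> / (lam * \<rho>) * \<Lambda> s - \<beta> / (lam * \<rho>) * \<Lambda> 0"
    proof (rule deriv_bound[OF s(1)])
      fix x assume x: "0 \<le> x" "x \<le> s"
      then have x': "x \<le> u" using s by simp
      show "((\<lambda>s. \<phi> s v) has_real_derivative pu \<phi> x v) (at x)" by (rule pd[OF x(1) x'])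
      show "((\<lambda>s. \<beta> / (lam * \<rho>) * \<Lambda> s) has_real_derivative \<beta> / (lam * \<rho>) * (lam * r x v * (- pu r x v) * \<Lambda> x)) (at x)"
        by (rule DERIV_cmult[OF Ld[OF x(1) x']])
      have "\<bar>pu \<phi> x v\<bar> = \<bar>\<zeta> x v\<bar> * (- pu r x v)" unfolding phu[OF x(1) x'] using rn[OF x(1) x'] by (simp add: abs_mult)
      also have "\<dots> \<le> (\<beta> * \<Lambda> x) * (- pu r x v)"
        using zeta[OF x(1) x'] rn[OF x(1) x'] by (intro mult_right_mono) auto
      also have "\<dots> = \<beta> * \<Lambda> x * (- pu r x v) * 1" by simp
      also have "\<dots> \<le> \<beta> * \<Lambda> x * (- pu r x v) * (r x v / \<rho>)"
        using rs[OF x(1) x'] rho_pos rn[OF x(1) x'] \<beta>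
        by (intro mult_left_mono mult_nonneg_nonneg) (auto simp: \<Lambda>_def)
      also have "\<dots> = \<beta> / (lam * \<rho>) * (lam * r x v * (- pu r x v) * \<Lambda> x)" using lam by simp
      finally show "\<bar>pu \<phi> x v\<bar> \<le> \<beta> / (lam * \<rho>) * (lam * r x v * (- pu r x v) * \<Lambda> x)" .
    qed
    moreover have "0 \<le> \<beta> / (lam * \<rho>) * \<Lambda> 0" using \<beta> lr by (simp add: \<Lambda>_def)
    ultimately show ?thesis by linarith
  qed
  have V2b: "\<bar>deriv (deriv V) x\<bar> \<le> B" if "\<bar>x - \<phi> 0 v\<bar> \<le> \<delta>" for x by (rule V2_out[OF v that])
  have V1diff: "\<bar>deriv V x - deriv V (\<phi> 0 v)\<bar> \<le> B * \<bar>x - \<phi> 0 v\<bar>" if "\<bar>x - \<phi> 0 v\<bar> \<le> \<delta>" for x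
  proof -
    have "norm (deriv V x - deriv V (\<phi> 0 v)) \<le> B * norm (x - \<phi> 0 v)"
    proof (rule field_differentiable_bound[of "{\<phi> 0 v - \<delta>..\<phi> 0 v + \<delta>}"])
      show "(deriv V has_field_derivative deriv (deriv V) z) (at z within {\<phi> 0 v - \<delta>..\<phi> 0 v + \<delta>})" for z
        by (rule has_field_derivative_at_within[OF V2])
      show "norm (deriv (deriv V) z) \<le> B" if "z \<in> {\<phi> 0 v - \<delta>..\<phi> 0 v + \<delta>}" for z
        using V2b[of z] that by (auto simp: abs_le_iff)
    qed (use that pos in auto)
    then show ?thesis by simp
  qed
  have f0: "\<bar>pv \<phi> 0 v\<bar> \<le> e3" "\<bar>deriv V (\<phi> 0 v)\<bar> \<le> Cv * \<bar>pv \<phi> 0 v\<bar>" by (rule phi_out[OF v0])+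
  have V1b: "\<bar>deriv V x\<bar> \<le> Cv * e3 + B * \<delta>" if x: "\<bar>x - \<phi> 0 v\<bar> \<le> \<delta>" for x
  proof -
    have "Cv * \<bar>pv \<phi> 0 v\<bar> \<le> Cv * e3" using f0(1) pos by (intro mult_left_mono) auto
    moreover have "B * \<bar>x - \<phi> 0 v\<bar> \<le> B * \<delta>" using x pos by (intro mult_left_mono) auto
    ultimately show ?thesis using V1diff[OF x] f0(2) by linarith
  qed
  have Vb: "V (\<phi> s v) \<le> e2" if s: "0 \<le> s" "s \<le> u" for s
  proof -
    have d: "\<bar>\<phi> s v - \<phi> 0 v\<bar> \<le> \<delta>" using dphi1[OF s] \<sigma>0 by simp
    have "norm (V (\<phi> s v) - V (\<phi> 0 v)) \<le> (Cv * e3 + B * \<delta>) * norm (\<phi> s v - \<phi> 0 v)"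
    proof (rule field_differentiable_bound[of "{\<phi> 0 v - \<delta>..\<phi> 0 v + \<delta>}"])
      show "(V has_field_derivative deriv V z) (at z within {\<phi> 0 v - \<delta>..\<phi> 0 v + \<delta>})" for z
        by (rule has_field_derivative_at_within[OF V1])
      show "norm (deriv V z) \<le> Cv * e3 + B * \<delta>" if "z \<in> {\<phi> 0 v - \<delta>..\<phi> 0 v + \<delta>}" for z
        using V1b[of z] that by (auto simp: abs_le_iff)
    qed (use d pos in auto)
    also have "\<dots> \<le> (Cv * e3 + B * \<delta>) * (\<sigma> * rp)" using dphi1[OF s] pos by (intro mult_left_mono) auto
    finally show ?thesis using V_out[OF v0] \<sigma>0(4) by simp
  qed
  have rV: "0 \<le> 4 * (r s v)\<^sup>2 * V (\<phi> s v)" "4 * (r s v)\<^sup>2 * V (\<phi> s v) \<le> 1" if s: "0 \<le> s" "s \<le> u" for s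
  proof -
    show "0 \<le> 4 * (r s v)\<^sup>2 * V (\<phi> s v)" using V_nonneg by simp
    have "4 * (r s v)\<^sup>2 * V (\<phi> s v) \<le> 4 * rp\<^sup>2 * e2"
      using Vb[OF s] rs[OF s] rho_pos V_nonneg by (intro mult_mono power_mono) auto
    then show "4 * (r s v)\<^sup>2 * V (\<phi> s v) \<le> 1" using e2_small by simp
  qed
  \<comment> \<open>\<kappa> grows in u at the relative rate r (- \<open>pu r\<close>) \<zeta>^2, so
    exp (\<sigma>^2 r^2 / 2) compensates its growth; on the horizon this factor is at most exp (1/2)
    < 2.\<close>
  have kap: "\<kappa> s v \<le> c2" if s: "0 \<le> s" "s \<le> u" for s
  proof -
    have "\<kappa> s v * exp (\<sigma>\<^sup>2 * (r s v)\<^sup>2 / 2) \<le> \<kappa> 0 v * exp (\<sigma>\<^sup>2 * (r 0 v)\<^sup>2 / 2)"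
    proof (rule deriv_nonpos_mono[OF s(1)])
      fix x assume x: "0 \<le> x" "x \<le> s"
      then have x': "x \<le> u" using s by simp
      let ?e = "exp (\<sigma>\<^sup>2 * (r x v)\<^sup>2 / 2)"
      have "((\<lambda>s. exp (\<sigma>\<^sup>2 * (r s v)\<^sup>2 / 2)) has_real_derivative \<sigma>\<^sup>2 * r x v * pu r x v * ?e) (at x)"
        by (auto intro!: derivative_eq_intros rd[OF x(1) x'])
      from DERIV_mult[OF kappa_u[OF sG[OF x(1) x']] this]
      show "((\<lambda>s. \<kappa> s v * exp (\<sigma>\<^sup>2 * (r s v)\<^sup>2 / 2)) has_real_derivative
         r x v * (pu \<phi> x v)\<^sup>2 / (\<Omega> x v)\<^sup>2 * ?e + \<sigma>\<^sup>2 * r x v * pu r x v * ?e * \<kappa> x v) (at x)" .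
      have kp: "0 < \<kappa> x v" using kappa_ge[OF sG[OF x(1) x']] pos by simp
      have "r x v * (pu \<phi> x v)\<^sup>2 / (\<Omega> x v)\<^sup>2 = r x v * (- pu r x v) * \<kappa> x v * (\<zeta> x v)\<^sup>2"
        unfolding Om_kappa[OF sG[OF x(1) x']] phu[OF x(1) x'] using rn[OF x(1) x'] kp
        by (simp add: power2_eq_square)
      also have "\<dots> \<le> r x v * (- pu r x v) * \<kappa> x v * \<sigma>\<^sup>2"
        using z\<sigma>[OF x(1) x'] rn[OF x(1) x'] kp rs[OF x(1) x'] rho_pos
        by (intro mult_left_mono mult_nonneg_nonneg) (auto simp: abs_le_square_iff[symmetric])
      finally have "r x v * (pu \<phi> x v)\<^sup>2 / (\<Omega> x v)\<^sup>2 * ?e \<le> r x v * (- pu r x v) * \<kappa> x v * \<sigma>\<^sup>2 * ?e"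
        by (rule mult_right_mono) simp
      then show "r x v * (pu \<phi> x v)\<^sup>2 / (\<Omega> x v)\<^sup>2 * ?e + \<sigma>\<^sup>2 * r x v * pu r x v * ?e * \<kappa> x v \<le> 0"
        by (simp add: algebra_simps)
    qed
    also have "\<dots> \<le> (c2 / 2) * 2"
    proof (rule mult_mono)
      show "\<kappa> 0 v \<le> c2 / 2" using kappa_out(2)[OF v0] by (simp add: \<kappa>_def)
      have "\<sigma> * r 0 v \<le> \<sigma> * rp" using \<sigma>0 r_out[OF v0] by (intro mult_left_mono) auto
      then have "\<sigma> * r 0 v \<le> 1" using \<sigma>0(3) by linarith
      then have "(\<sigma> * r 0 v)\<^sup>2 \<le> 1\<^sup>2" using \<sigma>0 rho_le_out[OF v0] rho_pos by (intro power_mono) auto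
      then have le: "\<sigma>\<^sup>2 * (r 0 v)\<^sup>2 / 2 \<le> 1/2" by (simp add: power_mult_distrib)
      have "exp (\<sigma>\<^sup>2 * (r 0 v)\<^sup>2 / 2) \<le> exp (1/2)" using le by simp
      also have "\<dots> \<le> 1 + 1/2 + (1/2)\<^sup>2" by (rule exp_bound) auto
      finally show "exp (\<sigma>\<^sup>2 * (r 0 v)\<^sup>2 / 2) \<le> 2" by (simp add: power2_eq_square)
    qed (use pos in auto)
    finally have 1: "\<kappa> s v * exp (\<sigma>\<^sup>2 * (r s v)\<^sup>2 / 2) \<le> c2" by simp
    have "\<kappa> s v * 1 \<le> \<kappa> s v * exp (\<sigma>\<^sup>2 * (r s v)\<^sup>2 / 2)"
      using kappa_ge[OF sG[OF s]] pos by (intro mult_left_mono) auto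
    then show ?thesis using 1 by simp
  qed
  have kge: "c3 \<le> \<kappa> s v" if "0 \<le> s" "s \<le> u" for s by (rule kappa_ge[OF sG[OF that]])
  have Omb: "(\<Omega> s v)\<^sup>2 \<le> - pu r s v / c3" if s: "0 \<le> s" "s \<le> u" for s
    unfolding Om_kappa[OF sG[OF s]] using kge[OF s] rn[OF s] pos by (intro divide_left_mono) auto
  have rrv1: "r s v * pv r s v \<le> r 0 v * pv r 0 v" if s: "0 \<le> s" "s \<le> u" for s
  proof (rule deriv_nonpos_mono[OF s(1)])
    fix x assume x: "0 \<le> x" "x \<le> s"
    then have x': "x \<le> u" using s by simp
    show "((\<lambda>s. r s v * pv r s v) has_real_derivative - ((\<Omega> x v)\<^sup>2 / 4 * (1 - 2 * (r x v)\<^sup>2 * V (\<phi> x v)))) (at x)"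
      by (rule r_rv_u[OF sG[OF x(1) x']])
    show "- ((\<Omega> x v)\<^sup>2 / 4 * (1 - 2 * (r x v)\<^sup>2 * V (\<phi> x v))) \<le> 0" using rV[OF x(1) x'] by simp
  qed
  \<comment> \<open>Subtracting r / (4 c3) makes the quantity nondecreasing in u, because the square
    of \<Omega> is at most - \<open>pu r\<close> / c3.\<close>
  have rrv2: "- (rp / (4 * c3)) \<le> r s v * pv r s v" if s: "0 \<le> s" "s \<le> u" for s
  proof -
    have "r 0 v * pv r 0 v - r 0 v / (4 * c3) \<le> r s v * pv r s v - r s v / (4 * c3)"
    proof (rule deriv_nonneg_mono[OF s(1)])
      fix x assume x: "0 \<le> x" "x \<le> s"
      then have x': "x \<le> u" using s by simp
      show "((\<lambda>s. r s v * pv r s v - r s v / (4 * c3)) has_real_derivative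
          - ((\<Omega> x v)\<^sup>2 / 4 * (1 - 2 * (r x v)\<^sup>2 * V (\<phi> x v))) - pu r x v / (4 * c3)) (at x)"
        by (intro DERIV_diff r_rv_u[OF sG[OF x(1) x']] DERIV_cdivide rd[OF x(1) x'])
      have "(\<Omega> x v)\<^sup>2 / 4 * (1 - 2 * (r x v)\<^sup>2 * V (\<phi> x v)) \<le> (\<Omega> x v)\<^sup>2 / 4 * 1"
        using rV[OF x(1) x'] by (intro mult_left_mono) auto
      then show "0 \<le> - ((\<Omega> x v)\<^sup>2 / 4 * (1 - 2 * (r x v)\<^sup>2 * V (\<phi> x v))) - pu r x v / (4 * c3)"
        using Omb[OF x(1) x'] by simp
    qed
    moreover have "0 \<le> r 0 v * pv r 0 v" using pv_out(1)[OF v0] rho_le_out[OF v0] rho_pos by simp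
    moreover have "r 0 v / (4 * c3) \<le> rp / (4 * c3)" using r_out[OF v0] pos by (intro divide_right_mono) auto
    moreover have "0 \<le> r s v / (4 * c3)" using rs[OF s] rho_pos pos by simp
    ultimately show ?thesis by linarith
  qed
  have rrv: "\<bar>r s v * pv r s v\<bar> \<le> rv_bound" if s: "0 \<le> s" "s \<le> u" for s
  proof -
    have "r 0 v * pv r 0 v \<le> rp * e1" using r_out[OF v0] pv_out[OF v0] rho_le_out[OF v0] rho_pos rp_pos
      by (intro mult_mono) auto
    moreover have "0 \<le> rp * e1" "0 \<le> rp / (4 * c3)" using rp_pos pos by auto
    ultimately show ?thesis using rrv1[OF s] rrv2[OF s] unfolding rv_bound_def by linarith
  qed
  show "controlled \<sigma> s v"
    unfolding controlled_def using z\<sigma>[OF s] kap[OF s] dphi1[OF s] \<sigma>0(2) V1b[of "\<phi> s v"] rV(2)[OF s] rrv[OF s] rrv1[OF s]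
    by auto
  define f where "f = \<bar>pv \<phi> 0 v\<bar>"
  have V1s: "\<bar>deriv V (\<phi> s v)\<bar> \<le> Cv * f + B * \<beta> / (lam * \<rho>) * \<Lambda> s" if s: "0 \<le> s" "s \<le> u" for s
  proof -
    have "\<bar>deriv V (\<phi> s v) - deriv V (\<phi> 0 v)\<bar> \<le> B * (\<beta> / (lam * \<rho>) * \<Lambda> s)"
      using V1diff[of "\<phi> s v"] dphi1[OF s] \<sigma>0(2) mult_left_mono[OF dphi2[OF s], of B] pos by simp
    then show ?thesis using f0(2) by (simp add: f_def)
  qed
  define E where "E = rv_bound / \<rho> + rp * B / (4 * c3 * (lam * \<rho>))"
  have Rr0: "0 \<le> rv_bound" using rp_pos pos by (simp add: rv_bound_def)
  have E0: "0 \<le> E" unfolding E_def using Rr0 rho_pos rp_pos pos lr by simp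
  have phv: "\<bar>r s v * pv \<phi> s v\<bar> \<le> rp * f + rp\<^sup>2 * Cv / (4 * c3) * f + \<beta> / (lam * \<rho>) * E * \<Lambda> s" if s: "0 \<le> s" "s \<le> u" for s
  proof -
    \<comment> \<open>The majorant has two parts: a multiple of \<Lambda> for the terms that contain
      \<zeta>, and a multiple of - r for the term proportional to the horizon value f.\<close>
    have "\<bar>r s v * pv \<phi> s v - r 0 v * pv \<phi> 0 v\<bar> \<le>
        (\<beta> / (lam * \<rho>) * E * \<Lambda> s - rp * Cv * f / (4 * c3) * r s v) - (\<beta> / (lam * \<rho>) * E * \<Lambda> 0 - rp * Cv * f / (4 * c3) * r 0 v)"
    proof (rule deriv_bound[OF s(1)])
      fix x assume x: "0 \<le> x" "x \<le> s"
      then have x': "x \<le> u" using s by simp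
      note xu = x(1) x'
      show "((\<lambda>s. r s v * pv \<phi> s v) has_real_derivative - (pu \<phi> x v * pv r x v) - r x v * (\<Omega> x v)\<^sup>2 * deriv V (\<phi> x v) / 4) (at x)"
        by (rule r_phiv_u[OF sG[OF xu]])
      show "((\<lambda>s. \<beta> / (lam * \<rho>) * E * \<Lambda> s - rp * Cv * f / (4 * c3) * r s v) has_real_derivative
         \<beta> / (lam * \<rho>) * E * (lam * r x v * (- pu r x v) * \<Lambda> x) - rp * Cv * f / (4 * c3) * pu r x v) (at x)"
        by (intro DERIV_diff DERIV_cmult Ld[OF xu] rd[OF xu])
      define n where "n = - pu r x v"
      have n: "0 < n" "pu r x v = - n" using rn[OF xu] by (auto simp: n_def)
      have "\<rho> * \<bar>pv r x v\<bar> \<le> r x v * \<bar>pv r x v\<bar>" using rs[OF xu] by (intro mult_right_mono) auto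
      also have "\<dots> \<le> rv_bound" using rrv[OF xu] rs[OF xu] rho_pos by (simp add: abs_mult)
      finally have pvb: "\<bar>pv r x v\<bar> \<le> rv_bound / \<rho>" using rho_pos by (simp add: field_simps)
      have "\<bar>pu \<phi> x v * pv r x v\<bar> = \<bar>\<zeta> x v\<bar> * \<bar>pv r x v\<bar> * n" using n by (simp add: phu[OF xu] abs_mult)
      also have "\<dots> \<le> (\<beta> * \<Lambda> x) * (rv_bound / \<rho>) * n"
        using zeta[OF xu] pvb n \<beta> by (intro mult_right_mono mult_mono) (auto simp: \<Lambda>_def)
      finally have t1: "\<bar>pu \<phi> x v * pv r x v\<bar> \<le> \<beta> * \<Lambda> x * (rv_bound / \<rho>) * n" .
      have "\<bar>r x v * (\<Omega> x v)\<^sup>2 * deriv V (\<phi> x v) / 4\<bar> = r x v * (\<Omega> x v)\<^sup>2 * \<bar>deriv V (\<phi> x v)\<bar> / 4"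
        using rs[OF xu] rho_pos by (simp add: abs_mult)
      also have "\<dots> \<le> rp * (n / c3) * (Cv * f + B * \<beta> / (lam * \<rho>) * \<Lambda> x) / 4"
        using V1s[OF xu] Omb[OF xu] rs[OF xu] rho_pos rp_pos n pos
        by (intro divide_right_mono mult_mono) auto
      also have "\<dots> = rp * Cv * f / (4 * c3) * n + \<beta> * \<Lambda> x * (rp * B / (4 * c3 * (lam * \<rho>))) * n"
        using pos lr by (simp add: field_simps)
      finally have t2: "\<bar>r x v * (\<Omega> x v)\<^sup>2 * deriv V (\<phi> x v) / 4\<bar> \<le> rp * Cv * f / (4 * c3) * n + \<beta> * \<Lambda> x * (rp * B / (4 * c3 * (lam * \<rho>))) * n" .
      have "\<beta> * \<Lambda> x * E * n * 1 \<le> \<beta> * \<Lambda> x * E * n * (r x v / \<rho>)"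
        using rs[OF xu] rho_pos E0 \<beta> n by (intro mult_left_mono) (auto simp: \<Lambda>_def)
      also have "\<dots> = \<beta> / (lam * \<rho>) * E * (lam * r x v * n * \<Lambda> x)" using lam by simp
      finally have t3: "\<beta> * \<Lambda> x * E * n \<le> \<beta> / (lam * \<rho>) * E * (lam * r x v * n * \<Lambda> x)" by simp
      have t4: "\<beta> * \<Lambda> x * E * n = \<beta> * \<Lambda> x * (rv_bound / \<rho>) * n + \<beta> * \<Lambda> x * (rp * B / (4 * c3 * (lam * \<rho>))) * n"
        unfolding E_def by (simp add: distrib_left distrib_right)
      have "\<bar>- (pu \<phi> x v * pv r x v) - r x v * (\<Omega> x v)\<^sup>2 * deriv V (\<phi> x v) / 4\<bar>
          \<le> \<beta> / (lam * \<rho>) * E * (lam * r x v * n * \<Lambda> x) + rp * Cv * f / (4 * c3) * n"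
        using t1 t2 t3 t4 by linarith
      then show "\<bar>- (pu \<phi> x v * pv r x v) - r x v * (\<Omega> x v)\<^sup>2 * deriv V (\<phi> x v) / 4\<bar>
          \<le> \<beta> / (lam * \<rho>) * E * (lam * r x v * (- pu r x v) * \<Lambda> x) - rp * Cv * f / (4 * c3) * pu r x v"
        using n(2) by simp
    qed
    moreover have "0 \<le> \<beta> / (lam * \<rho>) * E * \<Lambda> 0" using \<beta> lr E0 by (simp add: \<Lambda>_def)
    moreover have "0 \<le> rp * Cv * f / (4 * c3) * r s v"
      using rs[OF s] rho_pos rp_pos pos by (simp add: f_def)
    moreover have "rp * Cv * f / (4 * c3) * r 0 v \<le> rp * Cv * f / (4 * c3) * rp"
      using r_out[OF v0] rp_pos pos by (intro mult_left_mono) (auto simp: f_def)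
    moreover have "rp * Cv * f / (4 * c3) * rp = rp\<^sup>2 * Cv / (4 * c3) * f" by (simp add: power2_eq_square)
    moreover have "\<bar>r 0 v * pv \<phi> 0 v\<bar> \<le> rp * f"
      using r_out[OF v0] rho_le_out[OF v0] rho_pos by (auto simp: abs_mult f_def intro!: mult_right_mono)
    ultimately show ?thesis by linarith
  qed
  have "\<bar>deriv V (\<phi> s v) / (4 * \<kappa> s v)\<bar> = \<bar>deriv V (\<phi> s v)\<bar> / (4 * \<kappa> s v)" using kge[OF s] pos by simp
  also have "\<dots> \<le> (Cv * f + B * \<beta> / (lam * \<rho>) * \<Lambda> s) / (4 * c3)"
    using V1s[OF s] kge[OF s] pos by (intro frac_le) auto
  finally have q1: "\<bar>deriv V (\<phi> s v) / (4 * \<kappa> s v)\<bar> \<le> (Cv * f + B * \<beta> / (lam * \<rho>) * \<Lambda> s) / (4 * c3)" .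
  \<comment> \<open>E with lam replaced by 1. Since lam \<ge> 1 it dominates E, so the coefficient
    \<open>forcing_in\<close> does not depend on lam and lam can be chosen afterwards.\<close>
  define E' where "E' = rv_bound / \<rho> + rp * B / (4 * c3 * \<rho>)"
  have EE: "E \<le> E'" unfolding E_def E'_def
    using lam rho_pos rp_pos pos by (intro add_left_mono divide_left_mono) (auto simp: mult_le_cancel_left_pos)
  have "\<bar>pv \<phi> s v / r s v\<bar> = \<bar>r s v * pv \<phi> s v\<bar> / (r s v)\<^sup>2"
    using rs[OF s] rho_pos by (simp add: abs_mult power2_eq_square)
  also have "\<dots> \<le> (rp * f + rp\<^sup>2 * Cv / (4 * c3) * f + \<beta> / (lam * \<rho>) * E * \<Lambda> s) / \<rho>\<^sup>2"
    using phv[OF s] rs[OF s] rho_pos by (intro frac_le power_mono) auto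
  also have "\<dots> \<le> (rp * f + rp\<^sup>2 * Cv / (4 * c3) * f + \<beta> / (lam * \<rho>) * E' * \<Lambda> s) / \<rho>\<^sup>2"
    using EE \<beta> lr by (intro divide_right_mono add_left_mono mult_right_mono mult_left_mono) (auto simp: \<Lambda>_def)
  finally have q2: "\<bar>pv \<phi> s v / r s v\<bar> \<le> (rp * f + rp\<^sup>2 * Cv / (4 * c3) * f + \<beta> / (lam * \<rho>) * E' * \<Lambda> s) / \<rho>\<^sup>2" .
  have "(Cv * f + B * \<beta> / (lam * \<rho>) * \<Lambda> s) / (4 * c3) + (rp * f + rp\<^sup>2 * Cv / (4 * c3) * f + \<beta> / (lam * \<rho>) * E' * \<Lambda> s) / \<rho>\<^sup>2
     = forcing_out * f + forcing_in / lam * \<beta> * \<Lambda> s"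
  proof -
    have "(Cv * f + B * \<beta> / (lam * \<rho>) * \<Lambda> s) / (4 * c3) = Cv / (4 * c3) * f + B / (4 * c3 * \<rho>) / lam * \<beta> * \<Lambda> s"
      by (simp add: add_divide_distrib)
    moreover have "(rp * f + rp\<^sup>2 * Cv / (4 * c3) * f + \<beta> / (lam * \<rho>) * E' * \<Lambda> s) / \<rho>\<^sup>2
        = (rp + rp\<^sup>2 * Cv / (4 * c3)) / \<rho>\<^sup>2 * f + E' / \<rho> ^ 3 / lam * \<beta> * \<Lambda> s"
      using rho_pos lam pos by (simp add: field_simps power2_eq_square power3_eq_cube)
    ultimately show ?thesis unfolding forcing_out_def forcing_in_def E'_def[symmetric]
      by (simp add: distrib_right add_divide_distrib)
  qed
  then show "\<bar>deriv V (\<phi> s v) / (4 * \<kappa> s v) - pv \<phi> s v / r s v\<bar> \<le> forcing_out * \<bar>pv \<phi> 0 v\<bar> + forcing_in / lam * \<beta> * \<Lambda> s"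
    using q1 q2 unfolding f_def by linarith
qed

end

section \<open>Decay along the horizon and the bootstrap\<close>

context horizon_data
begin

text \<open>The numerator of the damping coefficient is at least 1/2 when 4 r^2 V \<le> 1, and its
  denominator is at most 4 c2 rp.\<close>

definition damping_min where "damping_min = 1 / (8 * c2 * rp)"

lemma damping_min_pos: "0 < damping_min"
  using pos rp_pos by (simp add: damping_min_def)

definition damping where "damping u v = (1 - 2 * (r u v)\<^sup>2 * V (\<phi> u v)) / (4 * \<kappa> u v * r u v)"

lemma kappa_pos: "(u,v) \<in> G \<Longrightarrow> 0 < \<kappa> u v"
  using kappa_ge[of u v] pos by linarith

lemma damping_bounds:
  assumes uv: "(u,v) \<in> G" and c: "\<kappa> u v \<le> c2" "4 * (r u v)\<^sup>2 * V (\<phi> u v) \<le> 1"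
  shows "damping_min \<le> damping u v" and "\<rho> \<le> r u v \<Longrightarrow> damping u v \<le> 1 / (4 * c3 * \<rho>)"
proof -
  note p = kappa_pos[OF uv] r_pos[OF uv] kappa_ge[OF uv] r_le_rp[OF uv]
  have "4 * \<kappa> u v * r u v \<le> 4 * c2 * rp" using p c by (intro mult_mono) auto
  then have "(1/2) / (4 * c2 * rp) \<le> damping u v"
    unfolding damping_def using p c by (intro frac_le) auto
  then show "damping_min \<le> damping u v" by (simp add: damping_min_def)
  assume rho: "\<rho> \<le> r u v"
  have "4 * c3 * \<rho> \<le> 4 * \<kappa> u v * r u v" using p pos rho rho_pos by (intro mult_mono) auto
  moreover have "0 \<le> (r u v)\<^sup>2 * V (\<phi> u v)" using V_nonneg by simp
  ultimately show "damping u v \<le> 1 / (4 * c3 * \<rho>)"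
    unfolding damping_def using p c rho_pos pos by (intro frac_le) (auto simp: mult.commute)
qed

lemma out_bounds:
  assumes "v0 \<le> v"
  shows "\<kappa> 0 v \<le> c2" "4 * (r 0 v)\<^sup>2 * V (\<phi> 0 v) \<le> 1"
proof -
  show "\<kappa> 0 v \<le> c2" using kappa_out(2)[OF assms] pos(1) unfolding \<kappa>_def by linarith
  have "4 * (r 0 v)\<^sup>2 * V (\<phi> 0 v) \<le> 4 * rp\<^sup>2 * e2"
    using V_out[OF assms] r_out[OF assms] rho_le_out[OF assms] rho_pos V_nonneg pos
    by (intro mult_mono power_mono) auto
  then show "4 * (r 0 v)\<^sup>2 * V (\<phi> 0 v) \<le> 1" using e2_small by simp
qed

definition mass_rate where "mass_rate v = (r 0 v)\<^sup>2 * V (\<phi> 0 v) * pv r 0 v + 2 * (r 0 v)\<^sup>2 * \<kappa> 0 v * (pv \<phi> 0 v)\<^sup>2"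

text \<open>The mass flux dominates the square of \<open>pv \<phi>\<close>; the bounded mass can
  therefore pay for square-integrable forcing.\<close>

lemma mass_rate_ge:
  assumes v: "v0 \<le> v"
  shows "2 * \<rho>\<^sup>2 * c3 * (pv \<phi> 0 v)\<^sup>2 \<le> mass_rate v"
proof -
  have "2 * \<rho>\<^sup>2 * c3 * (pv \<phi> 0 v)\<^sup>2 \<le> 2 * (r 0 v)\<^sup>2 * \<kappa> 0 v * (pv \<phi> 0 v)\<^sup>2"
    using rho_le_out[OF v] rho_pos kappa_ge[OF Gout[OF v]] pos
    by (intro mult_right_mono mult_mono power_mono) auto
  moreover have "0 \<le> (r 0 v)\<^sup>2 * V (\<phi> 0 v) * pv r 0 v"
    using V_nonneg pv_out(1)[OF v] by simp
  ultimately show ?thesis unfolding mass_rate_def by linarith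
qed

lemma mass_out': "v0 \<le> v \<Longrightarrow> ((\<lambda>t. hawking_mass r \<Omega> 0 t) has_real_derivative mass_rate v) (at v)"
  unfolding mass_rate_def by (rule mass_out)

lemma young: "0 < a \<Longrightarrow> 2 * x * y \<le> a * x\<^sup>2 + y\<^sup>2 / (a::real)"
proof -
  assume a: "0 < a"
  have "0 \<le> (a * x - y)\<^sup>2 / a" using a by simp
  also have "\<dots> = a * x\<^sup>2 + y\<^sup>2 / a - 2 * x * y" using a by (simp add: power2_eq_square field_simps)
  finally show ?thesis by simp
qed

text \<open>If |\<zeta>| stayed above b1, damping would lower its square at a fixed rate, up to a
  forcing that Young's inequality charges to the mass flux. As the mass is bounded, the square would
  become negative. Only one late v is produced; staying small afterwards is left to the
  bootstrap.\<close>

lemma zeta_out_small: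
  assumes b1: "0 < b1" and V2: "v0 \<le> V2"
  shows "\<exists>v\<ge>V2. \<bar>\<zeta> 0 v\<bar> < b1"
proof (rule ccontr)
  assume "\<not> ?thesis"
  then have ge: "\<And>v. V2 \<le> v \<Longrightarrow> b1 \<le> \<bar>\<zeta> 0 v\<bar>" by (auto simp: not_less)
  define C3 where "C3 = Cv / (4 * c3) + 1 / \<rho>"
  \<comment> \<open>Young's inequality leaves F^2 / \<open>damping_min\<close>; F^2 is at most C3^2
    times the square of \<open>pv \<phi>\<close>, and the flux is at least 2 \<rho>^2 c3 times that
    square.\<close>
  define Kc where "Kc = C3\<^sup>2 / (damping_min * (2 * \<rho>\<^sup>2 * c3))"
  have C30: "0 \<le> C3" using pos rho_pos by (simp add: C3_def)
  have Kc0: "0 \<le> Kc" using pos rho_pos damping_min_pos by (simp add: Kc_def)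
  define h where "h v = (\<zeta> 0 v)\<^sup>2 - Kc * hawking_mass r \<Omega> 0 v + damping_min * b1\<^sup>2 * v" for v
  have hle: "h v \<le> h V2" if v: "V2 \<le> v" for v
  proof (rule deriv_nonpos_mono[OF v])
    fix t assume t: "V2 \<le> t" "t \<le> v"
    then have t0: "v0 \<le> t" using V2 by simp
    define F where "F = deriv V (\<phi> 0 t) / (4 * \<kappa> 0 t) - pv \<phi> 0 t / r 0 t"
    define z where "z = \<zeta> 0 t"
    have dz: "((\<lambda>t. \<zeta> 0 t) has_real_derivative - (z * damping 0 t) + F) (at t)"
      using zeta_v[OF Gout[OF t0]] unfolding F_def damping_def z_def .
    show "(h has_real_derivative 2 * z * (- (z * damping 0 t) + F) - Kc * mass_rate t + damping_min * b1\<^sup>2) (at t)"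
      unfolding h_def by (auto intro!: derivative_eq_intros dz mass_out'[OF t0] simp: z_def)
    have f: "\<bar>F\<bar> \<le> C3 * \<bar>pv \<phi> 0 t\<bar>"
    proof -
      have "\<bar>deriv V (\<phi> 0 t) / (4 * \<kappa> 0 t)\<bar> \<le> (Cv * \<bar>pv \<phi> 0 t\<bar>) / (4 * c3)"
        using phi_out(2)[OF t0] kappa_ge[OF Gout[OF t0]] pos by (auto simp: abs_divide intro!: frac_le)
      moreover have "\<bar>pv \<phi> 0 t / r 0 t\<bar> \<le> \<bar>pv \<phi> 0 t\<bar> / \<rho>"
        using rho_le_out[OF t0] rho_pos by (auto simp: abs_divide intro!: divide_left_mono)
      ultimately have "\<bar>F\<bar> \<le> (Cv * \<bar>pv \<phi> 0 t\<bar>) / (4 * c3) + \<bar>pv \<phi> 0 t\<bar> / \<rho>"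
        unfolding F_def by linarith
      then show ?thesis unfolding C3_def by (simp add: distrib_right)
    qed
    have "F\<^sup>2 \<le> (C3 * \<bar>pv \<phi> 0 t\<bar>)\<^sup>2" using f C30 by (simp add: abs_le_square_iff[symmetric] abs_mult)
    then have "F\<^sup>2 / damping_min \<le> C3\<^sup>2 * (pv \<phi> 0 t)\<^sup>2 / damping_min"
      using damping_min_pos by (intro divide_right_mono) (auto simp: power_mult_distrib)
    also have "\<dots> = Kc * (2 * \<rho>\<^sup>2 * c3 * (pv \<phi> 0 t)\<^sup>2)"
      using pos rho_pos damping_min_pos by (simp add: Kc_def)
    also have "\<dots> \<le> Kc * mass_rate t" by (rule mult_left_mono[OF mass_rate_ge[OF t0] Kc0])
    finally have 1: "F\<^sup>2 / damping_min \<le> Kc * mass_rate t" .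
    have "damping_min * z\<^sup>2 \<le> damping 0 t * z\<^sup>2"
      by (rule mult_right_mono[OF damping_bounds(1)[OF Gout[OF t0] out_bounds[OF t0]]]) simp
    moreover have "2 * z * F \<le> damping_min * z\<^sup>2 + F\<^sup>2 / damping_min" by (rule young[OF damping_min_pos])
    moreover have "damping_min * b1\<^sup>2 \<le> damping_min * z\<^sup>2"
      using ge[OF t(1)] b1 damping_min_pos by (intro mult_left_mono) (auto simp: z_def abs_le_square_iff[symmetric])
    moreover have "2 * z * (- (z * damping 0 t) + F) = 2 * z * F - 2 * (damping 0 t * z\<^sup>2)"
      by (simp add: algebra_simps power2_eq_square)
    ultimately show "2 * z * (- (z * damping 0 t) + F) - Kc * mass_rate t + damping_min * b1\<^sup>2 \<le> 0" using 1 by linarith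
  qed
  define v where "v = max V2 ((h V2 + Kc * mp + 1) / (damping_min * b1\<^sup>2))"
  have ab: "0 < damping_min * b1\<^sup>2" using damping_min_pos b1 by simp
  have v: "V2 \<le> v" "v0 \<le> v" using V2 by (auto simp: v_def)
  have "(h V2 + Kc * mp + 1) / (damping_min * b1\<^sup>2) \<le> v" by (simp add: v_def)
  then have "h V2 + Kc * mp + 1 \<le> v * (damping_min * b1\<^sup>2)" by (rule pos_divide_le_eq[OF ab, THEN iffD1])
  then have "h V2 + Kc * mp + 1 \<le> damping_min * b1\<^sup>2 * v" by (simp only: mult.commute)
  moreover have "damping_min * b1\<^sup>2 * v \<le> h v + Kc * hawking_mass r \<Omega> 0 v" by (simp add: h_def)
  moreover have "Kc * hawking_mass r \<Omega> 0 v \<le> Kc * mp" by (rule mult_left_mono[OF m_out(1)[OF v(2)] Kc0])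
  ultimately show False using hle[OF v(1)] by linarith
qed

lemma open_U_positive:
  assumes "open U" "continuous_on U (\<lambda>p. f (fst p) (snd p))"
  shows "open {p \<in> U. (0::real) < f (fst p) (snd p)}"
proof -
  have "{p \<in> U. (0::real) < f (fst p) (snd p)} = U \<inter> (\<lambda>p. f (fst p) (snd p)) -` {0<..}" by auto
  then show ?thesis using continuous_open_preimage[OF assms(2,1) open_greaterThan[of "0::real"]] by simp
qed

text \<open>The horizon segment from v0 to v1 is compact, so the open conditions that hold on it
  hold on a product neighbourhood. This fixes the width \<eta> used for all later v.\<close>

lemma initial_strip:
  assumes v1: "v0 \<le> v1" and z: "\<bar>\<zeta> 0 v1\<bar> < b1"
  obtains \<eta> where "0 < \<eta>" "\<eta> < u0"
    "\<And>u v. 0 \<le> u \<Longrightarrow> u \<le> \<eta> \<Longrightarrow> v0 \<le> v \<Longrightarrow> v \<le> v1 \<Longrightarrow> (u,v) \<in> G \<and> 0 < pv r u v"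
    "\<And>u. 0 \<le> u \<Longrightarrow> u \<le> \<eta> \<Longrightarrow> \<bar>\<zeta> u v1\<bar> < b1"
proof -
  obtain U where U: "open U" "G \<subseteq> U" "C2_on U r" "C2_on U \<phi>" using obtain_U by metis
  obtain O' where O: "open O'" "G = Kset u0 v0 \<inter> O'" using Gop unfolding openin_open by blast
  define W where "W = O' \<inter> {p \<in> U. 0 < pv r (fst p) (snd p)}"
  \<comment> \<open>The condition |\<zeta>| < b1 with its denominator cleared, so that it is open on
    U, where the sign of \<open>pu r\<close> is not known.\<close>
  define Z where "Z = {p \<in> U. 0 < b1 * (- pu r (fst p) (snd p)) - \<bar>pu \<phi> (fst p) (snd p)\<bar>}"
  have oW: "open W" unfolding W_def
    by (intro open_Int O open_U_positive U C1_onD(5)[OF C2_onD(1)[OF U(3)]])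
  have oZ: "open Z" unfolding Z_def
    by (rule open_U_positive[OF U(1), of "\<lambda>a b. b1 * (- pu r a b) - \<bar>pu \<phi> a b\<bar>"])
       (intro continuous_intros C1_onD(4)[OF C2_onD(1)[OF U(3)]] C1_onD(4)[OF C2_onD(1)[OF U(4)]])
  have sub: "{0} \<times> {v0..v1} \<subseteq> W" using Gout O(2) U(2) pv_out(1) by (auto simp: W_def)
  have o': "open (prod.swap -` W)" by (rule open_vimage[OF oW]) (auto intro!: continuous_intros)
  obtain X where X: "0 \<in> X" "open X" "\<And>u v. u \<in> X \<Longrightarrow> v0 \<le> v \<Longrightarrow> v \<le> v1 \<Longrightarrow> (u,v) \<in> W"
  proof (rule tube_lemma[of "{v0..v1}" 0 "({v0..v1} \<times> UNIV) \<inter> prod.swap -` W" "UNIV :: real set"])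
    show "openin (top_of_set ({v0..v1} \<times> UNIV)) (({v0..v1} \<times> UNIV) \<inter> prod.swap -` W)"
      by (rule openin_open_Int[OF o'])
    show "(\<lambda>x. (x, 0)) ` {v0..v1} \<subseteq> ({v0..v1} \<times> UNIV) \<inter> prod.swap -` W" using sub by auto
    fix T :: "real set" assume "openin (top_of_set UNIV) T" "0 \<in> T" "{v0..v1} \<times> T \<subseteq> {v0..v1} \<times> UNIV \<inter> prod.swap -` W"
    then have T: "0 \<in> T" "open T" "\<And>x. x \<in> {v0..v1} \<times> T \<Longrightarrow> prod.swap x \<in> W" by auto
    have "(u,v) \<in> W" if "u \<in> T" "v0 \<le> v" "v \<le> v1" for u v using T(3)[of "(v,u)"] that by simp
    then show thesis by (rule that[OF T(1,2)])
  qed (use v1 in auto)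
  have zeq: "(u,v1) \<in> Z \<longleftrightarrow> \<bar>\<zeta> u v1\<bar> < b1" if "(u,v1) \<in> G" for u
  proof -
    have "\<bar>\<zeta> u v1\<bar> = \<bar>pu \<phi> u v1\<bar> / (- pu r u v1)" using ru_neg[OF that] by (simp add: \<zeta>_def abs_divide)
    then have "\<bar>\<zeta> u v1\<bar> < b1 \<longleftrightarrow> \<bar>pu \<phi> u v1\<bar> < b1 * (- pu r u v1)"
      using ru_neg[OF that] by (simp only: pos_divide_less_eq[of "- pu r u v1"] neg_0_less_iff_less)
    then show ?thesis using U(2) that by (auto simp: Z_def)
  qed
  have "(0,v1) \<in> Z" using zeq[OF Gout[OF v1]] z by simp
  then have "0 \<in> X \<inter> {s. (s, v1) \<in> Z}" using X by simp
  moreover have "open (X \<inter> {s. (s, v1) \<in> Z})" by (intro open_Int X slice_open oZ)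
  ultimately obtain e where e: "e > 0" "cball 0 e \<subseteq> X \<inter> {s. (s, v1) \<in> Z}" by (meson open_contains_cball)
  define \<eta> where "\<eta> = min e (u0 / 2)"
  have \<eta>: "0 < \<eta>" "\<eta> < u0" "\<eta> \<le> e" using e u0_pos by (auto simp: \<eta>_def)
  have inX: "u \<in> X \<and> (u,v1) \<in> Z" if "0 \<le> u" "u \<le> \<eta>" for u
    using e(2) that \<eta> by (auto simp: subset_iff dist_real_def)
  have A: "(u,v) \<in> G \<and> 0 < pv r u v" if "0 \<le> u" "u \<le> \<eta>" "v0 \<le> v" "v \<le> v1" for u v
  proof -
    have "(u,v) \<in> W" using inX[OF that(1,2)] X(3)[of u v] that by auto
    then show ?thesis using O(2) that \<eta> by (auto simp: W_def Kset_def)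
  qed
  show thesis
    by (rule that[OF \<eta>(1,2) A]) (use inX zeq A v1 in \<open>auto\<close>)
qed

lemma continuous_G:
  assumes "S \<subseteq> G"
  shows "continuous_on S (\<lambda>p. r (fst p) (snd p))" "continuous_on S (\<lambda>p. \<zeta> (fst p) (snd p))"
    "continuous_on S (\<lambda>p. \<phi> (fst p) (snd p))"
proof -
  show "continuous_on S (\<lambda>p. r (fst p) (snd p))" "continuous_on S (\<lambda>p. \<phi> (fst p) (snd p))"
    by (rule continuous_on_subset[OF C1_onD(3)[OF C1r] assms] continuous_on_subset[OF C1_onD(3)[OF C1p] assms])+
  have "\<forall>p\<in>S. pu r (fst p) (snd p) \<noteq> 0" using ru_neg assms by (metis less_irrefl prod.collapse subsetD)
  then show "continuous_on S (\<lambda>p. \<zeta> (fst p) (snd p))" unfolding \<zeta>_def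
    by (intro continuous_intros continuous_on_subset[OF C1_onD(4)[OF C1r] assms] continuous_on_subset[OF C1_onD(4)[OF C1p] assms])
qed

text \<open>The threshold b for the weighted quotient rises with the mass. Its growth pays for the
  horizon part of the forcing, and as little mass is left after v1, it never exceeds twice its
  initial value. The nonlocal part is absorbed by the damping.\<close>

lemma bootstrap:
  assumes \<sigma>: "small_sigma \<sigma>"
  obtains v1 \<eta> where "v0 + 1 \<le> v1" "0 < \<eta>" "\<eta> < u0"
    "\<And>u v. 0 \<le> u \<Longrightarrow> u \<le> \<eta> \<Longrightarrow> v0 \<le> v \<Longrightarrow> v \<le> v1 \<Longrightarrow> (u,v) \<in> G \<and> 0 < pv r u v"
    "\<And>u v. 0 \<le> u \<Longrightarrow> u \<le> \<eta> \<Longrightarrow> v1 \<le> v \<Longrightarrow> (u,v) \<in> G \<Longrightarrow> (\<And>t. v1 \<le> t \<Longrightarrow> t \<le> v \<Longrightarrow> \<rho> \<le> r u t) \<Longrightarrow> controlled \<sigma> u v"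
proof -
  \<comment> \<open>Makes the nonlocal coefficient at most a quarter of the damping.\<close>
  define lam where "lam = max 1 (4 * forcing_in / damping_min)"
  have lam: "1 \<le> lam" by (simp add: lam_def)
  have D2lam: "forcing_in / lam \<le> damping_min / 4"
  proof -
    have "4 * forcing_in / damping_min \<le> lam" by (simp add: lam_def)
    then have "4 * forcing_in \<le> lam * damping_min" using damping_min_pos by (simp add: pos_divide_le_eq)
    then show ?thesis using lam by (simp add: pos_divide_le_eq mult.commute)
  qed
  \<comment> \<open>The weight is at most exp (lam rp^2 / 2) and the threshold at most 2 b1, so
    |\<zeta>| stays at most \<sigma>.\<close>
  define b1 where "b1 = \<sigma> / (2 * exp (lam * rp\<^sup>2 / 2))"
  have b1: "0 < b1" using \<sigma> by (simp add: b1_def small_sigma_def)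
  have D10: "0 \<le> forcing_out" unfolding forcing_out_def using pos rho_pos rp_pos by simp
  define Kc where "Kc = forcing_out\<^sup>2 / (damping_min * b1 * (2 * \<rho>\<^sup>2 * c3))"
  have Kc0: "0 \<le> Kc" using pos rho_pos damping_min_pos b1 by (simp add: Kc_def)
  define ms where "ms v = hawking_mass r \<Omega> 0 v" for v
  have mmono: "ms v \<le> ms v'" if "v0 \<le> v" "v \<le> v'" for v v'
  proof (rule deriv_nonneg_mono[OF that(2)])
    fix t assume "v \<le> t" "t \<le> v'"
    then have t: "v0 \<le> t" using that by simp
    show "(ms has_real_derivative mass_rate t) (at t)" unfolding ms_def by (rule mass_out'[OF t])
    show "0 \<le> mass_rate t" using mass_rate_ge[OF t] rho_pos pos by (smt (verit) mult_nonneg_nonneg zero_le_power2)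
  qed
  \<comment> \<open>From V2 on, the mass still to come, multiplied by Kc, is at most b1.\<close>
  obtain V2 where V2: "v0 \<le> V2" "Kc * (mp - ms V2) \<le> b1"
  proof -
    obtain v where v: "v0 \<le> v" "mp - b1 / (Kc + 1) < ms v" using m_out(2)[of "b1 / (Kc + 1)"] b1 Kc0 by (auto simp: ms_def)
    have "Kc * (mp - ms v) \<le> Kc * (b1 / (Kc + 1))" using v(2) Kc0 by (intro mult_left_mono) auto
    also have "\<dots> \<le> b1" using Kc0 b1 by (simp add: field_simps)
    finally show thesis using that v(1) by blast
  qed
  obtain v1 where v1: "max V2 (v0 + 1) \<le> v1" "\<bar>\<zeta> 0 v1\<bar> < b1"
    using zeta_out_small[OF b1, of "max V2 (v0 + 1)"] V2(1) by (auto simp: le_max_iff_disj)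
  have v1': "v0 \<le> v1" "v0 + 1 \<le> v1" "V2 \<le> v1" using v1 by auto
  have Km: "Kc * (mp - ms v1) \<le> b1"
    using mult_left_mono[OF mmono[OF V2(1) v1'(3)] Kc0] V2(2) by (simp add: algebra_simps)
  obtain \<eta> where \<eta>: "0 < \<eta>" "\<eta> < u0"
    "\<And>u v. 0 \<le> u \<Longrightarrow> u \<le> \<eta> \<Longrightarrow> v0 \<le> v \<Longrightarrow> v \<le> v1 \<Longrightarrow> (u,v) \<in> G \<and> 0 < pv r u v"
    "\<And>u. 0 \<le> u \<Longrightarrow> u \<le> \<eta> \<Longrightarrow> \<bar>\<zeta> u v1\<bar> < b1"
    by (rule initial_strip[OF v1'(1) v1(2)], rule that)
  define b where "b t = b1 + Kc * (ms t - ms v1)" for t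
  have b_ge: "b1 \<le> b t" if "v1 \<le> t" for t
    using mmono[OF v1'(1) that] Kc0 by (simp add: b_def)
  have b_le: "b t * exp (lam * rp\<^sup>2 / 2) \<le> \<sigma>" if "v1 \<le> t" for t
  proof -
    have "ms t \<le> mp" using m_out(1)[of t] v1' that by (simp add: ms_def)
    then have "Kc * (ms t - ms v1) \<le> Kc * (mp - ms v1)" using Kc0 by (intro mult_left_mono) auto
    then have "b t \<le> 2 * b1" using Km by (simp add: b_def)
    then have "b t * exp (lam * rp\<^sup>2 / 2) \<le> 2 * b1 * exp (lam * rp\<^sup>2 / 2)" by (intro mult_right_mono) auto
    then show ?thesis by (simp add: b1_def)
  qed
  have main: "controlled \<sigma> u v"
    if u: "0 \<le> u" "u \<le> \<eta>" and v: "v1 \<le> v" and uv: "(u,v) \<in> G" and rho: "\<And>t. v1 \<le> t \<Longrightarrow> t \<le> v \<Longrightarrow> \<rho> \<le> r u t" for u v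
  proof -
    let ?R = "{0..u} \<times> {v1..v}"
    have RG: "(s,t) \<in> G" if "0 \<le> s" "s \<le> u" "v1 \<le> t" "t \<le> v" for s t using past[OF uv] that v1' by auto
    have RGs: "?R \<subseteq> G" using RG by auto
    define \<Lambda> where "\<Lambda> s t = exp (lam * ((r 0 t)\<^sup>2 - (r s t)\<^sup>2) / 2)" for s t
    define y where "y s t = \<zeta> s t * exp (- (lam * ((r 0 t)\<^sup>2 - (r s t)\<^sup>2) / 2))" for s t
    have zy: "\<zeta> s t = y s t * \<Lambda> s t" for s t by (simp add: y_def \<Lambda>_def mult.assoc exp_minus)
    have r0c: "continuous_on ?R (\<lambda>p. r 0 (snd p))"
      by (rule continuous_on_compose2[OF continuous_G(1)[OF subset_refl], where f = "\<lambda>p. (0, snd p)", simplified])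
         (use Gout v1' in \<open>auto intro!: continuous_intros\<close>)
    have yc: "continuous_on ?R (\<lambda>p. y (fst p) (snd p))"
      unfolding y_def by (intro continuous_intros continuous_G[OF RGs] r0c) auto
    have msd: "(ms has_real_derivative mass_rate t) (at t)" if "v1 \<le> t" for t
      unfolding ms_def using mass_out' v1' that by auto
    have bd: "(b has_real_derivative Kc * mass_rate t) (at t)" if "v1 \<le> t" for t
      unfolding b_def by (auto intro!: derivative_eq_intros msd[OF that])
    have bc1: "continuous_on {v1..v} b"
      by (rule DERIV_continuous_on[OF has_field_derivative_at_within[OF bd]]) simp
    have bc: "continuous_on ?R (\<lambda>p. b (snd p))"
      by (rule continuous_on_compose2[OF bc1]) (auto intro!: continuous_intros)
    have yzeta: "\<bar>y s t\<bar> \<le> \<bar>\<zeta> s t\<bar>" if "0 \<le> s" "s \<le> u" "v1 \<le> t" "t \<le> v" for s t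
    proof -
      have "r s t \<le> r 0 t" "0 < r s t" using r_decreasing[OF RG[OF that], of 0] r_pos[OF RG[OF that]] that by auto
      then have "(r s t)\<^sup>2 \<le> (r 0 t)\<^sup>2" by (intro power_mono) auto
      then have "exp (- (lam * ((r 0 t)\<^sup>2 - (r s t)\<^sup>2) / 2)) \<le> 1" using lam by simp
      then have "\<bar>\<zeta> s t\<bar> * exp (- (lam * ((r 0 t)\<^sup>2 - (r s t)\<^sup>2) / 2)) \<le> \<bar>\<zeta> s t\<bar> * 1" by (intro mult_left_mono) auto
      then show ?thesis by (simp add: y_def abs_mult)
    qed
    have line: "controlled \<sigma> s t \<and> \<bar>deriv V (\<phi> s t) / (4 * \<kappa> s t) - pv \<phi> s t / r s t\<bar> \<le> forcing_out * \<bar>pv \<phi> 0 t\<bar> + forcing_in / lam * b t * \<Lambda> s t"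
      if t: "v1 \<le> t" "t \<le> v" and yb: "\<And>s. 0 \<le> s \<Longrightarrow> s \<le> u \<Longrightarrow> \<bar>y s t\<bar> \<le> b t" and s: "0 \<le> s" "s \<le> u" for s t
    proof -
      have ut: "(u,t) \<in> G" using RG[of u t] u t by simp
      have b0: "0 \<le> b t" using b_ge[OF t(1)] b1 by linarith
      have z: "\<bar>\<zeta> s t\<bar> \<le> b t * exp (lam * ((r 0 t)\<^sup>2 - (r s t)\<^sup>2) / 2)" if "0 \<le> s" "s \<le> u" for s
        using mult_right_mono[OF yb[OF that], of "\<Lambda> s t"] by (simp add: zy abs_mult \<Lambda>_def)
      have t1: "v0 + 1 \<le> t" using v1' t by simp
      note le = line_estimates[OF ut t1 rho[OF t] lam b0 \<sigma> b_le[OF t(1)] z s]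
      then show ?thesis unfolding \<Lambda>_def by blast
    qed
    have small: "\<bar>y s t\<bar> < b t" if st: "0 \<le> s" "s \<le> u" "v1 \<le> t" "t \<le> v" for s t
    proof (rule ccontr)
      assume neg: "\<not> \<bar>y s t\<bar> < b t"
      \<comment> \<open>Failure is examined over the whole ingoing range at once. The estimate at
        one point needs the bound along the segment back to the horizon, so the earliest time is
        taken among all values of s.\<close>
      define Bad where "Bad = {p \<in> ?R. b (snd p) \<le> \<bar>y (fst p) (snd p)\<bar>}"
      have Bad_eq: "Bad = ?R \<inter> (\<lambda>p. \<bar>y (fst p) (snd p)\<bar> - b (snd p)) -` {0..}" by (auto simp: Bad_def)
      have "closed Bad" unfolding Bad_eq
        by (intro continuous_closed_preimage continuous_intros bc yc closed_Times)
      moreover have "bounded Bad"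
        by (rule bounded_subset[OF compact_imp_bounded[of ?R]]) (auto simp: Bad_def intro!: compact_Times)
      ultimately have "compact Bad" by (simp add: compact_eq_bounded_closed)
      moreover have "(s,t) \<in> Bad" using neg st by (simp add: Bad_def)
      then have "Bad \<noteq> {}" by blast
      ultimately obtain p where p: "p \<in> Bad" "\<And>q. q \<in> Bad \<Longrightarrow> snd p \<le> snd q"
        using continuous_attains_inf[of Bad snd] continuous_on_snd[OF continuous_on_id] by blast
      obtain s1 t1 where st1: "p = (s1,t1)" by (cases p)
      have s1: "0 \<le> s1" "s1 \<le> u" and t1: "v1 \<le> t1" "t1 \<le> v" and bad: "b t1 \<le> \<bar>y s1 t1\<bar>"
        using p(1) by (auto simp: Bad_def st1)
      have before: "\<bar>y s t\<bar> < b t" if "0 \<le> s" "s \<le> u" "v1 \<le> t" "t < t1" for s t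
        using p(2)[of "(s,t)"] that t1 by (force simp: Bad_def st1)
      have t1gt: "v1 < t1"
      proof (rule ccontr)
        assume "\<not> v1 < t1"
        then have "t1 = v1" using t1 by simp
        then have "\<bar>y s1 t1\<bar> < b1" using yzeta[OF s1 t1] \<eta>(4)[of s1] s1 u by simp
        then show False using bad b_ge[OF t1(1)] by simp
      qed
      \<comment> \<open>Before t1 the bound is strict for every s; the limit gives the nonstrict
        bound at t1, which is what the estimates along the ingoing line require.\<close>
      have at: "\<bar>y s t1\<bar> \<le> b t1" if s: "0 \<le> s" "s \<le> u" for s
      proof -
        have cl: "closure {v1..<t1} = {v1..t1}" using t1gt by simp
        have "continuous_on {v1..t1} (\<lambda>t. b t - \<bar>y s t\<bar>)"
        proof (intro continuous_intros)
          show "continuous_on {v1..t1} b" by (rule continuous_on_subset[OF bc1]) (use t1 in auto)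
          have "continuous_on {v1..t1} ((\<lambda>p. y (fst p) (snd p)) \<circ> (\<lambda>t. (s, t)))"
            by (intro continuous_on_compose continuous_intros continuous_on_subset[OF yc]) (use s t1 in auto)
          then show "continuous_on {v1..t1} (y s)" by (simp add: o_def)
        qed
        then have "0 \<le> b t1 - \<bar>y s t1\<bar>"
          using continuous_ge_on_closure[of "{v1..<t1}" "\<lambda>t. b t - \<bar>y s t\<bar>" t1 0] before[OF s] t1gt
          unfolding cl by (simp add: less_imp_le)
        then show ?thesis by simp
      qed
      have eq: "\<bar>y s1 t1\<bar> = b t1" using at[OF s1] bad by simp
      define sg where "sg = sgn (y s1 t1)"
      have sgy: "sg * y s1 t1 = b t1" using eq by (simp add: sg_def sgn_mult_self_eq abs_sgn mult.commute)
      have sgle: "sg * y s1 t \<le> \<bar>y s1 t\<bar>" for t by (auto simp: sg_def sgn_if abs_if)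
      have sgF: "sg * x \<le> \<bar>x\<bar>" for x by (auto simp: sg_def sgn_if abs_if)
      note G1 = RG[OF s1 t1]
      have G0: "(0,t1) \<in> G" using Gout v1' t1 by simp
      have t10: "v0 \<le> t1" using v1' t1 by simp
      define F where "F = deriv V (\<phi> s1 t1) / (4 * \<kappa> s1 t1) - pv \<phi> s1 t1 / r s1 t1"
      define wt where "wt = exp (- (lam * ((r 0 t1)\<^sup>2 - (r s1 t1)\<^sup>2) / 2))"
      define d where "d = lam * (r 0 t1 * pv r 0 t1 - r s1 t1 * pv r s1 t1)"
      have wt: "0 < wt" "wt * \<Lambda> s1 t1 = 1" "wt \<le> 1"
      proof -
        show "0 < wt" by (simp add: wt_def)
        show "wt * \<Lambda> s1 t1 = 1" by (simp add: wt_def \<Lambda>_def exp_minus)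
        have "(r s1 t1)\<^sup>2 \<le> (r 0 t1)\<^sup>2" using r_decreasing[OF G1, of 0] r_pos[OF G1] s1 by (intro power_mono) auto
        then show "wt \<le> 1" using lam by (simp add: wt_def)
      qed
      have dz: "((\<lambda>t. \<zeta> s1 t) has_real_derivative - (\<zeta> s1 t1 * damping s1 t1) + F) (at t1)"
        using zeta_v[OF G1] unfolding F_def damping_def .
      have dw: "((\<lambda>t. exp (- (lam * ((r 0 t)\<^sup>2 - (r s1 t)\<^sup>2) / 2))) has_real_derivative - d * wt) (at t1)"
        unfolding d_def wt_def
        by (auto intro!: derivative_eq_intros C1_onD(2)[OF C1r G1] C1_onD(2)[OF C1r G0] simp: field_simps)
      have dy: "((\<lambda>t. y s1 t) has_real_derivative (- (\<zeta> s1 t1 * damping s1 t1) + F) * wt + (- d * wt) * \<zeta> s1 t1) (at t1)"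
        unfolding y_def using DERIV_mult[OF dz dw] by (simp add: wt_def)
      have y1: "y s1 t1 = \<zeta> s1 t1 * wt" by (simp add: y_def wt_def)
      define Y where "Y = sg * ((- (\<zeta> s1 t1 * damping s1 t1) + F) * wt + (- d * wt) * \<zeta> s1 t1)"
      have dg: "((\<lambda>t. b t - sg * y s1 t) has_real_derivative Kc * mass_rate t1 - Y) (at t1)"
        unfolding Y_def by (intro DERIV_diff bd[OF t1(1)] DERIV_cmult dy)
      have L: "controlled \<sigma> s1 t1" "\<bar>F\<bar> \<le> forcing_out * \<bar>pv \<phi> 0 t1\<bar> + forcing_in / lam * b t1 * \<Lambda> s1 t1"
        using line[OF t1 at s1] by (auto simp: F_def)
      have bpos: "0 < b t1" using b_ge[OF t1(1)] b1 by linarith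
      have Yeq: "Y = - damping s1 t1 * b t1 + wt * (sg * F) - d * b t1"
        unfolding Y_def sgy[symmetric] y1 by (simp add: algebra_simps)
      have "damping_min \<le> damping s1 t1" using damping_bounds(1)[OF G1] L(1) by (auto simp: controlled_def)
      then have Y1: "damping_min * b t1 \<le> damping s1 t1 * b t1" using bpos by (intro mult_right_mono) auto
      have "0 \<le> d" unfolding d_def using L(1) lam by (auto simp: controlled_def)
      then have Y2: "0 \<le> d * b t1" using bpos by simp
      have "wt * (sg * F) \<le> wt * \<bar>F\<bar>" using sgF wt by (intro mult_left_mono) auto
      also have "\<dots> \<le> wt * (forcing_out * \<bar>pv \<phi> 0 t1\<bar> + forcing_in / lam * b t1 * \<Lambda> s1 t1)" using L(2) wt by (intro mult_left_mono) auto
      also have "\<dots> = wt * (forcing_out * \<bar>pv \<phi> 0 t1\<bar>) + forcing_in / lam * b t1 * (wt * \<Lambda> s1 t1)" by (simp add: algebra_simps)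
      also have "\<dots> = wt * (forcing_out * \<bar>pv \<phi> 0 t1\<bar>) + forcing_in / lam * b t1" by (simp add: wt)
      also have "\<dots> \<le> 1 * (forcing_out * \<bar>pv \<phi> 0 t1\<bar>) + damping_min / 4 * b t1"
        using wt D10 D2lam bpos by (intro add_mono mult_right_mono) auto
      finally have Y3: "wt * (sg * F) \<le> forcing_out * \<bar>pv \<phi> 0 t1\<bar> + damping_min / 4 * b t1" by simp
      \<comment> \<open>Young's inequality scaled by \<open>damping_min\<close> b1: a quarter of the
        damping at level b1 is spent, and the quadratic remainder is covered by the growth of
        b.\<close>
      have "forcing_out * \<bar>pv \<phi> 0 t1\<bar> \<le> damping_min * b1 / 4 + Kc * mass_rate t1"
      proof -
        define x where "x = forcing_out * \<bar>pv \<phi> 0 t1\<bar>"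
        have ab: "0 < damping_min * b1" using damping_min_pos b1 by simp
        have "2 * (1/2) * x \<le> (damping_min * b1) * (1/2)\<^sup>2 + x\<^sup>2 / (damping_min * b1)" by (rule young[OF ab])
        moreover have "x\<^sup>2 / (damping_min * b1) = Kc * (2 * \<rho>\<^sup>2 * c3 * (pv \<phi> 0 t1)\<^sup>2)"
          using rho_pos pos ab by (simp add: x_def Kc_def power_mult_distrib)
        moreover have "Kc * (2 * \<rho>\<^sup>2 * c3 * (pv \<phi> 0 t1)\<^sup>2) \<le> Kc * mass_rate t1" by (rule mult_left_mono[OF mass_rate_ge[OF t10] Kc0])
        ultimately show ?thesis by (simp add: x_def power2_eq_square)
      qed
      moreover have "damping_min * b1 / 4 \<le> damping_min / 4 * b t1" using b_ge[OF t1(1)] damping_min_pos by simp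
      ultimately have "wt * (sg * F) \<le> damping_min / 2 * b t1 + Kc * mass_rate t1" using Y3 by linarith
      moreover have "damping_min / 2 * b t1 < damping_min * b t1" using damping_min_pos bpos by simp
      ultimately have "0 < Kc * mass_rate t1 - Y" using Y1 Y2 unfolding Yeq by linarith
      \<comment> \<open>At t1 the difference between threshold and signed quotient vanishes with
        positive derivative, so it was negative shortly before, against the choice of t1.\<close>
      from DERIV_pos_inc_left[OF dg this] obtain e where e: "0 < e"
        "\<And>h. 0 < h \<Longrightarrow> h < e \<Longrightarrow> b (t1 - h) - sg * y s1 (t1 - h) < b t1 - sg * y s1 t1" by blast
      define h where "h = min (e / 2) (t1 - v1)"
      have h: "0 < h" "h < e" "v1 \<le> t1 - h" using e t1gt by (auto simp: h_def)
      have "b (t1 - h) - sg * y s1 (t1 - h) < 0" using e(2)[OF h(1,2)] sgy by simp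
      moreover have "\<bar>y s1 (t1 - h)\<bar> < b (t1 - h)" by (rule before[OF s1 h(3)]) (use h in simp)
      ultimately show False using sgle[of "t1 - h"] by linarith
    qed
    have "\<bar>y s v\<bar> \<le> b v" if "0 \<le> s" "s \<le> u" for s using small[OF that v] by simp
    from line[OF v order_refl this u(1) order_refl] show ?thesis by blast
  qed
  show thesis by (rule that[OF v1'(2) \<eta>(1,2) \<eta>(3) main])
qed

end

section \<open>The marginally trapped tube\<close>

lemma first_exit:
  fixes f :: "real \<Rightarrow> 'a::topological_space"
  assumes "open W" "continuous_on {a..b} f" "a \<le> b" "f a \<in> W" "f b \<notin> W"
  obtains c where "a < c" "c \<le> b" "f c \<notin> W" "\<And>x. a \<le> x \<Longrightarrow> x < c \<Longrightarrow> f x \<in> W"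
proof -
  define C where "C = {a..b} \<inter> f -` (- W)"
  have "closed C" unfolding C_def by (rule continuous_closed_preimage[OF assms(2)]) (use assms(1) in auto)
  moreover have "bounded C" by (rule bounded_subset[of "{a..b}"]) (auto simp: C_def)
  ultimately have "compact C" by (simp add: compact_eq_bounded_closed)
  moreover have "b \<in> C" using assms by (simp add: C_def)
  then have "C \<noteq> {}" by blast
  ultimately obtain c where c: "c \<in> C" "\<And>x. x \<in> C \<Longrightarrow> c \<le> x"
    using continuous_attains_inf[of C "\<lambda>x. x"] continuous_on_id by blast
  show thesis
  proof (rule that[of c])
    show "a < c" using c(1) assms(4) by (cases "a = c") (auto simp: C_def)
    show "c \<le> b" "f c \<notin> W" using c(1) by (auto simp: C_def)
    show "f x \<in> W" if "a \<le> x" "x < c" for x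
      using c(2)[of x] that c(1) by (force simp: C_def)
  qed
qed

lemma limit_ge:
  fixes f :: "real \<Rightarrow> real"
  assumes "a < b" "continuous_on {a..b} f" "\<And>x. a \<le> x \<Longrightarrow> x < b \<Longrightarrow> c \<le> f x"
  shows "c \<le> f b"
  using continuous_ge_on_closure[of "{a..<b}" f b c] assms by simp

locale controlled_strip = horizon_data +
  fixes \<sigma> v1 \<eta> :: real
  assumes strip_params: "v0 + 1 \<le> v1" "0 < \<eta>" "\<eta> < u0" "0 < \<sigma>"
    and strip: "\<And>u v. 0 \<le> u \<Longrightarrow> u \<le> \<eta> \<Longrightarrow> v0 \<le> v \<Longrightarrow> v \<le> v1 \<Longrightarrow> (u,v) \<in> G \<and> 0 < pv r u v"
    and ctrl: "\<And>u v. 0 \<le> u \<Longrightarrow> u \<le> \<eta> \<Longrightarrow> v1 \<le> v \<Longrightarrow> (u,v) \<in> G \<Longrightarrow> (\<And>t. v1 \<le> t \<Longrightarrow> t \<le> v \<Longrightarrow> \<rho> \<le> r u t) \<Longrightarrow> controlled \<sigma> u v"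
begin

text \<open>Stated through r rather than the sign of \<open>pv r\<close>: a lower bound for r passes
  to all smaller u because r decreases in u, and it is the hypothesis under which the bootstrap
  gives control.\<close>

definition regular where
  "regular u v \<longleftrightarrow> 0 \<le> u \<and> u \<le> \<eta> \<and> v1 \<le> v \<and> (u,v) \<in> G \<and> (\<forall>t. v1 \<le> t \<longrightarrow> t \<le> v \<longrightarrow> \<rho> \<le> r u t)"

lemma regularD:
  assumes "regular u v" "0 \<le> s" "s \<le> u" "v1 \<le> t" "t \<le> v"
  shows "(s,t) \<in> G" "\<rho> \<le> r s t" "controlled \<sigma> s t"
proof -
  have G: "(s,t) \<in> G" if "0 \<le> s" "s \<le> u" "v1 \<le> t" "t \<le> v" for s t
    using past[of u v s t] assms(1) that strip_params by (auto simp: regular_def)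
  show "(s,t) \<in> G" by (rule G) fact+
  have rho: "\<rho> \<le> r s t" if st: "0 \<le> s" "s \<le> u" "v1 \<le> t" "t \<le> v" for s t
  proof -
    have "\<rho> \<le> r u t" using assms(1) st by (auto simp: regular_def)
    also have "\<dots> \<le> r s t" by (rule r_decreasing[OF G]) (use st assms(1) in \<open>auto simp: regular_def\<close>)
    finally show ?thesis .
  qed
  show "\<rho> \<le> r s t" by (rule rho) fact+
  show "controlled \<sigma> s t"
    by (rule ctrl[OF _ _ _ G rho]) (use assms in \<open>auto simp: regular_def\<close>)
qed

lemma regularI:
  assumes "(u,v) \<in> G" "u \<le> \<eta>" "v1 \<le> v" "0 \<le> pv r u v"
  shows "regular u v"
proof -
  have "\<rho> \<le> r u t" if t: "v1 \<le> t" "t \<le> v" for t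
  proof (rule rho_le)
    have v0t: "v0 \<le> t" using t strip_params by simp
    show "(u,t) \<in> G" using past[OF assms(1)] G_ge(1)[OF assms(1)] v0t t by simp
    show "0 \<le> pv r u t" by (rule rv_past(1)[OF assms(1) v0t t(2) assms(4)])
  qed
  then show ?thesis using assms G_ge(1)[OF assms(1)] by (simp add: regular_def)
qed

text \<open>P = - r \<open>pu r\<close> solves the linear equation P_v = damping P with a
  coefficient between two positive constants. The same coefficient that damps \<zeta> drives this
  growth. The lower bound prevents regular lines from being long; both bounds keep \<Omega> under
  control for continuation.\<close>

lemma ru_grow:
  assumes "regular u v" "0 \<le> s" "s \<le> u"
  shows "exp (damping_min * (v - v1)) * (- (r s v1 * pu r s v1)) \<le> - (r s v * pu r s v)"
    and "- (r s v * pu r s v) \<le> exp (1 / (4 * c3 * \<rho>) * (v - v1)) * (- (r s v1 * pu r s v1))"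
proof -
  define P where "P t = - (r s t * pu r s t)" for t
  have vv: "v1 \<le> v" using assms(1) by (simp add: regular_def)
  have P: "(P has_real_derivative damping s t * P t) (at t)" "damping_min \<le> damping s t" "damping s t \<le> 1 / (4 * c3 * \<rho>)" "0 \<le> P t"
    if t: "v1 \<le> t" "t \<le> v" for t
  proof -
    note R = regularD[OF assms t]
    have "(P has_real_derivative (\<Omega> s t)\<^sup>2 / 4 * (1 - 2 * (r s t)\<^sup>2 * V (\<phi> s t))) (at t)"
      unfolding P_def using DERIV_minus[OF r_ru_v[OF R(1)]] by simp
    moreover have "damping s t * P t = (\<Omega> s t)\<^sup>2 / 4 * (1 - 2 * (r s t)\<^sup>2 * V (\<phi> s t))"
      using r_pos[OF R(1)] kappa_pos[OF R(1)] unfolding damping_def P_def Om_kappa[OF R(1)] by (simp add: field_simps)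
    ultimately show "(P has_real_derivative damping s t * P t) (at t)" by (simp only:)
    show "damping_min \<le> damping s t" "damping s t \<le> 1 / (4 * c3 * \<rho>)"
      using damping_bounds[OF R(1)] R(2,3) by (auto simp: controlled_def)
    show "0 \<le> P t" using r_pos[OF R(1)] ru_neg[OF R(1)] by (simp add: P_def mult_nonneg_nonpos)
  qed
  have ex: "((\<lambda>t. exp (- c * (t - v1)) * P t) has_real_derivative exp (- c * (t - v1)) * ((damping s t - c) * P t)) (at t)"
    if "v1 \<le> t" "t \<le> v" for c t
    by (auto intro!: derivative_eq_intros P(1)[OF that] simp: algebra_simps)
  have "exp (- damping_min * (v1 - v1)) * P v1 \<le> exp (- damping_min * (v - v1)) * P v"
    by (rule deriv_nonneg_mono[OF vv ex]) (use P in auto)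
  then have "exp (damping_min * (v - v1)) * P v1 \<le> exp (damping_min * (v - v1)) * (exp (- damping_min * (v - v1)) * P v)"
    by (intro mult_left_mono) auto
  then show "exp (damping_min * (v - v1)) * (- (r s v1 * pu r s v1)) \<le> - (r s v * pu r s v)"
    by (simp add: mult.assoc[symmetric] exp_add[symmetric] P_def)
  define A where "A = 1 / (4 * c3 * \<rho>)"
  have "exp (- A * (v - v1)) * P v \<le> exp (- A * (v1 - v1)) * P v1"
    by (rule deriv_nonpos_mono[OF vv ex]) (use P in \<open>auto simp: A_def mult_nonneg_nonpos mult_nonpos_nonneg\<close>)
  then have "exp (A * (v - v1)) * (exp (- A * (v - v1)) * P v) \<le> exp (A * (v - v1)) * P v1"
    by (intro mult_left_mono) auto
  then show "- (r s v * pu r s v) \<le> exp (1 / (4 * c3 * \<rho>) * (v - v1)) * (- (r s v1 * pu r s v1))"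
    by (simp add: mult.assoc[symmetric] exp_add[symmetric] P_def A_def[symmetric])
qed

text \<open>Integrating the growth of - r \<open>pu r\<close> over 0..u multiplies the initial gap D
  between the squared radii by an exponential in v - v1, while the gap cannot exceed rp^2. D is
  positive because u > 0, so the bound on v depends on u.\<close>

lemma regular_bounded:
  assumes u: "0 < u" "u \<le> \<eta>"
  shows "\<exists>Vm. \<forall>v. regular u v \<longrightarrow> v \<le> Vm"
proof -
  define D where "D = (r 0 v1)\<^sup>2 - (r u v1)\<^sup>2"
  have G1: "(s,v1) \<in> G" if "0 \<le> s" "s \<le> u" for s using strip[of s v1] that u strip_params by auto
  have "r u v1 < r 0 v1"
    by (rule DERIV_neg_imp_decreasing[OF u(1)]) (use C1_onD(1)[OF C1r G1] ru_neg[OF G1] in blast)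
  then have D: "0 < D" using r_pos[OF G1[of u]] u by (simp add: D_def power_strict_mono)
  show ?thesis
  proof (intro exI[of _ "v1 + rp\<^sup>2 / (damping_min * D)"] allI impI)
    fix v assume R: "regular u v"
    define E where "E = exp (damping_min * (v - v1))"
    have vv: "v1 \<le> v" using R by (simp add: regular_def)
    have "E * (r 0 v1)\<^sup>2 - (r 0 v)\<^sup>2 \<le> E * (r u v1)\<^sup>2 - (r u v)\<^sup>2"
    proof (rule deriv_nonneg_mono[OF less_imp_le[OF u(1)]])
      fix s assume s: "0 \<le> s" "s \<le> u"
      have Gv: "(s,v) \<in> G" by (rule regularD(1)[OF R s vv order_refl])
      show "((\<lambda>s. E * (r s v1)\<^sup>2 - (r s v)\<^sup>2) has_real_derivative 2 * (E * (r s v1 * pu r s v1) - r s v * pu r s v)) (at s)"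
        by (auto intro!: derivative_eq_intros C1_onD(1)[OF C1r G1[OF s]] C1_onD(1)[OF C1r Gv] simp: algebra_simps)
      show "0 \<le> 2 * (E * (r s v1 * pu r s v1) - r s v * pu r s v)" using ru_grow(1)[OF R s] by (simp add: E_def)
    qed
    then have "E * D \<le> (r 0 v)\<^sup>2 - (r u v)\<^sup>2" by (simp add: D_def algebra_simps)
    also have "\<dots> \<le> rp\<^sup>2"
    proof -
      have "v0 \<le> v" using vv strip_params by simp
      then have "(r 0 v)\<^sup>2 \<le> rp\<^sup>2" using r_out[of v] rho_le_out[of v] rho_pos by (intro power_mono) auto
      then show ?thesis using zero_le_power2[of "r u v"] by linarith
    qed
    finally have "E * D \<le> rp\<^sup>2" .
    moreover have "damping_min * (v - v1) \<le> E"
      using exp_ge_add_one_self[of "damping_min * (v - v1)"] unfolding E_def by linarith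
    then have "damping_min * (v - v1) * D \<le> E * D" using D by (intro mult_right_mono) auto
    ultimately have "(v - v1) * (damping_min * D) \<le> rp\<^sup>2" by (simp add: mult_ac)
    then have "v - v1 \<le> rp\<^sup>2 / (damping_min * D)" using damping_min_pos D by (simp add: pos_le_divide_eq)
    then show "v \<le> v1 + rp\<^sup>2 / (damping_min * D)" by simp
  qed
qed

text \<open>Strictness for s < u is what later leaves at most one tube point on each ingoing
  line.\<close>

lemma rv_decreasing:
  assumes R: "regular u v" and s: "0 \<le> s" "s < u" and "0 \<le> pv r u v"
  shows "0 < pv r s v"
proof -
  have vv: "v1 \<le> v" and u: "0 \<le> u" using R by (auto simp: regular_def)
  have "r u v * pv r u v < r s v * pv r s v"
  proof (rule DERIV_neg_imp_decreasing[OF s(2)])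
    fix x assume x: "s \<le> x" "x \<le> u"
    have x0: "0 \<le> x" using x s by simp
    note Rx = regularD[OF R x0 x(2) vv order_refl]
    have "4 * (r x v)\<^sup>2 * V (\<phi> x v) \<le> 1" using Rx(3) by (simp add: controlled_def)
    then have neg: "0 < (\<Omega> x v)\<^sup>2 / 4 * (1 - 2 * (r x v)\<^sup>2 * V (\<phi> x v))"
      using Om_pos[OF Rx(1)] by (intro mult_pos_pos) auto
    show "\<exists>y. ((\<lambda>s. r s v * pv r s v) has_real_derivative y) (at x) \<and> y < 0"
      by (rule exI, rule conjI, rule r_rv_u[OF Rx(1)]) (use neg in simp)
  qed
  moreover have "0 \<le> r u v * pv r u v" using r_pos[OF regularD(1)[OF R u order_refl vv order_refl]] assms(4) by simp
  moreover have "0 < r s v" by (rule r_pos[OF regularD(1)[OF R s(1) less_imp_le[OF s(2)] vv order_refl]])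
  ultimately show ?thesis by (metis le_less_trans zero_less_mult_pos)
qed

text \<open>The wave equation for w needs the other equations on an open set, hence the interior
  point away from the initial cones.\<close>

lemma w_uv:
  assumes "(u,v) \<in> G" "0 < u" "u < u0" "v0 < v"
  shows "((\<lambda>t. pu w u t) has_real_derivative wave_w r w \<phi> u v) (at v)" "((\<lambda>s. pv w s v) has_real_derivative wave_w r w \<phi> u v) (at u)"
proof -
  obtain U where U: "open U" "G \<subseteq> U" "C2_on U r" "C2_on U \<Omega>" "C2_on U \<phi>" using obtain_U by metis
  obtain O' where O: "open O'" "G = Kset u0 v0 \<inter> O'" using Gop unfolding openin_open by blast
  define N where "N = O' \<inter> ({0<..<u0} \<times> {v0<..})"
  have N: "open N" "N \<subseteq> G" "(u,v) \<in> N"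
    using O assms by (auto simp: N_def Kset_def intro!: open_Int open_Times)
  have NU: "N \<subseteq> U" using N U by blast
  have "wave_system N r (\<lambda>a b. ln (\<Omega> a b)) \<phi>"
    by (rule interior_solution(2)[OF N(1) C2_on_subset[OF U(3) NU] C2_on_subset[OF U(4) NU] C2_on_subset[OF U(5) NU]])
       (use N(2) r_pos Om_pos ru_neg EH in auto)
  then have W: "wave_system N r w \<phi>" by (simp add: w_def)
  show "((\<lambda>t. pu w u t) has_real_derivative wave_w r w \<phi> u v) (at v)" "((\<lambda>s. pv w s v) has_real_derivative wave_w r w \<phi> u v) (at u)"
    by (rule wave_systemD(4)[OF W N(3)] wave_systemD(5)[OF W N(3)])+
qed

lemma compact_bound_G:
  assumes "C1_on G f" "{a..b} \<times> {c..d} \<subseteq> G"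
  obtains K where "0 \<le> K" "\<And>u v. a \<le> u \<Longrightarrow> u \<le> b \<Longrightarrow> c \<le> v \<Longrightarrow> v \<le> d \<Longrightarrow> \<bar>f u v\<bar> \<le> K"
proof -
  obtain K where K: "0 \<le> K" "\<And>p. p \<in> {a..b} \<times> {c..d} \<Longrightarrow> norm (f (fst p) (snd p)) \<le> K"
    using compact_norm_bound[OF compact_Times[OF compact_Icc compact_Icc] continuous_on_subset[OF C1_onD(3)[OF assms(1)] assms(2)]] by blast
  show thesis by (rule that[OF K(1)]) (use K(2)[of "(_,_)"] in auto)
qed

text \<open>The bootstrap controls \<zeta>, \<kappa>, \<phi> and \<open>pv r\<close>, and the growth
  estimate bounds - \<open>pu r\<close> from both sides, hence \<Omega>. The remaining derivatives
  follow by integrating wave equations: r \<open>pv \<phi>\<close> from the horizon, then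
  \<open>pu w\<close> and \<open>pv w\<close>, whose common right-hand side contains only quantities
  already bounded.\<close>

lemma regular_extension:
  assumes s: "0 < s" "s \<le> \<eta>" and T: "v0 < T"
    and punct: "\<And>u v. 0 \<le> u \<Longrightarrow> u \<le> s \<Longrightarrow> v0 \<le> v \<Longrightarrow> v \<le> T \<Longrightarrow> (u,v) \<noteq> (s,T) \<Longrightarrow> (u,v) \<in> G"
    and rv: "\<And>v. v0 \<le> v \<Longrightarrow> v < T \<Longrightarrow> 0 \<le> pv r s v"
  shows "(s,T) \<in> G"
proof (cases "T \<le> v1")
  case True then show ?thesis using strip[of s T] s T by simp
next
  case False
  then have Tv: "v1 < T" by simp
  have rho: "\<rho> \<le> r u v" if u: "0 \<le> u" "u \<le> s" and v: "v0 \<le> v" "v \<le> T" and ne: "(u,v) \<noteq> (s,T)" for u v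
  proof -
    have lt: "\<rho> \<le> r u v" if v: "v0 \<le> v" "v < T" for v
    proof -
      have "(s,v) \<in> G" using punct[of s v] s v by auto
      then show ?thesis using rho_le[OF _ rv[OF v]] r_decreasing[OF _ u] order_trans by blast
    qed
    show ?thesis
    proof (cases "v < T")
      case True then show ?thesis using lt v by simp
    next
      case False
      \<comment> \<open>On the edge v = T the sign of \<open>pv r\<close> is not known, so the bound
        on r is a limit from smaller v.\<close>
      then have vT: "v = T" "u < s" using v ne u by auto
      have "{u} \<times> {v0..T} \<subseteq> G" using punct u vT by auto
      then have "continuous_on {v0..T} (r u)" by (intro continuous_on_subset[OF continuous_on_arg2[OF continuous_G(1)]]) auto
      from limit_ge[OF T this lt] show ?thesis using vT by simp
    qed
  qed
  have reg: "regular u v" if u: "0 \<le> u" "u \<le> s" and v: "v1 \<le> v" "v \<le> T" and ne: "(u,v) \<noteq> (s,T)" for u v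
    unfolding regular_def using punct[of u v] rho[of u] that s strip_params by auto
  have ct: "controlled \<sigma> u v" and Guv: "(u,v) \<in> G" and rg: "\<rho> \<le> r u v" "r u v \<le> rp"
    if u: "0 \<le> u" "u \<le> s" and v: "v1 \<le> v" "v \<le> T" and ne: "(u,v) \<noteq> (s,T)" for u v
    using regularD[OF reg[OF that] u(1) order_refl v(1) order_refl] r_le_rp by auto
  have edge: "{0..s} \<times> {v1..v1} \<subseteq> G" "{s/2..s/2} \<times> {v1..T} \<subseteq> G" "{0..0} \<times> {v1..T} \<subseteq> G"
    using punct s Tv strip_params by auto
  obtain n0 where n0: "0 \<le> n0" "\<And>u v. 0 \<le> u \<Longrightarrow> u \<le> s \<Longrightarrow> v1 \<le> v \<Longrightarrow> v \<le> v1 \<Longrightarrow> \<bar>pu r u v\<bar> \<le> n0"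
    by (rule compact_bound_G[OF C1ru edge(1)], rule that)
  obtain Kp where Kp: "0 \<le> Kp" "\<And>u v. 0 \<le> u \<Longrightarrow> u \<le> 0 \<Longrightarrow> v1 \<le> v \<Longrightarrow> v \<le> T \<Longrightarrow> \<bar>\<phi> u v\<bar> \<le> Kp"
    by (rule compact_bound_G[OF C1p edge(3)], rule that)
  obtain Ku where Ku: "0 \<le> Ku" "\<And>u v. 0 \<le> u \<Longrightarrow> u \<le> s \<Longrightarrow> v1 \<le> v \<Longrightarrow> v \<le> v1 \<Longrightarrow> \<bar>pu w u v\<bar> \<le> Ku"
    by (rule compact_bound_G[OF C1wu edge(1)], rule that)
  obtain Kv where Kv: "0 \<le> Kv" "\<And>u v. s/2 \<le> u \<Longrightarrow> u \<le> s/2 \<Longrightarrow> v1 \<le> v \<Longrightarrow> v \<le> T \<Longrightarrow> \<bar>pv w u v\<bar> \<le> Kv"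
    by (rule compact_bound_G[OF C1wv edge(2)], rule that)
  \<comment> \<open>The positive minimum of - \<open>pu r\<close> on the segment at v1, propagated
    upwards, keeps \<Omega> away from zero, so that w stays bounded.\<close>
  obtain u1 where u1: "0 \<le> u1" "u1 \<le> s" "\<And>u. 0 \<le> u \<Longrightarrow> u \<le> s \<Longrightarrow> - pu r u1 v1 \<le> - pu r u v1"
  proof -
    have "continuous_on {0..s} (\<lambda>u. - pu r u v1)"
      by (intro continuous_intros continuous_on_subset[OF continuous_on_arg1[OF continuous_on_subset[OF C1_onD(4)[OF C1r] edge(1)]]]) auto
    from continuous_attains_inf[OF compact_Icc _ this] s show thesis using that by fastforce
  qed
  have Gu1: "(u1,v1) \<in> G" using edge(1) u1 by auto
  define nlo where "nlo = \<rho> * (- pu r u1 v1)"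
  define nhi where "nhi = exp (1 / (4 * c3 * \<rho>) * (T - v1)) * (rp * n0)"
  have nlo: "0 < nlo" unfolding nlo_def by (rule mult_pos_pos) (use ru_neg[OF Gu1] rho_pos in auto)
  define nm where "nm = nhi / \<rho>"
  have n: "nlo / rp \<le> - pu r u v" "- pu r u v \<le> nm"
    if u: "0 \<le> u" "u \<le> s" and v: "v1 \<le> v" "v \<le> T" and ne: "(u,v) \<noteq> (s,T)" for u v
  proof -
    note R = reg[OF that]
    have G: "(u,v) \<in> G" "(u,v1) \<in> G" using Guv[OF that] edge u by auto
    have r1: "\<rho> \<le> r u v1" "r u v1 \<le> rp" using rg[of u v1] u Tv by auto
    have nn: "0 < - pu r u v" "0 < - pu r u v1" using ru_neg G by auto
    have "nlo \<le> r u v1 * (- pu r u v1)" unfolding nlo_def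
      using r1 u1(3)[OF u] rho_pos ru_neg[OF Gu1] by (intro mult_mono) auto
    also have "\<dots> \<le> exp (damping_min * (v - v1)) * (r u v1 * (- pu r u v1))"
      using mult_right_mono[of 1 "exp (damping_min * (v - v1))" "r u v1 * (- pu r u v1)"] damping_min_pos v r1 rho_pos nn by simp
    also have "\<dots> \<le> r u v * (- pu r u v)" using ru_grow(1)[OF R u(1) order_refl] by simp
    also have "\<dots> \<le> rp * (- pu r u v)" using rg(2)[OF that] nn by (intro mult_right_mono) auto
    finally have "nlo \<le> (- pu r u v) * rp" by (simp add: mult.commute)
    then show "nlo / rp \<le> - pu r u v" using rp_pos by (simp only: pos_divide_le_eq)
    have "\<rho> * (- pu r u v) \<le> r u v * (- pu r u v)" using rg(1)[OF that] nn by (intro mult_right_mono) auto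
    also have "\<dots> \<le> exp (1 / (4 * c3 * \<rho>) * (v - v1)) * (r u v1 * (- pu r u v1))"
      using ru_grow(2)[OF R u(1) order_refl] by simp
    also have "\<dots> \<le> nhi" unfolding nhi_def
    proof (rule mult_mono)
      have "0 \<le> 1 / (4 * c3 * \<rho>)" using pos rho_pos by simp
      then show "exp (1 / (4 * c3 * \<rho>) * (v - v1)) \<le> exp (1 / (4 * c3 * \<rho>) * (T - v1))"
        using v by (simp only: exp_le_cancel_iff) (intro mult_left_mono, auto)
      show "r u v1 * (- pu r u v1) \<le> rp * n0" using r1 n0(2)[OF u order_refl order_refl] nn rp_pos by (intro mult_mono) auto
    qed (use r1 rho_pos nn in \<open>auto intro!: mult_nonneg_nonpos\<close>)
    finally have "(- pu r u v) * \<rho> \<le> nhi" by (simp add: mult.commute)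
    then show "- pu r u v \<le> nm" unfolding nm_def using rho_pos by (simp only: pos_le_divide_eq)
  qed
  have nm0: "0 \<le> nm" using n0 rp_pos rho_pos by (simp add: nm_def nhi_def)
  define Olo where "Olo = nlo / rp / c2"
  define Ohi where "Ohi = nm / c3"
  have Om: "Olo \<le> (\<Omega> u v)\<^sup>2" "(\<Omega> u v)\<^sup>2 \<le> Ohi"
    if u: "0 \<le> u" "u \<le> s" and v: "v1 \<le> v" "v \<le> T" and ne: "(u,v) \<noteq> (s,T)" for u v
  proof -
    have kc: "\<kappa> u v \<le> c2" using ct[OF that] by (simp add: controlled_def)
    have nl: "0 \<le> nlo / rp" "0 \<le> - pu r u v" using nlo rp_pos ru_neg[OF Guv[OF that]] by auto
    show "Olo \<le> (\<Omega> u v)\<^sup>2" unfolding Om_kappa[OF Guv[OF that]] Olo_def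
      by (rule frac_le[OF nl(2) n(1)[OF that] kappa_pos[OF Guv[OF that]] kc])
    show "(\<Omega> u v)\<^sup>2 \<le> Ohi" unfolding Om_kappa[OF Guv[OF that]] Ohi_def
      by (rule frac_le[OF nm0 n(2)[OF that] pos(2) kappa_ge[OF Guv[OF that]]])
  qed
  have Olo0: "0 < Olo" using nlo rp_pos pos by (simp add: Olo_def)
  have Ohi0: "0 \<le> Ohi" using nm0 pos by (simp add: Ohi_def)
  define Kw where "Kw = \<bar>ln Olo\<bar> + \<bar>ln Ohi\<bar>"
  have wb: "\<bar>w u v\<bar> \<le> Kw"
    if u: "0 \<le> u" "u \<le> s" and v: "v1 \<le> v" "v \<le> T" and ne: "(u,v) \<noteq> (s,T)" for u v
  proof -
    have "2 * w u v = ln ((\<Omega> u v)\<^sup>2)" using wave_facts(5)[OF Guv[OF that]] by (metis ln_exp)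
    moreover have "0 < (\<Omega> u v)\<^sup>2" "0 < Ohi" using Om[OF that] Olo0 by linarith+
    then have "ln Olo \<le> ln ((\<Omega> u v)\<^sup>2) \<and> ln ((\<Omega> u v)\<^sup>2) \<le> ln Ohi"
      using Om[OF that] Olo0 by (simp only: ln_le_cancel_iff)
    ultimately show ?thesis unfolding Kw_def by linarith
  qed
  define V1m where "V1m = Cv * e3 + B * \<delta>"
  have V1m0: "0 \<le> V1m" using pos by (simp add: V1m_def)
  have pvb: "\<bar>pv r u v\<bar> \<le> rv_bound / \<rho>" and V1b: "\<bar>deriv V (\<phi> u v)\<bar> \<le> V1m" and pub: "\<bar>pu \<phi> u v\<bar> \<le> \<sigma> * nm"
    and prb: "\<bar>pu r u v\<bar> \<le> nm" and phb: "\<bar>\<phi> u v\<bar> \<le> Kp + \<delta>"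
    if u: "0 \<le> u" "u \<le> s" and v: "v1 \<le> v" "v \<le> T" and ne: "(u,v) \<noteq> (s,T)" for u v
  proof -
    note c = ct[OF that, unfolded controlled_def]
    have "\<rho> * \<bar>pv r u v\<bar> \<le> r u v * \<bar>pv r u v\<bar>" using rg[OF that] by (intro mult_right_mono) auto
    also have "\<dots> \<le> rv_bound" using c rg[OF that] rho_pos by (simp add: abs_mult)
    finally show "\<bar>pv r u v\<bar> \<le> rv_bound / \<rho>" using rho_pos by (simp add: field_simps)
    show "\<bar>deriv V (\<phi> u v)\<bar> \<le> V1m" using c by (simp add: V1m_def)
    have rn: "pu r u v < 0" by (rule ru_neg[OF Guv[OF that]])
    show pr: "\<bar>pu r u v\<bar> \<le> nm" using n(2)[OF that] rn by simp
    have "\<bar>pu \<phi> u v\<bar> = \<bar>\<zeta> u v\<bar> * \<bar>pu r u v\<bar>" using rn by (simp add: \<zeta>_def abs_divide)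
    also have "\<dots> \<le> \<sigma> * nm" using c pr strip_params by (intro mult_mono) auto
    finally show "\<bar>pu \<phi> u v\<bar> \<le> \<sigma> * nm" .
    show "\<bar>\<phi> u v\<bar> \<le> Kp + \<delta>" using c Kp(2)[of 0 v] v by (auto simp: abs_le_iff)
  qed
  have Rr0: "0 \<le> rv_bound / \<rho>" using rp_pos pos rho_pos by (simp add: rv_bound_def)
  define C5 where "C5 = \<sigma> * nm * (rv_bound / \<rho>) + rp * Ohi * V1m / 4"
  define Kf where "Kf = (rp * e3 + C5 * s) / \<rho>"
  have "0 \<le> \<sigma> * nm * (rv_bound / \<rho>)" using strip_params nm0 Rr0 by (intro mult_nonneg_nonneg) auto
  moreover have "0 \<le> rp * Ohi * V1m / 4" using rp_pos Ohi0 V1m0 by simp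
  ultimately have C50: "0 \<le> C5" unfolding C5_def by linarith
  have pfb: "\<bar>pv \<phi> u v\<bar> \<le> Kf"
    if u: "0 \<le> u" "u \<le> s" and v: "v1 \<le> v" "v \<le> T" and ne: "(u,v) \<noteq> (s,T)" for u v
  proof -
    have v0: "v0 \<le> v" using v strip_params by simp
    have "\<bar>r u v * pv \<phi> u v - r 0 v * pv \<phi> 0 v\<bar> \<le> C5 * u - C5 * 0"
    proof (rule deriv_bound[OF u(1)])
      fix x assume x: "0 \<le> x" "x \<le> u"
      have xs: "x \<le> s" "(x,v) \<noteq> (s,T)" using x u ne by auto
      note X = x(1) xs(1) v xs(2)
      show "((\<lambda>s. r s v * pv \<phi> s v) has_real_derivative - (pu \<phi> x v * pv r x v) - r x v * (\<Omega> x v)\<^sup>2 * deriv V (\<phi> x v) / 4) (at x)"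
        by (rule r_phiv_u[OF Guv[OF X]])
      show "((\<lambda>s. C5 * s) has_real_derivative C5) (at x)" by (auto intro!: derivative_eq_intros)
      have "\<bar>pu \<phi> x v * pv r x v\<bar> \<le> \<sigma> * nm * (rv_bound / \<rho>)"
        unfolding abs_mult using pub[OF X] pvb[OF X] strip_params nm0 by (intro mult_mono) auto
      moreover have "\<bar>r x v * (\<Omega> x v)\<^sup>2 * deriv V (\<phi> x v) / 4\<bar> \<le> rp * Ohi * V1m / 4"
        using rg[OF X] Om[OF X] V1b[OF X] rho_pos rp_pos Ohi0 by (auto simp: abs_mult intro!: mult_mono)
      ultimately show "\<bar>- (pu \<phi> x v * pv r x v) - r x v * (\<Omega> x v)\<^sup>2 * deriv V (\<phi> x v) / 4\<bar> \<le> C5"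
        unfolding C5_def by linarith
    qed
    moreover have "C5 * u \<le> C5 * s" using u C50 by (intro mult_left_mono) auto
    moreover have "\<bar>r 0 v * pv \<phi> 0 v\<bar> \<le> rp * e3"
      unfolding abs_mult using r_out[OF v0] rho_le_out[OF v0] rho_pos phi_out(1)[OF v0] rp_pos by (intro mult_mono) auto
    ultimately have "\<bar>r u v * pv \<phi> u v\<bar> \<le> rp * e3 + C5 * s" by linarith
    moreover have "\<rho> * \<bar>pv \<phi> u v\<bar> \<le> \<bar>r u v * pv \<phi> u v\<bar>"
      using rg[OF that] rho_pos by (auto simp: abs_mult intro!: mult_right_mono)
    ultimately have "\<bar>pv \<phi> u v\<bar> * \<rho> \<le> rp * e3 + C5 * s" by (simp add: mult.commute)
    then show ?thesis unfolding Kf_def using rho_pos by (simp only: pos_le_divide_eq)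
  qed
  have Kf0: "0 \<le> Kf" using rp_pos pos C50 s rho_pos by (simp add: Kf_def)
  define CW where "CW = Ohi / (4 * \<rho>\<^sup>2) + nm * (rv_bound / \<rho>) / \<rho>\<^sup>2 + \<sigma> * nm * Kf"
  have FwB: "\<bar>wave_w r w \<phi> u v\<bar> \<le> CW"
    if u: "0 \<le> u" "u \<le> s" and v: "v1 \<le> v" "v \<le> T" and ne: "(u,v) \<noteq> (s,T)" for u v
  proof -
    have rr: "\<rho>\<^sup>2 \<le> (r u v)\<^sup>2" "0 < \<rho>\<^sup>2" using rg[OF that] rho_pos by (auto intro: power_mono)
    have 1: "(\<Omega> u v)\<^sup>2 / (4 * (r u v)\<^sup>2) \<le> Ohi / (4 * \<rho>\<^sup>2)" using Om[OF that] rr Ohi0 by (intro frac_le) auto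
    have "\<bar>pu r u v\<bar> * \<bar>pv r u v\<bar> / (r u v)\<^sup>2 \<le> nm * (rv_bound / \<rho>) / \<rho>\<^sup>2"
      using prb[OF that] pvb[OF that] rr nm0 mult_nonneg_nonneg[OF nm0 Rr0] by (intro frac_le mult_mono) auto
    then have 2: "\<bar>pu r u v * pv r u v / (r u v)\<^sup>2\<bar> \<le> nm * (rv_bound / \<rho>) / \<rho>\<^sup>2" by (simp add: abs_mult)
    have 3: "\<bar>pu \<phi> u v * pv \<phi> u v\<bar> \<le> \<sigma> * nm * Kf"
      unfolding abs_mult using pub[OF that] pfb[OF that] strip_params nm0 by (intro mult_mono) auto
    have 4: "0 \<le> (\<Omega> u v)\<^sup>2 / (4 * (r u v)\<^sup>2)" by simp
    show ?thesis unfolding wave_w_def wave_facts(5)[OF Guv[OF that]] CW_def using 1 2 3 4 by linarith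
  qed
  have wub: "\<bar>pu w u v\<bar> \<le> Ku + CW * (T - v1)"
    if u: "s/2 \<le> u" "u \<le> s" and v: "v1 \<le> v" "v \<le> T" and ne: "(u,v) \<noteq> (s,T)" for u v
  proof -
    have CW0: "0 \<le> CW" using FwB[of 0 v1] s Tv by auto
    have "\<bar>pu w u v - pu w u v1\<bar> \<le> CW * v - CW * v1"
    proof (rule deriv_bound[OF v(1)])
      fix t assume t: "v1 \<le> t" "t \<le> v"
      have X: "0 \<le> u" "u \<le> s" "v1 \<le> t" "t \<le> T" "(u,t) \<noteq> (s,T)" using u t v ne s by auto
      show "((\<lambda>t. pu w u t) has_real_derivative wave_w r w \<phi> u t) (at t)"
        by (rule w_uv(1)[OF Guv[OF X]]) (use u s t strip_params in auto)
      show "\<bar>wave_w r w \<phi> u t\<bar> \<le> CW" by (rule FwB[OF X])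
      show "((\<lambda>t. CW * t) has_real_derivative CW) (at t)" by (auto intro!: derivative_eq_intros)
    qed
    moreover have "CW * v \<le> CW * T" using CW0 v by (intro mult_left_mono) auto
    moreover have "\<bar>pu w u v1\<bar> \<le> Ku" using Ku(2)[of u v1] u s by auto
    ultimately show ?thesis by (simp add: right_diff_distrib)
  qed
  \<comment> \<open>The integration starts on the line u = s/2, which lies in G up to v = T. The
    horizon cannot serve, since the wave equation for w is available for u > 0 only.\<close>
  have wvb: "\<bar>pv w u v\<bar> \<le> Kv + CW * s"
    if u: "s/2 \<le> u" "u \<le> s" and v: "v1 \<le> v" "v \<le> T" and ne: "(u,v) \<noteq> (s,T)" for u v
  proof -
    have CW0: "0 \<le> CW" using FwB[of 0 v1] s Tv by auto
    have "\<bar>pv w u v - pv w (s/2) v\<bar> \<le> CW * u - CW * (s/2)"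
    proof (rule deriv_bound[OF u(1)])
      fix x assume x: "s/2 \<le> x" "x \<le> u"
      have X: "0 \<le> x" "x \<le> s" "v1 \<le> v" "v \<le> T" "(x,v) \<noteq> (s,T)" using u x v ne s by auto
      show "((\<lambda>x. pv w x v) has_real_derivative wave_w r w \<phi> x v) (at x)"
        by (rule w_uv(2)[OF Guv[OF X]]) (use x u s v strip_params in auto)
      show "\<bar>wave_w r w \<phi> x v\<bar> \<le> CW" by (rule FwB[OF X])
      show "((\<lambda>t. CW * t) has_real_derivative CW) (at x)" by (auto intro!: derivative_eq_intros)
    qed
    moreover have "CW * u \<le> CW * s" "0 \<le> CW * (s/2)" using CW0 u s by (auto intro!: mult_left_mono)
    moreover have "\<bar>pv w (s/2) v\<bar> \<le> Kv" using Kv(2)[of "s/2" v] v by auto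
    ultimately show ?thesis by linarith
  qed
  define K where "K = (rp + Kw + (Kp + \<delta>)) + (nm + (Ku + CW * (T - v1)) + \<sigma> * nm) + (rv_bound / \<rho> + (Kv + CW * s) + Kf)"
  have CW0: "0 \<le> CW" using FwB[of 0 v1] s Tv by auto
  have nn: "0 \<le> rp" "0 \<le> Kw" "0 \<le> Kp + \<delta>" "0 \<le> nm" "0 \<le> Ku + CW * (T - v1)" "0 \<le> \<sigma> * nm" "0 \<le> Kv + CW * s"
    using rp_pos Kp Ku Kv pos nm0 CW0 Tv s strip_params by (auto simp: Kw_def)
  have "\<exists>G' r' \<Omega>' \<phi>'. is_development V u0 v0 G' r' \<Omega>' \<phi>' \<and> (s,T) \<in> G' \<and>
      (\<forall>(u,v)\<in>Cin u0 v0 \<union> Cout v0. r' u v = r u v \<and> \<Omega>' u v = \<Omega> u v \<and> \<phi>' u v = \<phi> u v)"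
  proof (rule extension[OF dev ru_neg, of "s/2" s "v1" T \<rho> K])
    show "0 < s/2" "s/2 < s" "s < u0" "v0 < v1" "v1 < T" "0 < \<rho>" using s strip_params Tv rho_pos by auto
    fix u v assume a: "s/2 \<le> u" "u \<le> s" "v1 \<le> v" "v \<le> T" "(u,v) \<noteq> (s,T)"
    then have X: "0 \<le> u" "u \<le> s" "v1 \<le> v" "v \<le> T" "(u,v) \<noteq> (s,T)" using s by auto
    have t1: "norm (r u v, w u v, \<phi> u v) \<le> rp + Kw + (Kp + \<delta>)"
      using triple_norm_le[of "(r u v, w u v, \<phi> u v)"] rg[OF X] rho_pos wb[OF X] phb[OF X] by simp
    have t2: "norm (pu r u v, pu w u v, pu \<phi> u v) \<le> nm + (Ku + CW * (T - v1)) + \<sigma> * nm"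
      using triple_norm_le[of "(pu r u v, pu w u v, pu \<phi> u v)"] prb[OF X] wub[OF a] pub[OF X] by simp
    have t3: "norm (pv r u v, pv w u v, pv \<phi> u v) \<le> rv_bound / \<rho> + (Kv + CW * s) + Kf"
      using triple_norm_le[of "(pv r u v, pv w u v, pv \<phi> u v)"] pvb[OF X] wvb[OF a] pfb[OF X] by simp
    have "norm (r u v, w u v, \<phi> u v) \<le> K" "norm (pu r u v, pu w u v, pu \<phi> u v) \<le> K" "norm (pv r u v, pv w u v, pv \<phi> u v) \<le> K"
      using t1 t2 t3 nn Rr0 Kf0 unfolding K_def by linarith+
    then show "(u,v) \<in> G \<and> \<rho> \<le> r u v \<and> norm (r u v, ln (\<Omega> u v), \<phi> u v) \<le> K \<and>
      norm (pu r u v, pu (\<lambda>a b. ln (\<Omega> a b)) u v, pu \<phi> u v) \<le> K \<and>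
      norm (pv r u v, pv (\<lambda>a b. ln (\<Omega> a b)) u v, pv \<phi> u v) \<le> K"
      using Guv[OF X] rg[OF X] unfolding w_def by blast
  qed
  then show ?thesis using maximal by blast
qed

end

section \<open>Existence and shape of the tube\<close>

context controlled_strip
begin

lemma obtain_open:
  obtains O' U where "open O'" "G = Kset u0 v0 \<inter> O'" "open U" "G \<subseteq> U" "C2_on U r"
  using Gop obtain_U unfolding openin_open by metis

lemma first_exit_G:
  assumes "0 \<le> u" "u \<le> u0" "v0 \<le> v" "(u,v) \<notin> G"
  obtains T where "v0 < T" "T \<le> v" "(u,T) \<notin> G" "\<And>t. v0 \<le> t \<Longrightarrow> t < T \<Longrightarrow> (u,t) \<in> G"
proof -
  obtain O' U where O: "open O'" "G = Kset u0 v0 \<inter> O'" by (rule obtain_open)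
  have iff: "(u,t) \<in> O' \<longleftrightarrow> (u,t) \<in> G" if "v0 \<le> t" for t using O(2) assms that by (auto simp: Kset_def)
  obtain T where "v0 < T" "T \<le> v" "(u,T) \<notin> O'" "\<And>t. v0 \<le> t \<Longrightarrow> t < T \<Longrightarrow> (u,t) \<in> O'"
    by (rule first_exit[OF O(1), of v0 v "\<lambda>t. (u,t)"])
       (use assms iff Gin in \<open>auto intro!: continuous_intros\<close>)
  then show thesis using that iff by force
qed

text \<open>The first missing point on the line u = s is the future corner of a rectangle that
  otherwise lies in G: below it by minimality, and to its left by \<open>left\<close> and the past
  property. Continuation supplies the corner, a contradiction.\<close>

lemma regular_reaches:
  assumes s: "0 < s" "s \<le> \<eta>" and v: "v0 \<le> v" "(s,v) \<notin> G"
    and left: "\<And>u. 0 \<le> u \<Longrightarrow> u < s \<Longrightarrow> (u,v) \<in> G"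
    and rv: "\<And>t. v0 \<le> t \<Longrightarrow> t < v \<Longrightarrow> (s,t) \<in> G \<Longrightarrow> 0 \<le> pv r s t"
  shows False
proof -
  obtain T where T: "v0 < T" "T \<le> v" "(s,T) \<notin> G" "\<And>t. v0 \<le> t \<Longrightarrow> t < T \<Longrightarrow> (s,t) \<in> G"
    by (rule first_exit_G[of s v]) (use s v strip_params in auto)
  have "(s,T) \<in> G"
  proof (rule regular_extension[OF s T(1)])
    fix u t assume ut: "0 \<le> u" "u \<le> s" "v0 \<le> t" "t \<le> T" "(u,t) \<noteq> (s,T)"
    show "(u,t) \<in> G"
    proof (cases "t < T")
      case True then show ?thesis using past[OF T(4)[of t]] ut by auto
    next
      case False
      then have "u < s" "t = T" using ut by auto
      then show ?thesis using past[OF left[of u]] ut T by auto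
    qed
  next
    fix t assume "v0 \<le> t" "t < T"
    then show "0 \<le> pv r s t" using rv[of t] T by auto
  qed
  then show False using T(3) by simp
qed

text \<open>Without a trapped point, every point of the line in G beyond v1 is regular, so the line
  leaves G at bounded v. Continuation cannot be applied at the exit point itself, because the
  ingoing line through it may leave G at a smaller u already.\<close>

lemma trapped:
  assumes u: "0 < u" "u \<le> \<eta>"
  obtains v where "v1 < v" "(u,v) \<in> G" "pv r u v < 0"
proof (rule ccontr)
  assume "\<not> thesis"
  then have nn: "0 \<le> pv r u v" if "(u,v) \<in> G" for v
  proof (cases "v1 < v")
    case True then show ?thesis using that \<open>\<not> thesis\<close> \<open>\<And>v. v1 < v \<Longrightarrow> (u,v) \<in> G \<Longrightarrow> pv r u v < 0 \<Longrightarrow> thesis\<close> by fastforce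
  next
    case False then show ?thesis using strip[of u v] u G_ge(3)[OF that] by auto
  qed
  obtain Vm where Vm: "\<And>v. regular u v \<Longrightarrow> v \<le> Vm" using regular_bounded[OF u] by blast
  have reg: "regular u v" if "(u,v) \<in> G" "v1 \<le> v" for v by (rule regularI[OF that(1) u(2) that(2) nn[OF that(1)]])
  define v where "v = max v1 (Vm + 1)"
  have v: "v1 \<le> v" "v0 \<le> v" "Vm < v" using strip_params by (auto simp: v_def)
  then have nG: "(u,v) \<notin> G" using reg[of v] Vm[of v] by auto
  obtain T where T: "v0 < T" "T \<le> v" "(u,T) \<notin> G" "\<And>t. v0 \<le> t \<Longrightarrow> t < T \<Longrightarrow> (u,t) \<in> G"
    by (rule first_exit_G[OF _ _ v(2) nG]) (use u strip_params in auto)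
  obtain O' U where O: "open O'" "G = Kset u0 v0 \<inter> O'" by (rule obtain_open)
  have iff: "(x,T) \<in> O' \<longleftrightarrow> (x,T) \<in> G" if "0 \<le> x" "x \<le> u" for x using O(2) that u T strip_params by (auto simp: Kset_def)
  \<comment> \<open>The leftmost missing point on v = T. To its left the ingoing line lies in G, and
    below it \<open>pv r\<close> \<ge> 0 is inherited from the line u, where it holds by
    assumption.\<close>
  obtain s where s: "0 < s" "s \<le> u" "(s,T) \<notin> O'" "\<And>x. 0 \<le> x \<Longrightarrow> x < s \<Longrightarrow> (x,T) \<in> O'"
    by (rule first_exit[OF O(1), of 0 u "\<lambda>x. (x,T)"])
       (use iff u T Gout in \<open>auto intro!: continuous_intros\<close>)
  show False
  proof (rule regular_reaches[of s T])
    show "(s,T) \<notin> G" using iff s by auto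
    show "(x,T) \<in> G" if "0 \<le> x" "x < s" for x using iff[of x] s that by auto
    fix t assume t: "v0 \<le> t" "t < T" "(s,t) \<in> G"
    have ut: "(u,t) \<in> G" by (rule T(4)[OF t(1,2)])
    show "0 \<le> pv r s t"
    proof (cases "v1 \<le> t")
      case True
      then show ?thesis using rv_decreasing[OF reg[OF ut True], of s] nn[OF ut] s by (cases "s = u") auto
    next
      case False then show ?thesis using strip[of s t] s u t by auto
    qed
  qed (use s u T in auto)
qed

definition tube where "tube = {(u,v) \<in> G. pv r u v = 0 \<and> pu r u v < 0}"

lemma tube_iff: "(u,v) \<in> tube \<longleftrightarrow> (u,v) \<in> G \<and> pv r u v = 0"
  using ru_neg by (auto simp: tube_def)

lemma asymptotic:
  assumes u: "0 < u" "u \<le> \<eta>"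
  shows "\<exists>v>v0. (u,v) \<in> tube"
proof -
  obtain v where v: "v1 < v" "(u,v) \<in> G" "pv r u v < 0" by (rule trapped[OF u])
  have G: "(u,t) \<in> G" if "v1 \<le> t" "t \<le> v" for t using past[OF v(2)] u that strip_params by auto
  have "continuous_on {v1..v} (\<lambda>t. pv r u t)"
    by (rule continuous_on_arg2[OF continuous_on_subset[OF C1_onD(5)[OF C1r]], of "{u}" "{v1..v}"]) (use G in auto)
  then obtain t where "v1 \<le> t" "t \<le> v" "pv r u t = 0"
    using IVT2'[of "pv r u" v 0 v1] v strip[of u v1] u strip_params by auto
  then show ?thesis using G strip_params by (intro exI[of _ t]) (auto simp: tube_iff)
qed

text \<open>At late v each ingoing line meets the tube exactly once: the strict decrease of r
  \<open>pv r\<close> in u gives at most one point, a first exit in u at least one. Uniqueness on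
  the line excludes ingoing segments, and persistence to the past gives the monotonicity behind
  achronality.\<close>

lemma conclusion:
  "\<exists>V1. tube \<inter> {(u,v). v \<ge> V1} \<noteq> {} \<and> connected (tube \<inter> {(u,v). v \<ge> V1})
      \<and> achronal (tube \<inter> {(u,v). v \<ge> V1}) \<and> no_ingoing_null_segments (tube \<inter> {(u,v). v \<ge> V1})"
proof -
  obtain O' U where O: "open O'" "G = Kset u0 v0 \<inter> O'" "open U" "G \<subseteq> U" "C2_on U r" by (rule obtain_open)
  have oW: "open (O' \<inter> {p \<in> U. 0 < pv r (fst p) (snd p)})" "open (O' \<inter> {p \<in> U. 0 < - pv r (fst p) (snd p)})"
  proof -
    show "open (O' \<inter> {p \<in> U. 0 < pv r (fst p) (snd p)})"
      by (intro open_Int O open_U_positive C1_onD(5)[OF C2_onD(1)[OF O(5)]])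
    show "open (O' \<inter> {p \<in> U. 0 < - pv r (fst p) (snd p)})"
      by (intro open_Int O open_U_positive[of U "\<lambda>a b. - pv r a b"] continuous_intros C1_onD(5)[OF C2_onD(1)[OF O(5)]])
  qed
  obtain v2 where v2: "v1 < v2" "(\<eta>,v2) \<in> G" "pv r \<eta> v2 < 0" by (rule trapped[of \<eta>]) (use strip_params in auto)
  obtain Vm where Vm: "\<And>v. regular \<eta> v \<Longrightarrow> v \<le> Vm" using regular_bounded[of \<eta>] strip_params by blast
  \<comment> \<open>After v2 the line u = \<eta> is trapped as far as it lies in G, which stops the
    search in u at \<eta>. After Vm that line is no longer regular, which confines all points with
    \<open>pv r\<close> \<ge> 0 to u < \<eta>.\<close>
  define V1 where "V1 = max v2 (Vm + 1)"
  have V1: "v2 \<le> V1" "Vm < V1" "v1 \<le> V1" "v0 \<le> V1" using v2 strip_params by (auto simp: V1_def)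
  have etaneg: "pv r \<eta> v < 0" if "(\<eta>,v) \<in> G" "V1 \<le> v" for v
  proof (rule ccontr)
    assume "\<not> pv r \<eta> v < 0"
    then have "0 \<le> pv r \<eta> v2" using rv_past(1)[OF that(1), of v2] that(2) V1 v2 strip_params by auto
    then show False using v2 by simp
  qed
  \<comment> \<open>A point beyond \<eta> with \<open>pv r\<close> \<ge> 0 has r \<ge> \<rho> on its
    outgoing line. Since r decreases in u, the line u = \<eta> would then be regular up to a v
    beyond Vm.\<close>
  have in_strip: "u < \<eta>" if uv: "(u,v) \<in> G" "V1 \<le> v" "0 \<le> pv r u v" for u v
  proof (rule ccontr)
    assume "\<not> u < \<eta>"
    then have le: "\<eta> \<le> u" by simp
    have v: "v0 \<le> v" "v1 \<le> v" using uv V1 by auto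
    have "regular \<eta> v" unfolding regular_def
    proof (intro conjI allI impI)
      show "(\<eta>,v) \<in> G" by (rule past[OF uv(1)]) (use strip_params le v in auto)
      fix t assume t: "v1 \<le> t" "t \<le> v"
      have v0t: "v0 \<le> t" using t strip_params by simp
      have ut: "(u,t) \<in> G" by (rule past[OF uv(1)]) (use strip_params le t v0t in auto)
      have "\<rho> \<le> r u t" by (rule rho_le[OF ut rv_past(1)[OF uv(1) v0t t(2) uv(3)]])
      also have "\<dots> \<le> r \<eta> t" by (rule r_decreasing[OF ut _ le]) (use strip_params in simp)
      finally show "\<rho> \<le> r \<eta> t" .
    qed (use strip_params v in auto)
    then show False using Vm[of v] V1 uv by simp
  qed
  have regA: "regular u v" if "(u,v) \<in> G" "V1 \<le> v" "0 \<le> pv r u v" for u v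
    by (rule regularI[OF that(1) less_imp_le[OF in_strip[OF that]] _ that(3)]) (use that V1 in simp)
  have before: "0 < pv r x v" if "(u,v) \<in> G" "V1 \<le> v" "0 \<le> pv r u v" "0 \<le> x" "x < u" for u v x
    by (rule rv_decreasing[OF regA[OF that(1-3)] that(4,5,3)])
  have ex: "\<exists>u. 0 < u \<and> (u,v) \<in> tube" if v: "V1 \<le> v" for v
  proof -
    let ?W = "O' \<inter> {p \<in> U. 0 < pv r (fst p) (snd p)}"
    have v': "v0 \<le> v" "v1 \<le> v" using V1 v by auto
    have iff: "(x,v) \<in> ?W \<longleftrightarrow> (x,v) \<in> G \<and> 0 < pv r x v" if "0 \<le> x" "x \<le> \<eta>" for x
      using O(2,4) that strip_params v' by (auto simp: Kset_def)
    obtain s where s: "0 < s" "s \<le> \<eta>" "(s,v) \<notin> ?W" "\<And>x. 0 \<le> x \<Longrightarrow> x < s \<Longrightarrow> (x,v) \<in> ?W"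
    proof (rule first_exit[OF oW(1), of 0 \<eta> "\<lambda>x. (x,v)"])
      show "(0,v) \<in> ?W" using iff[of 0] Gout[OF v'(1)] pv_out(1)[OF v'(1)] strip_params by simp
      show "(\<eta>,v) \<notin> ?W" using iff[of \<eta>] etaneg[OF _ v] strip_params by force
    qed (use strip_params in \<open>auto intro!: continuous_intros\<close>)
    have lt: "(x,v) \<in> G" "0 < pv r x v" if "0 \<le> x" "x < s" for x using s(4)[OF that] iff[of x] that s by auto
    \<comment> \<open>If the exit point were missing from G, continuation along u = s would supply
      it: \<open>pv r\<close> > 0 to its left persists to the past, and in the limit
      \<open>pv r\<close> \<ge> 0 on the line u = s.\<close>
    have sG: "(s,v) \<in> G"
    proof (rule ccontr)
      assume n: "(s,v) \<notin> G"
      show False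
      proof (rule regular_reaches[OF s(1,2) v'(1) n lt(1)])
        fix t assume t: "v0 \<le> t" "t < v" "(s,t) \<in> G"
        have Gx: "(x,t) \<in> G" if "0 \<le> x" "x \<le> s" for x using past[OF t(3) that t(1)] by simp
        have "continuous_on {0..s} (\<lambda>x. pv r x t)"
          by (rule continuous_on_arg1[OF continuous_on_subset[OF C1_onD(5)[OF C1r]], of "{0..s}" "{t}"]) (use Gx in auto)
        from limit_ge[OF s(1) this, of 0] show "0 \<le> pv r s t"
          using rv_past(2)[OF lt(1) t(1) less_imp_le[OF t(2)] lt(2)] less_imp_le by blast
      qed
    qed
    have "continuous_on {0..s} (\<lambda>x. pv r x v)"
      by (rule continuous_on_arg1[OF continuous_on_subset[OF C1_onD(5)[OF C1r]], of "{0..s}" "{v}"])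
         (use past[OF sG] v' in auto)
    from limit_ge[OF s(1) this, of 0] have "0 \<le> pv r s v" using lt(2) less_imp_le by blast
    moreover have "\<not> 0 < pv r s v" using iff[of s] s sG by auto
    ultimately show ?thesis using s sG by (auto simp: tube_iff)
  qed
  define a where "a v = (SOME u. 0 < u \<and> (u,v) \<in> tube)" for v
  have a: "0 < a v" "(a v, v) \<in> tube" "(a v, v) \<in> G" "pv r (a v) v = 0" "a v < \<eta>" if "V1 \<le> v" for v
  proof -
    show *: "0 < a v" "(a v, v) \<in> tube" using someI_ex[OF ex[OF that]] unfolding a_def by auto
    then show "(a v, v) \<in> G" "pv r (a v) v = 0" by (auto simp: tube_iff)
    then show "a v < \<eta>" using in_strip that by auto
  qed
  have uniq: "u = a v" if "(u,v) \<in> tube" "V1 \<le> v" for u v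
  proof (rule ccontr)
    assume "u \<noteq> a v"
    moreover have u: "(u,v) \<in> G" "pv r u v = 0" using that by (auto simp: tube_iff)
    moreover have "0 \<le> u" by (rule G_ge(1)[OF u(1)])
    ultimately show False
      using before[of u v "a v"] before[of "a v" v u] a[OF that(2)] that(2) by (cases "u < a v") auto
  qed
  \<comment> \<open>If a v < a v', the tube point at v' forces \<open>pv r\<close> \<ge> 0 at (a v',
    v), and then \<open>pv r\<close> > 0 at the tube point (a v, v).\<close>
  have mono: "a v' \<le> a v" if "V1 \<le> v" "v \<le> v'" for v v'
  proof (rule ccontr)
    assume "\<not> a v' \<le> a v"
    then have lt: "a v < a v'" by simp
    have v': "V1 \<le> v'" "v0 \<le> v" using that V1 by auto
    have G: "(a v', v) \<in> G" using past[OF a(3)[OF v'(1)]] a(1)[OF v'(1)] v' that by simp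
    have "0 \<le> pv r (a v') v" using rv_past(1)[OF a(3)[OF v'(1)] v'(2) that(2)] a(4)[OF v'(1)] by simp
    then have "0 < pv r (a v) v" using before[OF G that(1) _ _ lt] a(1)[OF that(1)] by simp
    then show False using a(4)[OF that(1)] by simp
  qed
  have cont: "continuous_on {V1..} a"
    unfolding continuous_on_iff
  proof (intro ballI allI impI)
    fix v e :: real assume "v \<in> {V1..}" and e: "0 < e"
    then have v: "V1 \<le> v" "v1 \<le> v" using V1 by auto
    \<comment> \<open>The tube is enclosed between u = lo, where \<open>pv r\<close> > 0, and u =
      hi, where \<open>pv r\<close> < 0; both signs persist for nearby v. The value lo = 0, the
      horizon itself, is allowed.\<close>
    obtain lo where lo: "0 \<le> lo" "a v - e < lo" "lo < a v"
      using a(1)[OF v(1)] e by (intro that[of "max 0 (a v - e/2)"]) auto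
    have loW: "(lo,v) \<in> O' \<inter> {p \<in> U. 0 < pv r (fst p) (snd p)}"
    proof -
      have "(lo,v) \<in> G" using past[OF a(3)[OF v(1)] lo(1) less_imp_le[OF lo(3)]] G_ge(3)[OF a(3)[OF v(1)]] by simp
      moreover have "0 < pv r lo v" using before[OF a(3)[OF v(1)] v(1) _ lo(1,3)] a(4)[OF v(1)] by simp
      ultimately show ?thesis using O(2,4) by auto
    qed
    obtain hi where hi: "a v < hi" "hi < a v + e" "hi < \<eta>" "(hi,v) \<in> O' \<inter> {p \<in> U. 0 < - pv r (fst p) (snd p)}"
    proof -
      note Ga = a(3)[OF v(1)]
      have ctl: "4 * (r (a v) v)\<^sup>2 * V (\<phi> (a v) v) \<le> 1"
        using regularD(3)[OF regA[OF Ga v(1)] _ order_refl v(2) order_refl] a[OF v(1)] by (simp add: controlled_def)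
      \<comment> \<open>Strict negativity of this derivative provides points with
        \<open>pv r\<close> < 0 immediately to the right of the tube.\<close>
      then have "- ((\<Omega> (a v) v)\<^sup>2 / 4 * (1 - 2 * (r (a v) v)\<^sup>2 * V (\<phi> (a v) v))) < 0"
        using Om_pos[OF Ga] by (simp add: mult_pos_pos)
      from DERIV_neg_dec_right[OF r_rv_u[OF Ga] this] obtain d where d: "0 < d"
        "\<And>h. 0 < h \<Longrightarrow> h < d \<Longrightarrow> r (a v + h) v * pv r (a v + h) v < r (a v) v * pv r (a v) v" by blast
      have "open {s. (s,v) \<in> O' \<inter> U}" by (rule slice_open) (use O in auto)
      moreover have "a v \<in> {s. (s,v) \<in> O' \<inter> U}" using Ga O by auto
      ultimately obtain d' where d': "0 < d'" "cball (a v) d' \<subseteq> {s. (s,v) \<in> O' \<inter> U}" by (meson open_contains_cball)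
      define h where "h = min (min (d/2) d') (min (e/2) ((\<eta> - a v)/2))"
      have h: "0 < h" "h < d" "h \<le> d'" "h < e" "h < \<eta> - a v"
      proof -
        have 1: "h \<le> d/2" "h \<le> d'" unfolding h_def
          by (rule min.coboundedI1, rule min.cobounded1 min.cobounded2)+
        have 2: "h \<le> e/2" "h \<le> (\<eta> - a v)/2" unfolding h_def
          by (rule min.coboundedI2, rule min.cobounded1 min.cobounded2)+
        have 3: "(\<eta> - a v)/2 < \<eta> - a v" "d/2 < d" "e/2 < e" using d(1) e a(5)[OF v(1)] by auto
        show "0 < h" using d(1) d'(1) e a(5)[OF v(1)] by (auto simp: h_def)
        show "h < d" "h \<le> d'" "h < e" "h < \<eta> - a v"
          using 1(1) 3(2) 1(2) 2(1) 3(3) 2(2) 3(1) by (blast intro: le_less_trans)+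
      qed
      have OU: "(a v + h, v) \<in> O' \<inter> U" using d'(2) h by (auto simp: subset_iff dist_real_def)
      then have Gh: "(a v + h, v) \<in> G" using O(2) a(1)[OF v(1)] h v V1 strip_params by (auto simp: Kset_def)
      have "r (a v + h) v * pv r (a v + h) v < 0" using d(2)[OF h(1,2)] a(4)[OF v(1)] by simp
      then have "pv r (a v + h) v < 0" using r_pos[OF Gh] by (simp add: mult_less_0_iff)
      then show thesis by (intro that[of "a v + h"]) (use h OU in auto)
    qed
    have "open ({t. (lo,t) \<in> O' \<inter> {p \<in> U. 0 < pv r (fst p) (snd p)}} \<inter> {t. (hi,t) \<in> O' \<inter> {p \<in> U. 0 < - pv r (fst p) (snd p)}})"
      by (intro open_Int slice_open oW)
    moreover have "v \<in> {t. (lo,t) \<in> O' \<inter> {p \<in> U. 0 < pv r (fst p) (snd p)}} \<inter> {t. (hi,t) \<in> O' \<inter> {p \<in> U. 0 < - pv r (fst p) (snd p)}}"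
      using loW hi(4) by simp
    ultimately obtain d where d: "0 < d" "ball v d \<subseteq> {t. (lo,t) \<in> O' \<inter> {p \<in> U. 0 < pv r (fst p) (snd p)}} \<inter> {t. (hi,t) \<in> O' \<inter> {p \<in> U. 0 < - pv r (fst p) (snd p)}}"
      by (meson open_contains_ball)
    show "\<exists>d>0. \<forall>x'\<in>{V1..}. dist x' v < d \<longrightarrow> dist (a x') (a v) < e"
    proof (intro exI[of _ d] conjI ballI impI d(1))
      fix t assume "t \<in> {V1..}" "dist t v < d"
      then have t: "V1 \<le> t" "t \<in> ball v d" by (auto simp: dist_commute)
      have t0: "v0 \<le> t" using t V1 by simp
      have lt: "(lo,t) \<in> G" "0 < pv r lo t" and ht: "(hi,t) \<in> G" "pv r hi t < 0"
        using d(2) t(2) O(2) lo hi(1,3) a(1,5)[OF v(1)] t0 strip_params by (auto simp: Kset_def subset_iff)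
      have "lo < a t"
      proof (rule ccontr)
        assume "\<not> lo < a t"
        then consider "a t = lo" | "a t < lo" by linarith
        then show False
        proof cases
          case 1 then show False using lt a(4)[OF t(1)] by simp
        next
          case 2
          then have "0 < pv r (a t) t" using before[OF lt(1) t(1) less_imp_le[OF lt(2)]] a(1)[OF t(1)] by simp
          then show False using a(4)[OF t(1)] by simp
        qed
      qed
      moreover have "a t < hi"
      proof (rule ccontr)
        assume "\<not> a t < hi"
        then consider "a t = hi" | "hi < a t" by linarith
        then show False
        proof cases
          case 1 then show False using ht a(4)[OF t(1)] by simp
        next
          case 2
          then have "0 < pv r hi t" using before[OF a(3)[OF t(1)] t(1) _ _ 2] a(4)[OF t(1)] hi(1) a(1)[OF v(1)] by simp
          then show False using ht by simp
        qed
      qed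
      ultimately show "dist (a t) (a v) < e" using lo hi by (simp add: dist_real_def abs_less_iff)
    qed
  qed
  have graph: "tube \<inter> {(u,v). v \<ge> V1} = (\<lambda>v. (a v, v)) ` {V1..}"
    using a(2) uniq by (auto simp: image_iff)
  show ?thesis
  proof (intro exI[of _ V1] conjI)
    show "tube \<inter> {(u,v). v \<ge> V1} \<noteq> {}" unfolding graph by auto
    show "connected (tube \<inter> {(u,v). v \<ge> V1})" unfolding graph
      by (intro connected_continuous_image continuous_intros cont) simp
    show "achronal (tube \<inter> {(u,v). v \<ge> V1})"
      unfolding graph achronal_def
    proof (intro ballI notI)
      fix p q assume "p \<in> (\<lambda>v. (a v, v)) ` {V1..}" "q \<in> (\<lambda>v. (a v, v)) ` {V1..}"
      then obtain v v' where "V1 \<le> v" "p = (a v, v)" "q = (a v', v')" by auto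
      moreover assume "fst p < fst q \<and> snd p < snd q"
      ultimately show False using mono[of v v'] by simp
    qed
    show "no_ingoing_null_segments (tube \<inter> {(u,v). v \<ge> V1})"
      unfolding no_ingoing_null_segments_def
    proof (intro notI, elim exE conjE)
      fix v x y :: real assume xy: "x < y" "{x..y} \<times> {v} \<subseteq> tube \<inter> {(u,v). v \<ge> V1}"
      moreover have "(x,v) \<in> {x..y} \<times> {v}" "(y,v) \<in> {x..y} \<times> {v}" using xy(1) by auto
      ultimately have "(x,v) \<in> tube \<inter> {(u,v). v \<ge> V1}" "(y,v) \<in> tube \<inter> {(u,v). v \<ge> V1}" by (meson subsetD)+
      then have "x = a v" "y = a v" using uniq by auto
      then show False using xy by simp
    qed
  qed
qed

end

section \<open>From the hypotheses on the data to the estimates\<close>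

context horizon_data
begin

lemma small_sigma_exists: "\<exists>\<sigma>. small_sigma \<sigma>"
proof
  define M where "M = Cv * e3 + B * \<delta>"
  \<comment> \<open>q is the product \<sigma> rp, in terms of which the conditions on \<sigma> are
    expressed.\<close>
  define q where "q = min (min \<delta> 1) (e2 / (2 * (M + 1)))"
  have M: "0 \<le> M" using pos by (simp add: M_def)
  have q: "0 < q" "q \<le> \<delta>" "q \<le> 1" "q \<le> e2 / (2 * (M + 1))"
    using pos M by (auto simp: q_def min.coboundedI1)
  have "M * q \<le> (M + 1) * (e2 / (2 * (M + 1)))" using q M by (intro mult_mono) auto
  also have "\<dots> = e2 / 2" using M by (simp add: field_simps)
  finally have "M * q \<le> e2 / 2" .
  then show "small_sigma (q / rp)"
    unfolding small_sigma_def M_def[symmetric] using q rp_pos by simp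
qed

end

theorem theorem4:
  fixes V :: "real \<Rightarrow> real"
    and u0 v0 :: real
    and G :: "(real \<times> real) set"
    and r \<Omega> \<phi> :: "real \<Rightarrow> real \<Rightarrow> real"
    and rp mp :: real
    and \<phi>0 \<phi>1 :: ereal
    and c0 c1 c2 c3 c4 \<delta>0 B \<epsilon> \<epsilon>' \<epsilon>'' :: real
  assumes u0_pos: "u0 > 0"
    (* V nonnegative and C^2 *)
    and V_C2: "\<forall>x. (V has_real_derivative deriv V x) (at x)"
              "\<forall>x. (deriv V has_real_derivative deriv (deriv V) x) (at x)"
              "continuous_on UNIV (deriv (deriv V))"
    and V_nonneg: "\<forall>x. V x \<ge> 0"
    (* the maximal future development of the data *)
    and maxdev: "is_maximal_development V u0 v0 G r \<Omega> \<phi>"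
    (* r_+, m_+ *)
    and r_bdd: "bdd_above ((\<lambda>p. r (fst p) (snd p)) ` Cout v0)"
    and rp_def: "rp = (SUP p\<in>Cout v0. r (fst p) (snd p))"
    and m_bdd: "bdd_above ((\<lambda>p. hawking_mass r \<Omega> (fst p) (snd p)) ` Cout v0)"
    and mp_def: "mp = (SUP p\<in>Cout v0. hawking_mass r \<Omega> (fst p) (snd p))"
    and r_le: "\<forall>(u,v)\<in>Cin u0 v0 \<union> Cout v0. r u v \<le> rp"
    and m_bounds: "\<forall>(u,v)\<in>Cin u0 v0 \<union> Cout v0. 0 \<le> hawking_mass r \<Omega> u v \<and> hawking_mass r \<Omega> u v \<le> mp"
    and out_signs: "\<forall>(u,v)\<in>Cout v0. pu r u v < 0 \<and> pv r u v > 0"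
    (* constants *)
    and c_pos: "c0 > 0" "c1 > 0" "c2 > 0" "c3 > 0" "c4 > 0"
    and c0_bound: "c0 < 1 / (4 * rp\<^sup>2)"
    and in_c1: "\<forall>(u,v)\<in>Cin u0 v0. (pu \<phi> u v / pu r u v)\<^sup>2 < c1"
    and out_c23: "\<forall>(u,v)\<in>Cout v0. c3 \<le> - pu r u v / (\<Omega> u v)\<^sup>2 \<and> - pu r u v / (\<Omega> u v)\<^sup>2 \<le> c2 / 2"
    and out_c4: "\<forall>(u,v)\<in>Cout v0. deriv V (\<phi> u v) < c4 * \<bar>pv \<phi> u v\<bar>"
    (* convexity bounds on V *)
    and phi0_def: "\<phi>0 = (INF p\<in>Cout v0. ereal (\<phi> (fst p) (snd p)))"
    and phi1_def: "\<phi>1 = (SUP p\<in>Cout v0. ereal (\<phi> (fst p) (snd p)))"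
    and \<delta>0_pos: "\<delta>0 > 0"
    and V''_bounds: "\<forall>x. \<phi>0 - ereal \<delta>0 < ereal x \<and> ereal x < \<phi>1 \<longrightarrow>
                         0 \<le> deriv (deriv V) x \<and> deriv (deriv V) x \<le> B"
    and B_bound: "B < 1 / rp\<^sup>2"
    (* smallness of the data along the event horizon *)
    and eps_pos: "\<epsilon> > 0" "\<epsilon>' > 0" "\<epsilon>'' > 0"
    and out_small: "\<forall>(u,v)\<in>Cout v0. pv r u v < \<epsilon> \<and> V (\<phi> u v) < \<epsilon>' / 2 \<and> \<bar>pv \<phi> u v\<bar> < \<epsilon>'' / 2"
    and out_phi_signs: "\<forall>(u,v)\<in>Cout v0. pv \<phi> u v < 0 \<and> pu \<phi> u v < 0"
    and out_key: "\<forall>(u,v)\<in>Cout v0.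
        deriv V (\<phi> u v) - 4 * sqrt c1 * c2 * (pv r u v / r u v) - 4 * c3 / rp * pv \<phi> u v > 0"
    and alt: "(\<forall>(u,v)\<in>Cout v0. deriv V (\<phi> u v) \<le> 0) \<or> \<bar>\<phi>0\<bar> < \<infinity>"
    and eps_cond1: "2 * \<epsilon>' + 8 * c2 / rp\<^sup>2 * \<epsilon> < 1 / rp\<^sup>2 - B"
    and eps_cond2: "\<epsilon>' < min (1 / (2 * rp\<^sup>2) - 2 * c0) (2 * c0)"
    and eps_cond3: "\<epsilon>'' < sqrt c1 * c3 * (1 - 2 * rp\<^sup>2 * \<epsilon>' - 4 * c2 * \<epsilon>) / (c2 * (c4 * rp + 4 * c3))"
  shows "let A = {(u,v) \<in> G. pv r u v = 0 \<and> pu r u v < 0} in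
           (\<exists>u1>0. \<forall>u\<in>{0<..<u1}. \<exists>v>v0. (u,v) \<in> A)
         \<and> (\<exists>V1. A \<inter> {(u,v). v \<ge> V1} \<noteq> {}
                \<and> connected (A \<inter> {(u,v). v \<ge> V1})
                \<and> achronal (A \<inter> {(u,v). v \<ge> V1})
                \<and> no_ingoing_null_segments (A \<inter> {(u,v). v \<ge> V1}))"
proof -
  have dev: "is_development V u0 v0 G r \<Omega> \<phi>"
    and maximal: "\<And>G' r' \<Omega>' \<phi>'. is_development V u0 v0 G' r' \<Omega>' \<phi>' \<Longrightarrow>
        \<forall>(u,v)\<in>Cin u0 v0 \<union> Cout v0. r' u v = r u v \<and> \<Omega>' u v = \<Omega> u v \<and> \<phi>' u v = \<phi> u v \<Longrightarrow> G' \<subseteq> G"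
    using maxdev unfolding is_maximal_development_def by blast+
  have out: "(0,v) \<in> Cout v0" if "v0 \<le> v" for v using that by (simp add: Cout_def)
  have r_pos: "0 < r 0 v" if "v0 \<le> v" for v
    using dev out[OF that] unfolding is_development_def by blast
  have r_out: "r 0 v \<le> rp" if "v0 \<le> v" for v using r_le out[OF that] by auto
  have rp: "0 < rp" using r_pos[of v0] r_out[of v0] by simp
  have phiv: "pv \<phi> 0 v < 0" if "v0 \<le> v" for v using out_phi_signs out[OF that] by auto
  have dphi: "((\<lambda>t. \<phi> 0 t) has_real_derivative pv \<phi> 0 v) (at v)" if "v0 \<le> v" for v
  proof -
    obtain U where "G \<subseteq> U" "C2_on U \<phi>" using dev unfolding is_development_def by auto
    moreover have "(0,v) \<in> G" using dev out[OF that] unfolding is_development_def by blast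
    ultimately show ?thesis using C1_onD(2)[OF C2_onD(1)] by blast
  qed
  have phi_mono: "\<phi> 0 v' \<le> \<phi> 0 v" if "v0 \<le> v" "v \<le> v'" for v v'
  proof (rule deriv_nonpos_mono[OF that(2)])
    fix x assume "v \<le> x" "x \<le> v'"
    then have "v0 \<le> x" using that by simp
    then show "((\<lambda>t. \<phi> 0 t) has_real_derivative pv \<phi> 0 x) (at x)" "pv \<phi> 0 x \<le> 0"
      using dphi phiv less_imp_le by blast+
  qed
  have phi_less: "\<phi> 0 (v0 + 1) < \<phi> 0 v0"
    by (rule DERIV_neg_imp_decreasing) (use dphi phiv in auto)
  \<comment> \<open>V'' is controlled only strictly below \<phi>1, and \<phi> starts at that
    supremum. As \<phi> decreases strictly, from v0 + 1 on it lies below \<phi> 0 v0 by more than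
    \<delta>, so a \<delta>-neighbourhood of its values stays admissible. The half of \<delta>0
    serves the lower end.\<close>
  define \<delta> where "\<delta> = min (\<delta>0 / 2) ((\<phi> 0 v0 - \<phi> 0 (v0 + 1)) / 2)"
  have \<delta>: "0 < \<delta>" "\<delta> < \<delta>0" "\<delta> < \<phi> 0 v0 - \<phi> 0 (v0 + 1)"
    using \<delta>0_pos phi_less by (auto simp: \<delta>_def min_less_iff_disj)
  have V2: "0 \<le> deriv (deriv V) x \<and> deriv (deriv V) x \<le> B" if v: "v0 + 1 \<le> v" and x: "\<bar>x - \<phi> 0 v\<bar> \<le> \<delta>" for v x
  proof -
    have v': "v0 \<le> v" using v by simp
    have "\<phi>0 \<le> ereal (\<phi> 0 v)" unfolding phi0_def using INF_lower[OF out[OF v'], of "\<lambda>p. ereal (\<phi> (fst p) (snd p))"] by simp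
    then have "\<phi>0 - ereal \<delta>0 \<le> ereal (\<phi> 0 v) - ereal \<delta>0" by (rule ereal_minus_mono) simp
    also have "\<dots> < ereal x" using x \<delta> by (simp add: abs_le_iff)
    finally have 1: "\<phi>0 - ereal \<delta>0 < ereal x" .
    have "\<phi> 0 v \<le> \<phi> 0 (v0 + 1)" by (rule phi_mono) (use v in auto)
    then have "ereal x < ereal (\<phi> 0 v0)" using x \<delta> by (simp add: abs_le_iff)
    also have "\<dots> \<le> \<phi>1" unfolding phi1_def using SUP_upper[OF out[OF order_refl], of "\<lambda>p. ereal (\<phi> (fst p) (snd p))"] by simp
    finally show ?thesis using V''_bounds 1 by blast
  qed
  have B0: "0 \<le> B" using V2[of "v0 + 1" "\<phi> 0 (v0 + 1)"] \<delta> by simp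
  \<comment> \<open>The constant c4 + 4 c3 / rp bounds |V'| by |\<open>pv \<phi>\<close>|: the upper
    bound on V' has the factor c4, and the positivity condition \<open>out_key\<close> yields the
    lower bound with 4 c3 / rp.\<close>
  interpret H: horizon_data V u0 v0 G r \<Omega> \<phi> rp mp c2 c3 B "c4 + 4 * c3 / rp" \<delta> \<epsilon> \<epsilon>' "\<epsilon>'' / 2"
  proof unfold_locales
    show "0 \<le> c4 + 4 * c3 / rp" using c_pos rp by simp
    show "hawking_mass r \<Omega> 0 v \<le> mp" if "v0 \<le> v" for v using m_bounds out[OF that] by auto
    show "\<exists>v\<ge>v0. mp - e < hawking_mass r \<Omega> 0 v" if "0 < e" for e
    proof -
      have "mp - e < (SUP p\<in>Cout v0. hawking_mass r \<Omega> (fst p) (snd p))" using mp_def that by simp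
      then obtain p where "p \<in> Cout v0" "mp - e < hawking_mass r \<Omega> (fst p) (snd p)"
        using less_cSUP_iff[OF _ m_bdd] out[OF order_refl] by blast
      then show ?thesis by (auto simp: Cout_def)
    qed
    show "pu r 0 v < 0" "0 < pv r 0 v" "pv r 0 v \<le> \<epsilon>" "V (\<phi> 0 v) \<le> \<epsilon>' / 2" "\<bar>pv \<phi> 0 v\<bar> \<le> \<epsilon>'' / 2"
      "c3 \<le> - pu r 0 v / (\<Omega> 0 v)\<^sup>2" "- pu r 0 v / (\<Omega> 0 v)\<^sup>2 \<le> c2 / 2" if "v0 \<le> v" for v
      using bspec[OF out_signs out[OF that]] bspec[OF out_small out[OF that]] bspec[OF out_c23 out[OF that]]
      by (simp_all add: less_imp_le)
    show "\<bar>deriv V (\<phi> 0 v)\<bar> \<le> (c4 + 4 * c3 / rp) * \<bar>pv \<phi> 0 v\<bar>" if v: "v0 \<le> v" for v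
    proof -
      have 1: "deriv V (\<phi> 0 v) < c4 * \<bar>pv \<phi> 0 v\<bar>" using bspec[OF out_c4 out[OF v]] by simp
      have 2: "0 < deriv V (\<phi> 0 v) - 4 * sqrt c1 * c2 * (pv r 0 v / r 0 v) - 4 * c3 / rp * pv \<phi> 0 v"
        using bspec[OF out_key out[OF v]] by simp
      have "0 < pv r 0 v" using bspec[OF out_signs out[OF v]] by simp
      then have 3: "0 \<le> 4 * sqrt c1 * c2 * (pv r 0 v / r 0 v)" using c_pos r_pos[OF v] by simp
      have 4: "4 * c3 / rp * pv \<phi> 0 v = - (4 * c3 / rp * \<bar>pv \<phi> 0 v\<bar>)" using phiv[OF v] by simp
      have 5: "0 \<le> c4 * \<bar>pv \<phi> 0 v\<bar>" "0 \<le> 4 * c3 / rp * \<bar>pv \<phi> 0 v\<bar>" using c_pos rp by auto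
      have "(c4 + 4 * c3 / rp) * \<bar>pv \<phi> 0 v\<bar> = c4 * \<bar>pv \<phi> 0 v\<bar> + 4 * c3 / rp * \<bar>pv \<phi> 0 v\<bar>" by (rule distrib_right)
      then show ?thesis using 1 2 3 4 5 by linarith
    qed
    show "\<bar>deriv (deriv V) x\<bar> \<le> B" if "v0 + 1 \<le> v" "\<bar>x - \<phi> 0 v\<bar> \<le> \<delta>" for v x using V2[OF that] by simp
    \<comment> \<open>\<epsilon>' lies below both entries of the minimum, and these add up to 1 / (2
      rp^2).\<close>
    have "2 * \<epsilon>' < 1 / (2 * rp\<^sup>2)" using eps_cond2 by simp
    then show "4 * rp\<^sup>2 * \<epsilon>' \<le> 1" using rp by (simp add: field_simps)
  qed (use V_C2 V_nonneg u0_pos dev maximal c_pos B0 \<delta> eps_pos r_out in auto)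
  obtain \<sigma> where \<sigma>: "H.small_sigma \<sigma>" using H.small_sigma_exists by blast
  obtain v1 \<eta> where strip: "v0 + 1 \<le> v1" "0 < \<eta>" "\<eta> < u0"
    "\<And>u v. 0 \<le> u \<Longrightarrow> u \<le> \<eta> \<Longrightarrow> v0 \<le> v \<Longrightarrow> v \<le> v1 \<Longrightarrow> (u,v) \<in> G \<and> 0 < pv r u v"
    "\<And>u v. 0 \<le> u \<Longrightarrow> u \<le> \<eta> \<Longrightarrow> v1 \<le> v \<Longrightarrow> (u,v) \<in> G \<Longrightarrow> (\<And>t. v1 \<le> t \<Longrightarrow> t \<le> v \<Longrightarrow> H.\<rho> \<le> r u t) \<Longrightarrow> H.controlled \<sigma> u v"
  proof (rule H.bootstrap[OF \<sigma>], goal_cases)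
    case (1 v1 \<eta>)
    show ?case by (rule that[of v1 \<eta>]) (fact 1)+
  qed
  interpret C: controlled_strip V u0 v0 G r \<Omega> \<phi> rp mp c2 c3 B "c4 + 4 * c3 / rp" \<delta> \<epsilon> \<epsilon>' "\<epsilon>'' / 2" \<sigma> v1 \<eta>
    by unfold_locales (use strip \<sigma> in \<open>auto simp: H.small_sigma_def\<close>)
  have "\<exists>u1>0. \<forall>u\<in>{0<..<u1}. \<exists>v>v0. (u,v) \<in> C.tube"
    using C.asymptotic strip(2) by (intro exI[of _ \<eta>]) auto
  then show ?thesis using C.conclusion unfolding Let_def C.tube_def[symmetric] by blast
qed

end
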